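(* The following are pairwise non-equivalent irreducible representations of the 2BTL algebra. For $N$ even: $V^{(N,2i+1)}_{\epsilon_1,\epsilon_2}$ and $\tilde V^{(N,2i+1)}_{\epsilon_1,\epsilon_2}$ with $\epsilon_1,\epsilon_2=\pm1$ and $i=0,1,\dots,\frac{N-2}2$. For $N$ odd: $V^{(N,2i)}_{\epsilon_1,\epsilon_2}$ and $\tilde V^{(N,2i)}_{\epsilon_1,\epsilon_2}$ with $\epsilon_1,\epsilon_2=\pm1$ and $i=1,\dots,\frac{N-1}2$, and also $V^{(N)}_\epsilon$ and $\tilde V^{(N)}_\epsilon$ with $\epsilon=\pm1$. Their dimensions are $\dim V^{(N,n)}_{\epsilon_1,\epsilon_2}=M_N(n)$, $\dim\tilde V^{(N,n)}_{\epsilon_1,\epsilon_2}=2^N-M_N(n)$, and $\dim V^{(N)}_\epsilon=2^{N-1}=\dim\tilde V^{(N)}_\epsilon$. The central element $Z_N$ acts on $V^{(N,n)}_{\epsilon_1,\epsilon_2}$ and on $\tilde V^{(N,n)}_{\epsilon_1,\epsilon_2}$ as the scalar $[N]\frac{[2(-n+\epsilon_1\omega_1+\epsilon_2\omega_2)]}{[-n+\epsilon_1\omega_1+\epsilon_2\omega_2]}$, and on $V^{(N)}_\epsilon$ and $\tilde V^{(N)}_\epsilon$ as the scalar $[N]\frac{[2(\omega_1+\epsilon\omega_2)]}{[\omega_1+\epsilon\omega_2]}$ (where $\frac{[2x]}{[x]}$ denotes $q^x+q^{-x}$).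
   Context: Let $N\ge2$. Fix complex numbers $\eta,\omega_1,\omega_2$; write $q^x=e^{\eta x}$ and $[x]=\frac{q^x-q^{-x}}{q-q^{-1}}$. Assume genericity: $q$ is not a root of unity, $[\omega_1-m]\neq0$ for all $m\in\mathbb Z$, $[\omega_2],[\omega_2+1]\ne0$. Call exceptional points the values of $\theta$ (considered through $q^\theta$): for $N$ even, $\pm(-2i-1+\epsilon_1\omega_1+\epsilon_2\omega_2)$, $0\le i\le\frac{N-2}2$; for $N$ odd, $\pm(\omega_1+\epsilon\omega_2)$ and $\pm(-2i+\epsilon_1\omega_1+\epsilon_2\omega_2)$, $1\le i\le\frac{N-1}2$ (all signs $\epsilon,\epsilon_1,\epsilon_2=\pm1$). It is assumed that the values $q^\theta$ at these exceptional points are pairwise distinct. Put $\delta=[2]$, $s_1=\frac{[\omega_1]}{[\omega_1+1]}$, $s_2=\frac{[\omega_2]}{[\omega_2+1]}$. $M_m(n)=\sum_{i=1}^{(m+1-|n|)/2}B_{m,|n|+2i-1}$, where $B_{m,n}=\binom{m}{(m-n)/2}$. The 2BTL algebra is the unital complex algebra with generators $e_0,\dots,e_N$ and relations $e_i^2=\delta e_i$, $e_ie_{i\pm1}e_i=e_i$ for $1\le i\le N-1$ (with $i\pm1\in\{0,\dots,N\}$), $e_0^2=s_1e_0$, $e_N^2=s_2e_N$, $e_ie_j=e_je_i$ for $|i-j|>1$. For given $\theta$: for $N$ even set $I_1=e_1e_3\cdots e_{N-1}$, $I_2=e_0e_2\cdots e_N$ and $b=\frac{[(\omega_1+\omega_2+1+\theta)/2][(\omega_1+\omega_2+1-\theta)/2]}{[\omega_1+1][\omega_2+1]}$;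 for $N$ odd set $I_1=e_1e_3\cdots e_N$, $I_2=e_0e_2\cdots e_{N-1}$ and $b=-\frac{[(\omega_1-\omega_2+\theta)/2][(\omega_1-\omega_2-\theta)/2]}{[\omega_1+1][\omega_2+1]}$. The double quotient $\mathcal A_b$ is the quotient of 2BTL by $I_1I_2I_1=bI_1$, $I_2I_1I_2=bI_2$. Define $E_0=1$ and $E_i=s_1^{(-1)^i}E_{i-1}e_{i-1}E_{i-1}$ for $1\le i\le N$. The $2^N$-dimensional module $W^{(N)}(b)$ is realised as the left ideal $\mathcal A_bE_N$. Put $r(u)=\frac{[u+1]}{[u]}$, $k(u)=-\frac{[(u-\omega_2+\theta)/2][(u-\omega_2-\theta)/2]}{[u][\omega_2+1]}$, $R_i(u)=e_i-r(u)$, $K_N(u)=e_N-k(u)$. A path is $p=(h_0,\dots,h_N)$ with $h_0=0$, $h_{i+1}-h_i=\pm1$; the fundamental path is $p_0=(0,-1,0,-1,\dots)$. A path $p'$ is obtained from $p$ by adding a tile at $i$ ($1\le i\le N-1$) if they agree except at $i$, $h_{i-1}=h_{i+1}$, and either $h_{i-1}\ge0$, $h_i=h_{i-1}-1$, $h_i'=h_{i-1}+1$ (from above), or $h_{i-1}<0$, $h_i=h_{i-1}+1$, $h'_i=h_{i-1}-1$ (from below); similarly for a half-tile at $i=N$ (omitting the condition on $h_{i+1}$). The basis $\mathbf B_1=\{b_p\}$ of $W^{(N)}(b)$ is defined by $b_{p_0}=E_N$ and $b_{p'}=X_ib_p$, where from above $X_i=R_i(\omega_1-h_{i-1})$ ($i<N$),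 $X_N=K_N(\omega_1-h_{N-1})$, and from below $X_i=R_i(-\omega_1+h_{i-1})$ ($i<N$), $X_N=K_N(-\omega_1+h_{N-1})$. Definition of the representations. For $n\geq1$, $n\equiv N-1\pmod2$, $n\le N-1$, take $\theta=-n+\epsilon_1\omega_1+\epsilon_2\omega_2$; $V^{(N,n)}_{\epsilon_1,\epsilon_2}$ is the invariant subspace of $W^{(N)}(b)$ spanned by the $b_p$ with $h_N\ge n+1$ if $\epsilon_1=+1$, respectively with $h_N\le-n-1$ if $\epsilon_1=-1$, and $\tilde V^{(N,n)}_{\epsilon_1,\epsilon_2}=W^{(N)}(b)/V^{(N,n)}_{\epsilon_1,\epsilon_2}$. For $N$ odd, take $\theta=\omega_1+\epsilon\omega_2$; $V^{(N)}_\epsilon$ is the invariant subspace spanned by the $b_p$ with $h_N\ge1$, and $\tilde V^{(N)}_\epsilon=W^{(N)}(b)/V^{(N)}_\epsilon$. Central element: in 2BTL put $g_i=e_i-q^{-1}$ ($1\le i\le N-1$), $g_0=q^{\omega_1}-(q^{1+\omega_1}-q^{-1-\omega_1})e_0$, $g_N=q^{\omega_2}-(q^{1+\omega_2}-q^{-1-\omega_2})e_N$, $J_0=g_1^{-1}\cdots g_{N-1}^{-1}g_Ng_{N-1}\cdots g_1g_0$, $J_i=g_iJ_{i-1}g_i$ ($1\le i\le N-1$), $Z_N=\sum_{i=0}^{N-1}(J_i+J_i^{-1})$. *)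

theory Defs
  imports
    "HOL-Algebra.QuotRing"
    "HOL-Library.Poly_Mapping"
    "Jordan_Normal_Form.VS_Connect"
begin

section \<open>Free algebras\<close>

text \<open>The free monoid, written additively so that finitely supported functions on it
  (\<^typ>\<open>'w \<Rightarrow>\<^sub>0 'c\<close>) form its monoid algebra.\<close>

datatype 'a fword = FWord (letters: "'a list")

instantiation fword :: (type) monoid_add
begin
definition zero_fword :: "'a fword" where "0 = FWord []"
definition plus_fword :: "'a fword \<Rightarrow> 'a fword \<Rightarrow> 'a fword"
  where "u + v = FWord (letters u @ letters v)"
instance
  by standard (auto simp: zero_fword_def plus_fword_def)
end

type_synonym 'a free_alg = "'a fword \<Rightarrow>\<^sub>0 complex"

definition gen :: "'a \<Rightarrow> 'a free_alg"
  where "gen i = Poly_Mapping.single (FWord [i]) 1"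

definition scal :: "complex \<Rightarrow> 'a free_alg"
  where "scal c = Poly_Mapping.single 0 c"

definition free_algebra :: "'a set \<Rightarrow> 'a free_alg ring"
  where "free_algebra X =
    \<lparr>carrier = {f. \<forall>w\<in>Poly_Mapping.keys f. set (letters w) \<subseteq> X},
     mult = (*), one = 1, zero = 0, add = (+)\<rparr>"


section \<open>Left modules over a (non-commutative) ring\<close>

text \<open>The record \<^typ>\<open>('a, 'b) module\<close> of HOL-Algebra is reused; its fields \<^const>\<open>mult\<close> and
  \<^const>\<open>one\<close> play no role.  The locale \<^locale>\<open>module\<close> itself requires a commutative ring.\<close>

locale left_module = R?: ring R + M?: abelian_group M
  for R :: "('a, 'r) ring_scheme" (structure) and M :: "('a, 'b, 'm) module_scheme" (structure) +
  assumes smult_closed: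
      "\<lbrakk>a \<in> carrier R; x \<in> carrier M\<rbrakk> \<Longrightarrow> a \<odot>\<^bsub>M\<^esub> x \<in> carrier M"
    and smult_l_distr:
      "\<lbrakk>a \<in> carrier R; b \<in> carrier R; x \<in> carrier M\<rbrakk> \<Longrightarrow>
        (a \<oplus>\<^bsub>R\<^esub> b) \<odot>\<^bsub>M\<^esub> x = a \<odot>\<^bsub>M\<^esub> x \<oplus>\<^bsub>M\<^esub> b \<odot>\<^bsub>M\<^esub> x"
    and smult_r_distr:
      "\<lbrakk>a \<in> carrier R; x \<in> carrier M; y \<in> carrier M\<rbrakk> \<Longrightarrow>
        a \<odot>\<^bsub>M\<^esub> (x \<oplus>\<^bsub>M\<^esub> y) = a \<odot>\<^bsub>M\<^esub> x \<oplus>\<^bsub>M\<^esub> a \<odot>\<^bsub>M\<^esub> y"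
    and smult_assoc:
      "\<lbrakk>a \<in> carrier R; b \<in> carrier R; x \<in> carrier M\<rbrakk> \<Longrightarrow>
        (a \<otimes>\<^bsub>R\<^esub> b) \<odot>\<^bsub>M\<^esub> x = a \<odot>\<^bsub>M\<^esub> (b \<odot>\<^bsub>M\<^esub> x)"
    and smult_one: "x \<in> carrier M \<Longrightarrow> \<one>\<^bsub>R\<^esub> \<odot>\<^bsub>M\<^esub> x = x"

definition irreducible_module :: "('a, 'r) ring_scheme \<Rightarrow> ('a, 'b, 'm) module_scheme \<Rightarrow> bool"
  where "irreducible_module R M \<longleftrightarrow>
    left_module R M \<and> carrier M \<noteq> {\<zero>\<^bsub>M\<^esub>} \<and>
    (\<forall>H. Module.submodule H R M \<longrightarrow> H = {\<zero>\<^bsub>M\<^esub>} \<or> H = carrier M)"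

definition equivalent_modules ::
  "('a, 'r) ring_scheme \<Rightarrow> ('a, 'b, 'm) module_scheme \<Rightarrow> ('a, 'c, 'n) module_scheme \<Rightarrow> bool"
  where "equivalent_modules R M M' \<longleftrightarrow>
    (\<exists>f\<in>LinearCombinations.module_hom R M M'. bij_betw f (carrier M) (carrier M'))"

definition quotient_module :: "('a, 'b) module \<Rightarrow> 'b set \<Rightarrow> ('a, 'b set) module"
  where "quotient_module M U =
    \<lparr>carrier = a_rcosets\<^bsub>M\<^esub> U, mult = undefined, one = undefined, zero = U, add = set_add M,
     smult = (\<lambda>a X. \<Union>x\<in>X. U +>\<^bsub>M\<^esub> (a \<odot>\<^bsub>M\<^esub> x))\<rparr>"


section \<open>Numbers\<close>

definition qpow :: "complex \<Rightarrow> complex \<Rightarrow> complex"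
  where "qpow \<eta> x = exp (\<eta> * x)"

definition qnum :: "complex \<Rightarrow> complex \<Rightarrow> complex"
  where "qnum \<eta> x = (qpow \<eta> x - qpow \<eta> (- x)) / (qpow \<eta> 1 - qpow \<eta> (- 1))"

definition binB :: "nat \<Rightarrow> int \<Rightarrow> nat"
  where "binB m n = m choose nat ((int m - n) div 2)"

definition numM :: "nat \<Rightarrow> int \<Rightarrow> nat"
  where "numM m n = (\<Sum>i = 1..(int m + 1 - \<bar>n\<bar>) div 2. binB m (\<bar>n\<bar> + 2 * i - 1))"


section \<open>The two-boundary Temperley-Lieb algebra\<close>

text \<open>\<open>Generic n \<epsilon>\<^sub>1 \<epsilon>\<^sub>2\<close> indexes the pair of representations for
  \<open>\<theta> = - n + \<epsilon>\<^sub>1 \<omega>\<^sub>1 + \<epsilon>\<^sub>2 \<omega>\<^sub>2\<close>, and \<open>Middle \<epsilon>\<close> (\<open>N\<close> odd) the pair for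
  \<open>\<theta> = \<omega>\<^sub>1 + \<epsilon> \<omega>\<^sub>2\<close>.\<close>

datatype label = Generic nat int int | Middle int

locale two_BTL =
  fixes N :: nat and \<eta> \<omega>\<^sub>1 \<omega>\<^sub>2 :: complex
begin

abbreviation qp :: "complex \<Rightarrow> complex" where "qp \<equiv> qpow \<eta>"
abbreviation qn :: "complex \<Rightarrow> complex" where "qn \<equiv> qnum \<eta>"

definition \<delta> :: complex where "\<delta> = qn 2"
definition s\<^sub>1 :: complex where "s\<^sub>1 = qn \<omega>\<^sub>1 / qn (\<omega>\<^sub>1 + 1)"
definition s\<^sub>2 :: complex where "s\<^sub>2 = qn \<omega>\<^sub>2 / qn (\<omega>\<^sub>2 + 1)"

definition relations :: "nat free_alg set"
  where "relations =
      {gen i * gen i - scal \<delta> * gen i | i. 1 \<le> i \<and> i \<le> N - 1}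
    \<union> {gen i * gen j * gen i - gen i | i j. 1 \<le> i \<and> i \<le> N - 1 \<and> (j = i - 1 \<or> j = i + 1)}
    \<union> {gen 0 * gen 0 - scal s\<^sub>1 * gen 0}
    \<union> {gen N * gen N - scal s\<^sub>2 * gen N}
    \<union> {gen i * gen j - gen j * gen i | i j. i \<le> N \<and> j \<le> N \<and> \<bar>int i - int j\<bar> > 1}"

abbreviation F :: "nat free_alg ring" where "F \<equiv> free_algebra {0..N}"

definition TL_ideal :: "nat free_alg set" where "TL_ideal = genideal F relations"

definition TL :: "nat free_alg set ring" where "TL = F Quot TL_ideal"

definition cl :: "nat free_alg \<Rightarrow> nat free_alg set" where "cl x = TL_ideal +>\<^bsub>F\<^esub> x"

text \<open>The complex vector space underlying a module over \<^const>\<open>TL\<close>.\<close>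

definition vspace :: "(nat free_alg set, 'm) module \<Rightarrow> (complex, 'm) module"
  where "vspace M =
    \<lparr>carrier = carrier M, mult = mult M, one = one M, zero = zero M, add = add M,
     smult = (\<lambda>c w. cl (scal c) \<odot>\<^bsub>M\<^esub> w)\<rparr>"

definition fin_dim :: "(nat free_alg set, 'm) module \<Rightarrow> bool"
  where "fin_dim M \<longleftrightarrow> vectorspace.fin_dim class_ring (vspace M)"

text \<open>Only meaningful together with \<^const>\<open>fin_dim\<close>.\<close>

definition dimension :: "(nat free_alg set, 'm) module \<Rightarrow> nat"
  where "dimension M = vectorspace.dim class_ring (vspace M)"

definition acts_as_scalar ::
  "nat free_alg set \<Rightarrow> (nat free_alg set, 'm) module \<Rightarrow> complex \<Rightarrow> bool"
  where "acts_as_scalar z M c \<longleftrightarrow> (\<forall>w\<in>carrier M. z \<odot>\<^bsub>M\<^esub> w = c \<odot>\<^bsub>vspace M\<^esub> w)"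


subsection \<open>The element \<open>Z\<^sub>N\<close>\<close>

definition g :: "nat \<Rightarrow> nat free_alg set"
  where "g i = cl
    (if i = 0 then
       scal (qp \<omega>\<^sub>1) - scal (qp (1 + \<omega>\<^sub>1) - qp (- 1 - \<omega>\<^sub>1)) * gen 0
     else if i = N then
       scal (qp \<omega>\<^sub>2) - scal (qp (1 + \<omega>\<^sub>2) - qp (- 1 - \<omega>\<^sub>2)) * gen N
     else gen i - scal (qp (- 1)))"

primrec J :: "nat \<Rightarrow> nat free_alg set" where
  "J 0 = foldr (mult TL)
     (map (\<lambda>i. inv\<^bsub>TL\<^esub> g i) [1..<N] @ [g N] @ map g (rev [1..<N]) @ [g 0]) \<one>\<^bsub>TL\<^esub>"
| "J (Suc i) = g (Suc i) \<otimes>\<^bsub>TL\<^esub> J i \<otimes>\<^bsub>TL\<^esub> g (Suc i)"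

definition Z :: "nat free_alg set"
  where "Z = (\<Oplus>\<^bsub>TL\<^esub>i\<in>{..<N}. J i \<oplus>\<^bsub>TL\<^esub> inv\<^bsub>TL\<^esub> J i)"


subsection \<open>The double quotient and its module \<open>W\<close>\<close>

text \<open>For both parities of \<open>N\<close>, \<open>I\<^sub>1\<close> is the product of the \<open>e\<^sub>i\<close>, \<open>i \<le> N\<close>, with odd
  index and \<open>I\<^sub>2\<close> that with even index.\<close>

definition I\<^sub>1 :: "nat free_alg" where "I\<^sub>1 = prod_list (map gen (filter odd [0..<Suc N]))"
definition I\<^sub>2 :: "nat free_alg" where "I\<^sub>2 = prod_list (map gen (filter even [0..<Suc N]))"

definition bpar :: "complex \<Rightarrow> complex"
  where "bpar \<theta> =
    (if even N then
       qn ((\<omega>\<^sub>1 + \<omega>\<^sub>2 + 1 + \<theta>) / 2) * qn ((\<omega>\<^sub>1 + \<omega>\<^sub>2 + 1 - \<theta>) / 2)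
         / (qn (\<omega>\<^sub>1 + 1) * qn (\<omega>\<^sub>2 + 1))
     else
       - (qn ((\<omega>\<^sub>1 - \<omega>\<^sub>2 + \<theta>) / 2) * qn ((\<omega>\<^sub>1 - \<omega>\<^sub>2 - \<theta>) / 2)
         / (qn (\<omega>\<^sub>1 + 1) * qn (\<omega>\<^sub>2 + 1))))"

definition DQ_ideal :: "complex \<Rightarrow> nat free_alg set set"
  where "DQ_ideal b =
    genideal TL {cl (I\<^sub>1 * I\<^sub>2 * I\<^sub>1 - scal b * I\<^sub>1), cl (I\<^sub>2 * I\<^sub>1 * I\<^sub>2 - scal b * I\<^sub>2)}"

definition DQ :: "complex \<Rightarrow> nat free_alg set set ring"
  where "DQ b = TL Quot DQ_ideal b"

definition clDQ :: "complex \<Rightarrow> nat free_alg set \<Rightarrow> nat free_alg set set"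
  where "clDQ b t = DQ_ideal b +>\<^bsub>TL\<^esub> t"

primrec E :: "nat \<Rightarrow> nat free_alg" where
  "E 0 = 1"
| "E (Suc i) = scal (s\<^sub>1 powi ((- 1) ^ Suc i)) * E i * gen i * E i"

definition W :: "complex \<Rightarrow> (nat free_alg set, nat free_alg set set) module"
  where "W b =
    \<lparr>carrier = (\<lambda>a. a \<otimes>\<^bsub>DQ b\<^esub> clDQ b (cl (E N))) ` carrier (DQ b),
     mult = mult (DQ b), one = one (DQ b), zero = zero (DQ b), add = add (DQ b),
     smult = (\<lambda>t w. clDQ b t \<otimes>\<^bsub>DQ b\<^esub> w)\<rparr>"


subsection \<open>The basis \<open>B\<^sub>1\<close>\<close>

definition r :: "complex \<Rightarrow> complex"
  where "r u = qn (u + 1) / qn u"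

definition k :: "complex \<Rightarrow> complex \<Rightarrow> complex"
  where "k \<theta> u =
    - (qn ((u - \<omega>\<^sub>2 + \<theta>) / 2) * qn ((u - \<omega>\<^sub>2 - \<theta>) / 2) / (qn u * qn (\<omega>\<^sub>2 + 1)))"

text \<open>The element \<open>R\<^sub>i(u)\<close> for \<open>i < N\<close> and \<open>K\<^sub>N(u)\<close> for \<open>i = N\<close>.\<close>

definition X :: "complex \<Rightarrow> nat \<Rightarrow> complex \<Rightarrow> nat free_alg"
  where "X \<theta> i u = (if i < N then gen i - scal (r u) else gen N - scal (k \<theta> u))"

definition fund_path :: "int list"
  where "fund_path = map (\<lambda>j. if even j then 0 else - 1) [0..<Suc N]"

text \<open>Paths are lists \<open>[h\<^sub>0, \<dots>, h\<^sub>N]\<close>, and \<open>basis_vec \<theta> p w\<close> says that \<open>w\<close> is the vector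
  \<open>b\<^sub>p\<close> of \<open>W (bpar \<theta>)\<close>, obtained by adding tiles to the fundamental path in some order.\<close>

inductive basis_vec :: "complex \<Rightarrow> int list \<Rightarrow> nat free_alg set set \<Rightarrow> bool"
  for \<theta> :: complex
  where
    fundamental: "basis_vec \<theta> fund_path (clDQ (bpar \<theta>) (cl (E N)))"
  | from_above:
      "\<lbrakk>basis_vec \<theta> p w; 1 \<le> i; i \<le> N; i < N \<longrightarrow> p ! (i + 1) = p ! (i - 1);
        p ! (i - 1) \<ge> 0; p ! i = p ! (i - 1) - 1\<rbrakk> \<Longrightarrow>
       basis_vec \<theta> (p[i := p ! (i - 1) + 1])
         (cl (X \<theta> i (\<omega>\<^sub>1 - of_int (p ! (i - 1)))) \<odot>\<^bsub>W (bpar \<theta>)\<^esub> w)"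
  | from_below:
      "\<lbrakk>basis_vec \<theta> p w; 1 \<le> i; i \<le> N; i < N \<longrightarrow> p ! (i + 1) = p ! (i - 1);
        p ! (i - 1) < 0; p ! i = p ! (i - 1) + 1\<rbrakk> \<Longrightarrow>
       basis_vec \<theta> (p[i := p ! (i - 1) - 1])
         (cl (X \<theta> i (- \<omega>\<^sub>1 + of_int (p ! (i - 1)))) \<odot>\<^bsub>W (bpar \<theta>)\<^esub> w)"


subsection \<open>The representations at the exceptional points\<close>

definition labels :: "label set"
  where "labels =
    (if even N then
       {Generic (2 * i + 1) \<epsilon>\<^sub>1 \<epsilon>\<^sub>2 | i \<epsilon>\<^sub>1 \<epsilon>\<^sub>2.
          i \<le> (N - 2) div 2 \<and> \<epsilon>\<^sub>1 \<in> {1, - 1} \<and> \<epsilon>\<^sub>2 \<in> {1, - 1}}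
     else
       {Generic (2 * i) \<epsilon>\<^sub>1 \<epsilon>\<^sub>2 | i \<epsilon>\<^sub>1 \<epsilon>\<^sub>2.
          1 \<le> i \<and> i \<le> (N - 1) div 2 \<and> \<epsilon>\<^sub>1 \<in> {1, - 1} \<and> \<epsilon>\<^sub>2 \<in> {1, - 1}}
       \<union> {Middle \<epsilon> | \<epsilon>. \<epsilon> \<in> {1, - 1}})"

primrec \<theta>_of :: "label \<Rightarrow> complex" where
  "\<theta>_of (Generic n \<epsilon>\<^sub>1 \<epsilon>\<^sub>2) = - of_nat n + of_int \<epsilon>\<^sub>1 * \<omega>\<^sub>1 + of_int \<epsilon>\<^sub>2 * \<omega>\<^sub>2"
| "\<theta>_of (Middle \<epsilon>) = \<omega>\<^sub>1 + of_int \<epsilon> * \<omega>\<^sub>2"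

text \<open>The exceptional points are exactly the \<open>\<sigma> * \<theta>_of l\<close> with \<open>\<sigma> = \<plusminus>1\<close> and
  \<open>l \<in> labels\<close>.\<close>

definition exceptional_points_distinct :: bool
  where "exceptional_points_distinct \<longleftrightarrow>
    inj_on (\<lambda>(\<sigma>, l). qp (of_int \<sigma> * \<theta>_of l)) ({1, - 1 :: int} \<times> labels)"

text \<open>Condition on the final height \<open>h\<^sub>N\<close> selecting the vectors that span the subspace.\<close>

primrec height_cond :: "label \<Rightarrow> int \<Rightarrow> bool" where
  "height_cond (Generic n \<epsilon>\<^sub>1 \<epsilon>\<^sub>2) h \<longleftrightarrow> (if \<epsilon>\<^sub>1 = 1 then h \<ge> int n + 1 else h \<le> - int n - 1)"
| "height_cond (Middle \<epsilon>) h \<longleftrightarrow> h \<ge> 1"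

abbreviation W_of :: "label \<Rightarrow> (nat free_alg set, nat free_alg set set) module"
  where "W_of l \<equiv> W (bpar (\<theta>_of l))"

definition V_space :: "label \<Rightarrow> nat free_alg set set set"
  where "V_space l =
    LinearCombinations.module.span class_ring (vspace (W_of l))
      {w. \<exists>p. basis_vec (\<theta>_of l) p w \<and> height_cond l (p ! N)}"

definition V :: "label \<Rightarrow> (nat free_alg set, nat free_alg set set) module"
  where "V l = (W_of l)\<lparr>carrier := V_space l\<rparr>"

definition V_tilde :: "label \<Rightarrow> (nat free_alg set, nat free_alg set set set) module"
  where "V_tilde l = quotient_module (W_of l) (V_space l)"

end

end

(* The generators act on functions on paths: e_i, for i >= 1, mixes the two paths that differ at
   height i through a rank one 2x2 matrix, and e_0 multiplies by s_1 the paths that start with a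
   down step. This satisfies the relations of the double quotient. There E_N projects onto the
   fundamental path p_0, and adding a tile sends the unit function at p to the one at p', plus
   nothing else; so b_p corresponds to the unit function at p. Conversely, rewriting words in the
   generators modulo the relations shows that the b_p span W, so W is the space of functions on
   paths.

   A half-tile at N has a vanishing matrix coefficient exactly when the height h_{N-1} before it
   satisfies q^theta = q^{+-(omega_1 - h_{N-1}) +- omega_2}. At an exceptional point, distinctness leaves
   one such height c, so that the functions supported on the paths with h_N on the far side of c
   form a submodule V. The algebra contains the projection onto each single path, and all flips
   other than those across c are invertible. Hence V and W/V are irreducible, and they are not
   equivalent because they involve different paths.

   Z is central by the braid relations of the g_i. It therefore commutes with the projections, so
   it is a scalar on W, which is read off the path (0, 1, ..., N). These scalars distinguish the
   exceptional points. *)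

theory Submission
  imports Defs
begin

section \<open>Linear operators on functions\<close>

text \<open>That the \<open>b_p\<close> span is the hard half. A path can be tiled in many orders,
  and a priori two orders give different vectors and a generator may leave the span. One induction
  on the number of tiles (\<open>bvec_main\<close>) settles both: any removable tile may be taken as
  the last one added, and \<open>e_i\<close> kills \<open>b_p\<close> if \<open>p\<close> has a
  slope at \<open>i\<close>. Where no tile is left to remove, the claim becomes that
  \<open>e_i * e_j * E_N\<close> is a specific multiple of \<open>e_i * E_N\<close> for neighbouring
  \<open>i\<close>, \<open>j\<close>. This is derived for words up to an unknown scalar, which is
  then found by evaluation in the path representation. The relations of the double quotient enter
  for \<open>i = N - 1\<close>, \<open>j = N\<close> only: there \<open>E_N\<close> is rewritten as
  a palindrome of alternating products, so that \<open>I_1 I_2 I_1\<close> or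
  \<open>I_2 I_1 I_2\<close> appears.

  The matrices satisfy the relations by identities for \<open>r\<close> and \<open>k\<close>:
  \<open>r(u) + r(-u)\<close> and \<open>k(u) + k(-u)\<close> are traces and give the squares,
  \<open>r(u) r(-u-1) = 1\<close> gives \<open>e_i e_j e_i = e_i\<close> away from \<open>N\<close>,
  and a sum of two products of \<open>r\<close> and \<open>k\<close> replaces it next to
  \<open>N\<close>.\<close>

typedef 'a lop =
  "{f :: ('a \<Rightarrow> complex) \<Rightarrow> ('a \<Rightarrow> complex).
     (\<forall>x y. f (\<lambda>p. x p + y p) = (\<lambda>p. f x p + f y p)) \<and>
     (\<forall>c x. f (\<lambda>p. c * x p) = (\<lambda>p. c * f x p))}"
  morphisms app Lop
  by (rule exI[of _ "\<lambda>x. x"]) simp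

setup_lifting type_definition_lop

text \<open>Composition becomes the multiplication of a ring, so operator identities can be proved
  by \<open>algebra_simps\<close>. Operators act on all functions, not only on those supported on
  paths, so that the identity is a unit and the representation below is unital.\<close>

instantiation lop :: (type) ring_1
begin
lift_definition zero_lop :: "'a lop" is "\<lambda>x p. 0" by simp
lift_definition one_lop :: "'a lop" is "\<lambda>x. x" by simp
lift_definition plus_lop :: "'a lop \<Rightarrow> 'a lop \<Rightarrow> 'a lop" is "\<lambda>f g x p. f x p + g x p"
  by (simp add: algebra_simps)
lift_definition minus_lop :: "'a lop \<Rightarrow> 'a lop \<Rightarrow> 'a lop" is "\<lambda>f g x p. f x p - g x p"
  by (simp add: algebra_simps)
lift_definition uminus_lop :: "'a lop \<Rightarrow> 'a lop" is "\<lambda>f x p. - f x p"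
  by (simp add: algebra_simps)
lift_definition times_lop :: "'a lop \<Rightarrow> 'a lop \<Rightarrow> 'a lop" is "\<lambda>f g x. f (g x)"
  by simp
instance
proof
  show "(0 :: 'a lop) \<noteq> 1"
    by transfer (metis zero_neq_one)
qed (transfer; simp add: algebra_simps fun_eq_iff; fail)+
end

lift_definition sc :: "complex \<Rightarrow> 'a lop" is "\<lambda>c x p. c * x p"
  by (simp add: algebra_simps)

lemma app_simps [simp]:
  "app 0 x = (\<lambda>p. 0)" "app 1 x = x" "app (A + B) x = (\<lambda>p. app A x p + app B x p)"
  "app (A - B) x = (\<lambda>p. app A x p - app B x p)" "app (- A) x = (\<lambda>p. - app A x p)"
  "app (A * B) x = app A (app B x)" "app (sc c) x = (\<lambda>p. c * x p)"
  by (transfer; simp)+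

lemma app_add: "app A (\<lambda>p. x p + y p) = (\<lambda>p. app A x p + app A y p)"
  by transfer blast

lemma app_cmult: "app A (\<lambda>p. c * x p) = (\<lambda>p. c * app A x p)"
  by transfer blast

lemma app_zero: "app A (\<lambda>p. 0) = (\<lambda>p. 0)"
  using app_cmult[of A 0 "\<lambda>p. 0"] by simp

lemma app_sum: "app A (\<lambda>p. \<Sum>i\<in>I. x i p) = (\<lambda>p. \<Sum>i\<in>I. app A (x i) p)"
  by (induction I rule: infinite_finite_induct) (auto simp: app_zero app_add)

lemma app_sum_left: "app (\<Sum>i\<in>I. A i) x = (\<lambda>p. \<Sum>i\<in>I. app (A i) x p)"
  by (induction I rule: infinite_finite_induct) auto

lemma lop_eqI: "(\<And>x p. app A x p = app B x p) \<Longrightarrow> A = B"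
  by transfer (simp add: fun_eq_iff)

lemma sc_simps [simp]: "sc 0 = 0" "sc 1 = 1"
  by (rule lop_eqI; simp)+

lemma sc_add: "sc (a + b) = sc a + sc b" and sc_diff: "sc (a - b) = sc a - sc b"
  and sc_mult: "sc (a * b) = sc a * sc b" and sc_minus: "sc (- a) = - sc a"
  by (rule lop_eqI; simp add: algebra_simps)+

lemma sc_comm: "sc c * A = A * sc c"
  by (rule lop_eqI) (simp add: app_cmult)

lemma commute_mult:
  fixes a x y :: "'a::ring_1"
  assumes "a * x = x * a" "a * y = y * a"
  shows "a * (x * y) = x * y * a"
  by (metis assms mult.assoc)

lemma cancel_left:
  fixes a b x :: "'a::ring_1"
  shows "a * b = 1 \<Longrightarrow> a * (b * x) = x"
  by (simp add: mult.assoc[symmetric])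

lemma mult_cong_left:
  fixes a b x :: "'a::ring_1"
  shows "a * b = c \<Longrightarrow> a * (b * x) = c * x"
  by (simp add: mult.assoc[symmetric])

section \<open>Evaluation of free algebras at operators\<close>

definition ev :: "('b \<Rightarrow> 'a lop) \<Rightarrow> 'b free_alg \<Rightarrow> 'a lop"
  where "ev G x = (\<Sum>w\<in>Poly_Mapping.keys x. sc (Poly_Mapping.lookup x w) * prod_list (map G (letters w)))"

lemma ev_superset:
  assumes "finite S" "Poly_Mapping.keys x \<subseteq> S"
  shows "ev G x = (\<Sum>w\<in>S. sc (Poly_Mapping.lookup x w) * prod_list (map G (letters w)))"
  unfolding ev_def by (rule sum.mono_neutral_left) (use assms in \<open>auto simp: in_keys_iff\<close>)

lemma ev_single: "ev G (Poly_Mapping.single w c) = sc c * prod_list (map G (letters w))"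
  by (cases "c = 0") (auto simp: ev_def)

lemma ev_add: "ev G (x + y) = ev G x + ev G y"
proof -
  let ?S = "Poly_Mapping.keys x \<union> Poly_Mapping.keys y"
  have "finite ?S" "Poly_Mapping.keys (x + y) \<subseteq> ?S"
    by (auto dest: subsetD[OF Poly_Mapping.keys_add])
  then show ?thesis
    by (simp add: ev_superset[of ?S] lookup_add sc_add distrib_right sum.distrib)
qed

lemma ev_0 [simp]: "ev G 0 = 0"
  by (simp add: ev_def)

lemma ev_minus: "ev G (- x) = - ev G x"
  using ev_add[of G x "- x"] by (simp add: eq_neg_iff_add_eq_0 add.commute)

lemma ev_diff: "ev G (x - y) = ev G x - ev G y"
  using ev_add[of G x "- y"] by (simp add: ev_minus)

lemma ev_sum: "ev G (\<Sum>i\<in>I. x i) = (\<Sum>i\<in>I. ev G (x i))"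
  by (induction I rule: infinite_finite_induct) (auto simp: ev_add)

lemma sum_single_keys: "(\<Sum>w\<in>Poly_Mapping.keys x. Poly_Mapping.single w (Poly_Mapping.lookup x w)) = x"
  by (rule poly_mapping_eqI)
    (auto simp: lookup_sum lookup_single when_def in_keys_iff sum.delta)

text \<open>Both factors are split into monomials, where multiplicativity is concatenation of words
  and scalars move past operators. It holds on the whole free algebra, so no carrier conditions
  accompany it.\<close>

lemma ev_mult: "ev G (x * y) = ev G x * ev G y"
proof -
  let ?m = "\<lambda>x w. Poly_Mapping.single w (Poly_Mapping.lookup x w)"
  have "ev G (x * y) =
      ev G ((\<Sum>w\<in>Poly_Mapping.keys x. ?m x w) * (\<Sum>v\<in>Poly_Mapping.keys y. ?m y v))"
    by (simp only: sum_single_keys)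
  also have "\<dots> = (\<Sum>w\<in>Poly_Mapping.keys x. \<Sum>v\<in>Poly_Mapping.keys y. ev G (?m x w * ?m y v))"
    by (simp add: sum_product ev_sum)
  also have "\<dots> = (\<Sum>w\<in>Poly_Mapping.keys x. \<Sum>v\<in>Poly_Mapping.keys y. ev G (?m x w) * ev G (?m y v))"
  proof (intro sum.cong refl)
    fix w v
    have "sc a * sc b * (P * Q) = sc a * P * (sc b * Q)" for a b and P Q :: "'a lop"
      using sc_comm[of b P, THEN mult_cong_left, of Q] by (simp add: mult.assoc)
    then show "ev G (?m x w * ?m y v) = ev G (?m x w) * ev G (?m y v)"
      unfolding mult_single ev_single plus_fword_def sc_mult fword.sel map_append prod_list.append .
  qed
  also have "\<dots> = ev G x * ev G y"
    by (simp add: sum_product[symmetric] ev_sum[symmetric] sum_single_keys)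
  finally show ?thesis .
qed

lemma ev_gen [simp]: "ev G (gen i) = G i"
  by (simp add: gen_def ev_single)

lemma ev_scal [simp]: "ev G (scal c) = sc c"
  by (simp add: scal_def ev_single zero_fword_def)

lemma ev_1 [simp]: "ev G 1 = 1"
  by (metis ev_scal scal_def single_one sc_simps(2))

lemma ev_prod_list: "ev G (prod_list xs) = prod_list (map (ev G) xs)"
  by (induction xs) (auto simp: ev_mult)

section \<open>Scalars and carriers of free algebras\<close>

lemma scal_simps [simp]: "scal 0 = 0" "scal 1 = 1"
  by (simp_all add: scal_def)

lemma scal_add: "scal (a + b) = scal a + scal b" and scal_diff: "scal (a - b) = scal a - scal b"
  and scal_mult: "scal (a * b) = scal a * scal b"
  by (simp_all add: scal_def single_add single_diff mult_single)

lemma scal_comm: "scal c * x = x * scal c"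
proof -
  let ?m = "\<lambda>w. Poly_Mapping.single w (Poly_Mapping.lookup x w)"
  have "scal c * (\<Sum>w\<in>Poly_Mapping.keys x. ?m w) = (\<Sum>w\<in>Poly_Mapping.keys x. ?m w) * scal c"
    by (simp add: sum_distrib_left sum_distrib_right scal_def mult_single mult.commute)
  then show ?thesis
    by (simp only: sum_single_keys)
qed

lemma free_algebra_simps [simp]:
  "mult (free_algebra X) = (*)" "one (free_algebra X) = 1" "zero (free_algebra X) = 0"
  "add (free_algebra X) = (+)"
  by (simp_all add: free_algebra_def)

lemma scal_in [simp]: "scal c \<in> carrier (free_algebra X)"
  by (auto simp: free_algebra_def scal_def zero_fword_def split: if_splits)

lemma gen_in [simp]: "gen i \<in> carrier (free_algebra X) \<longleftrightarrow> i \<in> X"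
  by (auto simp: free_algebra_def gen_def)

lemma add_in: "x \<in> carrier (free_algebra X) \<Longrightarrow> y \<in> carrier (free_algebra X) \<Longrightarrow>
    x + y \<in> carrier (free_algebra X)"
  unfolding free_algebra_def using Poly_Mapping.keys_add by fastforce

lemma minus_in: "x \<in> carrier (free_algebra X) \<Longrightarrow> - x \<in> carrier (free_algebra X)"
  by (auto simp: free_algebra_def in_keys_iff)

lemma diff_in: "x \<in> carrier (free_algebra X) \<Longrightarrow> y \<in> carrier (free_algebra X) \<Longrightarrow>
    x - y \<in> carrier (free_algebra X)"
  using add_in[of x X "- y"] minus_in by fastforce

lemma mult_in: "x \<in> carrier (free_algebra X) \<Longrightarrow> y \<in> carrier (free_algebra X) \<Longrightarrow>
    x * y \<in> carrier (free_algebra X)"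
  unfolding free_algebra_def using Poly_Mapping.keys_mult[of x y]
  by (fastforce simp: plus_fword_def)

lemma zero_in [simp]: "0 \<in> carrier (free_algebra X)" and one_in [simp]: "1 \<in> carrier (free_algebra X)"
  using scal_in[of 0 X] scal_in[of 1 X] by simp_all

lemma sum_in: "(\<And>i. i \<in> I \<Longrightarrow> x i \<in> carrier (free_algebra X)) \<Longrightarrow>
    (\<Sum>i\<in>I. x i) \<in> carrier (free_algebra X)"
  by (induction I rule: infinite_finite_induct) (auto intro: add_in)

lemma prod_list_in: "(\<And>x. x \<in> set xs \<Longrightarrow> x \<in> carrier (free_algebra X)) \<Longrightarrow>
    prod_list xs \<in> carrier (free_algebra X)"
  by (induction xs) (auto intro: mult_in)

lemma single_eq_word:
  "Poly_Mapping.single (FWord w) c = scal c * prod_list (map gen w)"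
proof -
  have "prod_list (map gen w) = Poly_Mapping.single (FWord w) (1::complex)"
  proof (induction w)
    case Nil
    show ?case by (simp add: zero_fword_def[symmetric])
  qed (simp add: gen_def mult_single plus_fword_def)
  then show ?thesis by (simp add: scal_def mult_single)
qed

text \<open>Words are built by prepending letters, so left multiplication by single generators
  suffices. This is the form that suits left modules, where \<open>gen i * y\<close> acts after
  \<open>y\<close>.\<close>

lemma free_algebra_induct [consumes 1, case_names one gen add scal]:
  assumes x: "x \<in> carrier (free_algebra X)"
    and one: "P 1"
    and gen: "\<And>i y. i \<in> X \<Longrightarrow> y \<in> carrier (free_algebra X) \<Longrightarrow> P y \<Longrightarrow> P (gen i * y)"
    and add: "\<And>y z. y \<in> carrier (free_algebra X) \<Longrightarrow> z \<in> carrier (free_algebra X) \<Longrightarrow> P y \<Longrightarrow> P z \<Longrightarrow> P (y + z)"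
    and scal: "\<And>c y. y \<in> carrier (free_algebra X) \<Longrightarrow> P y \<Longrightarrow> P (scal c * y)"
  shows "P x"
proof -
  have word: "prod_list (map gen w) \<in> carrier (free_algebra X) \<and> P (prod_list (map gen w))"
    if "set w \<subseteq> X" for w
    using that by (induction w) (auto intro: one gen mult_in)
  have sg: "Poly_Mapping.single w c \<in> carrier (free_algebra X) \<and> P (Poly_Mapping.single w c)"
    if "w \<in> Poly_Mapping.keys x" for w c
  proof -
    have "set (letters w) \<subseteq> X" using x that by (auto simp: free_algebra_def)
    then show ?thesis
      using single_eq_word[of "letters w" c] word[of "letters w"] scal mult_in[OF scal_in] by auto
  qed
  have P0: "P 0"
    using scal[of 1 0] one by simp
  have "(\<Sum>w\<in>S. Poly_Mapping.single w (Poly_Mapping.lookup x w)) \<in> carrier (free_algebra X) \<and>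
      P (\<Sum>w\<in>S. Poly_Mapping.single w (Poly_Mapping.lookup x w))"
    if "finite S" "S \<subseteq> Poly_Mapping.keys x" for S
    using that
  proof (induction S rule: finite_induct)
    case empty
    then show ?case by (simp add: P0)
  next
    case (insert w S)
    have "(\<Sum>w\<in>S. Poly_Mapping.single w (Poly_Mapping.lookup x w)) \<in> carrier (free_algebra X)"
      "P (\<Sum>w\<in>S. Poly_Mapping.single w (Poly_Mapping.lookup x w))"
      using insert by auto
    then show ?case
      using insert.hyps insert.prems sg[of w "Poly_Mapping.lookup x w"] add[of "Poly_Mapping.single w (Poly_Mapping.lookup x w)"]
        add_in[of "Poly_Mapping.single w (Poly_Mapping.lookup x w)" X] by simp
  qed
  from this[of "Poly_Mapping.keys x"] show ?thesis
    by (simp add: sum_single_keys)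
qed

section \<open>A central element of the two-boundary Hecke algebra\<close>

lemma commute_inverse:
  fixes a b x :: "'a::ring_1"
  assumes "a * b = 1" "b * a = 1" "a * x = x * a"
  shows "b * x = x * b"
proof -
  have "b * x = b * (x * a) * b" using assms(1) by (simp add: mult.assoc)
  also have "\<dots> = x * b" unfolding assms(3)[symmetric] using assms(2) by (simp add: mult.assoc[symmetric])
  finally show ?thesis .
qed

text \<open>No base field is assumed: \<open>\<kappa>\<close>, \<open>\<alpha>\<close>,
  \<open>\<beta>\<close> are merely central. The difference \<open>G i - Gi i\<close> in the bulk
  and the sums at the two ends reflect the normalisation, in which the two eigenvalues have product
  -1 in the bulk and 1 at the boundaries.\<close>

locale hecke =
  fixes N :: nat and G Gi :: "nat \<Rightarrow> 'a::ring_1" and \<kappa> \<alpha> \<beta> :: 'a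
  assumes N2: "N \<ge> 2"
    and inv1: "i \<le> N \<Longrightarrow> G i * Gi i = 1" and inv2: "i \<le> N \<Longrightarrow> Gi i * G i = 1"
    and braid: "1 \<le> i \<Longrightarrow> i + 1 < N \<Longrightarrow> G i * G (Suc i) * G i = G (Suc i) * G i * G (Suc i)"
    and braid0: "G 0 * G 1 * G 0 * G 1 = G 1 * G 0 * G 1 * G 0"
    and braidN: "G (N-1) * G N * G (N-1) * G N = G N * G (N-1) * G N * G (N-1)"
    and far: "i \<le> N \<Longrightarrow> j \<le> N \<Longrightarrow> i + 1 < j \<Longrightarrow> G i * G j = G j * G i"
    and quad: "1 \<le> i \<Longrightarrow> i < N \<Longrightarrow> G i - Gi i = \<kappa>" and \<kappa>: "\<kappa> * x = x * \<kappa>"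
    and quad0: "G 0 + Gi 0 = \<alpha>" and \<alpha>: "\<alpha> * x = x * \<alpha>"
    and quadN: "G N + Gi N = \<beta>" and \<beta>: "\<beta> * x = x * \<beta>"
begin

lemma far': "i \<le> N \<Longrightarrow> j \<le> N \<Longrightarrow> i + 1 < j \<or> j + 1 < i \<Longrightarrow> G i * G j = G j * G i"
  using far[of i j] far[of j i] by auto

lemma farI: "i \<le> N \<Longrightarrow> j \<le> N \<Longrightarrow> i + 1 < j \<or> j + 1 < i \<Longrightarrow> Gi i * G j = G j * Gi i"
  by (rule commute_inverse[OF inv1 inv2]) (auto simp: far')

text \<open>\<open>tt d\<close> is the conjugate \<open>g\<^sub>j\<^sub>+\<^sub>1\<^sup>-\<^sup>1 \<cdots> g\<^sub>N\<^sub>-\<^sub>1\<^sup>-\<^sup>1 g\<^sub>N g\<^sub>N\<^sub>-\<^sub>1 \<cdots> g\<^sub>j\<^sub>+\<^sub>1\<close> with \<open>j = N - 1 - d\<close>.\<close>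

primrec tt :: "nat \<Rightarrow> 'a" where
  "tt 0 = G N"
| "tt (Suc d) = Gi (N - 1 - d) * tt d * G (N - 1 - d)"

primrec ti :: "nat \<Rightarrow> 'a" where
  "ti 0 = Gi N"
| "ti (Suc d) = Gi (N - 1 - d) * ti d * G (N - 1 - d)"

primrec JJ :: "nat \<Rightarrow> 'a" where
  "JJ 0 = tt (N - 1) * G 0"
| "JJ (Suc i) = G (Suc i) * JJ i * G (Suc i)"

primrec JI :: "nat \<Rightarrow> 'a" where
  "JI 0 = Gi 0 * ti (N - 1)"
| "JI (Suc i) = Gi (Suc i) * JI i * Gi (Suc i)"

definition ZZ :: 'a where "ZZ = (\<Sum>i<N. JJ i + JI i)"

text \<open>Matches the recursive conjugate with the explicit product in the definition of
  \<open>J 0\<close>.\<close>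

lemma tt_eq_word:
  assumes "d < N"
  shows "tt d = prod_list (map Gi [N - d..<N]) * G N * prod_list (map G (rev [N - d..<N]))"
  using assms
proof (induction d)
  case (Suc d)
  have "N - Suc d < N" "Suc (N - Suc d) = N - d" "N - 1 - d = N - Suc d"
    using Suc.prems by auto
  then have "[N - Suc d..<N] = (N - 1 - d) # [N - d..<N]"
    by (simp add: upt_conv_Cons)
  then show ?case
    using Suc by (simp add: mult.assoc)
qed simp

lemma conj_inv:
  fixes a b c d :: 'a
  assumes "a * b = 1" "b * a = 1" "c * d = 1"
  shows "(b * c * a) * (b * d * a) = 1"
  using assms by (simp add: mult.assoc cancel_left)

lemma tt_inv: "d < N \<Longrightarrow> tt d * ti d = 1 \<and> ti d * tt d = 1"
proof (induction d)
  case 0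
  then show ?case by (simp add: inv1 inv2)
next
  case (Suc d)
  then show ?case
    using conj_inv[of "G (N - 1 - d)" "Gi (N - 1 - d)"] inv1[of "N - 1 - d"] inv2[of "N - 1 - d"]
    by auto
qed

lemma tt_quad: "d < N \<Longrightarrow> tt d + ti d = \<beta>"
proof (induction d)
  case 0
  then show ?case by (simp add: quadN)
next
  case (Suc d)
  have "tt (Suc d) + ti (Suc d) = Gi (N - 1 - d) * (tt d + ti d) * G (N - 1 - d)"
    by (simp add: algebra_simps)
  also have "\<dots> = \<beta>"
    using Suc inv2[of "N - 1 - d"] by (simp add: \<beta>[symmetric] mult.assoc)
  finally show ?case .
qed

text \<open>All letters of \<open>tt d\<close> have index at least \<open>N - d\<close>, so
  \<open>G j\<close> is far from each of them.\<close>

lemma tt_comm_low: "d < N \<Longrightarrow> j + d + 2 \<le> N \<Longrightarrow> G j * tt d = tt d * G j"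
proof (induction d)
  case 0
  then show ?case by (simp add: far')
next
  case (Suc d)
  have a: "G j * Gi (N - 1 - d) = Gi (N - 1 - d) * G j" "G j * G (N - 1 - d) = G (N - 1 - d) * G j"
    "G j * tt d = tt d * G j"
    using Suc farI[of "N - 1 - d" j] far'[of "N - 1 - d" j] by (simp_all add: less_diff_conv)
  show ?case
    unfolding tt.simps by (intro commute_mult a)
qed

text \<open>The critical case is the second smallest index. There \<open>G j\<close> turns into
  \<open>G (j - 1)\<close> when it passes \<open>Gi (j - 1) * Gi j\<close>, commutes with the inner
  conjugate by \<open>tt_comm_low\<close>, and turns back into \<open>G j\<close> on the other
  side.\<close>

lemma tt_comm_high: "d < N \<Longrightarrow> j + d > N \<Longrightarrow> j < N \<Longrightarrow> G j * tt d = tt d * G j"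
proof (induction d)
  case (Suc d)
  define m where "m = N - 1 - d"
  have m: "Suc m + d = N" using Suc.prems by (simp add: m_def)
  show ?case
  proof (cases "j = Suc m")
    case False
    then have "j > m + 1" using Suc.prems m by simp
    then have "G j * Gi m = Gi m * G j" "G j * G m = G m * G j" "G j * tt d = tt d * G j"
      using Suc farI[of m j] far'[of m j] m by auto
    then show ?thesis
      unfolding tt.simps m_def[symmetric] by (intro commute_mult)
  next
    case True
    then obtain e where e: "d = Suc e" using Suc.prems m by (cases d) auto
    have m1: "1 \<le> m" "N - 1 - e = Suc m" using m Suc.prems e by auto
    let ?a = "G m" and ?b = "G (Suc m)" and ?ai = "Gi m" and ?bi = "Gi (Suc m)" and ?s = "tt e"
    have inv: "?a * ?ai = 1" "?ai * ?a = 1" "?b * ?bi = 1" "?bi * ?b = 1"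
      using m e by (auto simp: inv1 inv2)
    have br: "?a * ?b * ?a = ?b * ?a * ?b" using braid[of m] m1 m e by auto
    have s: "?a * ?s = ?s * ?a" using tt_comm_low[of e m] m e by auto
    have 1: "?b * ?ai * ?bi = ?ai * ?bi * ?a"
    proof -
      have "?b * ?ai * ?bi = ?ai * ?bi * (?b * ?a * ?b) * ?ai * ?bi"
        using inv by (simp add: mult.assoc cancel_left)
      also have "\<dots> = ?ai * ?bi * ?a"
        unfolding br[symmetric] using inv by (simp add: mult.assoc cancel_left)
      finally show ?thesis .
    qed
    have "?b * (?ai * (?bi * ?s * ?b) * ?a) = (?b * ?ai * ?bi) * ?s * ?b * ?a"
      by (simp add: mult.assoc)
    also have "\<dots> = ?ai * ?bi * ?s * (?a * ?b * ?a)"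
      unfolding 1 using s[symmetric, THEN mult_cong_left] by (simp add: mult.assoc)
    also have "\<dots> = (?ai * (?bi * ?s * ?b) * ?a) * ?b"
      unfolding br by (simp add: mult.assoc)
    finally show ?thesis
      using True e m1 m by (simp add: m_def)
  qed
qed simp

text \<open>Conjugation by \<open>?c = ?a * ?b\<close> sends \<open>?a\<close> to \<open>?b\<close>,
  by the braid relation, and \<open>?u\<close> to \<open>?t\<close>, because \<open>?a\<close>
  commutes with \<open>?t\<close>. So the relation for \<open>?a\<close>, \<open>?u\<close> is a
  conjugate of the one already known for \<open>?b\<close>, \<open>?t\<close>.\<close>

lemma tt_braid: "d < N - 1 \<Longrightarrow>
    G (N - 1 - d) * tt d * G (N - 1 - d) * tt d = tt d * G (N - 1 - d) * tt d * G (N - 1 - d)"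
proof (induction d)
  case 0
  then show ?case using braidN by simp
next
  case (Suc d)
  define m where "m = N - 1 - Suc d"
  have m: "N - 1 - d = Suc m" "1 \<le> m" "Suc (Suc m) + d = N" using Suc.prems by (auto simp: m_def)
  let ?a = "G m" and ?b = "G (Suc m)" and ?ai = "Gi m" and ?bi = "Gi (Suc m)" and ?t = "tt d"
  have inv: "?a * ?ai = 1" "?ai * ?a = 1" "?b * ?bi = 1" "?bi * ?b = 1"
    using m by (auto simp: inv1 inv2)
  have br: "?a * ?b * ?a = ?b * ?a * ?b" using braid[of m] m by auto
  have s: "?a * ?t = ?t * ?a" using tt_comm_low[of d m] m by auto
  have IH: "?b * ?t * ?b * ?t = ?t * ?b * ?t * ?b" using Suc m by simp
  let ?c = "?a * ?b" and ?ci = "?bi * ?ai" and ?u = "?bi * ?t * ?b"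
  have c: "?ci * ?c = 1" "?c * ?ci = 1" using inv by (simp_all add: mult.assoc cancel_left)
  have ca: "?c * ?a = ?b * ?c" using br by (simp add: mult.assoc)
  have cu: "?c * ?u = ?t * ?c"
    using inv s[THEN mult_cong_left] by (simp add: mult.assoc cancel_left)
  have ca': "?c * (?a * x) = ?b * (?c * x)" and cu': "?c * (?u * x) = ?t * (?c * x)" for x
    by (metis ca mult.assoc, metis cu mult.assoc)
  have cc: "?c * (?a * (?u * (?a * ?u))) = ?b * (?t * (?b * (?t * ?c)))"
    unfolding ca' cu' cu ..
  have "?c * (?u * (?a * (?u * ?a))) = ?t * (?b * (?t * (?b * ?c)))"
    unfolding ca' cu' ca ..
  also have "\<dots> = ?c * (?a * (?u * (?a * ?u)))"
    unfolding cc using IH[THEN arg_cong[of _ _ "\<lambda>x. x * ?c"]] by (simp add: mult.assoc)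
  finally have "?ci * (?c * (?u * (?a * (?u * ?a)))) = ?ci * (?c * (?a * (?u * (?a * ?u))))"
    by (rule arg_cong)
  then have "?a * ?u * ?a * ?u = ?u * ?a * ?u * ?a"
    unfolding cancel_left[OF c(1)] by (simp only: mult.assoc)
  then show ?case using m by (simp add: m_def)
qed

lemma JJ_inv: "i < N \<Longrightarrow> JJ i * JI i = 1 \<and> JI i * JJ i = 1"
proof (induction i)
  case 0
  have "tt (N - 1) * (G 0 * Gi 0) * ti (N - 1) = 1" "Gi 0 * (ti (N - 1) * tt (N - 1)) * G 0 = 1"
    using tt_inv[of "N - 1"] N2 by (auto simp: inv1 inv2)
  then show ?case by (simp add: mult.assoc)
next
  case (Suc i)
  have "G (Suc i) * (JJ i * (G (Suc i) * Gi (Suc i)) * JI i) * Gi (Suc i) = 1"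
    "Gi (Suc i) * (JI i * (Gi (Suc i) * G (Suc i)) * JJ i) * G (Suc i) = 1"
    using Suc by (auto simp: inv1 inv2)
  then show ?case by (simp add: mult.assoc)
qed

section \<open>Commutation of the \<open>JJ i\<close> with the generators and with
  \<open>JJ 0\<close>\<close>

lemma JI_comm: "i < N \<Longrightarrow> x * JJ i = JJ i * x \<Longrightarrow> x * JI i = JI i * x"
  using commute_inverse[of "JJ i" "JI i" x] JJ_inv by metis

lemma G_J0: assumes "2 \<le> j" "j < N" shows "G j * JJ 0 = JJ 0 * G j"
proof -
  have "G j * tt (N - 1) = tt (N - 1) * G j" "G j * G 0 = G 0 * G j"
    using assms tt_comm_high[of "N - 1" j] far'[of j 0] by auto
  then show ?thesis unfolding JJ.simps by (intro commute_mult)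
qed

lemma G_J_low: "i + 1 < j \<Longrightarrow> j < N \<Longrightarrow> G j * JJ i = JJ i * G j"
proof (induction i)
  case 0
  then show ?case using G_J0[of j] by simp
next
  case (Suc i)
  then have "G j * JJ i = JJ i * G j" "G j * G (Suc i) = G (Suc i) * G j"
    using far'[of j "Suc i"] by auto
  then show ?case unfolding JJ.simps by (intro commute_mult)
qed

text \<open>The usual argument for Jucys-Murphy elements. In the critical case the element is
  \<open>?b * (?a * ?J * ?a) * ?b\<close> with \<open>?J\<close> commuting with \<open>?b\<close>,
  and two braid moves carry \<open>?a\<close> from the left end to the right end.\<close>

lemma G_J_high: assumes "1 \<le> j" shows "j < i \<Longrightarrow> i < N \<Longrightarrow> G j * JJ i = JJ i * G j"
proof (induction i)
  case (Suc i)
  show ?case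
  proof (cases "j = i")
    case False
    then have "G j * JJ i = JJ i * G j" "G j * G (Suc i) = G (Suc i) * G j"
      using Suc far'[of j "Suc i"] by auto
    then show ?thesis unfolding JJ.simps by (intro commute_mult)
  next
    case True
    then obtain e where e: "j = Suc e" using assms by (cases j) auto
    let ?a = "G j" and ?b = "G (Suc j)" and ?J = "JJ e"
    have "?b * ?J = ?J * ?b" using e True Suc.prems G_J_low[of e "Suc j"] by auto
    moreover have "?a * ?b * ?a = ?b * ?a * ?b" using braid[of j] assms True Suc.prems by auto
    moreover have "?a * (?b * (?a * ?J * ?a) * ?b) = (?a * ?b * ?a) * ?J * ?a * ?b"
      by (simp only: mult.assoc)
    moreover have "(?b * ?a * ?b) * ?J * ?a * ?b = ?b * ?a * (?b * ?J) * ?a * ?b"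
      by (simp only: mult.assoc)
    moreover have "?b * ?a * (?J * ?b) * ?a * ?b = ?b * ?a * ?J * (?b * ?a * ?b)"
      by (simp only: mult.assoc)
    moreover have "?b * ?a * ?J * (?a * ?b * ?a) = ?b * (?a * ?J * ?a) * ?b * ?a"
      by (simp only: mult.assoc)
    ultimately have "?a * (?b * (?a * ?J * ?a) * ?b) = ?b * (?a * ?J * ?a) * ?b * ?a"
      by simp
    then show ?thesis unfolding True[symmetric] JJ.simps e by (simp only: JJ.simps)
  qed
qed simp

lemma T_conj: "tt (N - 1) = Gi 1 * tt (N - 2) * G 1"
proof -
  have "N - 1 = Suc (N - 2)" "N - 1 - (N - 2) = 1" using N2 by auto
  then show ?thesis using tt.simps(2)[of "N - 2"] by simp
qed

lemma G0_T': "G 0 * tt (N - 2) = tt (N - 2) * G 0"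
  using tt_comm_low[of "N - 2" 0] N2 by simp

text \<open>The leading \<open>Gi 1\<close> of \<open>tt (N - 1)\<close> cancels. What remains of
  the left boundary is \<open>G 1 * G 0 * G 1\<close>, which commutes with \<open>G 0\<close> by
  \<open>braid0\<close>.\<close>

lemma J1_eq: "JJ 1 = tt (N - 2) * (G 1 * G 0 * G 1)"
proof -
  have "JJ 1 = (G 1 * Gi 1) * tt (N - 2) * (G 1 * G 0 * G 1)"
    using T_conj by (simp add: mult.assoc)
  then show ?thesis using inv1[of 1] N2 by simp
qed

lemma G0_J1: "G 0 * JJ 1 = JJ 1 * G 0"
  unfolding J1_eq by (rule commute_mult[OF G0_T']) (use braid0 in \<open>simp add: mult.assoc\<close>)

lemma G0_J: "1 \<le> i \<Longrightarrow> i < N \<Longrightarrow> G 0 * JJ i = JJ i * G 0"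
proof (induction i rule: dec_induct)
  case base
  then show ?case using G0_J1 by simp
next
  case (step i)
  then have "G 0 * JJ i = JJ i * G 0" "G 0 * G (Suc i) = G (Suc i) * G 0"
    using far'[of 0 "Suc i"] by auto
  then show ?case unfolding JJ.simps by (intro commute_mult)
qed

text \<open>Multiplication by \<open>G 1\<close> clears the inverse in \<open>JJ 0\<close>. Then
  both boundary relations apply: \<open>braid0\<close> at the left end and \<open>tt_braid\<close>,
  which transports \<open>braidN\<close> next to \<open>G 1\<close>.\<close>

lemma J0_J1: "JJ 0 * JJ 1 = JJ 1 * JJ 0"
proof -
  let ?a = "G 0" and ?b = "G 1" and ?bi = "Gi 1" and ?t = "tt (N - 2)"
  have inv: "?b * ?bi = 1" "?bi * ?b = 1" using N2 inv1 inv2 by auto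
  have J0: "JJ 0 = ?bi * ?t * ?b * ?a" using T_conj by (simp add: mult.assoc)
  have s: "?a * ?t = ?t * ?a" by (rule G0_T')
  have bt: "?b * ?t * ?b * ?t = ?t * ?b * ?t * ?b"
    using tt_braid[of "N - 2"] N2 by (simp add: numeral_2_eq_2 Suc_diff_Suc)
  have ab: "?a * ?b * ?a * ?b = ?b * ?a * ?b * ?a" by (rule braid0)
  have "?b * (JJ 0 * JJ 1) = ?t * ?b * (?a * ?t) * ?b * ?a * ?b"
    unfolding J0 J1_eq using inv by (simp add: mult.assoc cancel_left)
  also have "\<dots> = ?t * ?b * ?t * (?a * ?b * ?a * ?b)"
    unfolding s by (simp add: mult.assoc)
  also have "\<dots> = (?t * ?b * ?t * ?b) * ?a * ?b * ?a"
    unfolding ab by (simp add: mult.assoc)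
  also have "\<dots> = ?b * ?t * ?b * (?t * ?a) * ?b * ?a"
    unfolding bt[symmetric] by (simp add: mult.assoc)
  also have "\<dots> = ?b * (JJ 1 * JJ 0)"
    unfolding J0 J1_eq s[symmetric] using inv by (simp add: mult.assoc cancel_left)
  finally have "?bi * (?b * (JJ 0 * JJ 1)) = ?bi * (?b * (JJ 1 * JJ 0))"
    by (rule arg_cong)
  then show ?thesis
    unfolding cancel_left[OF inv(2)] .
qed

lemma J0_J: "i < N \<Longrightarrow> JJ 0 * JJ i = JJ i * JJ 0"
proof (cases "i = 0")
  case False
  assume "i < N"
  moreover have "1 \<le> i" using False by simp
  ultimately have "1 \<le> i \<Longrightarrow> i < N \<Longrightarrow> JJ 0 * JJ i = JJ i * JJ 0"
  proof (induction i)
    case (Suc i)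
    show ?case
    proof (cases "i = 0")
      case False
      then have "JJ 0 * JJ i = JJ i * JJ 0" "JJ 0 * G (Suc i) = G (Suc i) * JJ 0"
        using Suc G_J0[of "Suc i"] by auto
      then show ?thesis unfolding JJ.simps(2) by (intro commute_mult)
    qed (use J0_J1 in simp)
  qed simp
  then show ?thesis using \<open>i < N\<close> \<open>1 \<le> i\<close> by blast
qed simp

text \<open>It is easier to commute with the inverse: \<open>ai * (x + a * x * a)\<close> and
  \<open>(x + a * x * a) * ai\<close> differ by the commutator of \<open>x\<close> with
  \<open>a - ai\<close>, which is central.\<close>

lemma quad_step:
  fixes a ai x k :: 'a
  assumes "a * ai = 1" "ai * a = 1" "a - ai = k" "\<And>x. k * x = x * k"
  shows "a * (x + a * x * a) = (x + a * x * a) * a"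
proof -
  have "ai * (x + a * x * a) = ai * x + x * a" "(x + a * x * a) * ai = x * ai + a * x"
    using assms(1,2) by (simp_all add: distrib_left distrib_right mult.assoc cancel_left)
  moreover have "ai * x + x * a = x * ai + a * x"
  proof -
    have "a * x - ai * x = x * a - x * ai"
      using assms(4)[of x] unfolding assms(3)[symmetric] by (simp add: left_diff_distrib right_diff_distrib)
    then show ?thesis by (simp add: algebra_simps)
  qed
  ultimately show ?thesis
    using commute_inverse[of ai a "x + a * x * a"] assms by simp
qed

text \<open>\<open>G j\<close> commutes with \<open>JJ i\<close> unless \<open>i\<close> is
  \<open>j - 1\<close> or \<open>j\<close>. These two do not commute with it separately, but their
  sum has the shape of \<open>quad_step\<close>, as \<open>JJ j\<close> is
  \<open>G j * JJ (j - 1) * G j\<close>.\<close>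

lemma ZZ_G: assumes "1 \<le> j" "j < N" shows "G j * ZZ = ZZ * G j"
proof -
  obtain m where m: "j = Suc m" using assms by (cases j) auto
  define D where "D i = G j * (JJ i + JI i) - (JJ i + JI i) * G j" for i
  have D0: "D i = 0" if "i < N" "i \<notin> {m, j}" for i
  proof -
    have "G j * JJ i = JJ i * G j"
      using that assms m G_J_low[of i j] G_J_high[of j i] by (cases "i < m") auto
    then show ?thesis
      using JI_comm[OF \<open>i < N\<close>] by (simp add: D_def algebra_simps)
  qed
  have inv: "G j * Gi j = 1" "Gi j * G j = 1" "G j - Gi j = \<kappa>" using assms by (auto simp: inv1 inv2 quad)
  have "G j * (JJ m + JJ j) = (JJ m + JJ j) * G j"
    using quad_step[OF inv, of "JJ m"] \<kappa> m by auto
  \<comment> \<open>The same argument for the inverses, with \<open>Gi j\<close> as the conjugating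
    element and \<open>- \<kappa>\<close> as the central difference.\<close>
  moreover have "Gi j * (JI m + JI j) = (JI m + JI j) * Gi j"
    using quad_step[OF inv(2,1), of "- \<kappa>" "JI m"] inv(3) \<kappa> m by (auto simp: minus_equation_iff)
  then have "G j * (JI m + JI j) = (JI m + JI j) * G j"
    using commute_inverse[of "Gi j" "G j"] inv by blast
  ultimately have "D m + D j = 0"
    by (simp add: D_def algebra_simps)
  have "G j * ZZ - ZZ * G j = (\<Sum>i<N. D i)"
    unfolding ZZ_def D_def sum_distrib_left sum_distrib_right sum_subtractf ..
  also have "\<dots> = (\<Sum>i\<in>{m, j}. D i)"
    by (rule sum.mono_neutral_right) (use m assms D0 in auto)
  also have "\<dots> = 0" using \<open>D m + D j = 0\<close> m by simp
  finally show ?thesis by simp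
qed

text \<open>The inverses in \<open>JI 0\<close> are eliminated by
  \<open>Gi 0 = \<alpha> - G 0\<close> and \<open>ti (N - 1) = \<beta> - tt (N - 1)\<close>. The
  resulting polynomial commutes with \<open>G 0\<close> because of the quadratic equation
  \<open>aa\<close>.\<close>

lemma G0_Z: "G 0 * ZZ = ZZ * G 0"
proof -
  let ?a = "G 0" and ?t = "tt (N - 1)"
  have ai: "Gi 0 = \<alpha> - ?a" using quad0 by (simp add: algebra_simps)
  have bi: "ti (N - 1) = \<beta> - ?t" using tt_quad[of "N - 1"] N2 by (simp add: algebra_simps)
  have aa: "?a * ?a = \<alpha> * ?a - 1"
    using inv2[of 0] ai by (simp add: algebra_simps)
  have "JJ 0 + JI 0 = ?t * ?a + ?a * ?t - \<alpha> * ?t - ?a * \<beta> + \<alpha> * \<beta>"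
    unfolding JJ.simps JI.simps ai bi by (simp add: algebra_simps)
  moreover have "?a * (?t * ?a + ?a * ?t - \<alpha> * ?t - ?a * \<beta> + \<alpha> * \<beta>) -
      (?t * ?a + ?a * ?t - \<alpha> * ?t - ?a * \<beta> + \<alpha> * \<beta>) * ?a = 0"
  proof -
    have 1: "?a * (?a * ?t) = \<alpha> * ?a * ?t - ?t" "?t * ?a * ?a = ?t * (\<alpha> * ?a) - ?t"
      using aa[THEN mult_cong_left, of ?t] by (simp_all add: aa left_diff_distrib right_diff_distrib mult.assoc)
    have 2: "?a * (\<alpha> * ?t) = \<alpha> * ?a * ?t" "?t * (\<alpha> * ?a) = \<alpha> * ?t * ?a"
      "?a * (?a * \<beta>) = ?a * \<beta> * ?a" "?a * (\<alpha> * \<beta>) = \<alpha> * \<beta> * ?a"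
      using \<alpha>[of ?a] \<alpha>[of ?t] \<beta>[of ?a] \<alpha>[of \<beta>] \<beta>[of "?a * \<alpha>"]
        \<alpha>[of ?a, THEN mult_cong_left, of ?t] \<alpha>[of ?t, symmetric, THEN mult_cong_left, of ?a]
        \<alpha>[of ?a, symmetric, THEN mult_cong_left, of \<beta>]
      by (simp_all add: mult.assoc)
    have 3: "?a * (?a * ?t) = \<alpha> * (?a * ?t) - ?t" "?t * (?a * ?a) = \<alpha> * (?t * ?a) - ?t"
      using 1 2 by (simp_all add: mult.assoc)
    show ?thesis
      using 2 3 by (simp add: distrib_left distrib_right left_diff_distrib right_diff_distrib mult.assoc)
  qed
  ultimately have "?a * (JJ 0 + JI 0) - (JJ 0 + JI 0) * ?a = 0" by (simp only:)
  then have "?a * (JJ 0 + JI 0) = (JJ 0 + JI 0) * ?a" by (simp only: right_minus_eq)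
  moreover have "?a * (JJ i + JI i) = (JJ i + JI i) * ?a" if "1 \<le> i" "i < N" for i
    using G0_J[OF that] JI_comm[OF that(2) G0_J[OF that]] by (simp only: distrib_left distrib_right)
  ultimately have "?a * (JJ i + JI i) = (JJ i + JI i) * ?a" if "i < N" for i
    using that by (cases "i = 0") auto
  then show ?thesis
    unfolding ZZ_def sum_distrib_left sum_distrib_right by (intro sum.cong) auto
qed

text \<open>For \<open>j = N\<close>, centrality is pulled back from \<open>JJ 0\<close>, which
  commutes with every \<open>JJ i\<close>: removing \<open>G 0\<close> leaves
  \<open>tt (N - 1)\<close>, and undoing the conjugations one at a time ends at
  \<open>tt 0 = G N\<close>. All removed letters are known to commute with
  \<open>ZZ\<close>.\<close>

lemma ZZ_central: assumes "j \<le> N" shows "G j * ZZ = ZZ * G j"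
proof (cases "j < N")
  case True
  then show ?thesis using G0_Z ZZ_G[of j] by (cases "j = 0") auto
next
  case False
  have "JJ 0 * (JJ i + JI i) = (JJ i + JI i) * JJ 0" if "i < N" for i
    using J0_J[OF that] JI_comm[OF that J0_J[OF that]] by (simp only: distrib_left distrib_right)
  then have J0: "JJ 0 * ZZ = ZZ * JJ 0"
    unfolding ZZ_def sum_distrib_left sum_distrib_right by (intro sum.cong) auto
  have T0: "tt (N - 1) * ZZ = ZZ * tt (N - 1)"
  proof -
    have "tt (N - 1) = JJ 0 * Gi 0" using inv1[of 0] by (simp add: mult.assoc)
    moreover have "Gi 0 * ZZ = ZZ * Gi 0"
      by (rule commute_inverse[OF inv1 inv2 G0_Z]) auto
    ultimately show ?thesis using commute_mult[of ZZ "JJ 0" "Gi 0"] J0 by simp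
  qed
  have "tt (N - 1 - e) * ZZ = ZZ * tt (N - 1 - e)" if "e \<le> N - 1" for e
    using that
  proof (induction e)
    case (Suc e)
    define d where "d = N - 1 - Suc e"
    have d: "N - 1 - e = Suc d" "N - 1 - d = Suc e" using Suc.prems by (auto simp: d_def)
    let ?g = "G (Suc e)" and ?gi = "Gi (Suc e)"
    have inv: "?g * ?gi = 1" "?gi * ?g = 1" using Suc.prems by (auto intro: inv1 inv2)
    have g: "?g * ZZ = ZZ * ?g" using ZZ_G[of "Suc e"] Suc.prems N2 by auto
    have gi: "?gi * ZZ = ZZ * ?gi" by (rule commute_inverse[OF inv g])
    have "tt d = ?g * tt (Suc d) * ?gi"
      using inv d by (simp add: mult.assoc cancel_left)
    moreover have "tt (Suc d) * ZZ = ZZ * tt (Suc d)" using Suc d by auto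
    ultimately show ?case unfolding d_def[symmetric] using commute_mult[of ZZ "?g * tt (Suc d)" ?gi] commute_mult[of ZZ ?g "tt (Suc d)"] g gi
      by (simp add: mult.assoc)
  qed (use T0 in simp)
  from this[of "N - 1"] show ?thesis using False assms by simp
qed

end

section \<open>The representation on paths\<close>

lemma qpow_add: "qpow \<eta> (x + y) = qpow \<eta> x * qpow \<eta> y"
  and qpow_minus: "qpow \<eta> (- x) = inverse (qpow \<eta> x)"
  and qpow_diff: "qpow \<eta> (x - y) = qpow \<eta> x / qpow \<eta> y"
  and qpow_0 [simp]: "qpow \<eta> 0 = 1"
  and qpow_nonzero [simp]: "qpow \<eta> x \<noteq> 0"
  by (simp_all add: qpow_def distrib_left right_diff_distrib exp_add exp_diff exp_minus)

lemma qnum_minus [simp]: "qnum \<eta> (- x) = - qnum \<eta> x"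
  by (simp add: qnum_def diff_divide_distrib)

lemma qnum_eq_0_iff:
  assumes "qpow \<eta> 1 - qpow \<eta> (- 1) \<noteq> 0"
  shows "qnum \<eta> x = 0 \<longleftrightarrow> qpow \<eta> (2 * x) = 1"
proof -
  have "qnum \<eta> x = 0 \<longleftrightarrow> qpow \<eta> x = inverse (qpow \<eta> x)"
    using assms by (simp add: qnum_def qpow_minus)
  also have "\<dots> \<longleftrightarrow> qpow \<eta> (2 * x) = 1"
    unfolding mult_2 qpow_add by (simp add: field_simps)
  finally show ?thesis .
qed

text \<open>A product-to-sum formula. It writes the numerator of \<open>k\<close> as a sum of
  exponentials in which the terms in \<open>\<theta>\<close> stand apart, so that values of
  \<open>k\<close> can be added.\<close>

lemma qnum_mult:
  assumes "qpow \<eta> 1 - qpow \<eta> (- 1) \<noteq> 0"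
  shows "(qpow \<eta> 1 - qpow \<eta> (- 1))\<^sup>2 * (qnum \<eta> x * qnum \<eta> y) =
    qpow \<eta> (x + y) + qpow \<eta> (- (x + y)) - qpow \<eta> (x - y) - qpow \<eta> (- (x - y))"
proof -
  have "(qpow \<eta> 1 - qpow \<eta> (- 1))\<^sup>2 * (qnum \<eta> x * qnum \<eta> y) =
      (qpow \<eta> x - qpow \<eta> (- x)) * (qpow \<eta> y - qpow \<eta> (- y))"
    using assms by (simp add: qnum_def power2_eq_square)
  also have "\<dots> = qpow \<eta> (x + y) + qpow \<eta> (- (x + y)) - qpow \<eta> (x - y) - qpow \<eta> (- (x - y))"
    unfolding qpow_minus by (simp add: qpow_add qpow_diff field_simps)
  finally show ?thesis .
qed

lemma quotient_sum:
  fixes a b c d a' b' e :: complex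
  shows "- ((a + b - c - d) / e) + (a' + b' - c - d) / e = (a' + b' - a - b) / e"
  by (simp add: add_divide_distrib diff_divide_distrib)

definition (in two_BTL) Paths :: "int list set"
  where "Paths = {p. length p = Suc N \<and> p ! 0 = 0 \<and> (\<forall>i<N. p ! Suc i = p ! i + 1 \<or> p ! Suc i = p ! i - 1)}"

text \<open>At \<open>i = N\<close> the condition is vacuous, so that a half-tile is handled like a
  tile.\<close>

definition (in two_BTL) turn :: "int list \<Rightarrow> nat \<Rightarrow> bool"
  where "turn p i \<longleftrightarrow> (i < N \<longrightarrow> p ! Suc i = p ! (i - 1))"

text \<open>\<open>oh h\<close> is the next height of an absent tile and \<open>nh h\<close> that of a present one,
  following height \<open>h\<close>; \<open>uu h\<close> is the parameter of the tile.\<close>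

definition oh :: "int \<Rightarrow> int" where "oh h = (if h \<ge> 0 then h - 1 else h + 1)"
definition nh :: "int \<Rightarrow> int" where "nh h = (if h \<ge> 0 then h + 1 else h - 1)"

text \<open>\<open>\<theta>\<close> is arbitrary here. The algebra \<open>TL\<close> does not depend
  on it, while the half-tile coefficients, and with them the path representation, do; every
  exceptional point is a separate instance.\<close>

locale btl = two_BTL N \<eta> \<omega>\<^sub>1 \<omega>\<^sub>2 for N \<eta> \<omega>\<^sub>1 \<omega>\<^sub>2 +
  fixes \<theta> :: complex
  assumes N2: "N \<ge> 2"
    and q_gen: "\<forall>m::nat. m > 0 \<longrightarrow> qpow \<eta> 1 ^ m \<noteq> 1"
    and w1_gen: "\<forall>m::int. qnum \<eta> (\<omega>\<^sub>1 - of_int m) \<noteq> 0"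
    and w2_gen: "qnum \<eta> \<omega>\<^sub>2 \<noteq> 0" "qnum \<eta> (\<omega>\<^sub>2 + 1) \<noteq> 0"
begin

definition uu :: "int \<Rightarrow> complex"
  where "uu h = (if h \<ge> 0 then \<omega>\<^sub>1 - of_int h else - \<omega>\<^sub>1 + of_int h)"

text \<open>\<open>cf\<close> and \<open>tau\<close> treat tiles and half-tiles uniformly: the
  scalar subtracted from \<open>e_i\<close>, and the weight in \<open>e_i * e_i\<close>.\<close>

definition cf :: "nat \<Rightarrow> complex \<Rightarrow> complex"
  where "cf i u = (if i < N then r u else k \<theta> u)"

definition tau :: "nat \<Rightarrow> complex"
  where "tau i = (if i < N then \<delta> else s\<^sub>2)"

section \<open>Identities for the tile coefficients\<close>

abbreviation DD :: complex where "DD \<equiv> qp 1 - qp (- 1)"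

lemma DD: "DD \<noteq> 0"
proof
  assume "DD = 0"
  then have "qp 1 ^ 2 = 1"
    by (simp add: qpow_minus field_simps power2_eq_square)
  then show False using q_gen by auto
qed

lemma qn_w1: "qn (\<omega>\<^sub>1 - of_int m) \<noteq> 0" and qn_w1': "qn (- \<omega>\<^sub>1 + of_int m) \<noteq> 0"
proof -
  show "qn (\<omega>\<^sub>1 - of_int m) \<noteq> 0" using w1_gen by blast
  then show "qn (- \<omega>\<^sub>1 + of_int m) \<noteq> 0"
    using qnum_minus[of \<eta> "\<omega>\<^sub>1 - of_int m"] by simp
qed

lemma qn_uu: "qn (uu h) \<noteq> 0"
  unfolding uu_def using qn_w1[of h] qn_w1'[of h] by presburger

lemma qn_w1_0: "qn \<omega>\<^sub>1 \<noteq> 0" "qn (\<omega>\<^sub>1 + 1) \<noteq> 0"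
  using qn_w1[of 0] qn_w1[of "-1"] by simp_all

lemma s1_nz: "s\<^sub>1 \<noteq> 0" and s2_nz: "s\<^sub>2 \<noteq> 0"
  using qn_w1_0 w2_gen by (simp_all add: s\<^sub>1_def s\<^sub>2_def)

lemma k_eq: "k \<theta> u = - ((qp (u - \<omega>\<^sub>2) + qp (- (u - \<omega>\<^sub>2)) - qp \<theta> - qp (- \<theta>)) / (DD\<^sup>2 * (qn u * qn (\<omega>\<^sub>2 + 1))))"
proof -
  have 1: "(u - \<omega>\<^sub>2 + \<theta>) / 2 + (u - \<omega>\<^sub>2 - \<theta>) / 2 = u - \<omega>\<^sub>2" "(u - \<omega>\<^sub>2 + \<theta>) / 2 - (u - \<omega>\<^sub>2 - \<theta>) / 2 = \<theta>"
    by (simp_all add: field_simps)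
  have 2: "DD\<^sup>2 * (qn ((u - \<omega>\<^sub>2 + \<theta>) / 2) * qn ((u - \<omega>\<^sub>2 - \<theta>) / 2)) =
      qp (u - \<omega>\<^sub>2) + qp (- (u - \<omega>\<^sub>2)) - qp \<theta> - qp (- \<theta>)"
    using qnum_mult[OF DD, of "(u - \<omega>\<^sub>2 + \<theta>) / 2" "(u - \<omega>\<^sub>2 - \<theta>) / 2"] unfolding 1 .
  show ?thesis
    unfolding k_def 2[symmetric] using DD by simp
qed

text \<open>The two summands are the diagonal entries of the 2x2 block of a tile, so this is its
  trace, which governs \<open>e_i * e_i\<close>. \<open>k_sum\<close> is the same for the
  half-tile.\<close>

lemma r_sum: assumes "qn u \<noteq> 0" shows "r u + r (- u) = \<delta>"
proof -
  have "DD\<^sup>2 * (qn 2 * qn u) = DD\<^sup>2 * (qn 1 * (qn (u + 1) + qn (u - 1)))"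
    unfolding distrib_left qnum_mult[OF DD] by (simp add: algebra_simps)
  moreover have "qn 1 = 1" using DD by (simp add: qnum_def)
  ultimately have e: "qn 2 * qn u = qn (u + 1) + qn (u - 1)" using DD by simp
  have m: "qn (- u + 1) = - qn (u - 1)"
    using qnum_minus[of \<eta> "u - 1"] by simp
  have "r (- u) = qn (u - 1) / qn u"
    unfolding r_def m by simp
  then have "r u + r (- u) = (qn 2 * qn u) / qn u"
    unfolding e by (simp add: r_def add_divide_distrib)
  then show ?thesis
    using assms by (simp add: \<delta>_def)
qed

lemma k_sum: assumes "qn u \<noteq> 0" shows "k \<theta> u + k \<theta> (- u) = s\<^sub>2"
proof -
  let ?e = "DD\<^sup>2 * (qn u * qn (\<omega>\<^sub>2 + 1))"
  have eq: "- u - \<omega>\<^sub>2 = - (u + \<omega>\<^sub>2)" by simp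
  have neg: "- (X / (e * (- a * b))) = X / (e * (a * b))" for X e a b :: complex by simp
  have "k \<theta> (- u) = (qp (u + \<omega>\<^sub>2) + qp (- (u + \<omega>\<^sub>2)) - qp \<theta> - qp (- \<theta>)) / ?e"
    unfolding k_eq[of "- u"] eq minus_minus qnum_minus neg by (simp only: add.commute)
  then have "k \<theta> u + k \<theta> (- u) = (qp (u + \<omega>\<^sub>2) + qp (- (u + \<omega>\<^sub>2)) - qp (u - \<omega>\<^sub>2) - qp (- (u - \<omega>\<^sub>2))) / ?e"
    unfolding k_eq[of u] by (simp only: quotient_sum)
  also have "\<dots> = DD\<^sup>2 * (qn u * qn \<omega>\<^sub>2) / ?e"
    unfolding qnum_mult[OF DD] ..
  also have "\<dots> = s\<^sub>2" using assms DD by (simp add: s\<^sub>2_def)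
  finally show ?thesis .
qed

lemma cf_sum: "qn u \<noteq> 0 \<Longrightarrow> cf i u + cf i (- u) = tau i"
  by (simp add: cf_def tau_def r_sum k_sum)

text \<open>The source of \<open>e_i * e_j * e_i = e_i\<close> for neighbours strictly between the
  boundaries: the middle factor lets one intermediate path survive, whose weight is this
  product.\<close>

lemma r_inv: assumes "qn u \<noteq> 0" "qn (u + 1) \<noteq> 0" shows "r u * r (- u - 1) = 1"
  using assms qnum_minus[of \<eta> u] qnum_minus[of \<eta> "u + 1"] by (simp add: r_def)

text \<open>The counterpart of \<open>r_inv\<close> when the middle factor is \<open>e_N\<close>. No
  later height selects the intermediate path, so the weights of two paths add up; their terms in
  \<open>\<theta>\<close> cancel.\<close>

lemma rk_sum:
  assumes "qn u \<noteq> 0" "qn (u + 1) \<noteq> 0" "qn (u - 1) \<noteq> 0"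
  shows "r (- u) * k \<theta> (u - 1) + r u * k \<theta> (- u - 1) = 1"
proof -
  let ?e = "DD\<^sup>2 * (qn u * qn (\<omega>\<^sub>2 + 1))"
  let ?P = "\<lambda>y. qp y + qp (- y) - qp \<theta> - qp (- \<theta>)"
  have m: "qn (- u + 1) = - qn (u - 1)" "qn (- u - 1) = - qn (u + 1)"
    using qnum_minus[of \<eta> "u - 1"] qnum_minus[of \<eta> "u + 1"] by simp_all
  have 1: "r (- u) * k \<theta> (u - 1) = - (?P (u - 1 - \<omega>\<^sub>2) / ?e)"
    unfolding k_eq r_def using assms m by simp
  have "r u * k \<theta> (- u - 1) = ?P (- u - 1 - \<omega>\<^sub>2) / ?e"
    unfolding k_eq r_def using assms m by simp
  moreover have "- u - 1 - \<omega>\<^sub>2 = - (u + (\<omega>\<^sub>2 + 1))" "- (- (u + (\<omega>\<^sub>2 + 1))) = u + (\<omega>\<^sub>2 + 1)"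
    by simp_all
  ultimately have 2: "r u * k \<theta> (- u - 1) = (qp (- (u + (\<omega>\<^sub>2 + 1))) + qp (u + (\<omega>\<^sub>2 + 1)) - qp \<theta> - qp (- \<theta>)) / ?e"
    by metis
  have "u - 1 - \<omega>\<^sub>2 = u - (\<omega>\<^sub>2 + 1)" by simp
  then have "r (- u) * k \<theta> (u - 1) = - ((qp (u - (\<omega>\<^sub>2 + 1)) + qp (- (u - (\<omega>\<^sub>2 + 1))) - qp \<theta> - qp (- \<theta>)) / ?e)"
    unfolding 1 by metis
  then have "r (- u) * k \<theta> (u - 1) + r u * k \<theta> (- u - 1) =
      (qp (u + (\<omega>\<^sub>2 + 1)) + qp (- (u + (\<omega>\<^sub>2 + 1))) - qp (u - (\<omega>\<^sub>2 + 1)) - qp (- (u - (\<omega>\<^sub>2 + 1)))) / ?e"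
    unfolding 2 by (simp only: quotient_sum add.commute[of "qp (- (u + (\<omega>\<^sub>2 + 1)))"])
  also have "\<dots> = DD\<^sup>2 * (qn u * qn (\<omega>\<^sub>2 + 1)) / ?e"
    unfolding qnum_mult[OF DD] ..
  also have "\<dots> = 1" using assms DD w2_gen by simp
  finally show ?thesis .
qed

text \<open>On heights \<open>z = h \<plusminus> 1\<close> following the height \<open>h\<close>, \<open>e\<^sub>i\<close> has the rank one matrix
  \<open>aa i h z * bb i h z'\<close>. It is scaled so that \<open>e\<^sub>i - cf i (uu h)\<close> maps the path without the tile
  to the path with it, with coefficient 1.\<close>

definition aa :: "nat \<Rightarrow> int \<Rightarrow> int \<Rightarrow> complex"
  where "aa i h z = (if z = nh h then 1 else cf i (uu h))"
definition bb :: "nat \<Rightarrow> int \<Rightarrow> int \<Rightarrow> complex"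
  where "bb i h z = (if z = nh h then cf i (- uu h) else 1)"
definition dd :: "nat \<Rightarrow> int \<Rightarrow> int \<Rightarrow> complex"
  where "dd i h z = aa i h z * bb i h z"

lemma dd_up: "dd i h (h + 1) = cf i (- \<omega>\<^sub>1 + of_int h)"
  and dd_down: "dd i h (h - 1) = cf i (\<omega>\<^sub>1 - of_int h)"
  by (auto simp: dd_def aa_def bb_def nh_def uu_def)

lemma dd_sum: "dd i h (h + 1) + dd i h (h - 1) = tau i"
proof -
  have "- (\<omega>\<^sub>1 - of_int h) = - \<omega>\<^sub>1 + of_int h" by simp
  then show ?thesis
    using cf_sum[OF qn_w1, of i h] unfolding dd_up dd_down by (metis add.commute)
qed

text \<open>A step and the step back have inverse diagonal weights, because the parameters of tiles
  based on adjacent heights are related as \<open>u\<close> and \<open>- u - 1\<close> in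
  \<open>r_inv\<close>.\<close>

lemma dd_pair: assumes "i < N" "j < N" "z = h + 1 \<or> z = h - 1" shows "dd i h z * dd j z h = 1"
  using assms(3)
proof
  assume z: "z = h + 1"
  have "dd j z h = r (\<omega>\<^sub>1 - of_int z)" using dd_down[of j z] z assms by (simp add: cf_def)
  moreover have "dd i h z = r (- \<omega>\<^sub>1 + of_int h)" unfolding z dd_up using assms by (simp add: cf_def)
  moreover have "- (- \<omega>\<^sub>1 + of_int h) - 1 = \<omega>\<^sub>1 - of_int z" "- \<omega>\<^sub>1 + of_int h + 1 = - \<omega>\<^sub>1 + of_int z"
    using z by simp_all
  ultimately show ?thesis
    using r_inv[of "- \<omega>\<^sub>1 + of_int h"] qn_w1'[of h] qn_w1'[of z] by metis
next
  assume z: "z = h - 1"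
  have "dd j z h = r (- \<omega>\<^sub>1 + of_int z)" using dd_up[of j z] z assms by (simp add: cf_def)
  moreover have "dd i h z = r (\<omega>\<^sub>1 - of_int h)" unfolding z dd_down using assms by (simp add: cf_def)
  moreover have "- (\<omega>\<^sub>1 - of_int h) - 1 = - \<omega>\<^sub>1 + of_int z" "\<omega>\<^sub>1 - of_int h + 1 = \<omega>\<^sub>1 - of_int z"
    using z by simp_all
  ultimately show ?thesis
    using r_inv[of "\<omega>\<^sub>1 - of_int h"] qn_w1[of h] qn_w1[of z] by metis
qed

lemma dd_sumN: assumes "i < N"
  shows "dd i h (h + 1) * dd N (h + 1) h + dd i h (h - 1) * dd N (h - 1) h = 1"
proof -
  let ?u = "\<omega>\<^sub>1 - of_int h"
  have "dd N (h + 1) h = k \<theta> (?u - 1)" using dd_down[of N "h + 1"] by (simp add: cf_def algebra_simps)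
  moreover have "dd N (h - 1) h = k \<theta> (- ?u - 1)" using dd_up[of N "h - 1"] by (simp add: cf_def algebra_simps)
  moreover have "dd i h (h + 1) = r (- ?u)" "dd i h (h - 1) = r ?u"
    using assms by (simp_all add: dd_up dd_down cf_def)
  ultimately show ?thesis
    using rk_sum[of ?u] qn_w1[of h] qn_w1[of "h - 1"] qn_w1[of "h + 1"] by (simp add: algebra_simps)
qed

section \<open>The operators of the generators on paths\<close>

definition S1 :: "nat \<Rightarrow> (int list \<Rightarrow> complex) \<Rightarrow> int list \<Rightarrow> complex"
  where "S1 i x p =
    bb i (p ! (i - 1)) (p ! (i - 1) + 1) * x (p[i := p ! (i - 1) + 1]) +
    bb i (p ! (i - 1)) (p ! (i - 1) - 1) * x (p[i := p ! (i - 1) - 1])"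

text \<open>\<open>S1\<close> pairs \<open>x\<close> with the row vector \<open>bb\<close> and does
  not see the height at \<open>i\<close>; multiplication by \<open>aa\<close> makes this the rank
  one block. The value 0 off \<open>Paths\<close> keeps the image of each generator supported on
  paths, although the operators act on functions of arbitrary lists.\<close>

definition pef :: "nat \<Rightarrow> (int list \<Rightarrow> complex) \<Rightarrow> int list \<Rightarrow> complex"
  where "pef i x p =
    (if i = 0 then (if p \<in> Paths \<and> p ! 1 = - 1 then s\<^sub>1 * x p else 0)
     else if i \<le> N \<and> p \<in> Paths \<and> turn p i then aa i (p ! (i - 1)) (p ! i) * S1 i x p else 0)"

definition pe :: "nat \<Rightarrow> int list lop"
  where "pe i = Lop (pef i)"

lemma app_pe [simp]: "app (pe i) = pef i"
  unfolding pe_def by (rule Lop_inverse) (auto simp: pef_def S1_def fun_eq_iff algebra_simps)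

abbreviation rho :: "nat free_alg \<Rightarrow> int list lop" where "rho \<equiv> ev pe"

lemma pef_not_path: "p \<notin> Paths \<Longrightarrow> pef i x p = 0"
  by (simp add: pef_def)

lemma pef_0: "p \<in> Paths \<Longrightarrow> pef 0 x p = (if p ! 1 = - 1 then s\<^sub>1 * x p else 0)"
  by (simp add: pef_def)

lemma pef_pos: "p \<in> Paths \<Longrightarrow> 1 \<le> i \<Longrightarrow> i \<le> N \<Longrightarrow>
    pef i x p = (if turn p i then aa i (p ! (i - 1)) (p ! i) * S1 i x p else 0)"
  by (simp add: pef_def)

lemma path_length: "p \<in> Paths \<Longrightarrow> length p = Suc N"
  and path_0: "p \<in> Paths \<Longrightarrow> p ! 0 = 0"
  and path_step: "p \<in> Paths \<Longrightarrow> i < N \<Longrightarrow> p ! Suc i = p ! i + 1 \<or> p ! Suc i = p ! i - 1"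
  by (auto simp: Paths_def)

lemma path_step': "p \<in> Paths \<Longrightarrow> 1 \<le> i \<Longrightarrow> i \<le> N \<Longrightarrow> p ! i = p ! (i - 1) + 1 \<or> p ! i = p ! (i - 1) - 1"
  using path_step[of p "i - 1"] by auto

lemma flip_path:
  assumes "p \<in> Paths" "1 \<le> i" "i \<le> N" "turn p i" "z = p ! (i - 1) + 1 \<or> z = p ! (i - 1) - 1"
  shows "p[i := z] \<in> Paths"
proof -
  have "p[i := z] ! Suc j = p[i := z] ! j + 1 \<or> p[i := z] ! Suc j = p[i := z] ! j - 1" if "j < N" for j
  proof -
    consider "j = i" | "Suc j = i" | "j \<noteq> i" "Suc j \<noteq> i" by blast
    then show ?thesis
      using assms path_step[OF assms(1) that] path_length[OF assms(1)] that
      by cases (auto simp: turn_def nth_list_update)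
  qed
  then show ?thesis
    using assms by (simp add: Paths_def)
qed

lemma turn_upd_same: "1 \<le> i \<Longrightarrow> turn (p[i := z]) i = turn p i"
  by (auto simp: turn_def nth_list_update)

lemma turn_upd_far: "i \<noteq> Suc j \<Longrightarrow> Suc i \<noteq> j \<Longrightarrow> 1 \<le> j \<Longrightarrow> turn (p[i := z]) j = turn p j"
  by (auto simp: turn_def nth_list_update)

lemma S1_upd: "1 \<le> i \<Longrightarrow> S1 i x (p[i := z]) = S1 i x p"
  by (simp add: S1_def nth_list_update)

lemma pef_flip:
  assumes "p \<in> Paths" "1 \<le> i" "i \<le> N" "turn p i" "z = p ! (i - 1) + 1 \<or> z = p ! (i - 1) - 1"
  shows "pef i x (p[i := z]) = aa i (p ! (i - 1)) z * S1 i x p"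
  using assms flip_path[OF assms] path_length[OF assms(1)]
  by (subst pef_pos) (auto simp: turn_upd_same S1_upd nth_list_update)

text \<open>A rank one matrix squares to its trace times itself, and the trace is
  \<open>dd_sum\<close>.\<close>

lemma pe_square: assumes "1 \<le> i" "i \<le> N" shows "pe i * pe i = sc (tau i) * pe i"
proof (rule lop_eqI)
  fix x p
  have "pef i (pef i x) p = tau i * pef i x p"
  proof (cases "p \<in> Paths \<and> turn p i")
    case True
    let ?h = "p ! (i - 1)"
    have "S1 i (pef i x) p = (dd i ?h (?h + 1) + dd i ?h (?h - 1)) * S1 i x p"
      unfolding S1_def[of i "pef i x"] using True assms by (simp add: pef_flip dd_def algebra_simps)
    then show ?thesis
      using True assms by (simp add: pef_pos dd_sum)
  qed (use assms in \<open>auto simp: pef_def\<close>)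
  then show "app (pe i * pe i) x p = app (sc (tau i) * pe i) x p" by simp
qed

lemma pe0_square: "pe 0 * pe 0 = sc s\<^sub>1 * pe 0"
  by (rule lop_eqI) (simp add: pef_def)

text \<open>The flips may read a common height, when \<open>i + 1 = j - 1\<close>, but neither
  changes a height that the other one reads.\<close>

lemma pe_far: assumes "1 \<le> i" "i + 1 < j" "j \<le> N" shows "pe i * pe j = pe j * pe i"
proof (rule lop_eqI)
  fix x p
  have "pef i (pef j x) p = pef j (pef i x) p"
  proof (cases "p \<in> Paths")
    case True
    let ?h = "p ! (i - 1)" and ?m = "p ! (j - 1)"
    have ij: "i \<noteq> j" "i \<noteq> j - 1" "i - 1 \<noteq> j" "i - 1 \<noteq> j - 1" "1 \<le> j" "i \<le> N" using assms by auto
    have l: "length p = Suc N" by (rule path_length[OF True])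
    have 1: "pef j x (p[i := z]) = (if turn p j then aa j ?m (p ! j) *
        (bb j ?m (?m + 1) * x (p[i := z, j := ?m + 1]) + bb j ?m (?m - 1) * x (p[i := z, j := ?m - 1])) else 0)"
      if "turn p i" "z = ?h + 1 \<or> z = ?h - 1" for z
      using flip_path[OF True assms(1) _ that] assms ij l
      by (simp add: pef_pos turn_upd_far S1_def nth_list_update)
    have 2: "pef i x (p[j := z]) = (if turn p i then aa i ?h (p ! i) *
        (bb i ?h (?h + 1) * x (p[j := z, i := ?h + 1]) + bb i ?h (?h - 1) * x (p[j := z, i := ?h - 1])) else 0)"
      if "turn p j" "z = ?m + 1 \<or> z = ?m - 1" for z
      using flip_path[OF True _ assms(3) that] assms ij l
      by (simp add: pef_pos turn_upd_far S1_def nth_list_update)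
    show ?thesis
    proof (cases "turn p i \<and> turn p j")
      case t: True
      then show ?thesis
        using True assms ij 1 2 l
        by (simp add: pef_pos S1_def[of i "pef j x"] S1_def[of j "pef i x"] list_update_swap[of i j] algebra_simps)
    next
      case t: False
      have "pef i (pef j x) p = 0" using True assms ij 1 t by (simp add: pef_pos S1_def[of i "pef j x"])
      moreover have "pef j (pef i x) p = 0" using True assms ij 2 t by (simp add: pef_pos S1_def[of j "pef i x"])
      ultimately show ?thesis by simp
    qed
  qed (simp add: pef_not_path)
  then show "app (pe i * pe j) x p = app (pe j * pe i) x p" by simp
qed

lemma pe0_far: assumes "2 \<le> j" "j \<le> N" shows "pe 0 * pe j = pe j * pe 0"
proof (rule lop_eqI)
  fix x p
  have "pef 0 (pef j x) p = pef j (pef 0 x) p"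
  proof (cases "p \<in> Paths \<and> turn p j")
    case True
    let ?m = "p ! (j - 1)"
    have l: "length p = Suc N" using True path_length by blast
    have "pef 0 x (p[j := z]) = (if p ! 1 = - 1 then s\<^sub>1 * x (p[j := z]) else 0)" if "z = ?m + 1 \<or> z = ?m - 1" for z
      using flip_path[of p j z] True assms that by (simp add: pef_0 nth_list_update)
    then show ?thesis
      using True assms by (simp add: pef_0 pef_pos S1_def algebra_simps)
  qed (use assms in \<open>auto simp: pef_def\<close>)
  then show "app (pe 0 * pe j) x p = app (pe j * pe 0) x p" by simp
qed

text \<open>\<open>?f\<close> lives on paths that turn at \<open>i\<close>, so after the flip at
  \<open>i + 1\<close> only the term with the original height there counts. If
  \<open>i + 1 < N\<close>, the height at \<open>i + 2\<close> also selects one value at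
  \<open>i\<close>, and \<open>dd_pair\<close> applies; if \<open>i + 1 = N\<close>, both values
  survive and \<open>dd_sumN\<close> applies.\<close>

lemma pe_braid_up: assumes "1 \<le> i" "i < N" shows "pe i * pe (Suc i) * pe i = pe i"
proof (rule lop_eqI)
  fix x p
  let ?j = "Suc i" and ?f = "pef i x"
  have "pef i (pef ?j ?f) p = pef i x p"
  proof (cases "p \<in> Paths \<and> turn p i")
    case True
    let ?h = "p ! (i - 1)"
    have l: "length p = Suc N" and P: "p \<in> Paths" using True path_length by auto
    have pj: "p ! ?j = ?h" using True assms by (simp add: turn_def)
    have f0: "?f q = 0" if "q ! Suc i \<noteq> q ! (i - 1)" for q
      using that assms by (simp add: pef_def turn_def)
    have g: "pef ?j ?f (p[i := z]) =
        (if ?j < N \<longrightarrow> p ! Suc ?j = z then dd ?j z ?h * (aa i ?h z * S1 i x p) else 0)"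
      if z: "z = ?h + 1 \<or> z = ?h - 1" for z
    proof -
      have q: "p[i := z] \<in> Paths" using flip_path[OF P] True assms z by auto
      have t: "turn (p[i := z]) ?j \<longleftrightarrow> (?j < N \<longrightarrow> p ! Suc ?j = z)"
        using assms l by (simp add: turn_def nth_list_update)
      have id: "p[i := z, ?j := ?h] = p[i := z]"
        using pj by (metis list_update_id list_update_swap n_not_Suc_n)
      have "S1 ?j ?f (p[i := z]) = bb ?j z ?h * ?f (p[i := z])"
        using z assms l id f0[of "p[i := z, ?j := z + 1]"] f0[of "p[i := z, ?j := z - 1]"]
        by (auto simp: S1_def nth_list_update)
      also have "?f (p[i := z]) = aa i ?h z * S1 i x p"
        by (rule pef_flip) (use True assms z in auto)
      finally show ?thesis
        using q t assms l pj by (simp add: pef_pos nth_list_update dd_def)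
    qed
    have "S1 i (pef ?j ?f) p = S1 i x p"
    proof (cases "?j < N")
      case True
      have "p ! Suc ?j = ?h + 1 \<or> p ! Suc ?j = ?h - 1" using path_step[OF P True] pj by simp
      moreover have "dd i ?h (?h + 1) * dd ?j (?h + 1) ?h = 1" "dd i ?h (?h - 1) * dd ?j (?h - 1) ?h = 1"
        using dd_pair True assms by auto
      ultimately show ?thesis
        unfolding S1_def[of i "pef ?j ?f"] using g True by (auto simp: dd_def algebra_simps)
    next
      case False
      then have "?j = N" using assms by simp
      have "S1 i (pef ?j ?f) p =
          (dd i ?h (?h + 1) * dd ?j (?h + 1) ?h + dd i ?h (?h - 1) * dd ?j (?h - 1) ?h) * S1 i x p"
        unfolding S1_def[of i "pef ?j ?f"] using g False by (simp add: dd_def algebra_simps)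
      then show ?thesis using dd_sumN[OF assms(2)] \<open>?j = N\<close> by simp
    qed
    then show ?thesis using True assms by (simp add: pef_pos)
  qed (use assms in \<open>auto simp: pef_def\<close>)
  then show "app (pe i * pe ?j * pe i) x p = app (pe i) x p" by simp
qed

lemma pe_braid_down: assumes "1 \<le> i" "i < N" shows "pe i * pe (i - 1) * pe i = pe i"
proof (rule lop_eqI)
  fix x p
  let ?j = "i - 1" and ?f = "pef i x"
  have "pef i (pef ?j ?f) p = pef i x p"
  proof (cases "p \<in> Paths \<and> turn p i")
    case True
    let ?h = "p ! (i - 1)"
    have l: "length p = Suc N" and P: "p \<in> Paths" and t: "turn p i" using True path_length by auto
    have q: "p[i := z] \<in> Paths" if "z = ?h + 1 \<or> z = ?h - 1" for z
      using flip_path[OF P] True assms that by auto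
    have fz: "?f (p[i := z]) = aa i ?h z * S1 i x p" if "z = ?h + 1 \<or> z = ?h - 1" for z
      by (rule pef_flip) (use True assms that in auto)
    have "S1 i (pef ?j ?f) p = S1 i x p"
    proof (cases "?j = 0")
      case j0: True
      then have "i = 1" using assms by simp
      have h0: "?h = 0" using path_0[OF P] j0 by simp
      \<comment> \<open>\<open>e_0\<close> keeps just the flip with an initial down step; its factor
        cancels the diagonal weight of that flip.\<close>
      have "dd 1 0 (-1) * s\<^sub>1 = 1"
        using dd_down[of 1 0] qn_w1_0 assms N2 by (simp add: cf_def r_def s\<^sub>1_def)
      moreover have "pef 0 ?f (p[i := 1]) = 0" "pef 0 ?f (p[i := - 1]) = s\<^sub>1 * (aa i 0 (-1) * S1 i x p)"
        using q[of 1] q[of "-1"] fz[of "-1"] h0 \<open>i = 1\<close> l N2 by (simp_all add: pef_0 nth_list_update)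
      ultimately show ?thesis
        unfolding S1_def[of i "pef ?j ?f"] using h0 \<open>i = 1\<close> by (simp add: dd_def algebra_simps)
    next
      case False
      then have j: "1 \<le> ?j" "Suc ?j = i" using assms by auto
      let ?m = "p ! (?j - 1)"
      have m: "?h = ?m + 1 \<or> ?h = ?m - 1" using path_step'[OF P, of ?j] j assms by auto
      have f0: "?f s = 0" if "s ! Suc i \<noteq> s ! (i - 1)" for s
        using that assms by (simp add: pef_def turn_def)
      have pi: "p ! Suc i = ?h" using t assms by (simp add: turn_def)
      have g: "pef ?j ?f (p[i := z]) = (if z = ?m then dd ?j ?m ?h * (aa i ?h z * S1 i x p) else 0)"
        if z: "z = ?h + 1 \<or> z = ?h - 1" for z
      proof -
        have tj: "turn (p[i := z]) ?j \<longleftrightarrow> z = ?m"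
        proof -
          have "?j < N" using assms by simp
          then show ?thesis using j assms l by (simp add: turn_def nth_list_update)
        qed
        have id: "p[i := z, ?j := ?h] = p[i := z]"
          using j by (metis list_update_id list_update_swap n_not_Suc_n)
        have "S1 ?j ?f (p[i := z]) = bb ?j ?m ?h * ?f (p[i := z])"
          using m assms l id pi j f0[of "p[i := z, ?j := ?m + 1]"] f0[of "p[i := z, ?j := ?m - 1]"]
          by (auto simp: S1_def nth_list_update)
        moreover have "pef ?j ?f (p[i := z]) = (if z = ?m then aa ?j ?m ?h * S1 ?j ?f (p[i := z]) else 0)"
          using q[OF z] tj assms j by (subst pef_pos) (auto simp: nth_list_update)
        ultimately show ?thesis
          unfolding fz[OF z] dd_def by (simp only: mult.assoc)
      qed
      have "dd i ?h ?m * dd ?j ?m ?h = 1"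
        using dd_pair[of i ?j ?m ?h] assms j m by auto
      then show ?thesis
        unfolding S1_def[of i "pef ?j ?f"] using g m by (auto simp: dd_def algebra_simps)
    qed
    then show ?thesis using True assms by (simp add: pef_pos)
  qed (use assms in \<open>auto simp: pef_def\<close>)
  then show "app (pe i * pe ?j * pe i) x p = app (pe i) x p" by simp
qed

section \<open>The relations of the two-boundary algebra\<close>

lemma relations_in: "relations \<subseteq> carrier F"
  using N2 by (auto simp: relations_def intro!: diff_in mult_in)

lemma rho_relations: assumes "x \<in> relations" shows "rho x = 0"
  using assms unfolding relations_def
proof (elim UnE)
  assume "x \<in> {gen i * gen i - scal \<delta> * gen i | i. 1 \<le> i \<and> i \<le> N - 1}"
  then obtain i where x: "x = gen i * gen i - scal \<delta> * gen i" and i: "1 \<le> i" "i < N" using N2 by auto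
  have "tau i = \<delta>" using i by (simp add: tau_def)
  then show ?thesis using pe_square[of i] i by (simp add: x ev_diff ev_mult)
next
  assume "x \<in> {gen i * gen j * gen i - gen i | i j. 1 \<le> i \<and> i \<le> N - 1 \<and> (j = i - 1 \<or> j = i + 1)}"
  then obtain i j where x: "x = gen i * gen j * gen i - gen i" and i: "1 \<le> i" "i < N" "j = i - 1 \<or> j = Suc i"
    using N2 by auto
  then show ?thesis using pe_braid_up[of i] pe_braid_down[of i] by (auto simp: ev_diff ev_mult)
next
  assume "x \<in> {gen 0 * gen 0 - scal s\<^sub>1 * gen 0}"
  then show ?thesis by (simp add: ev_diff ev_mult pe0_square)
next
  assume "x \<in> {gen N * gen N - scal s\<^sub>2 * gen N}"
  moreover have "tau N = s\<^sub>2" by (simp add: tau_def)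
  ultimately show ?thesis using pe_square[of N] N2 by (simp add: ev_diff ev_mult)
next
  assume "x \<in> {gen i * gen j - gen j * gen i | i j. i \<le> N \<and> j \<le> N \<and> \<bar>int i - int j\<bar> > 1}"
  then obtain i j where x: "x = gen i * gen j - gen j * gen i" and "i \<le> N" "j \<le> N" "\<bar>int i - int j\<bar> > 1"
    by blast
  then have i: "i \<le> N" "j \<le> N" "i + 1 < j \<or> j + 1 < i" by linarith+
  have "pe i * pe j = pe j * pe i"
  proof (cases "i + 1 < j")
    case True
    then show ?thesis using i pe_far[of i j] pe0_far[of j] by (cases "i = 0") auto
  next
    case False
    then show ?thesis using i pe_far[of j i] pe0_far[of i] by (cases "j = 0") auto
  qed
  then show ?thesis by (simp add: x ev_diff ev_mult)
qed

end

section \<open>The double quotient acts on paths\<close>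

lemma fund_path_nth [simp]:
  "j \<le> N \<Longrightarrow> two_BTL.fund_path N ! j = (if even j then 0 else - 1)"
  unfolding two_BTL.fund_path_def by (subst nth_map) (auto simp: nth_append)

context btl
begin

lemma fund_path_length [simp]: "length fund_path = Suc N"
  by (simp add: fund_path_def)

lemma fund_path_Paths: "fund_path \<in> Paths"
  by (auto simp: Paths_def)

text \<open>A product of generators with pairwise distance at least 2 is again of rank one in the
  heights at these positions. \<open>SS\<close>, \<open>AA\<close> and \<open>BB\<close> are the
  iterated forms of \<open>S1\<close>, \<open>aa\<close> and \<open>bb\<close>.\<close>

fun SS :: "nat list \<Rightarrow> (int list \<Rightarrow> complex) \<Rightarrow> int list \<Rightarrow> complex" where
  "SS [] x p = x p"
| "SS (i # L) x p =
    bb i (p ! (i - 1)) (p ! (i - 1) + 1) * SS L x (p[i := p ! (i - 1) + 1]) +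
    bb i (p ! (i - 1)) (p ! (i - 1) - 1) * SS L x (p[i := p ! (i - 1) - 1])"

definition AA :: "nat list \<Rightarrow> int list \<Rightarrow> complex"
  where "AA L p = prod_list (map (\<lambda>i. aa i (p ! (i - 1)) (p ! i)) L)"
definition BB :: "nat list \<Rightarrow> int list \<Rightarrow> complex"
  where "BB L p = prod_list (map (\<lambda>i. bb i (p ! (i - 1)) (p ! i)) L)"

definition far_list :: "nat list \<Rightarrow> bool"
  where "far_list L \<longleftrightarrow> sorted_wrt (\<lambda>i j. i + 1 < j) L \<and> set L \<subseteq> {1..N}"

lemma far_list_Cons: "far_list (i # L) \<longleftrightarrow> 1 \<le> i \<and> i \<le> N \<and> (\<forall>j\<in>set L. i + 1 < j) \<and> far_list L"
  by (auto simp: far_list_def)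

lemma app_word:
  assumes "far_list L" "p \<in> Paths"
  shows "app (prod_list (map pe L)) x p = (if \<forall>i\<in>set L. turn p i then AA L p * SS L x p else 0)"
  using assms
proof (induction L arbitrary: p)
  case Nil
  then show ?case by (simp add: AA_def)
next
  case (Cons i L)
  have i: "1 \<le> i" "i \<le> N" "\<And>j. j \<in> set L \<Longrightarrow> i + 1 < j" "far_list L"
    using Cons.prems(1) by (auto simp: far_list_Cons)
  let ?y = "app (prod_list (map pe L)) x" and ?h = "p ! (i - 1)"
  show ?case
  proof (cases "turn p i")
    case True
    have y: "?y (p[i := z]) = (if \<forall>j\<in>set L. turn p j then AA L p * SS L x (p[i := z]) else 0)"
      if "z = ?h + 1 \<or> z = ?h - 1" for z
    proof -
      have "turn (p[i := z]) j = turn p j" if "j \<in> set L" for j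
        using i(3)[OF that] by (intro turn_upd_far) auto
      moreover have "AA L (p[i := z]) = AA L p"
        unfolding AA_def using i(3) by (intro arg_cong[of _ _ prod_list] map_cong) (force simp: nth_list_update)+
      ultimately show ?thesis
        using Cons.IH[OF i(4) flip_path[OF Cons.prems(2) i(1,2) True that]] by auto
    qed
    show ?thesis
      using True Cons.prems i by (auto simp: pef_pos S1_def y AA_def algebra_simps)
  qed (use Cons.prems i in \<open>simp add: pef_pos\<close>)
qed

definition agree :: "nat list \<Rightarrow> int list \<Rightarrow> int list \<Rightarrow> bool"
  where "agree L p q \<longleftrightarrow> length p = length q \<and> (\<forall>j\<le>N. j \<notin> set L \<longrightarrow> p ! j = q ! j)"

lemma agree_upd: "agree (i # L) p q \<Longrightarrow> length p = Suc N \<Longrightarrow> i \<le> N \<Longrightarrow> agree L (p[i := z]) (q[i := z])"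
  by (auto simp: agree_def nth_list_update)

lemma SS_agree: "far_list L \<Longrightarrow> length p = Suc N \<Longrightarrow> agree L p q \<Longrightarrow> SS L x p = SS L x q"
proof (induction L arbitrary: p q)
  case Nil
  then have "p = q" by (auto simp: agree_def intro!: nth_equalityI)
  then show ?case by simp
next
  case (Cons i L)
  have i: "1 \<le> i" "i \<le> N" "\<And>j. j \<in> set L \<Longrightarrow> i + 1 < j" "far_list L"
    using Cons.prems(1) by (auto simp: far_list_Cons)
  have "i - 1 \<notin> set (i # L)" using i(1) i(3)[of "i - 1"] by auto
  then have "p ! (i - 1) = q ! (i - 1)" using Cons.prems(3) i by (auto simp: agree_def)
  moreover have "SS L x (p[i := z]) = SS L x (q[i := z])" for z
    using Cons.IH[OF i(4) _ agree_upd[OF Cons.prems(3,2) i(2), of z]] Cons.prems by simp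
  ultimately show ?case by simp
qed

lemma SS_zero: "far_list L \<Longrightarrow> length p = Suc N \<Longrightarrow> (\<And>q. agree L p q \<Longrightarrow> x q = 0) \<Longrightarrow> SS L x p = 0"
proof (induction L arbitrary: p)
  case Nil
  then show ?case by (simp add: agree_def)
next
  case (Cons i L)
  have "SS L x (p[i := z]) = 0" for z
  proof (rule Cons.IH)
    fix q assume q: "agree L (p[i := z]) q"
    have "agree (i # L) p q" using q by (auto simp: agree_def nth_list_update split: if_splits)
    then show "x q = 0" by (rule Cons.prems(3))
  qed (use Cons.prems in \<open>auto simp: far_list_Cons\<close>)
  then show ?case by simp
qed

text \<open>Of the \<open>2 ^ length L\<close> terms of the iterated pairing, the one that produces
  \<open>p0\<close> is the only one where \<open>x\<close> may be nonzero.\<close>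

lemma SS_single:
  assumes "far_list L" "p0 \<in> Paths" "agree L p p0" "\<And>q. agree L q p0 \<Longrightarrow> q \<noteq> p0 \<Longrightarrow> x q = 0"
  shows "SS L x p = BB L p0 * x p0"
proof -
  have "SS L x p0 = BB L p0 * x p0"
    using assms(1,2,4)
  proof (induction L)
    case Nil
    then show ?case by (simp add: BB_def)
  next
    case (Cons i L)
    have i: "1 \<le> i" "i \<le> N" "far_list L" using Cons.prems(1) by (auto simp: far_list_Cons)
    have l: "length p0 = Suc N" using Cons.prems(2) by (rule path_length)
    have IH: "SS L x p0 = BB L p0 * x p0"
      by (rule Cons.IH[OF i(3) Cons.prems(2)]) (use Cons.prems(3) in \<open>auto simp: agree_def\<close>)
    have "SS L x (p0[i := z]) = 0" if "z \<noteq> p0 ! i" for z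
    proof (rule SS_zero[OF i(3)])
      fix q assume q: "agree L (p0[i := z]) q"
      have "i \<notin> set L" using Cons.prems(1) by (auto simp: far_list_Cons)
      then have "q ! i = z" using q i l by (auto simp: agree_def)
      then have "q \<noteq> p0" using that by auto
      moreover have "agree (i # L) q p0" using q l by (auto simp: agree_def nth_list_update split: if_splits)
      ultimately show "x q = 0" using Cons.prems(3) by blast
    qed (simp add: l)
    moreover have "p0 ! i = p0 ! (i - 1) + 1 \<or> p0 ! i = p0 ! (i - 1) - 1"
      using path_step'[OF Cons.prems(2) i(1,2)] .
    ultimately show ?case
      using IH by (auto simp: BB_def list_update_id[of p0 i, simplified]) (metis list_update_id)+
  qed
  then show ?thesis
    using SS_agree[OF assms(1) _ assms(3)] path_length[OF assms(2)] assms(3) by (simp add: agree_def)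
qed

text \<open>\<open>G1\<close> fixes all heights outside \<open>L1\<close> and \<open>G2\<close> all
  heights outside \<open>L2\<close>. As these sets are disjoint, \<open>p0\<close> is the only path
  in the ranges of both operators, so the sandwich \<open>P1 * P2 * P1\<close> reduces to one
  coefficient at \<open>p0\<close>.\<close>

lemma rank_one:
  assumes L: "far_list L1" "far_list L2" and dis: "set L1 \<inter> set L2 = {}" and p0: "p0 \<in> Paths"
    and P1: "\<And>x p. app P1 x p = (if G1 p then \<kappa>1 * AA L1 p * SS L1 x p else 0)"
    and P2: "\<And>x p. app P2 x p = (if G2 p then \<kappa>2 * AA L2 p * SS L2 x p else 0)"
    and G1: "G1 p0" "\<And>p. G1 p \<Longrightarrow> agree L1 p p0" and G2: "G2 p0" "\<And>p. G2 p \<Longrightarrow> agree L2 p p0"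
  shows "P1 * P2 * P1 = sc (\<kappa>1 * \<kappa>2 * (AA L1 p0 * BB L1 p0) * (AA L2 p0 * BB L2 p0)) * P1"
proof (rule lop_eqI)
  fix x p
  have l: "length p0 = Suc N" using p0 by (rule path_length)
  have uniq: "q = p0" if "agree L1 q p0" "agree L2 q p0" for q
  proof (rule nth_equalityI)
    fix j assume "j < length q"
    then have "j \<le> N" using that l by (simp add: agree_def)
    then show "q ! j = p0 ! j" using that dis by (cases "j \<in> set L1") (auto simp: agree_def)
  qed (use that in \<open>simp add: agree_def\<close>)
  have SSp0: "SS L1 x q = SS L1 x p0" if "G1 q" for q
    using SS_agree[OF L(1) _ G1(2)[OF that]] G1(2)[OF that] l by (simp add: agree_def)
  have f: "app P1 x q = (if G1 q then \<kappa>1 * AA L1 q * SS L1 x p0 else 0)" for q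
    using P1 SSp0 by simp
  have g: "app P2 (app P1 x) q = (if G2 q then \<kappa>2 * AA L2 q * (BB L2 p0 * app P1 x p0) else 0)" for q
  proof (cases "G2 q")
    case True
    have "SS L2 (app P1 x) q = BB L2 p0 * app P1 x p0"
    proof (rule SS_single[OF L(2) p0 G2(2)[OF True]])
      fix s assume "agree L2 s p0" "s \<noteq> p0"
      then have "\<not> G1 s" using uniq G1(2) by blast
      then show "app P1 x s = 0" by (simp add: P1)
    qed
    then show ?thesis by (simp add: P2 True)
  qed (simp add: P2)
  have "app P1 (app P2 (app P1 x)) p =
      (if G1 p then \<kappa>1 * AA L1 p * (BB L1 p0 * app P2 (app P1 x) p0) else 0)"
  proof (cases "G1 p")
    case True
    have "SS L1 (app P2 (app P1 x)) p = BB L1 p0 * app P2 (app P1 x) p0"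
    proof (rule SS_single[OF L(1) p0 G1(2)[OF True]])
      fix s assume "agree L1 s p0" "s \<noteq> p0"
      then have "\<not> G2 s" using uniq G2(2) by blast
      then show "app P2 (app P1 x) s = 0" by (simp add: P2)
    qed
    then show ?thesis by (simp add: P1 True)
  qed (simp add: P1)
  then show "app (P1 * P2 * P1) x p =
      app (sc (\<kappa>1 * \<kappa>2 * (AA L1 p0 * BB L1 p0) * (AA L2 p0 * BB L2 p0)) * P1) x p"
    using G1(1) G2(1) by (simp add: f g)
qed

abbreviation Lodd :: "nat list" where "Lodd \<equiv> filter odd [0..<Suc N]"
abbreviation Leven :: "nat list" where "Leven \<equiv> filter even [Suc 0..<Suc N]"

lemma far_list_parity: "far_list Lodd" "far_list Leven"
proof -
  have *: "sorted_wrt (\<lambda>i j. i + 1 < j) (filter P [a..<b])"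
    if "\<And>i j. P i \<Longrightarrow> P j \<Longrightarrow> i < j \<Longrightarrow> i + 1 < j" for P :: "nat \<Rightarrow> bool" and a b
  proof (rule sorted_wrt_mono_rel)
    show "sorted_wrt (<) (filter P [a..<b])" by (intro sorted_wrt_filter sorted_wrt_upt)
  qed (use that in auto)
  have "i + 1 < j" if "odd i" "odd j" "i < j" for i j :: nat using that by presburger
  moreover have "i + 1 < j" if "even i" "even j" "i < j" for i j :: nat using that by presburger
  ultimately show "far_list Lodd" "far_list Leven"
    unfolding far_list_def using *[of odd] *[of even] by (auto simp del: upt_Suc elim: oddE)
qed

lemma set_parity: "set Lodd = {i. odd i \<and> i \<le> N}" "set Leven = {i. even i \<and> 1 \<le> i \<and> i \<le> N}"
  by (auto simp del: upt_Suc)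

text \<open>The factor 1 fits the pattern of \<open>rank_one\<close>; for \<open>I\<^sub>2\<close>
  its place is taken by \<open>s\<^sub>1\<close>, contributed by \<open>e_0\<close>.\<close>

lemma rho_I1: "app (rho I\<^sub>1) x p = (if p \<in> Paths \<and> (\<forall>i\<in>set Lodd. turn p i) then 1 * AA Lodd p * SS Lodd x p else 0)"
proof -
  have e: "rho I\<^sub>1 = prod_list (map pe Lodd)" by (simp add: I\<^sub>1_def ev_prod_list comp_def del: upt_Suc)
  show ?thesis
  proof (cases "p \<in> Paths")
    case False
    have "Lodd = 1 # filter odd [2..<Suc N]"
    proof -
      have "[0..<Suc N] = 0 # 1 # [2..<Suc N]"
        using N2 upt_conv_Cons[of 0 "Suc N"] upt_conv_Cons[of 1 "Suc N"] by (simp del: upt_Suc add: numeral_2_eq_2)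
      then show ?thesis by (simp del: upt_Suc)
    qed
    then have "app (rho I\<^sub>1) x p = 0"
      unfolding e using False by (simp add: pef_not_path del: upt_Suc)
    then show ?thesis using False by simp
  qed (auto simp: e app_word[OF far_list_parity(1)] simp del: upt_Suc)
qed

lemma rho_I2: "app (rho I\<^sub>2) x p =
    (if p \<in> Paths \<and> p ! 1 = - 1 \<and> (\<forall>i\<in>set Leven. turn p i) then s\<^sub>1 * AA Leven p * SS Leven x p else 0)"
proof -
  have "filter even [0..<Suc N] = 0 # Leven" by (simp add: upt_rec[of 0] del: upt_Suc)
  then have e: "rho I\<^sub>2 = pe 0 * prod_list (map pe Leven)"
    by (simp add: I\<^sub>2_def ev_prod_list ev_mult comp_def del: upt_Suc)
  show ?thesis
    by (cases "p \<in> Paths") (auto simp: e pef_0 pef_not_path app_word[OF far_list_parity(2)] simp del: upt_Suc)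
qed

text \<open>Turns at all odd positions below \<open>N\<close> make all even heights equal to the
  initial height 0.\<close>

lemma agree_odd:
  assumes p: "p \<in> Paths" "\<forall>i\<in>set Lodd. turn p i" shows "agree Lodd p fund_path"
proof -
  have "2 * m \<le> N \<Longrightarrow> p ! (2 * m) = 0" for m
  proof (induction m)
    case (Suc m)
    then have "Suc (2 * m) \<in> set Lodd" "Suc (2 * m) < N" unfolding set_parity by auto
    then show ?case using p(2) Suc by (auto simp: turn_def simp del: upt_Suc set_filter)
  qed (use p path_0 in auto)
  then show ?thesis
    using path_length[OF p(1)] unfolding agree_def set_parity by (auto elim!: evenE)
qed

lemma agree_even:
  assumes p: "p \<in> Paths" "p ! 1 = - 1" "\<forall>i\<in>set Leven. turn p i" shows "agree Leven p fund_path"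
proof -
  have "Suc (2 * m) \<le> N \<Longrightarrow> p ! Suc (2 * m) = - 1" for m
  proof (induction m)
    case (Suc m)
    then have "Suc (Suc (2 * m)) \<in> set Leven" "Suc (Suc (2 * m)) < N" unfolding set_parity by auto
    then show ?case using p(3) Suc by (auto simp: turn_def simp del: upt_Suc set_filter)
  qed (use p in auto)
  then show ?thesis
    using path_length[OF p(1)] path_0[OF p(1)] unfolding agree_def set_parity
    by (auto elim!: oddE simp: not_less_eq_eq)
qed

lemma fund_turn: "1 \<le> i \<Longrightarrow> turn fund_path i"
  by (auto simp: turn_def)

lemma AABB: "AA L p * BB L p = prod_list (map (\<lambda>i. dd i (p ! (i - 1)) (p ! i)) L)"
  unfolding AA_def BB_def by (induction L) (auto simp: dd_def algebra_simps)

lemma dd_fund_odd: "1 \<le> i \<Longrightarrow> i < N \<Longrightarrow> odd i \<Longrightarrow> s\<^sub>1 * dd i 0 (-1) = 1"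
  using dd_down[of i 0] qn_w1_0 by (simp add: cf_def r_def s\<^sub>1_def)

lemma dd_fund_even: assumes "i < N" "even i" shows "dd i (-1) 0 = s\<^sub>1"
proof -
  have "dd 1 0 (-1) * dd i (-1) 0 = 1" using dd_pair[of 1 i "-1" 0] assms N2 by simp
  then have "s\<^sub>1 = s\<^sub>1 * dd 1 0 (-1) * dd i (-1) 0" by (simp only: mult.assoc mult.right_neutral)
  also have "s\<^sub>1 * dd 1 0 (-1) = 1" using dd_fund_odd[of 1] N2 by simp
  finally show ?thesis by simp
qed

text \<open>Along the fundamental path the diagonal weights below \<open>N\<close> are alternately
  \<open>1 / s\<^sub>1\<close> and \<open>s\<^sub>1\<close>. Together with the factor from
  \<open>e_0\<close> they cancel in pairs for even \<open>N\<close>, and leave one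
  \<open>s\<^sub>1\<close> for odd \<open>N\<close>. The last weight is a value of \<open>k\<close>,
  and this is where \<open>b\<close> comes from.\<close>

lemma loop_weight:
  "1 * s\<^sub>1 * (AA Lodd fund_path * BB Lodd fund_path) * (AA Leven fund_path * BB Leven fund_path) = bpar \<theta>"
proof -
  let ?d = "\<lambda>i. dd i (fund_path ! (i - 1)) (fund_path ! i)"
  have dl: "prod_list (map f L) = (\<Prod>i\<in>set L. f i)" if "distinct L" for f :: "nat \<Rightarrow> complex" and L
    using that by (rule prod.distinct_set_conv_list[symmetric])
  have "(AA Lodd fund_path * BB Lodd fund_path) * (AA Leven fund_path * BB Leven fund_path) =
      (\<Prod>i\<in>set Lodd. ?d i) * (\<Prod>i\<in>set Leven. ?d i)"
    unfolding AABB by (simp add: dl del: upt_Suc)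
  also have "\<dots> = (\<Prod>i\<in>set Lodd \<union> set Leven. ?d i)"
    by (rule prod.union_disjoint[symmetric]) (auto simp del: upt_Suc)
  also have "set Lodd \<union> set Leven = {1..N}"
    unfolding set_parity by (auto simp: odd_pos Suc_leI elim: oddE)
  also have "(\<Prod>i\<in>{1..N}. ?d i) = (\<Prod>i\<in>{1..N-1}. ?d i) * ?d N"
    using N2 by (cases N) (auto simp: prod.nat_ivl_Suc')
  finally have 1: "(AA Lodd fund_path * BB Lodd fund_path) * (AA Leven fund_path * BB Leven fund_path) =
      (\<Prod>i\<in>{1..N-1}. ?d i) * ?d N" .
  have 2: "m < N \<Longrightarrow> (\<Prod>i\<in>{1..m}. ?d i) = (if even m then 1 else 1 / s\<^sub>1)" for m
  proof (induction m)
    case (Suc m)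
    then show ?case
      using dd_fund_odd[of "Suc m"] dd_fund_even[of "Suc m"] s1_nz
      by (auto simp: prod.nat_ivl_Suc' field_simps)
  qed simp
  show ?thesis
  proof (cases "even N")
    case True
    have "dd N (-1) 0 = k \<theta> (- \<omega>\<^sub>1 - 1)" using dd_up[of N "-1"] by (simp add: cf_def)
    moreover have "k \<theta> (- \<omega>\<^sub>1 - 1) = bpar \<theta>"
    proof -
      have e: "(- \<omega>\<^sub>1 - 1 - \<omega>\<^sub>2 + \<theta>) / 2 = - ((\<omega>\<^sub>1 + \<omega>\<^sub>2 + 1 - \<theta>) / 2)"
        "(- \<omega>\<^sub>1 - 1 - \<omega>\<^sub>2 - \<theta>) / 2 = - ((\<omega>\<^sub>1 + \<omega>\<^sub>2 + 1 + \<theta>) / 2)"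
        "- \<omega>\<^sub>1 - 1 = - (\<omega>\<^sub>1 + 1)" by (simp_all add: field_simps)
      have "k \<theta> (- \<omega>\<^sub>1 - 1) = - (qn (- ((\<omega>\<^sub>1 + \<omega>\<^sub>2 + 1 - \<theta>) / 2)) * qn (- ((\<omega>\<^sub>1 + \<omega>\<^sub>2 + 1 + \<theta>) / 2)) /
          (qn (- (\<omega>\<^sub>1 + 1)) * qn (\<omega>\<^sub>2 + 1)))"
        unfolding k_def by (simp only: e(1,2)) (simp only: e(3))
      also have "\<dots> = bpar \<theta>"
        unfolding bpar_def qnum_minus by (simp add: True mult.commute)
      finally show ?thesis .
    qed
    ultimately show ?thesis
      using 1 2[of "N - 1"] True N2 s1_nz by (simp add: mult.assoc)
  next
    case False
    have "dd N 0 (-1) = k \<theta> \<omega>\<^sub>1" using dd_down[of N "0"] by (simp add: cf_def)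
    moreover have "s\<^sub>1 * k \<theta> \<omega>\<^sub>1 = bpar \<theta>"
      using qn_w1_0 by (simp add: k_def bpar_def False s\<^sub>1_def)
    ultimately show ?thesis
      using 1 2[of "N - 1"] False N2 by (simp add: mult.assoc)
  qed
qed

lemma parity_disjoint: "set Lodd \<inter> set Leven = {}"
  by (auto simp del: upt_Suc)

lemma rho_loop1: "rho (I\<^sub>1 * I\<^sub>2 * I\<^sub>1 - scal (bpar \<theta>) * I\<^sub>1) = 0"
proof -
  have "rho I\<^sub>1 * rho I\<^sub>2 * rho I\<^sub>1 = sc (1 * s\<^sub>1 * (AA Lodd fund_path * BB Lodd fund_path) * (AA Leven fund_path * BB Leven fund_path)) * rho I\<^sub>1"
    by (rule rank_one[OF far_list_parity parity_disjoint fund_path_Paths rho_I1 rho_I2])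
      (use fund_path_Paths fund_turn agree_odd agree_even N2 in \<open>auto simp: Suc_leI odd_pos simp del: upt_Suc\<close>)
  then show ?thesis unfolding loop_weight by (simp add: ev_mult ev_diff)
qed

lemma rho_loop2: "rho (I\<^sub>2 * I\<^sub>1 * I\<^sub>2 - scal (bpar \<theta>) * I\<^sub>2) = 0"
proof -
  have "rho I\<^sub>2 * rho I\<^sub>1 * rho I\<^sub>2 = sc (s\<^sub>1 * 1 * (AA Leven fund_path * BB Leven fund_path) * (AA Lodd fund_path * BB Lodd fund_path)) * rho I\<^sub>2"
    by (rule rank_one[OF far_list_parity(2,1) _ fund_path_Paths rho_I2 rho_I1])
      (use parity_disjoint fund_path_Paths fund_turn agree_odd agree_even N2 in \<open>auto simp: Suc_leI odd_pos simp del: upt_Suc\<close>)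
  moreover have "s\<^sub>1 * 1 * (AA Leven fund_path * BB Leven fund_path) * (AA Lodd fund_path * BB Lodd fund_path) = bpar \<theta>"
    using loop_weight by (simp add: mult_ac)
  ultimately show ?thesis by (simp add: ev_mult ev_diff)
qed

end

subsection \<open>Quotient maps\<close>

lemma free_algebra_ring: "ring (free_algebra X)"
proof (rule ringI)
  show "abelian_group (free_algebra X)"
  proof (rule abelian_groupI)
    show "\<exists>y\<in>carrier (free_algebra X). y \<oplus>\<^bsub>free_algebra X\<^esub> x = \<zero>\<^bsub>free_algebra X\<^esub>"
      if "x \<in> carrier (free_algebra X)" for x
      using minus_in[OF that] by (intro bexI[of _ "- x"]) auto
  qed (auto simp: add_in ac_simps)
  show "monoid (free_algebra X)"
    by (rule monoidI) (auto simp: mult_in mult.assoc)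
qed (auto simp: algebra_simps)

lemma free_algebra_a_minus:
  assumes "x \<in> carrier (free_algebra X)" "y \<in> carrier (free_algebra X)"
  shows "x \<ominus>\<^bsub>free_algebra X\<^esub> y = x - y"
proof -
  interpret ring "free_algebra X" by (rule free_algebra_ring)
  have "\<ominus>\<^bsub>free_algebra X\<^esub> y = - y"
    by (rule minus_equality) (use assms minus_in in auto)
  then show ?thesis by (simp add: a_minus_def)
qed

context btl
begin

lemma TL_ideal: "ideal TL_ideal F"
  unfolding TL_ideal_def by (rule ring.genideal_ideal[OF free_algebra_ring relations_in])

lemma TL_ring: "ring TL"
  unfolding TL_def by (rule ideal.quotient_is_ring[OF TL_ideal])

lemma cl_hom: "cl \<in> Ring.ring_hom F TL"
  using ideal.rcos_ring_hom[OF TL_ideal] unfolding TL_def cl_def[abs_def] .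

lemma cl_simps:
  assumes "x \<in> carrier F" "y \<in> carrier F"
  shows "cl (x + y) = cl x \<oplus>\<^bsub>TL\<^esub> cl y" "cl (x * y) = cl x \<otimes>\<^bsub>TL\<^esub> cl y"
  using ring_hom_add[OF cl_hom assms] ring_hom_mult[OF cl_hom assms] by simp_all

lemma cl_closed: "x \<in> carrier F \<Longrightarrow> cl x \<in> carrier TL"
  by (rule ring_hom_closed[OF cl_hom])

lemma cl_one: "cl 1 = \<one>\<^bsub>TL\<^esub>"
  using ring_hom_one[OF cl_hom] by simp

lemma cl_zero: "cl 0 = \<zero>\<^bsub>TL\<^esub>"
  using ring_hom_zero[OF cl_hom free_algebra_ring TL_ring] by simp

lemma TL_carrier: "carrier TL = cl ` carrier F"
  unfolding TL_def cl_def FactRing_def A_RCOSETS_def' by auto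

lemma rho_ideal: "x \<in> TL_ideal \<Longrightarrow> rho x = 0"
proof -
  have "ideal {x \<in> carrier F. rho x = 0} F"
  proof (rule idealI)
    show "subgroup {x \<in> carrier F. rho x = 0} (add_monoid F)"
    proof
      show "inv\<^bsub>add_monoid F\<^esub> x \<in> {x \<in> carrier F. rho x = 0}" if "x \<in> {x \<in> carrier F. rho x = 0}" for x
      proof -
        interpret ring F by (rule free_algebra_ring)
        have "\<ominus>\<^bsub>F\<^esub> x = - x" by (rule minus_equality) (use that minus_in in auto)
        then show ?thesis using that minus_in[of x] by (auto simp: a_inv_def ev_minus)
      qed
    qed (auto simp: ev_add add_in)
  qed (auto simp: free_algebra_ring ev_mult mult_in)
  moreover have "relations \<subseteq> {x \<in> carrier F. rho x = 0}"
    using relations_in rho_relations by auto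
  ultimately show "x \<in> TL_ideal \<Longrightarrow> rho x = 0"
    using ring.genideal_minimal[OF free_algebra_ring] unfolding TL_ideal_def by blast
qed

lemma cl_eq_iff:
  assumes "x \<in> carrier F" "y \<in> carrier F"
  shows "cl x = cl y \<longleftrightarrow> x - y \<in> TL_ideal"
  using ring.quotient_eq_iff_same_a_r_cos[OF free_algebra_ring TL_ideal assms] free_algebra_a_minus[OF assms]
  by (auto simp: cl_def)

lemma cl_eq_rho: "x \<in> carrier F \<Longrightarrow> y \<in> carrier F \<Longrightarrow> cl x = cl y \<Longrightarrow> rho x = rho y"
  using cl_eq_iff rho_ideal[of "x - y"] by (simp add: ev_diff)

text \<open>\<open>rho\<close> on classes, through a chosen representative; by
  \<open>cl_eq_rho\<close> the choice is immaterial.\<close>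

definition trho :: "nat free_alg set \<Rightarrow> int list lop"
  where "trho t = rho (SOME x. x \<in> carrier F \<and> cl x = t)"

lemma trho_cl [simp]: assumes "x \<in> carrier F" shows "trho (cl x) = rho x"
proof -
  let ?P = "\<lambda>y. y \<in> carrier F \<and> cl y = cl x"
  have "?P (SOME y. ?P y)" by (rule someI[of ?P x]) (simp add: assms)
  then show ?thesis unfolding trho_def using cl_eq_rho assms by blast
qed

lemma trho_hom:
  assumes "s \<in> carrier TL" "t \<in> carrier TL"
  shows "trho (s \<oplus>\<^bsub>TL\<^esub> t) = trho s + trho t" "trho (s \<otimes>\<^bsub>TL\<^esub> t) = trho s * trho t"
proof -
  obtain x y where xy: "s = cl x" "t = cl y" "x \<in> carrier F" "y \<in> carrier F"
    using assms TL_carrier by auto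
  show "trho (s \<oplus>\<^bsub>TL\<^esub> t) = trho s + trho t" "trho (s \<otimes>\<^bsub>TL\<^esub> t) = trho s * trho t"
    unfolding xy using xy(3,4) by (simp_all add: cl_simps[symmetric] add_in mult_in ev_add ev_mult)
qed

lemma trho_one: "trho \<one>\<^bsub>TL\<^esub> = 1" and trho_zero: "trho \<zero>\<^bsub>TL\<^esub> = 0"
  unfolding cl_one[symmetric] cl_zero[symmetric] by simp_all

abbreviation b0 :: complex where "b0 \<equiv> bpar \<theta>"

lemma I_in: "I\<^sub>1 \<in> carrier F" "I\<^sub>2 \<in> carrier F"
  unfolding I\<^sub>1_def I\<^sub>2_def by (auto intro!: prod_list_in simp del: upt_Suc)

lemma DQ_gens_in: "{cl (I\<^sub>1 * I\<^sub>2 * I\<^sub>1 - scal b0 * I\<^sub>1), cl (I\<^sub>2 * I\<^sub>1 * I\<^sub>2 - scal b0 * I\<^sub>2)} \<subseteq> carrier TL"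
  by (auto intro!: cl_closed diff_in mult_in I_in)

lemma DQ_ideal: "ideal (DQ_ideal b0) TL"
  unfolding DQ_ideal_def by (rule ring.genideal_ideal[OF TL_ring DQ_gens_in])

lemma DQ_ring: "ring (DQ b0)"
  unfolding DQ_def by (rule ideal.quotient_is_ring[OF DQ_ideal])

lemma clDQ_hom: "clDQ b0 \<in> Ring.ring_hom TL (DQ b0)"
  using ideal.rcos_ring_hom[OF DQ_ideal] unfolding DQ_def clDQ_def[abs_def] .

definition cc :: "nat free_alg \<Rightarrow> nat free_alg set set"
  where "cc x = clDQ b0 (cl x)"

lemma cc_hom: "cc \<in> Ring.ring_hom F (DQ b0)"
  using ring_hom_trans[OF cl_hom clDQ_hom] by (simp add: cc_def[abs_def] comp_def)

lemma cc_simps: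
  assumes "x \<in> carrier F" "y \<in> carrier F"
  shows "cc (x + y) = cc x \<oplus>\<^bsub>DQ b0\<^esub> cc y" "cc (x * y) = cc x \<otimes>\<^bsub>DQ b0\<^esub> cc y"
  using ring_hom_add[OF cc_hom assms] ring_hom_mult[OF cc_hom assms] by simp_all

lemma cc_zero: "cc 0 = \<zero>\<^bsub>DQ b0\<^esub>"
  using ring_hom_zero[OF cc_hom free_algebra_ring DQ_ring] by simp

lemma DQ_carrier: "carrier (DQ b0) = cc ` carrier F"
proof -
  have "carrier (DQ b0) = clDQ b0 ` carrier TL"
    unfolding DQ_def clDQ_def FactRing_def A_RCOSETS_def' by auto
  then show ?thesis by (auto simp: TL_carrier cc_def)
qed

lemma trho_ideal: "t \<in> DQ_ideal b0 \<Longrightarrow> trho t = 0"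
proof -
  interpret ring TL by (rule TL_ring)
  have "ideal {t \<in> carrier TL. trho t = 0} TL"
  proof (rule idealI)
    show "subgroup {t \<in> carrier TL. trho t = 0} (add_monoid TL)"
    proof
      show "inv\<^bsub>add_monoid TL\<^esub> t \<in> {t \<in> carrier TL. trho t = 0}" if "t \<in> {t \<in> carrier TL. trho t = 0}" for t
      proof -
        have "trho (t \<oplus>\<^bsub>TL\<^esub> \<ominus>\<^bsub>TL\<^esub> t) = trho t + trho (\<ominus>\<^bsub>TL\<^esub> t)" using that by (intro trho_hom) auto
        then have "trho (\<ominus>\<^bsub>TL\<^esub> t) = 0" using that by (simp add: r_neg trho_zero)
        then show ?thesis using that a_inv_closed[of t] by (simp add: a_inv_def)
      qed
    qed (auto simp: trho_hom trho_zero)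
  qed (auto simp: TL_ring trho_hom)
  moreover have "{cl (I\<^sub>1 * I\<^sub>2 * I\<^sub>1 - scal b0 * I\<^sub>1), cl (I\<^sub>2 * I\<^sub>1 * I\<^sub>2 - scal b0 * I\<^sub>2)} \<subseteq> {t \<in> carrier TL. trho t = 0}"
    using DQ_gens_in rho_loop1 rho_loop2 I_in by (auto simp: diff_in mult_in)
  ultimately show "t \<in> DQ_ideal b0 \<Longrightarrow> trho t = 0"
    using genideal_minimal unfolding DQ_ideal_def by blast
qed

lemma cc_eq_rho:
  assumes "x \<in> carrier F" "y \<in> carrier F" "cc x = cc y"
  shows "rho x = rho y"
proof -
  interpret ring TL by (rule TL_ring)
  have xy: "cl x \<in> carrier TL" "cl y \<in> carrier TL" using assms cl_closed by auto
  have "cl x \<ominus>\<^bsub>TL\<^esub> cl y \<in> DQ_ideal b0"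
    using quotient_eq_iff_same_a_r_cos[OF DQ_ideal xy] assms(3) by (simp add: cc_def clDQ_def)
  then have "trho (cl x \<ominus>\<^bsub>TL\<^esub> cl y) = 0" by (rule trho_ideal)
  moreover have "trho (cl x) = trho (cl x \<ominus>\<^bsub>TL\<^esub> cl y) + trho (cl y)"
    using xy by (simp add: trho_hom(1)[symmetric] a_minus_def a_assoc l_neg)
  ultimately show ?thesis using assms by simp
qed

lemma cc_relation:
  assumes "x - y \<in> relations" "x \<in> carrier F" "y \<in> carrier F"
  shows "cc x = cc y"
proof -
  have "x - y \<in> TL_ideal"
    using ring.genideal_self[OF free_algebra_ring relations_in] assms unfolding TL_ideal_def by blast
  then show ?thesis using cl_eq_iff[of x y] assms by (simp add: cc_def)
qed

lemma cc_loop1: "cc (I\<^sub>1 * I\<^sub>2 * I\<^sub>1) = cc (scal b0 * I\<^sub>1)" and cc_loop2: "cc (I\<^sub>2 * I\<^sub>1 * I\<^sub>2) = cc (scal b0 * I\<^sub>2)"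
proof -
  interpret ring TL by (rule TL_ring)
  have gen: "cc x = cc y" if "cl (x - y) \<in> DQ_ideal b0" "x \<in> carrier F" "y \<in> carrier F" for x y
  proof -
    have xy: "cl x \<in> carrier TL" "cl y \<in> carrier TL" using that cl_closed by auto
    have "cl x = cl (x - y) \<oplus>\<^bsub>TL\<^esub> cl y" using that by (simp add: cl_simps[symmetric] diff_in)
    then have "cl x \<ominus>\<^bsub>TL\<^esub> cl y = cl (x - y)"
      using that xy cl_closed[OF diff_in[OF that(2,3)]] by (simp add: a_minus_def a_assoc r_neg)
    then show ?thesis
      using quotient_eq_iff_same_a_r_cos[OF DQ_ideal xy] that(1) by (simp add: cc_def clDQ_def)
  qed
  have "cl (I\<^sub>1 * I\<^sub>2 * I\<^sub>1 - scal b0 * I\<^sub>1) \<in> DQ_ideal b0" "cl (I\<^sub>2 * I\<^sub>1 * I\<^sub>2 - scal b0 * I\<^sub>2) \<in> DQ_ideal b0"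
    using genideal_self[OF DQ_gens_in] unfolding DQ_ideal_def by auto
  then show "cc (I\<^sub>1 * I\<^sub>2 * I\<^sub>1) = cc (scal b0 * I\<^sub>1)" "cc (I\<^sub>2 * I\<^sub>1 * I\<^sub>2) = cc (scal b0 * I\<^sub>2)"
    using gen[OF _ mult_in[OF mult_in[OF I_in] I_in(1)] mult_in[OF scal_in I_in(1)]]
      gen[OF _ mult_in[OF mult_in[OF I_in(2,1)] I_in(2)] mult_in[OF scal_in I_in(2)]] by simp_all
qed

subsection \<open>Projections onto prefixes of paths\<close>

text \<open>Only values at paths are constrained, since scalars act on functions of all lists. The
  element is required to lie in the algebra, which makes the projection available in every
  module.\<close>

definition prefix_proj :: "int list \<Rightarrow> nat \<Rightarrow> nat free_alg \<Rightarrow> bool"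
  where "prefix_proj p i y \<longleftrightarrow> y \<in> carrier F \<and>
    (\<forall>x. \<forall>q\<in>Paths. app (rho y) x q = (if \<forall>j\<le>i. q ! j = p ! j then x q else 0))"

text \<open>Between the two projections the height at \<open>i\<close> must return to its value, so
  \<open>e_i\<close> contributes its diagonal entry. It also tests whether the path turns at
  \<open>i\<close>, and this is how the next height is detected.\<close>

lemma prefix_proj_step:
  assumes "prefix_proj p i y" "1 \<le> i" "i < N" "p \<in> Paths" "q \<in> Paths"
  shows "app (rho (y * gen i * y)) x q =
    (if (\<forall>j\<le>i. q ! j = p ! j) \<and> q ! Suc i = p ! (i - 1) then dd i (p ! (i - 1)) (p ! i) * x q else 0)"
proof -
  have Py: "app (rho y) x q = (if \<forall>j\<le>i. q ! j = p ! j then x q else 0)" if "q \<in> Paths" for x q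
    using assms(1) that by (simp add: prefix_proj_def)
  show ?thesis
  proof (cases "\<forall>j\<le>i. q ! j = p ! j")
    case True
    let ?h = "p ! (i - 1)"
    have qh: "q ! (i - 1) = ?h" "q ! i = p ! i" using True by auto
    show ?thesis
    proof (cases "turn q i")
      case t: True
      have l: "length q = Suc N" using assms(5) by (rule path_length)
      have u: "app (rho y) x (q[i := z]) = (if z = p ! i then x q else 0)" if "z = ?h + 1 \<or> z = ?h - 1" for z
      proof -
        have "(\<forall>j\<le>i. q[i := z] ! j = p ! j) \<longleftrightarrow> z = p ! i"
          using True l assms(3) by (auto simp: nth_list_update)
        moreover have "q[i := z] \<in> Paths" using flip_path[of q i z] assms t that qh by auto
        ultimately show ?thesis using Py qh by (auto simp: list_update_id[of q i, unfolded qh])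
      qed
      have "p ! i = ?h + 1 \<or> p ! i = ?h - 1" using path_step'[OF assms(4,2)] assms(3) by simp
      then have "S1 i (app (rho y) x) q = bb i ?h (p ! i) * x q"
        unfolding S1_def qh using u by auto
      then show ?thesis
        using Py[OF assms(5)] True t assms qh by (simp add: ev_mult pef_pos dd_def turn_def)
    next
      case False
      then show ?thesis using Py[OF assms(5)] True assms qh by (auto simp: ev_mult pef_pos turn_def)
    qed
  next
    case False
    then show ?thesis using Py[OF assms(5)] by (auto simp: ev_mult)
  qed
qed

text \<open>Restricted to \<open>i < N\<close>: at \<open>N\<close> the weights are values of
  \<open>k\<close> and may vanish.\<close>

lemma dd_nz: assumes "i < N" "z = h + 1 \<or> z = h - 1" shows "dd i h z \<noteq> 0"
  using dd_pair[OF assms(1,1,2)] by auto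

text \<open>The normalised \<open>y * gen i * y\<close> selects the paths that turn at
  \<open>i\<close>, and \<open>y\<close> minus it selects those that go straight on. The first step
  is decided by \<open>e_0\<close>.\<close>

lemma prefix_proj_ex:
  assumes p: "p \<in> Paths"
  shows "1 \<le> i \<Longrightarrow> i \<le> N \<Longrightarrow> \<exists>y. prefix_proj p i y"
proof (induction i rule: nat_induct_at_least)
  case base
  let ?e = "scal (1 / s\<^sub>1) * gen 0 :: nat free_alg"
  have le1: "(\<forall>j\<le>1. q ! j = p ! j) \<longleftrightarrow> q ! 1 = p ! 1" if "q \<in> Paths" for q
    using path_0[OF that] path_0[OF p] by (auto simp: le_Suc_eq)
  have e: "app (rho ?e) x q = (if q ! 1 = - 1 then x q else 0)" if "q \<in> Paths" for x q
    using that s1_nz by (simp add: ev_mult pef_0)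
  have q1: "q ! 1 = 1 \<or> q ! 1 = - 1" if "q \<in> Paths" for q
    using path_step'[OF that, of 1] path_0[OF that] N2 by auto
  show ?case
  proof (cases "p ! 1 = - 1")
    case True
    then have "prefix_proj p 1 ?e" using e le1 by (auto simp: prefix_proj_def intro!: mult_in)
    then show ?thesis by blast
  next
    case False
    then have "prefix_proj p 1 (1 - ?e)"
      using e le1 q1[OF p] q1 by (fastforce simp: prefix_proj_def ev_diff intro!: mult_in diff_in)
    then show ?thesis by blast
  qed
next
  case (Suc i)
  then obtain y where y: "prefix_proj p i y" by auto
  have i: "i < N" using Suc by simp
  let ?h = "p ! (i - 1)"
  let ?d = "dd i ?h (p ! i)"
  let ?e = "scal (1 / ?d) * (y * gen i * y)"
  have d: "?d \<noteq> 0" using dd_nz[OF i] path_step'[OF p] Suc by simp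
  have y': "y \<in> carrier F" "\<And>x q. q \<in> Paths \<Longrightarrow> app (rho y) x q = (if \<forall>j\<le>i. q ! j = p ! j then x q else 0)"
    using y by (auto simp: prefix_proj_def)
  have e: "app (rho ?e) x q = (if (\<forall>j\<le>i. q ! j = p ! j) \<and> q ! Suc i = ?h then x q else 0)" if "q \<in> Paths" for x q
    unfolding ev_mult[of _ "scal (1 / ?d)"] using prefix_proj_step[OF y Suc(1) i p that, of x] d by auto
  have ein: "?e \<in> carrier F" using y' i by (auto intro!: mult_in)
  have s: "(\<forall>j\<le>Suc i. q ! j = p ! j) \<longleftrightarrow> (\<forall>j\<le>i. q ! j = p ! j) \<and> q ! Suc i = p ! Suc i" for q
    by (auto simp: le_Suc_eq)
  show ?case
  proof (cases "p ! Suc i = ?h")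
    case True
    then have "prefix_proj p (Suc i) ?e" using e ein s by (simp add: prefix_proj_def)
    then show ?thesis by blast
  next
    case False
    have eq: "q ! Suc i = p ! Suc i \<longleftrightarrow> q ! Suc i \<noteq> ?h" if "q \<in> Paths" "q ! i = p ! i" for q
      using path_step[OF that(1) i] path_step[OF p i] path_step'[OF p, of i] Suc i that(2) False by auto
    have "app (rho (y - ?e)) x q = (if \<forall>j\<le>Suc i. q ! j = p ! j then x q else 0)" if q: "q \<in> Paths" for x q
    proof (cases "\<forall>j\<le>i. q ! j = p ! j")
      case True
      then have "q ! i = p ! i" by simp
      then show ?thesis
        unfolding s ev_diff app_simps e[OF q] y'(2)[OF q] using eq[OF q] True by auto
    qed (use e[OF q] y'(2)[OF q] s in \<open>auto simp: ev_diff\<close>)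
    then have "prefix_proj p (Suc i) (y - ?e)"
      unfolding prefix_proj_def using ein y' by (auto intro!: diff_in)
    then show ?thesis by blast
  qed
qed

lemma path_proj_ex:
  assumes "p \<in> Paths"
  obtains y where "y \<in> carrier F" "\<And>x q. q \<in> Paths \<Longrightarrow> app (rho y) x q = (if q = p then x q else 0)"
proof -
  obtain y where y: "prefix_proj p N y" using prefix_proj_ex[OF assms, of N] N2 by auto
  have "(\<forall>j\<le>N. q ! j = p ! j) \<longleftrightarrow> q = p" if "q \<in> Paths" for q
    using path_length[OF that] path_length[OF assms] by (auto intro!: nth_equalityI)
  then show ?thesis using that y by (auto simp: prefix_proj_def)
qed

lemma E_in: "i \<le> N \<Longrightarrow> E i \<in> carrier F"
  by (induction i) (auto intro!: mult_in)

text \<open>The powers of \<open>s\<^sub>1\<close> in the definition of \<open>E\<close> are the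
  inverses of the diagonal weights along the fundamental path.\<close>

lemma prefix_proj_E: "i \<le> N \<Longrightarrow> prefix_proj fund_path i (E i)"
proof (induction i)
  case 0
  then show ?case using path_0 by (simp add: prefix_proj_def)
next
  case (Suc i)
  then have y: "prefix_proj fund_path i (E i)" and i: "i < N" by auto
  have s: "(\<forall>j\<le>Suc i. q ! j = fund_path ! j) \<longleftrightarrow> (\<forall>j\<le>i. q ! j = fund_path ! j) \<and> q ! Suc i = fund_path ! Suc i" for q
    by (auto simp: le_Suc_eq)
  have "app (rho (E (Suc i))) x q = (if \<forall>j\<le>Suc i. q ! j = fund_path ! j then x q else 0)" if q: "q \<in> Paths" for x q
  proof (cases "i = 0")
    case True
    have "(\<forall>j\<le>Suc i. q ! j = fund_path ! j) \<longleftrightarrow> q ! 1 = - 1"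
      unfolding s using path_0[OF q] True i by simp
    then show ?thesis using q s1_nz i True by (simp add: ev_mult pef_0)
  next
    case False
    have "app (rho (E (Suc i))) x q = s\<^sub>1 powi ((- 1) ^ Suc i) * app (rho (E i * gen i * E i)) x q"
      by (simp add: ev_mult mult.assoc)
    also have "\<dots> = s\<^sub>1 powi ((- 1) ^ Suc i) * (if (\<forall>j\<le>i. q ! j = fund_path ! j) \<and> q ! Suc i = fund_path ! (i - 1)
        then dd i (fund_path ! (i - 1)) (fund_path ! i) * x q else 0)"
      using prefix_proj_step[OF y _ i fund_path_Paths q] False by simp
    also have "fund_path ! (i - 1) = fund_path ! Suc i" using i False by simp
    also have "s\<^sub>1 powi ((- 1) ^ Suc i) * dd i (fund_path ! Suc i) (fund_path ! i) = 1"
      using i False dd_fund_odd[of i] dd_fund_even[of i] s1_nz by (cases "even i") auto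
    then have "s\<^sub>1 powi ((- 1) ^ Suc i) * (if (\<forall>j\<le>i. q ! j = fund_path ! j) \<and> q ! Suc i = fund_path ! Suc i
        then dd i (fund_path ! Suc i) (fund_path ! i) * x q else 0) = (if \<forall>j\<le>Suc i. q ! j = fund_path ! j then x q else 0)"
      unfolding s by (auto simp: mult.assoc[symmetric])
    finally show ?thesis .
  qed
  then show ?case using E_in[OF Suc.prems] by (simp add: prefix_proj_def del: E.simps)
qed

end

section \<open>The scalar by which \<open>Z\<close> acts\<close>

text \<open>In the expansion, \<open>x * y * x = x\<close> cancels against part of
  \<open>c * (x * x)\<close>, by \<open>c * d = 1\<close>. What remains is symmetric in the two
  generators.\<close>

lemma TL_braid:
  fixes a b c d :: "'a::ring_1"
  assumes "a * b * a = a" "b * a * b = b" "a * a = (c + d) * a" "b * b = (c + d) * b"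
    and c: "\<And>x. c * x = x * c" and cd: "c * d = 1"
  shows "(a - c) * (b - c) * (a - c) = (b - c) * (a - c) * (b - c)"
proof -
  have e: "(x - c) * (y - c) * (x - c) = c * (c * x) + c * (c * y) - c * (x * y) - c * (y * x) - c * (c * c)"
    if h: "x * y * x = x" "x * x = (c + d) * x" for x y
  proof -
    have r: "x * c = c * x" "y * c = c * y" "\<And>z. x * (c * z) = c * (x * z)" "\<And>z. y * (c * z) = c * (y * z)"
      by (simp_all add: c mult.assoc)
    have 1: "x * (y * x) = x" "c * (x * x) = c * (c * x) + x"
      using h cd by (simp_all add: mult.assoc distrib_left distrib_right mult.assoc[of c d, symmetric])
    have "(x - c) * (y - c) * (x - c) = x * (y * x) - c * (x * y) - c * (x * x) + c * (c * x)
        - c * (y * x) + c * (c * y) + c * (c * x) - c * (c * c)"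
      by (simp add: left_diff_distrib right_diff_distrib mult.assoc r)
    then show ?thesis unfolding 1 by (simp add: algebra_simps)
  qed
  show ?thesis unfolding e[OF assms(1,3)] e[OF assms(2,4)] by (simp add: algebra_simps)
qed

lemma sc_left_comm: "x * (sc a * z) = sc a * (x * z)"
proof -
  have "x * (sc a * z) = x * sc a * z" by (simp only: mult.assoc)
  also have "x * sc a = sc a * x" by (rule sc_comm[symmetric])
  finally show ?thesis by (simp only: mult.assoc)
qed

lemma sc_sc: "sc a * (sc b * z) = sc (a * b) * z"
  by (simp only: sc_mult mult.assoc)

lemma scal_left_comm: "x * (scal a * z) = scal a * (x * z)"
proof -
  have "x * (scal a * z) = x * scal a * z" by (simp only: mult.assoc)
  also have "x * scal a = scal a * x" by (rule scal_comm[symmetric])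
  finally show ?thesis by (simp only: mult.assoc)
qed

lemma scal_scal: "scal a * (scal b * z) = scal (a * b) * z"
  by (simp only: scal_mult mult.assoc)

text \<open>The two sides are the squares of \<open>u - sc D * z\<close> for
  \<open>z = x * y\<close> and \<open>z = y * x\<close>. Here \<open>z\<close> is idempotent, and
  the condition on \<open>D\<close> is what makes \<open>u * z + z * u\<close> equal to
  \<open>sc D * z + w\<close> with the same \<open>w\<close> in both cases. The terms in
  \<open>z\<close> then cancel.\<close>

lemma boundary_braid:
  fixes x y :: "'a lop"
  assumes h: "x * x = sc s * x" "y * y = sc t * y" "y * x * y = y" and D: "D = A * t - 2 * (A * c) + D * c * s"
  shows "(sc A - sc D * x) * (y - sc c) * (sc A - sc D * x) * (y - sc c) =
    (y - sc c) * (sc A - sc D * x) * (y - sc c) * (sc A - sc D * x)"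
proof -
  have m: "x * sc a = sc a * x" "y * sc a = sc a * y" "x * (sc a * z) = sc a * (x * z)" "y * (sc a * z) = sc a * (y * z)"
    "sc a * (sc b * z) = sc (a * b) * z" "sc a * sc b = sc (a * b)" for a b z
    by (rule sc_comm[symmetric] sc_left_comm sc_sc sc_mult[symmetric])+
  have h': "x * (x * z) = sc s * (x * z)" "y * (y * z) = sc t * (y * z)" "y * (x * (y * z)) = y * z" "y * (x * y) = y" for z
    using h by (metis mult.assoc)+
  define u where "u = sc A * y - sc (A * c) + sc (D * c) * x"
  define w where "w = sc A * y + sc (D * c) * (x * (y * x))"
  have k: "sc D * z = sc (A * t) * z - sc (A * c) * z - sc (A * c) * z + sc (D * c * s) * z" for z :: "'a lop"
  proof -
    have "sc D = sc (A * t) - sc (A * c) - sc (A * c) + sc (D * c * s)"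
      by (subst D) (simp add: sc_add[symmetric] sc_diff[symmetric])
    then show ?thesis by (metis distrib_right left_diff_distrib)
  qed
  have P: "(sc A - sc D * x) * (y - sc c) = u - sc D * (x * y)"
    and Q: "(y - sc c) * (sc A - sc D * x) = u - sc D * (y * x)"
    unfolding u_def by (simp_all add: algebra_simps m)
  have uz: "u * (x * y) + x * y * u = sc D * (x * y) + w" "u * (y * x) + y * x * u = sc D * (y * x) + w"
    unfolding k unfolding u_def w_def by (simp_all add: distrib_left distrib_right left_diff_distrib right_diff_distrib mult.assoc m h h' mult.commute mult.left_commute)
  have sq: "(u - sc D * z) * (u - sc D * z) = u * u - sc D * (u * z + z * u) + sc D * (sc D * (z * z))" for z
  proof -
    have "u * sc a = sc a * u" "u * (sc a * v) = sc a * (u * v)" "z * sc a = sc a * z" "z * (sc a * v) = sc a * (z * v)" for a v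
      by (rule sc_comm[symmetric] sc_left_comm)+
    then show ?thesis by (simp add: algebra_simps)
  qed
  have xyxy: "x * y * (x * y) = x * y" "y * x * (y * x) = y * x"
    using h' by (simp_all add: mult.assoc)
  have "(u - sc D * (x * y)) * (u - sc D * (x * y)) = (u - sc D * (y * x)) * (u - sc D * (y * x))"
    unfolding sq uz xyxy by (simp add: distrib_left)
  then show ?thesis
    using P Q by (metis mult.assoc)
qed

context btl
begin

section \<open>The Hecke generators in the two-boundary algebra\<close>

definition D1 :: complex where "D1 = qp (1 + \<omega>\<^sub>1) - qp (- 1 - \<omega>\<^sub>1)"
definition D2 :: complex where "D2 = qp (1 + \<omega>\<^sub>2) - qp (- 1 - \<omega>\<^sub>2)"

lemma qn_DD: "DD * qn x = qp x - qp (- x)"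
  using DD by (simp add: qnum_def)

lemma D_eq: "D1 = DD * qn (\<omega>\<^sub>1 + 1)" "D2 = DD * qn (\<omega>\<^sub>2 + 1)"
  unfolding qn_DD D1_def D2_def by (simp_all add: add.commute)

lemma D_s: "D1 * s\<^sub>1 = qp \<omega>\<^sub>1 - qp (- \<omega>\<^sub>1)" "D2 * s\<^sub>2 = qp \<omega>\<^sub>2 - qp (- \<omega>\<^sub>2)"
proof -
  have "D1 * s\<^sub>1 = DD * qn \<omega>\<^sub>1" "D2 * s\<^sub>2 = DD * qn \<omega>\<^sub>2"
    unfolding D_eq s\<^sub>1_def s\<^sub>2_def using qn_w1_0 w2_gen by simp_all
  then show "D1 * s\<^sub>1 = qp \<omega>\<^sub>1 - qp (- \<omega>\<^sub>1)" "D2 * s\<^sub>2 = qp \<omega>\<^sub>2 - qp (- \<omega>\<^sub>2)"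
    by (simp_all only: qn_DD)
qed

lemma delta_eq: "\<delta> = qp 1 + qp (- 1)"
proof -
  have "DD * \<delta> = DD * (qp 1 + qp (- 1))"
    unfolding \<delta>_def qn_DD qpow_minus[of \<eta> 2] using qpow_add[of \<eta> 1 1] by (simp add: qpow_minus field_simps)
  then show ?thesis using DD by simp
qed

definition gF :: "nat \<Rightarrow> nat free_alg" where
  "gF i = (if i = 0 then scal (qp \<omega>\<^sub>1) - scal D1 * gen 0
     else if i = N then scal (qp \<omega>\<^sub>2) - scal D2 * gen N else gen i - scal (qp (- 1)))"

definition giF :: "nat \<Rightarrow> nat free_alg" where
  "giF i = (if i = 0 then scal (qp (- \<omega>\<^sub>1)) + scal D1 * gen 0
     else if i = N then scal (qp (- \<omega>\<^sub>2)) + scal D2 * gen N else gen i - scal (qp 1))"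

lemma g_eq: "g i = cl (gF i)"
  by (simp add: g_def gF_def D1_def D2_def)

lemma gF_in: "i \<le> N \<Longrightarrow> gF i \<in> carrier F" and giF_in: "i \<le> N \<Longrightarrow> giF i \<in> carrier F"
  by (auto simp: gF_def giF_def intro!: diff_in add_in mult_in)

text \<open>An identity in the free algebra: the product misses 1 by a multiple of the quadratic
  relation, hence equals 1 in the quotient.\<close>

lemma boundary_inverse:
  fixes e :: "nat free_alg"
  assumes "D * s = A - A'" "A * A' = 1"
  shows "(scal A - scal D * e) * (scal A' + scal D * e) - 1 = scal (- (D * D)) * (e * e - scal s * e)"
    "(scal A' + scal D * e) * (scal A - scal D * e) - 1 = scal (- (D * D)) * (e * e - scal s * e)"
proof -
  have m: "e * scal a = scal a * e" "e * (scal a * z) = scal a * (e * z)" "scal a * (scal b * z) = scal (a * b) * z"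
    "scal a * scal b = scal (a * b)" for a b z
    by (rule scal_comm[symmetric] scal_left_comm scal_scal scal_mult[symmetric])+
  have s: "scal (D * D * s) * e = scal (D * A) * e - scal (D * A') * e"
    using assms(1) by (simp add: scal_diff[symmetric] left_diff_distrib[symmetric] mult.assoc right_diff_distrib)
  have neg: "scal (- c) * z = - (scal c * z)" for c and z :: "nat free_alg"
  proof -
    have "scal (- c) = - (scal c :: nat free_alg)" using scal_diff[of 0 c] by simp
    then show ?thesis by simp
  qed
  show "(scal A - scal D * e) * (scal A' + scal D * e) - 1 = scal (- (D * D)) * (e * e - scal s * e)"
    "(scal A' + scal D * e) * (scal A - scal D * e) - 1 = scal (- (D * D)) * (e * e - scal s * e)"
    using assms(2) s by (simp_all add: algebra_simps m neg)
qed

lemma gF_inverse: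
  assumes "i \<le> N"
  shows "cl (gF i * giF i) = cl 1 \<and> cl (giF i * gF i) = cl 1"
proof -
  have rel: "cl x = cl 1" if "x - 1 = c * y" "y \<in> relations" "c \<in> carrier F" "x \<in> carrier F" for x c y
  proof -
    have "y \<in> TL_ideal" using that ring.genideal_self[OF free_algebra_ring relations_in] unfolding TL_ideal_def by blast
    then have "c * y \<in> TL_ideal" using ideal.I_l_closed[OF TL_ideal _ that(3)] by simp
    then show ?thesis using cl_eq_iff[of x 1] that by simp
  qed
  have in': "gF i * giF i \<in> carrier F" "giF i * gF i \<in> carrier F"
    using assms gF_in giF_in by (auto intro!: mult_in)
  consider "i = 0" | "i = N" "i \<noteq> 0" | "1 \<le> i" "i < N" using assms by linarith
  then show ?thesis
  proof cases
    case 1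
    have "gen 0 * gen 0 - scal s\<^sub>1 * gen 0 \<in> relations" by (auto simp: relations_def)
    moreover have "qp \<omega>\<^sub>1 * qp (- \<omega>\<^sub>1) = 1" by (simp add: qpow_minus)
    ultimately show ?thesis
      using 1 rel[OF boundary_inverse(1)[OF D_s(1)]] rel[OF boundary_inverse(2)[OF D_s(1)]] in' by (simp add: gF_def giF_def)
  next
    case 2
    have "gen N * gen N - scal s\<^sub>2 * gen N \<in> relations" by (auto simp: relations_def)
    moreover have "qp \<omega>\<^sub>2 * qp (- \<omega>\<^sub>2) = 1" by (simp add: qpow_minus)
    ultimately show ?thesis
      using 2 rel[OF boundary_inverse(1)[OF D_s(2)]] rel[OF boundary_inverse(2)[OF D_s(2)]] in' by (simp add: gF_def giF_def)
  next
    case 3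
    have r: "gen i * gen i - scal \<delta> * gen i \<in> relations" using 3 by (auto simp: relations_def)
    have q: "scal (qp (- 1)) * scal (qp 1) = (1 :: nat free_alg)" "scal (qp 1) * scal (qp (- 1)) = (1 :: nat free_alg)"
      by (simp_all add: scal_mult[symmetric] qpow_minus)
    have d: "gen i * scal \<delta> = gen i * scal (qp 1) + gen i * scal (qp (- 1))"
      by (simp add: delta_eq scal_add distrib_left)
    have "gF i * giF i - 1 = 1 * (gen i * gen i - scal \<delta> * gen i)" "giF i * gF i - 1 = 1 * (gen i * gen i - scal \<delta> * gen i)"
      using 3 by (simp_all add: gF_def giF_def algebra_simps q d scal_comm[of _ "gen i"])
    then show ?thesis using rel[OF _ r one_in] in' by blast
  qed
qed

definition GG :: "nat \<Rightarrow> int list lop" where "GG i = rho (gF i)"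
definition GI :: "nat \<Rightarrow> int list lop" where "GI i = rho (giF i)"

lemma GG_simps:
  "GG 0 = sc (qp \<omega>\<^sub>1) - sc D1 * pe 0" "GI 0 = sc (qp (- \<omega>\<^sub>1)) + sc D1 * pe 0"
  "GG N = sc (qp \<omega>\<^sub>2) - sc D2 * pe N" "GI N = sc (qp (- \<omega>\<^sub>2)) + sc D2 * pe N"
  "1 \<le> i \<Longrightarrow> i < N \<Longrightarrow> GG i = pe i - sc (qp (- 1))" "1 \<le> i \<Longrightarrow> i < N \<Longrightarrow> GI i = pe i - sc (qp 1)"
  using N2 by (auto simp: GG_def GI_def gF_def giF_def ev_diff ev_mult ev_add)

lemma GG_inv: assumes "i \<le> N" shows "GG i * GI i = 1" "GI i * GG i = 1"
proof -
  have "rho (gF i * giF i) = rho 1" "rho (giF i * gF i) = rho 1"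
    using gF_inverse[OF assms] cl_eq_rho[OF mult_in[OF gF_in[OF assms] giF_in[OF assms]] one_in]
      cl_eq_rho[OF mult_in[OF giF_in[OF assms] gF_in[OF assms]] one_in] by blast+
  then show "GG i * GI i = 1" "GI i * GG i = 1" by (simp_all add: GG_def GI_def ev_mult)
qed

lemma lin_comm: "x * y = y * x \<Longrightarrow> (sc a + sc b * x) * (sc c + sc d * y) = (sc c + sc d * y) * (sc a + sc b * x)"
  for x y :: "'b lop"
proof -
  assume xy: "x * y = y * x"
  have m: "x * sc a = sc a * x" "y * sc a = sc a * y" "x * (sc a * z) = sc a * (x * z)" "y * (sc a * z) = sc a * (y * z)"
    "sc a * (sc b * z) = sc (a * b) * z" "sc a * sc b = sc (a * b)" for a b z
    by (rule sc_comm[symmetric] sc_left_comm sc_sc sc_mult[symmetric])+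
  show ?thesis by (simp add: algebra_simps m xy mult.commute)
qed

lemma GG_lin: assumes "i \<le> N" shows "\<exists>a b. GG i = sc a + sc b * pe i"
proof -
  consider "i = 0" | "i = N" | "1 \<le> i" "i < N" using assms by linarith
  then show ?thesis
  proof cases
    case 1
    have "GG i = sc (qp \<omega>\<^sub>1) + sc (- D1) * pe i" using 1 by (simp add: GG_simps sc_minus)
    then show ?thesis by blast
  next
    case 2
    have "GG i = sc (qp \<omega>\<^sub>2) + sc (- D2) * pe i" using 2 by (simp add: GG_simps sc_minus)
    then show ?thesis by blast
  next
    case 3
    have "GG i = sc (- qp (- 1)) + sc 1 * pe i" using 3 by (simp add: GG_simps sc_minus)
    then show ?thesis by blast
  qed
qed

sublocale hk: hecke N GG GI "sc (qp 1 - qp (- 1))" "sc (qp \<omega>\<^sub>1 + qp (- \<omega>\<^sub>1))" "sc (qp \<omega>\<^sub>2 + qp (- \<omega>\<^sub>2))"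
proof
  show "2 \<le> N" by (rule N2)
  show "GG i * GI i = 1" "GI i * GG i = 1" if "i \<le> N" for i using GG_inv[OF that] by auto
  show "GG i * GG (Suc i) * GG i = GG (Suc i) * GG i * GG (Suc i)" if i: "1 \<le> i" "i + 1 < N" for i
  proof -
    have "pe i * pe (Suc i) * pe i = pe i" "pe (Suc i) * pe i * pe (Suc i) = pe (Suc i)"
      using pe_braid_up[of i] pe_braid_down[of "Suc i"] i by auto
    moreover have "pe i * pe i = (sc (qp (- 1)) + sc (qp 1)) * pe i" "pe (Suc i) * pe (Suc i) = (sc (qp (- 1)) + sc (qp 1)) * pe (Suc i)"
      using pe_square[of i] pe_square[of "Suc i"] i by (auto simp: tau_def delta_eq sc_add[symmetric] add.commute)
    moreover have "sc (qp (- 1)) * sc (qp 1) = (1 :: int list lop)" by (simp add: sc_mult[symmetric] qpow_minus)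
    ultimately show ?thesis
      using i TL_braid[OF _ _ _ _ sc_comm] by (simp add: GG_simps)
  qed
  show "GG 0 * GG 1 * GG 0 * GG 1 = GG 1 * GG 0 * GG 1 * GG 0"
  proof -
    have "GG 0 = sc (qp \<omega>\<^sub>1) - sc D1 * pe 0" "GG 1 = pe 1 - sc (qp (- 1))"
      using GG_simps N2 by auto
    moreover have "pe 1 * pe 1 = sc \<delta> * pe 1" "pe 1 * pe 0 * pe 1 = pe 1"
      using pe_square[of 1] pe_braid_down[of 1] N2 by (auto simp: tau_def)
    \<comment> \<open>The condition of \<open>boundary_braid\<close> for
      \<open>A = qp \<omega>\<^sub>1\<close>, \<open>c = qp (- 1)\<close>,
      \<open>t = \<delta>\<close> and \<open>s = s\<^sub>1\<close>; it reflects the normalisation of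
      \<open>g 0\<close>.\<close>
    moreover have "D1 = qp \<omega>\<^sub>1 * \<delta> - 2 * (qp \<omega>\<^sub>1 * qp (- 1)) + D1 * qp (- 1) * s\<^sub>1"
    proof -
      have h: "D1 * qp (- 1) * s\<^sub>1 = qp (- 1) * (qp \<omega>\<^sub>1 - qp (- \<omega>\<^sub>1))" using D_s(1) by (simp add: mult_ac)
      show ?thesis
        unfolding h delta_eq unfolding D1_def by (simp add: qpow_add qpow_diff qpow_minus field_simps)
    qed
    ultimately show ?thesis using boundary_braid[OF pe0_square] by simp
  qed
  show "GG (N - 1) * GG N * GG (N - 1) * GG N = GG N * GG (N - 1) * GG N * GG (N - 1)"
  proof -
    have 1: "GG N = sc (qp \<omega>\<^sub>2) - sc D2 * pe N" "GG (N - 1) = pe (N - 1) - sc (qp (- 1))"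
      using GG_simps N2 by auto
    have 2: "pe (N - 1) * pe (N - 1) = sc \<delta> * pe (N - 1)" "pe (N - 1) * pe N * pe (N - 1) = pe (N - 1)" "pe N * pe N = sc s\<^sub>2 * pe N"
      using pe_square[of "N - 1"] pe_square[of N] pe_braid_up[of "N - 1"] N2 by (auto simp: tau_def)
    have "D2 = qp \<omega>\<^sub>2 * \<delta> - 2 * (qp \<omega>\<^sub>2 * qp (- 1)) + D2 * qp (- 1) * s\<^sub>2"
    proof -
      have h: "D2 * qp (- 1) * s\<^sub>2 = qp (- 1) * (qp \<omega>\<^sub>2 - qp (- \<omega>\<^sub>2))" using D_s(2) by (simp add: mult_ac)
      show ?thesis
        unfolding h delta_eq unfolding D2_def by (simp add: qpow_add qpow_diff qpow_minus field_simps)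
    qed
    then show ?thesis using boundary_braid[OF 2(3,1,2)] 1 by simp
  qed
  show "GG i * GG j = GG j * GG i" if ij: "i \<le> N" "j \<le> N" "i + 1 < j" for i j
  proof -
    obtain a b c d where "GG i = sc a + sc b * pe i" "GG j = sc c + sc d * pe j"
      using GG_lin ij by meson
    moreover have "pe i * pe j = pe j * pe i"
      using ij pe_far[of i j] pe0_far[of j] by (cases "i = 0") auto
    ultimately show ?thesis using lin_comm by simp
  qed
  show "GG i - GI i = sc (qp 1 - qp (- 1))" if "1 \<le> i" "i < N" for i
    using that by (simp add: GG_simps sc_diff)
  show "GG 0 + GI 0 = sc (qp \<omega>\<^sub>1 + qp (- \<omega>\<^sub>1))" "GG N + GI N = sc (qp \<omega>\<^sub>2 + qp (- \<omega>\<^sub>2))"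
    by (simp_all add: GG_simps sc_add)
qed (rule sc_comm)+

section \<open>The operator of \<open>Z\<close> in the path representation\<close>

lemma trho_g: "i \<le> N \<Longrightarrow> trho (g i) = GG i"
  by (simp add: g_eq gF_in GG_def)

lemma g_Units: assumes "i \<le> N" shows "g i \<in> Units TL" "inv\<^bsub>TL\<^esub> g i = cl (giF i)"
proof -
  interpret ring TL by (rule TL_ring)
  have c: "g i \<in> carrier TL" "cl (giF i) \<in> carrier TL"
    using assms by (auto simp: g_eq intro!: cl_closed gF_in giF_in)
  have e: "g i \<otimes>\<^bsub>TL\<^esub> cl (giF i) = \<one>\<^bsub>TL\<^esub>" "cl (giF i) \<otimes>\<^bsub>TL\<^esub> g i = \<one>\<^bsub>TL\<^esub>"
    using gF_inverse[OF assms] assms by (auto simp: g_eq cl_simps(2)[symmetric] gF_in giF_in cl_one)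
  show u: "g i \<in> Units TL" unfolding Units_def using c e by blast
  have "inv\<^bsub>TL\<^esub> g i = inv\<^bsub>TL\<^esub> g i \<otimes>\<^bsub>TL\<^esub> (g i \<otimes>\<^bsub>TL\<^esub> cl (giF i))"
    using u unfolding e by simp
  also have "\<dots> = cl (giF i)"
    using u c by (simp add: m_assoc[symmetric])
  finally show "inv\<^bsub>TL\<^esub> g i = cl (giF i)" .
qed

lemma trho_inv_g: "i \<le> N \<Longrightarrow> trho (inv\<^bsub>TL\<^esub> g i) = GI i"
  by (simp add: g_Units giF_in GI_def)

lemma trho_foldr:
  "set xs \<subseteq> Units TL \<Longrightarrow> foldr (mult TL) xs \<one>\<^bsub>TL\<^esub> \<in> Units TL \<and>
    trho (foldr (mult TL) xs \<one>\<^bsub>TL\<^esub>) = prod_list (map trho xs)"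
proof -
  interpret ring TL by (rule TL_ring)
  show "set xs \<subseteq> Units TL \<Longrightarrow> foldr (mult TL) xs \<one>\<^bsub>TL\<^esub> \<in> Units TL \<and>
    trho (foldr (mult TL) xs \<one>\<^bsub>TL\<^esub>) = prod_list (map trho xs)"
    by (induction xs) (auto simp: trho_one trho_hom Units_closed)
qed

lemma trho_J: "i < N \<Longrightarrow> J i \<in> Units TL \<and> trho (J i) = hk.JJ i"
proof (induction i)
  case 0
  interpret ring TL by (rule TL_ring)
  have U: "set (map (\<lambda>i. inv\<^bsub>TL\<^esub> g i) [1..<N] @ [g N] @ map g (rev [1..<N]) @ [g 0]) \<subseteq> Units TL"
    using g_Units(1) by auto
  have "hk.tt (N - 1) = prod_list (map GI [1..<N]) * GG N * prod_list (map GG (rev [1..<N]))"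
    using hk.tt_eq_word[of "N - 1"] N2 by simp
  moreover have "map trho (map (\<lambda>i. inv\<^bsub>TL\<^esub> g i) [1..<N]) = map GI [1..<N]" "map trho (map g (rev [1..<N])) = map GG (rev [1..<N])"
    by (auto simp: trho_inv_g trho_g)
  ultimately have "trho (J 0) = hk.JJ 0"
    using trho_foldr[OF U] by (simp add: trho_g mult.assoc del: map_map)
  then show ?case using trho_foldr[OF U] by simp
next
  case (Suc i)
  interpret ring TL by (rule TL_ring)
  have u: "g (Suc i) \<in> Units TL" "J i \<in> Units TL" using g_Units Suc by auto
  then have "trho (J (Suc i)) = hk.JJ (Suc i)"
    using Suc trho_g[of "Suc i"] by (simp add: trho_hom Units_closed)
  then show ?case using u by simp
qed

lemma trho_inv_J: assumes "i < N" shows "trho (inv\<^bsub>TL\<^esub> J i) = hk.JI i"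
proof -
  interpret ring TL by (rule TL_ring)
  have u: "J i \<in> Units TL" and e: "trho (J i) = hk.JJ i" using trho_J[OF assms] by auto
  have "trho (inv\<^bsub>TL\<^esub> J i) * hk.JJ i = trho (inv\<^bsub>TL\<^esub> J i \<otimes>\<^bsub>TL\<^esub> J i)"
    using u by (simp add: trho_hom e Units_closed del: Units_l_inv)
  also have "\<dots> = 1" using u by (simp add: trho_one)
  finally show ?thesis
    using hk.JJ_inv[OF assms] by (metis mult.assoc mult.left_neutral mult.right_neutral)
qed

lemma Z_closed: "Z \<in> carrier TL" and trho_Z: "trho Z = hk.ZZ"
proof -
  interpret ring TL by (rule TL_ring)
  let ?f = "\<lambda>i. J i \<oplus>\<^bsub>TL\<^esub> inv\<^bsub>TL\<^esub> J i"
  have f: "?f i \<in> carrier TL" "trho (?f i) = hk.JJ i + hk.JI i" if "i < N" for i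
    using trho_J[OF that] trho_inv_J[OF that] by (auto simp: trho_hom Units_closed)
  have "n \<le> N \<Longrightarrow> (\<Oplus>\<^bsub>TL\<^esub>i\<in>{..<n}. ?f i) \<in> carrier TL \<and>
      trho (\<Oplus>\<^bsub>TL\<^esub>i\<in>{..<n}. ?f i) = (\<Sum>i<n. hk.JJ i + hk.JI i)" for n
  proof (induction n)
    case (Suc n)
    have "(\<Oplus>\<^bsub>TL\<^esub>i\<in>{..<Suc n}. ?f i) = ?f n \<oplus>\<^bsub>TL\<^esub> (\<Oplus>\<^bsub>TL\<^esub>i\<in>{..<n}. ?f i)"
      unfolding lessThan_Suc using Suc.prems f by (intro finsum_insert) auto
    then show ?case using Suc f[of n] by (simp add: trho_hom add.commute)
  qed (simp add: trho_zero)
  from this[of N] show "Z \<in> carrier TL" "trho Z = hk.ZZ"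
    by (auto simp: Z_def hk.ZZ_def)
qed

text \<open>Each \<open>pe i\<close> can be recovered from \<open>GG i\<close>, since
  \<open>D1\<close> and \<open>D2\<close> are nonzero, so centrality with respect to the Hecke
  generators carries over to the whole algebra.\<close>

lemma ZZ_central: assumes "y \<in> carrier F" shows "rho y * hk.ZZ = hk.ZZ * rho y"
  using assms
proof (induction rule: free_algebra_induct)
  case (gen i y)
  have "pe i * hk.ZZ = hk.ZZ * pe i"
  proof -
    have i: "i \<le> N" using gen by simp
    obtain a b where ab: "pe i = sc a + sc b * GG i"
    proof -
      have D: "D1 \<noteq> 0" "D2 \<noteq> 0" using D_eq DD qn_w1_0 w2_gen by auto
      have *: "pe i = sc (x / y) + sc (- 1 / y) * GG i" if "GG i = sc x - sc y * pe i" "y \<noteq> 0" for x y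
        unfolding that(1) using that(2)
        by (simp add: right_diff_distrib mult.assoc[symmetric] sc_mult[symmetric] sc_minus)
      consider "i = 0" | "i = N" | "1 \<le> i" "i < N" using i by linarith
      then show ?thesis
      proof cases
        case 3
        have "pe i = sc (qp (- 1)) + sc 1 * GG i" using 3 by (simp add: GG_simps)
        then show ?thesis using that by blast
      next
        case 1
        have "GG i = sc (qp \<omega>\<^sub>1) - sc D1 * pe i" using 1 GG_simps(1) by simp
        then show ?thesis using *[OF _ D(1)] that by blast
      next
        case 2
        have "GG i = sc (qp \<omega>\<^sub>2) - sc D2 * pe i" using 2 GG_simps(3) by simp
        then show ?thesis using *[OF _ D(2)] that by blast
      qed
    qed
    show ?thesis
      using hk.ZZ_central[OF i] commute_mult[of hk.ZZ "sc b" "GG i"] sc_comm[of _ hk.ZZ]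
      unfolding ab distrib_left distrib_right by simp
  qed
  then show ?case using gen commute_mult[of hk.ZZ "pe i" "rho y"] by (simp add: ev_mult)
next
  case (scal c y)
  then show ?case using commute_mult[of hk.ZZ "sc c" "rho y"] sc_comm[of c hk.ZZ] by (simp add: ev_mult)
qed (simp_all add: ev_add algebra_simps)

subsection \<open>Tiles\<close>

text \<open>The distance from the heights \<open>0\<close>, \<open>-1\<close> of the fundamental path: a tile can be removed
  wherever it is maximal.\<close>

definition lev :: "int \<Rightarrow> nat" where "lev h = nat (if h \<ge> 0 then h else - h - 1)"

lemma uncover_tile:
  assumes p: "p \<in> Paths" "p \<noteq> fund_path"
  obtains i where "1 \<le> i" "i \<le> N" "turn p i" "p ! i = nh (p ! (i - 1))"
proof -
  let ?M = "Max ((\<lambda>i. lev (p ! i)) ` {0..N})"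
  have le: "lev (p ! i) \<le> ?M" if "i \<le> N" for i using that by (intro Max_ge) auto
  have "?M \<in> (\<lambda>i. lev (p ! i)) ` {0..N}" by (intro Max_in) auto
  then obtain i where "i \<in> {0..N}" "?M = lev (p ! i)" by (rule imageE)
  then have i: "i \<le> N" "lev (p ! i) = ?M" by simp_all
  have "?M \<noteq> 0"
  proof
    assume M: "?M = 0"
    then have "p ! j = 0 \<or> p ! j = - 1" if "j \<le> N" for j
      using le[OF that] by (auto simp: lev_def split: if_splits)
    then have "j \<le> N \<Longrightarrow> p ! j = (if even j then 0 else - 1)" for j
    proof (induction j)
      case (Suc j)
      then show ?case using path_step[OF p(1), of j] Suc.prems by force
    qed (use path_0 p in auto)
    then have "p = fund_path"
      using path_length[OF p(1)] by (intro nth_equalityI) auto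
    then show False using p by simp
  qed
  moreover have "lev 0 = 0" by (simp add: lev_def)
  ultimately have i1: "1 \<le> i" using i path_0[OF p(1)] by (cases i) auto
  \<comment> \<open>A neighbouring height that is not further out lies one step inwards. Both
    neighbours of the outermost height therefore coincide, which gives the turn.\<close>
  have out: "p ! i = nh h \<and> h = oh (p ! i)" if "h = p ! i + 1 \<or> h = p ! i - 1" "lev h \<le> ?M" for h
    using that i \<open>?M \<noteq> 0\<close> by (auto simp: lev_def nh_def oh_def split: if_splits)
  have 1: "p ! i = nh (p ! (i - 1)) \<and> p ! (i - 1) = oh (p ! i)"
    using out[of "p ! (i - 1)"] path_step'[OF p(1) i1 i(1)] le[of "i - 1"] i by auto
  moreover have "turn p i"
    using out[of "p ! Suc i"] path_step[OF p(1), of i] le[of "Suc i"] conjunct2[OF 1] by (auto simp: turn_def)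
  ultimately show ?thesis using that i1 i by blast
qed

definition vv :: "int list \<Rightarrow> int list \<Rightarrow> complex"
  where "vv p q = (if q = p then 1 else 0)"

lemma X_in: "1 \<le> i \<Longrightarrow> i \<le> N \<Longrightarrow> X \<theta> i u \<in> carrier F"
  by (auto simp: X_def intro!: diff_in)

lemma rho_X: "1 \<le> i \<Longrightarrow> i \<le> N \<Longrightarrow> rho (X \<theta> i u) = pe i - sc (cf i u)"
  by (auto simp: X_def cf_def ev_diff)

lemma oh_nh: "oh h = h + 1 \<or> oh h = h - 1" "nh h = h + 1 \<or> nh h = h - 1" "oh h \<noteq> nh h" "oh (nh h) = h"
  "z = h + 1 \<or> z = h - 1 \<longleftrightarrow> z = oh h \<or> z = nh h"
  by (auto simp: oh_def nh_def)

lemma S1_alt: "S1 i x p = x (p[i := oh (p ! (i - 1))]) + cf i (- uu (p ! (i - 1))) * x (p[i := nh (p ! (i - 1))])"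
  by (auto simp: S1_def bb_def oh_def nh_def)

lemma pef_vv:
  assumes q: "q \<in> Paths" "1 \<le> i" "i \<le> N" "turn q i" "q ! i = oh (q ! (i - 1))"
  shows "pef i (vv q) = (\<lambda>s. cf i (uu (q ! (i - 1))) * vv q s + vv (q[i := nh (q ! (i - 1))]) s)"
proof
  fix s
  let ?h = "q ! (i - 1)"
  let ?p = "q[i := nh ?h]"
  have l: "length q = Suc N" using q path_length by auto
  have pP: "?p \<in> Paths" using flip_path[OF q(1-4)] oh_nh by auto
  have np: "?p \<noteq> q" using q l oh_nh(3)[of ?h] by (metis le_imp_less_Suc nth_list_update_eq)
  have eqq: "s[i := oh (s ! (i - 1))] = q \<longleftrightarrow> s = q \<or> s = ?p" if "s \<in> Paths" "turn s i"
  proof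
    assume a: "s[i := oh (s ! (i - 1))] = q"
    then have h: "s ! (i - 1) = ?h" using q(2) by (metis diff_less less_one nth_list_update_neq order.strict_iff_not zero_less_diff gr0I less_le_trans not_less_iff_gr_or_eq)
    have s: "s = q[i := s ! i]" using a by (metis list_update_id list_update_overwrite)
    have "s ! i = oh ?h \<or> s ! i = nh ?h" using path_step'[OF that(1) q(2,3)] oh_nh(5) h by metis
    then show "s = q \<or> s = ?p" using s q(5) by (metis list_update_id)
  next
    assume "s = q \<or> s = ?p"
    then show "s[i := oh (s ! (i - 1))] = q"
      using q(2,5) l by (auto simp: nth_list_update) (metis list_update_id)+
  qed
  have nq: "s[i := nh (s ! (i - 1))] \<noteq> q" if "s \<in> Paths"
  proof
    assume a: "s[i := nh (s ! (i - 1))] = q"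
    have ls: "length s = Suc N" using that path_length by auto
    have "q ! i = nh (s ! (i - 1))" "q ! (i - 1) = s ! (i - 1)"
      using q(2,3) ls unfolding a[symmetric] by (auto simp: nth_list_update)
    then show False using q(5) oh_nh(3) by metis
  qed
  show "pef i (vv q) s = cf i (uu ?h) * vv q s + vv ?p s"
  proof (cases "s \<in> Paths \<and> turn s i")
    case True
    have "S1 i (vv q) s = (if s = q \<or> s = ?p then 1 else 0)"
      unfolding S1_alt using True eqq nq by (simp add: vv_def)
    moreover have "aa i (?p ! (i - 1)) (?p ! i) = 1" "aa i (q ! (i - 1)) (q ! i) = cf i (uu ?h)"
      using q l oh_nh(3)[of ?h] by (auto simp: aa_def nth_list_update)
    ultimately show ?thesis
      using True q np by (auto simp: pef_pos vv_def)
  next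
    case False
    then have "s \<noteq> q" "s \<noteq> ?p" using q pP turn_upd_same[OF q(2)] by auto
    then show ?thesis using False q by (auto simp: pef_def vv_def)
  qed
qed

text \<open>A lift of \<open>basis_vec\<close> to the free algebra that counts tiles; the count is
  the induction measure later. A path has one such element for every order of its tiles, and their
  agreement modulo the relations is \<open>bvec_unique\<close>.\<close>

inductive bvec :: "nat \<Rightarrow> int list \<Rightarrow> nat free_alg \<Rightarrow> bool" where
  base: "bvec 0 fund_path (E N)"
| tile: "bvec m p y \<Longrightarrow> 1 \<le> i \<Longrightarrow> i \<le> N \<Longrightarrow> turn p i \<Longrightarrow> p ! i = oh (p ! (i - 1)) \<Longrightarrow>
    bvec (Suc m) (p[i := nh (p ! (i - 1))]) (X \<theta> i (uu (p ! (i - 1))) * y)"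

lemma bvec_in: "bvec m p y \<Longrightarrow> p \<in> Paths \<and> y \<in> carrier F"
proof (induction rule: bvec.induct)
  case base
  then show ?case using fund_path_Paths E_in by simp
next
  case (tile m p y i)
  then show ?case using flip_path[of p i "nh (p ! (i - 1))"] oh_nh(2) mult_in[OF X_in] by simp
qed

lemma rho_E_vv: "app (rho (E N)) (vv fund_path) s = vv fund_path s" if "s \<in> Paths"
proof -
  have "(\<forall>j\<le>N. s ! j = fund_path ! j) \<longleftrightarrow> s = fund_path"
    using path_length[OF that] by (auto intro!: nth_equalityI)
  then show ?thesis using prefix_proj_E[of N] that by (auto simp: prefix_proj_def vv_def)
qed

definition supp_fun :: "int list set \<Rightarrow> (int list \<Rightarrow> complex) set"
  where "supp_fun S = {f. \<forall>p. p \<notin> S \<longrightarrow> f p = 0}"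

lemma rho_supp: assumes "y \<in> carrier F" "f \<in> supp_fun Paths" shows "app (rho y) f \<in> supp_fun Paths"
  using assms(1)
proof (induction rule: free_algebra_induct)
  case (gen i y)
  then show ?case by (simp add: ev_mult supp_fun_def pef_not_path)
qed (use assms in \<open>auto simp: supp_fun_def ev_add ev_mult\<close>)

lemma vv_supp: "p \<in> S \<Longrightarrow> vv p \<in> supp_fun S"
  by (auto simp: vv_def supp_fun_def)

lemma supp_fun_eqI: "f \<in> supp_fun S \<Longrightarrow> f' \<in> supp_fun S \<Longrightarrow> (\<And>p. p \<in> S \<Longrightarrow> f p = f' p) \<Longrightarrow> f = f'"
proof (rule ext)
  show "f \<in> supp_fun S \<Longrightarrow> f' \<in> supp_fun S \<Longrightarrow> (\<And>p. p \<in> S \<Longrightarrow> f p = f' p) \<Longrightarrow> f p = f' p" for p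
    by (cases "p \<in> S") (auto simp: supp_fun_def)
qed

lemma rho_bvec: "bvec m p y \<Longrightarrow> app (rho y) (vv fund_path) = vv p"
proof (induction rule: bvec.induct)
  case base
  then show ?case
    using fund_path_Paths E_in by (intro supp_fun_eqI[of _ Paths] rho_supp vv_supp rho_E_vv) auto
next
  case (tile m p y i)
  then show ?case
    using bvec_in[OF tile(1)] pef_vv[of p i] by (simp add: ev_mult rho_X)
qed

lemma bvec_ex: "p \<in> Paths \<Longrightarrow> \<exists>m y. bvec m p y"
proof (induction "\<Sum>i\<le>N. lev (p ! i)" arbitrary: p rule: less_induct)
  case less
  show ?case
  proof (cases "p = fund_path")
    case True
    then show ?thesis using bvec.base by blast
  next
    case False
    obtain i where i: "1 \<le> i" "i \<le> N" "turn p i" "p ! i = nh (p ! (i - 1))"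
      using uncover_tile[OF less.prems False] .
    let ?h = "p ! (i - 1)"
    let ?q = "p[i := oh ?h]"
    have l: "length p = Suc N" using less.prems by (rule path_length)
    have q: "?q \<in> Paths" using flip_path[OF less.prems i(1-3)] oh_nh(1) by auto
    have "(\<Sum>j\<le>N. lev (?q ! j)) < (\<Sum>j\<le>N. lev (p ! j))"
    proof (rule sum_strict_mono_ex1)
      have "lev (oh ?h) < lev (nh ?h)" by (simp add: lev_def oh_def nh_def)
      then show "\<exists>j\<in>{..N}. lev (?q ! j) < lev (p ! j)" "\<forall>j\<in>{..N}. lev (?q ! j) \<le> lev (p ! j)"
        using i l by (auto simp: nth_list_update intro!: bexI[of _ i])
    qed simp
    then obtain m y where "bvec m ?q y" using less.hyps q by blast
    from bvec.tile[OF this i(1,2)] have "bvec (Suc m) p (X \<theta> i (uu ?h) * y)"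
      using i l turn_upd_same[OF i(1)] by (simp add: nth_list_update) (metis list_update_id)
    then show ?thesis by blast
  qed
qed

subsection \<open>Evaluation on the top path\<close>

definition top :: "int list" where "top = map int [0..<Suc N]"

lemma top_nth: "i \<le> N \<Longrightarrow> top ! i = int i"
  unfolding top_def by (subst nth_map) (auto simp: nth_append)

lemma top_Paths: "top \<in> Paths"
  by (auto simp: Paths_def top_nth) (simp add: top_def)

text \<open>The top path has no turn before \<open>N\<close> and starts upwards, so the row and the
  column of \<open>e_i\<close> at this path vanish. Both are wanted because products are evaluated
  from either side.\<close>

lemma top_pe: assumes "i < N" shows "pef i x top = 0" "pef i (vv top) = (\<lambda>_. 0)"
proof -
  have t: "\<not> turn top i" if "1 \<le> i" using assms that by (simp add: turn_def top_nth)
  show "pef i x top = 0"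
    using t N2 by (cases "i = 0") (auto simp: pef_def top_nth)
  show "pef i (vv top) = (\<lambda>_. 0)"
  proof
    fix s
    show "pef i (vv top) s = 0"
    proof (cases "i = 0")
      case True
      then show ?thesis using N2 by (auto simp: pef_def vv_def top_nth)
    next
      case False
      then have i: "1 \<le> i" by simp
      have "s[i := z] \<noteq> top" if "turn s i" for z
        using t[OF i] turn_upd_same[OF i, of s z] that by auto
      then show ?thesis using i assms by (auto simp: pef_def S1_def vv_def)
    qed
  qed
qed

definition gv :: "nat \<Rightarrow> complex" where "gv i = (if i = 0 then qp \<omega>\<^sub>1 else - qp (- 1))"

lemma gv_nz: "gv i \<noteq> 0" by (simp add: gv_def)

lemma inverse_gv: "inverse (gv i) = (if i = 0 then qp (- \<omega>\<^sub>1) else - qp 1)"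
  by (simp add: gv_def qpow_minus)

lemma top_GG: assumes "i < N"
  shows "app (GG i) x top = gv i * x top" "app (GI i) x top = inverse (gv i) * x top"
    "app (GG i) (vv top) = (\<lambda>s. gv i * vv top s)" "app (GI i) (vv top) = (\<lambda>s. inverse (gv i) * vv top s)"
proof -
  have G: "GG i = (if i = 0 then sc (qp \<omega>\<^sub>1) - sc D1 * pe i else pe i - sc (qp (- 1)))"
    "GI i = (if i = 0 then sc (qp (- \<omega>\<^sub>1)) + sc D1 * pe i else pe i - sc (qp 1))"
    using assms GG_simps(5,6)[of i] by (auto simp: GG_simps(1,2))
  show "app (GG i) x top = gv i * x top" "app (GI i) x top = inverse (gv i) * x top"
    "app (GG i) (vv top) = (\<lambda>s. gv i * vv top s)" "app (GI i) (vv top) = (\<lambda>s. inverse (gv i) * vv top s)"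
    unfolding G inverse_gv unfolding gv_def using top_pe[of 0] assms by (simp_all add: top_pe[OF assms])
qed

lemma top_conj:
  assumes "i < N"
  shows "app (GI i * A * GG i) (vv top) top = app A (vv top) top"
    "app (GG i * A * GG i) (vv top) top = (gv i)\<^sup>2 * app A (vv top) top"
    "app (GI i * A * GI i) (vv top) top = (inverse (gv i))\<^sup>2 * app A (vv top) top"
  using gv_nz by (simp_all add: top_GG[OF assms] app_cmult power2_eq_square)

lemma top_tt: "d < N \<Longrightarrow> app (hk.tt d) (vv top) top = app (GG N) (vv top) top \<and>
    app (hk.ti d) (vv top) top = app (GI N) (vv top) top"
proof (induction d)
  case (Suc d)
  then show ?case using top_conj(1)[of "N - 1 - d"] by simp
qed simp

text \<open>On the top path \<open>GG i\<close> with \<open>i < N\<close> acts from both sides by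
  the scalar \<open>gv i\<close>. The conjugations in \<open>tt\<close> therefore cancel, each step
  of \<open>JJ\<close> contributes the square of \<open>gv\<close>, and the diagonal entry of
  \<open>GG N\<close> is all that remains to be computed.\<close>

lemma top_JJ: "i < N \<Longrightarrow>
    app (hk.JJ i) (vv top) top = qp (- 2 * of_nat i) * (qp \<omega>\<^sub>1 * app (GG N) (vv top) top) \<and>
    app (hk.JI i) (vv top) top = qp (2 * of_nat i) * (qp (- \<omega>\<^sub>1) * app (GI N) (vv top) top)"
proof (induction i)
  case 0
  then show ?case
    using top_tt[of "N - 1"] N2 by (simp add: top_GG app_cmult inverse_gv) (simp add: gv_def)
next
  case (Suc i)
  have "qp (- 2 * of_nat (Suc i)) = (gv (Suc i))\<^sup>2 * qp (- 2 * of_nat i)"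
    by (simp add: gv_def power2_eq_square qpow_add[symmetric])
  moreover have "qp (2 * of_nat (Suc i)) = (inverse (gv (Suc i)))\<^sup>2 * qp (2 * of_nat i)"
    by (simp add: inverse_gv power2_eq_square qpow_add[symmetric])
  ultimately show ?case
    using Suc top_conj(2,3)[of "Suc i"] by (simp add: mult.assoc)
qed

lemma qp_sum: "DD * (\<Sum>i<n. qp (2 * of_nat i)) = qp (2 * of_nat n - 1) - qp (- 1)"
  "DD * (\<Sum>i<n. qp (- 2 * of_nat i)) = qp 1 - qp (1 - 2 * of_nat n)"
proof -
  have a: "(qp 1 - qp (- 1)) * qp x = qp (x + 1) - qp (x - 1)" for x
    using DD by (simp add: qpow_add qpow_diff qpow_minus field_simps)
  show "DD * (\<Sum>i<n. qp (2 * of_nat i)) = qp (2 * of_nat n - 1) - qp (- 1)"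
  proof (induction n)
    case (Suc n)
    have "2 * of_nat n + 1 = (2 * of_nat (Suc n) - 1 :: complex)" by simp
    then show ?case using a[of "2 * of_nat n"] Suc by (simp add: distrib_left add.commute[of 1])
  qed simp
  show "DD * (\<Sum>i<n. qp (- 2 * of_nat i)) = qp 1 - qp (1 - 2 * of_nat n)"
  proof (induction n)
    case (Suc n)
    have e: "- 2 * of_nat n + 1 = (1 - 2 * of_nat n :: complex)" "- 2 * of_nat n - 1 = (1 - 2 * of_nat (Suc n) :: complex)" by simp_all
    show ?case using a[of "- 2 * of_nat n"] Suc unfolding e sum.lessThan_Suc distrib_left by simp
  qed simp
qed

definition zval :: complex where "zval = qn (of_nat N) * (qp \<theta> + qp (- \<theta>))"

lemma top_ZZ: "app hk.ZZ (vv top) top = zval"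
proof -
  let ?u = "\<omega>\<^sub>1 - of_nat (N - 1)"
  let ?A = "app (GG N) (vv top) top" and ?B = "app (GI N) (vv top) top"
  have "pef N (vv top) top = k \<theta> (- ?u)"
  proof -
    have t: "turn top N" by (simp add: turn_def)
    have n: "top ! (N - 1) = int (N - 1)" "top ! N = int (N - 1) + 1" using N2 by (auto simp: top_nth)
    have up: "top[N := int (N - 1) + 1] = top" using n by (metis list_update_id)
    have "length top = Suc N" by (simp add: top_def)
    then have "top[N := int (N - 1) - 1] ! N = int (N - 1) - 1" by simp
    then have dn: "top[N := int (N - 1) - 1] \<noteq> top" using n by (metis add_diff_cancel_left' diff_diff_eq2 eq_iff_diff_eq_0 one_neq_zero diff_add_cancel add_cancel_right_right one_add_one zero_neq_numeral)
    have "S1 N (vv top) top = bb N (int (N - 1)) (int (N - 1) + 1)"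
      unfolding S1_def n(1) up using dn by (simp add: vv_def)
    then have "pef N (vv top) top = dd N (int (N - 1)) (int (N - 1) + 1)"
      using pef_pos[OF top_Paths _ le_refl, of "vv top"] t N2 unfolding dd_def n by simp
    also have "\<dots> = k \<theta> (- ?u)" unfolding dd_up by (simp add: cf_def)
    finally show ?thesis .
  qed
  then have AB: "?A = qp \<omega>\<^sub>2 - D2 * k \<theta> (- ?u)" "?B = qp (- \<omega>\<^sub>2) + D2 * k \<theta> (- ?u)"
    by (simp_all add: GG_simps vv_def)
  have qu: "qn ?u \<noteq> 0" using qn_w1[of "int (N - 1)"] by simp
  have kk: "D2 * (DD * qn ?u) * k \<theta> (- ?u) = qp (?u + \<omega>\<^sub>2) + qp (- (?u + \<omega>\<^sub>2)) - qp \<theta> - qp (- \<theta>)"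
  proof -
    have e: "- ?u - \<omega>\<^sub>2 = - (?u + \<omega>\<^sub>2)" by simp
    have neg: "D * c * (D * a) * - (x / (D\<^sup>2 * (- a * c))) = x" if "D \<noteq> 0" "a \<noteq> 0" "c \<noteq> 0" for D a c x :: complex
      using that by (simp add: power2_eq_square)
    show ?thesis
      unfolding k_eq[of "- ?u"] e minus_minus qnum_minus D_eq neg[OF DD qu w2_gen(2)] by simp
  qed
  \<comment> \<open>The contribution of \<open>k\<close> cancels the exponentials in
    \<open>?u + \<omega>\<^sub>2\<close> and leaves those in \<open>\<theta>\<close>; this is the
    only way \<open>\<theta>\<close> enters the scalar.\<close>
  have main: "qp ?u * ?A + qp (- ?u) * ?B = qp \<theta> + qp (- \<theta>)"
  proof -
    have "qp ?u * ?A + qp (- ?u) * ?B = qp (?u + \<omega>\<^sub>2) + qp (- (?u + \<omega>\<^sub>2)) - D2 * (qp ?u - qp (- ?u)) * k \<theta> (- ?u)"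
    proof -
      have "qp (?u + \<omega>\<^sub>2) = qp ?u * qp \<omega>\<^sub>2" "qp (- (?u + \<omega>\<^sub>2)) = qp (- ?u) * qp (- \<omega>\<^sub>2)"
        by (simp add: qpow_add) (metis minus_add_distrib qpow_add)
      then show ?thesis unfolding AB by (simp only:) (simp only: algebra_simps)
    qed
    then show ?thesis using kk unfolding qn_DD by simp
  qed
  have "app hk.ZZ (vv top) top = (\<Sum>i<N. qp (- 2 * of_nat i) * (qp \<omega>\<^sub>1 * ?A) + qp (2 * of_nat i) * (qp (- \<omega>\<^sub>1) * ?B))"
    unfolding hk.ZZ_def app_sum_left using top_JJ by (intro sum.cong) auto
  also have "\<dots> = (\<Sum>i<N. qp (- 2 * of_nat i)) * (qp \<omega>\<^sub>1 * ?A) + (\<Sum>i<N. qp (2 * of_nat i)) * (qp (- \<omega>\<^sub>1) * ?B)"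
    by (simp add: sum.distrib sum_distrib_right)
  finally have "DD * app hk.ZZ (vv top) top = DD * (\<Sum>i<N. qp (- 2 * of_nat i)) * (qp \<omega>\<^sub>1 * ?A) + DD * (\<Sum>i<N. qp (2 * of_nat i)) * (qp (- \<omega>\<^sub>1) * ?B)"
    by (simp only: distrib_left mult.assoc)
  \<comment> \<open>Both geometric sums contain the factor \<open>qp N - qp (- N)\<close>; the
    complementary powers shift \<open>\<omega>\<^sub>1\<close> to \<open>?u\<close>.\<close>
  also have "\<dots> = (DD * qn (of_nat N)) * (qp ?u * ?A + qp (- ?u) * ?B)"
  proof -
    have n: "of_nat (N - 1) = (of_nat N - 1 :: complex)" using N2 by (simp add: of_nat_diff)
    have 1: "(qp 1 - qp (1 - 2 * of_nat N)) * qp \<omega>\<^sub>1 = (qp (of_nat N) - qp (- of_nat N)) * qp ?u"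
      unfolding left_diff_distrib qpow_add[symmetric] n by (simp add: algebra_simps)
    have 2: "(qp (2 * of_nat N - 1) - qp (- 1)) * qp (- \<omega>\<^sub>1) = (qp (of_nat N) - qp (- of_nat N)) * qp (- ?u)"
      unfolding left_diff_distrib qpow_add[symmetric] n by (simp add: algebra_simps)
    show ?thesis
      unfolding qp_sum qn_DD distrib_left mult.assoc[symmetric] 1 2 ..
  qed
  finally have "DD * app hk.ZZ (vv top) top = DD * zval"
    unfolding main zval_def by (simp add: mult.assoc)
  then show ?thesis using DD by simp
qed

lemma hecke_supp: "i \<le> N \<Longrightarrow> f \<in> supp_fun Paths \<Longrightarrow> app (GG i) f \<in> supp_fun Paths \<and> app (GI i) f \<in> supp_fun Paths"
  unfolding GG_def GI_def using rho_supp gF_in giF_in by blast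

lemma ZZ_supp: assumes "f \<in> supp_fun Paths" shows "app hk.ZZ f \<in> supp_fun Paths"
proof -
  have "d < N \<Longrightarrow> f \<in> supp_fun Paths \<Longrightarrow> app (hk.tt d) f \<in> supp_fun Paths \<and> app (hk.ti d) f \<in> supp_fun Paths" for d f
    by (induction d arbitrary: f) (auto simp: hecke_supp)
  then have "i < N \<Longrightarrow> f \<in> supp_fun Paths \<Longrightarrow> app (hk.JJ i) f \<in> supp_fun Paths \<and> app (hk.JI i) f \<in> supp_fun Paths" for i f
    using N2 by (induction i arbitrary: f) (auto simp: hecke_supp)
  then show ?thesis
    unfolding hk.ZZ_def app_sum_left using assms by (auto simp: supp_fun_def)
qed

lemma finite_Paths: "finite Paths"
proof -
  have "Paths \<subseteq> {xs. set xs \<subseteq> {- int N..int N} \<and> length xs = Suc N}"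
  proof
    fix p assume p: "p \<in> Paths"
    have bound: "i \<le> N \<Longrightarrow> \<bar>p ! i\<bar> \<le> int i" for i
    proof (induction i)
      case (Suc i)
      then show ?case using path_step[OF p, of i] by auto
    qed (simp add: path_0[OF p])
    then have "p ! i \<in> {- int N..int N}" if "i < length p" for i
    proof -
      have "i \<le> N" using path_length[OF p] that by simp
      then have "\<bar>p ! i\<bar> \<le> int N" using bound[of i] by linarith
      then show ?thesis by auto
    qed
    then show "p \<in> {xs. set xs \<subseteq> {- int N..int N} \<and> length xs = Suc N}"
      using path_length[OF p] by (auto simp: in_set_conv_nth)
  qed
  then show ?thesis using finite_lists_length_eq[of "{- int N..int N}" "Suc N"] finite_subset by blast
qed

lemma supp_sum: assumes "finite S" "f \<in> supp_fun S" shows "f = (\<lambda>q. \<Sum>p\<in>S. f p * vv p q)"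
proof
  fix q
  have "(\<Sum>p\<in>S. f p * vv p q) = (\<Sum>p\<in>S. if p = q then f p else 0)"
    by (intro sum.cong) (auto simp: vv_def)
  then show "f q = (\<Sum>p\<in>S. f p * vv p q)"
    using assms by (simp add: supp_fun_def)
qed

text \<open>\<open>vv fund_path\<close> is an eigenvector because \<open>Z\<close> commutes with the
  projection onto it. Every \<open>vv p\<close> arises from it by adding tiles, whatever
  \<open>\<theta>\<close> is, so the eigenvalue is the same on all paths even where the module is
  reducible.\<close>

lemma ZZ_scalar: assumes "f \<in> supp_fun Paths" shows "app hk.ZZ f = (\<lambda>p. zval * f p)"
proof -
  obtain x0 where x0: "x0 \<in> carrier F" "\<And>x q. q \<in> Paths \<Longrightarrow> app (rho x0) x q = (if q = fund_path then x q else 0)"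
    using path_proj_ex[OF fund_path_Paths] by metis
  have proj: "app (rho x0) x = (\<lambda>q. x fund_path * vv fund_path q)" if "x \<in> supp_fun Paths" for x
    using that x0(2) fund_path_Paths by (intro supp_fun_eqI[of _ Paths] rho_supp x0(1)) (auto simp: supp_fun_def vv_def)
  define c where "c = app hk.ZZ (vv fund_path) fund_path"
  have fundc: "app hk.ZZ (vv fund_path) = (\<lambda>q. c * vv fund_path q)"
  proof -
    have v: "vv fund_path \<in> supp_fun Paths" by (rule vv_supp[OF fund_path_Paths])
    have "vv fund_path fund_path = 1" by (simp add: vv_def)
    then have "app hk.ZZ (vv fund_path) = app hk.ZZ (app (rho x0) (vv fund_path))"
      using proj[OF v] by simp
    also have "\<dots> = app (rho x0) (app hk.ZZ (vv fund_path))"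
      using ZZ_central[OF x0(1)] by (metis app_simps(6))
    also have "\<dots> = (\<lambda>q. c * vv fund_path q)"
      using proj[OF ZZ_supp[OF v]] by (simp add: c_def)
    finally show ?thesis .
  qed
  have vvc: "app hk.ZZ (vv p) = (\<lambda>q. c * vv p q)" if p: "p \<in> Paths" for p
  proof -
    obtain m y where y: "bvec m p y" using bvec_ex[OF p] by blast
    have "app hk.ZZ (vv p) = app (rho y) (app hk.ZZ (vv fund_path))"
      unfolding rho_bvec[OF y, symmetric] using ZZ_central[of y] bvec_in[OF y] by (metis app_simps(6))
    then show ?thesis using rho_bvec[OF y] by (simp add: fundc app_cmult)
  qed
  have "c = zval" using top_ZZ vvc[OF top_Paths] by (simp add: vv_def)
  note f = supp_sum[OF finite_Paths assms]
  have "app hk.ZZ f = app hk.ZZ (\<lambda>q. \<Sum>p\<in>Paths. f p * vv p q)" using f by simp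
  also have "\<dots> = (\<lambda>q. \<Sum>p\<in>Paths. f p * (c * vv p q))"
    unfolding app_sum app_cmult using vvc by (intro ext sum.cong) auto
  also have "\<dots> = (\<lambda>q. c * (\<Sum>p\<in>Paths. f p * vv p q))"
    by (simp add: sum_distrib_left mult_ac)
  also have "\<dots> = (\<lambda>q. zval * f q)" using f \<open>c = zval\<close> by metis
  finally show ?thesis .
qed

section \<open>Spanning\<close>

subsection \<open>Congruence modulo the relations\<close>

text \<open>Congruence in the double quotient, with the carrier conditions built in so that the
  rules compose without side conditions.\<close>

definition eqv :: "nat free_alg \<Rightarrow> nat free_alg \<Rightarrow> bool"
  where "eqv x y \<longleftrightarrow> x \<in> carrier F \<and> y \<in> carrier F \<and> cc x = cc y"

lemma eqv_refl: "x \<in> carrier F \<Longrightarrow> eqv x x"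
  and eqv_sym: "eqv x y \<Longrightarrow> eqv y x"
  and eqv_trans [trans]: "eqv x y \<Longrightarrow> eqv y z \<Longrightarrow> eqv x z"
  by (auto simp: eqv_def)

lemma eqv_in: "eqv x y \<Longrightarrow> x \<in> carrier F" "eqv x y \<Longrightarrow> y \<in> carrier F"
  by (auto simp: eqv_def)

lemma eqv_add: "eqv x x' \<Longrightarrow> eqv y y' \<Longrightarrow> eqv (x + y) (x' + y')"
  and eqv_mult: "eqv x x' \<Longrightarrow> eqv y y' \<Longrightarrow> eqv (x * y) (x' * y')"
  by (auto simp: eqv_def cc_simps intro: add_in mult_in)

lemma eqv_scal: "eqv x x' \<Longrightarrow> eqv (scal c * x) (scal c * x')"
  by (rule eqv_mult[OF eqv_refl]) auto

lemma eqv_diff: assumes "eqv x x'" "eqv y y'" shows "eqv (x - y) (x' - y')"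
proof -
  have "scal (- 1) = (- 1 :: nat free_alg)" using scal_diff[of 0 1] by simp
  then show ?thesis using eqv_add[OF assms(1) eqv_scal[OF assms(2), of "- 1"]] by simp
qed

lemma eqv_sum: "(\<And>i. i \<in> I \<Longrightarrow> eqv (x i) (y i)) \<Longrightarrow> eqv (\<Sum>i\<in>I. x i) (\<Sum>i\<in>I. y i)"
  by (induction I rule: infinite_finite_induct) (auto intro: eqv_add eqv_refl)

lemma eqv_rho: "eqv x y \<Longrightarrow> rho x = rho y"
  by (auto simp: eqv_def intro: cc_eq_rho)

lemma eqv_relation: "x - y \<in> relations \<Longrightarrow> x \<in> carrier F \<Longrightarrow> y \<in> carrier F \<Longrightarrow> eqv x y"
  unfolding eqv_def using cc_relation by blast

lemma eqv_square: assumes "1 \<le> i" "i \<le> N" shows "eqv (gen i * gen i) (scal (tau i) * gen i)"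
proof -
  have "gen i * gen i - scal (tau i) * gen i \<in> relations"
  proof (cases "i = N")
    case False
    then have "1 \<le> i \<and> i \<le> N - 1" using assms by simp
    then show ?thesis using False assms unfolding relations_def tau_def by auto
  qed (simp add: tau_def relations_def)
  then show ?thesis by (rule eqv_relation) (use assms in \<open>auto intro!: mult_in\<close>)
qed

lemma eqv_square0: "eqv (gen 0 * gen 0) (scal s\<^sub>1 * gen 0)"
proof -
  have "gen 0 * gen 0 - scal s\<^sub>1 * gen 0 \<in> relations" by (auto simp: relations_def)
  then show ?thesis by (rule eqv_relation) (auto intro!: mult_in)
qed

lemma eqv_braid: assumes "1 \<le> i" "i < N" "j = Suc i \<or> j = i - 1" shows "eqv (gen i * gen j * gen i) (gen i)"
proof -
  have "1 \<le> i \<and> i \<le> N - 1 \<and> (j = i - 1 \<or> j = i + 1)" using assms by auto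
  then have "gen i * gen j * gen i - gen i \<in> relations" unfolding relations_def by blast
  then show ?thesis by (rule eqv_relation) (use assms in \<open>auto intro!: mult_in\<close>)
qed

abbreviation far :: "nat \<Rightarrow> nat \<Rightarrow> bool" where "far i j \<equiv> i + 1 < j \<or> j + 1 < i"

lemma eqv_far: assumes "i \<le> N" "j \<le> N" "far i j" shows "eqv (gen i * gen j) (gen j * gen i)"
proof -
  have "i \<le> N \<and> j \<le> N \<and> \<bar>int i - int j\<bar> > 1" using assms by auto
  then have "gen i * gen j - gen j * gen i \<in> relations" unfolding relations_def by blast
  then show ?thesis by (rule eqv_relation) (use assms in \<open>auto intro!: mult_in\<close>)
qed

subsection \<open>Words up to nonzero scalars\<close>

text \<open>Letters beyond \<open>N\<close> are sent to 0, so that every word gives an element of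
  the algebra and commutation rules for words hold without index bounds.\<close>

definition mon :: "nat list \<Rightarrow> nat free_alg"
  where "mon w = prod_list (map (\<lambda>i. if i \<le> N then gen i else 0) w)"

definition sim :: "nat free_alg \<Rightarrow> nat free_alg \<Rightarrow> bool"
  where "sim x y \<longleftrightarrow> (\<exists>c. c \<noteq> 0 \<and> eqv x (scal c * y))"

lemma sim_refl: "x \<in> carrier F \<Longrightarrow> sim x x"
  unfolding sim_def by (rule exI[of _ 1]) (simp add: eqv_refl)

lemma eqv_sim: "eqv x y \<Longrightarrow> sim x y"
  unfolding sim_def by (rule exI[of _ 1]) simp

lemma sim_trans: assumes "sim x y" "sim y z" shows "sim x z"
proof -
  obtain c d where c: "c \<noteq> 0" "eqv x (scal c * y)" and d: "d \<noteq> 0" "eqv y (scal d * z)"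
    using assms by (auto simp: sim_def)
  have "eqv x (scal (c * d) * z)"
    using eqv_trans[OF c(2) eqv_scal[OF d(2)]] by (simp add: scal_scal)
  then show ?thesis unfolding sim_def using c d by (intro exI[of _ "c * d"]) simp
qed

lemma sim_sym: assumes "sim x y" "y \<in> carrier F" shows "sim y x"
proof -
  obtain c where c: "c \<noteq> 0" "eqv x (scal c * y)" using assms by (auto simp: sim_def)
  have "eqv (scal (1 / c) * x) y"
    using eqv_scal[OF c(2), of "1 / c"] c(1) by (simp add: scal_scal)
  then show ?thesis unfolding sim_def using c eqv_sym by (intro exI[of _ "1 / c"]) simp
qed

lemma sim_mult: assumes "sim x x'" "sim y y'" shows "sim (x * y) (x' * y')"
proof -
  obtain c d where c: "c \<noteq> 0" "eqv x (scal c * x')" and d: "d \<noteq> 0" "eqv y (scal d * y')"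
    using assms by (auto simp: sim_def)
  have "scal c * x' * (scal d * y') = scal (c * d) * (x' * y')"
    by (simp add: mult.assoc scal_left_comm[of x'] scal_scal)
  then have "eqv (x * y) (scal (c * d) * (x' * y'))"
    using eqv_mult[OF c(2) d(2)] by simp
  then show ?thesis unfolding sim_def using c d by (intro exI[of _ "c * d"]) simp
qed

lemma mon_in: "mon w \<in> carrier F"
  unfolding mon_def by (rule prod_list_in) auto

lemma mon_simps [simp]: "mon [] = 1" "mon (u @ v) = mon u * mon v" "i \<le> N \<Longrightarrow> mon (i # w) = gen i * mon w"
  by (simp_all add: mon_def)

text \<open>The equivalence \<open>sim\<close> is turned into equality of classes, so that words can
  be transformed in equational chains with \<open>PC_cong\<close>.\<close>

definition PC :: "nat list \<Rightarrow> nat list set" where "PC u = {v. sim (mon u) (mon v)}"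

lemma PC_eq: "PC u = PC v \<longleftrightarrow> sim (mon u) (mon v)"
  unfolding PC_def using sim_trans sim_sym[OF _ mon_in] sim_refl[OF mon_in] by blast

lemma PC_cong: "PC u = PC v \<Longrightarrow> PC (a @ u @ b) = PC (a @ v @ b)"
  unfolding PC_eq mon_simps by (intro sim_mult sim_refl mon_in)

text \<open>\<open>\<delta> = 0\<close> would make q a root of unity of order dividing 4.\<close>

lemma tau_nz: "tau i \<noteq> 0"
proof -
  have "\<delta> \<noteq> 0"
  proof
    assume "\<delta> = 0"
    then have "qp (2 * 2) = 1"
      using qnum_eq_0_iff[OF DD, of 2] by (simp add: \<delta>_def)
    moreover have "qp (2 * 2) = qp 1 ^ 4"
      using qpow_add[of \<eta> 2 2] qpow_add[of \<eta> 1 1] by (simp add: power4_eq_xxxx mult.assoc)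
    ultimately show False using q_gen[rule_format, of 4] by simp
  qed
  then show ?thesis using s2_nz by (simp add: tau_def)
qed

lemma PC_square: assumes "i \<le> N" shows "PC [i, i] = PC [i]"
proof (cases "i = 0")
  case True
  then show ?thesis unfolding PC_eq sim_def using eqv_square0 s1_nz by (auto simp: mult.assoc)
next
  case False
  then show ?thesis unfolding PC_eq sim_def using eqv_square[of i] tau_nz[of i] assms by auto
qed

lemma PC_braid: "1 \<le> i \<Longrightarrow> i < N \<Longrightarrow> j = Suc i \<or> j = i - 1 \<Longrightarrow> PC [i, j, i] = PC [i]"
  unfolding PC_eq using eqv_sim[OF eqv_braid[of i j]] by (auto simp: mult.assoc)

lemma PC_far2: assumes "far i j" shows "PC [i, j] = PC [j, i]"
proof (cases "i \<le> N \<and> j \<le> N")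
  case True
  then show ?thesis unfolding PC_eq using eqv_sim[OF eqv_far[of i j]] assms by auto
next
  case False
  then show ?thesis unfolding PC_eq by (auto simp: mon_def intro: sim_refl)
qed

lemma PC_far1: "\<forall>j\<in>set w. far i j \<Longrightarrow> PC (i # w) = PC (w @ [i])"
proof (induction w)
  case (Cons j w)
  have "PC (i # j # w) = PC (j # i # w)" using PC_cong[OF PC_far2[of i j], of "[]" w] Cons.prems by simp
  also have "\<dots> = PC ((j # w) @ [i])" using PC_cong[OF Cons.IH, of "[j]" "[]"] Cons.prems by simp
  finally show ?case .
qed simp

lemma PC_far: "\<forall>i\<in>set v. \<forall>j\<in>set w. far i j \<Longrightarrow> PC (v @ w) = PC (w @ v)"
proof (induction v)
  case (Cons i v)
  have "PC (i # v @ w) = PC (i # w @ v)" using PC_cong[OF Cons.IH, of "[i]" "[]"] Cons.prems by simp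
  also have "\<dots> = PC (w @ i # v)" using PC_cong[OF PC_far1[of w i], of "[]" v] Cons.prems by simp
  finally show ?case by simp
qed simp

section \<open>Words of the elements \<open>E i\<close>\<close>

primrec Ew :: "nat \<Rightarrow> nat list" where
  "Ew 0 = []"
| "Ew (Suc i) = Ew i @ [i] @ Ew i"

lemma Ew_letters: "j \<in> set (Ew i) \<Longrightarrow> j < i"
  by (induction i) auto

lemma Ew_far: "i \<le> m \<Longrightarrow> PC (Suc m # Ew i) = PC (Ew i @ [Suc m])"
  by (intro PC_far1) (auto dest: Ew_letters)

lemma E_sim: "i \<le> N \<Longrightarrow> sim (E i) (mon (Ew i))"
proof (induction i)
  case 0
  then show ?case by (simp add: sim_refl)
next
  case (Suc i)
  let ?c = "s\<^sub>1 powi ((- 1) ^ Suc i)"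
  have "sim (E i * gen i * E i) (mon (Ew (Suc i)))"
  proof -
    have "sim (E i) (mon (Ew i))" "sim (gen i) (gen i)" using Suc by (auto intro: sim_refl)
    from sim_mult[OF sim_mult[OF this] this(1)] show ?thesis using Suc.prems by (simp add: mult.assoc)
  qed
  moreover have "sim (scal ?c * (E i * gen i * E i)) (E i * gen i * E i)"
    unfolding sim_def using Suc.prems s1_nz E_in[of i]
    by (intro exI[of _ ?c]) (auto intro!: eqv_refl mult_in)
  ultimately show ?case using sim_trans by (simp add: mult.assoc)
qed

text \<open>The claims support each other: the collapse of \<open>e_i E_i e_i\<close> to
  \<open>E_{i-1} e_i\<close> yields idempotency one step later, and idempotency is used for the next
  collapse.\<close>

lemma Ew_idem: "i \<le> N \<Longrightarrow> PC (Ew i @ Ew i) = PC (Ew i) \<and> PC (Ew i @ Ew (i - 1)) = PC (Ew i) \<and>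
    (1 \<le> i \<longrightarrow> i < N \<longrightarrow> PC ([i] @ Ew i @ [i]) = PC (Ew (i - 1) @ [i]))"
proof (induction i)
  case (Suc i)
  then have id: "PC (Ew i @ Ew i) = PC (Ew i)" and s: "PC (Ew i @ Ew (i - 1)) = PC (Ew i)" and i: "i < N" by auto
  have "PC (Ew (Suc i) @ Ew (Suc i - 1)) = PC (Ew (Suc i))"
    using PC_cong[OF id, of "Ew i @ [i]" "[]"] by simp
  moreover have id': "PC (Ew (Suc i) @ Ew (Suc i)) = PC (Ew (Suc i))"
  proof (cases "i = 0")
    case True
    then show ?thesis using PC_square[of 0] by simp
  next
    case False
    then have A: "PC ([i] @ Ew i @ [i]) = PC (Ew (i - 1) @ [i])" using Suc i by auto
    have "PC (Ew (Suc i) @ Ew (Suc i)) = PC (Ew i @ [i] @ Ew i @ [i] @ Ew i)"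
      using PC_cong[OF id, of "Ew i @ [i]" "[i] @ Ew i"] by simp
    also have "\<dots> = PC (Ew i @ Ew (i - 1) @ [i] @ Ew i)"
      using PC_cong[OF A, of "Ew i" "Ew i"] by simp
    also have "\<dots> = PC (Ew (Suc i))"
      using PC_cong[OF s, of "[]" "[i] @ Ew i"] by simp
    finally show ?thesis .
  qed
  moreover have "PC ([Suc i] @ Ew (Suc i) @ [Suc i]) = PC (Ew i @ [Suc i])" if "Suc i < N"
  proof -
    have f: "PC (Suc i # Ew i) = PC (Ew i @ [Suc i])" by (rule Ew_far) simp
    have "PC ([Suc i] @ Ew (Suc i) @ [Suc i]) = PC (Ew i @ [Suc i, i] @ Ew i @ [Suc i])"
      using PC_cong[OF f, of "[]" "[i] @ Ew i @ [Suc i]"] by simp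
    also have "\<dots> = PC (Ew i @ [Suc i, i, Suc i] @ Ew i)"
      using PC_cong[OF f[symmetric], of "Ew i @ [Suc i, i]" "[]"] by simp
    also have "\<dots> = PC (Ew i @ [Suc i] @ Ew i)"
      using PC_cong[OF PC_braid[of "Suc i" i], of "Ew i" "Ew i"] that by simp
    also have "\<dots> = PC (Ew i @ Ew i @ [Suc i])"
      using PC_cong[OF f, of "Ew i" "[]"] by simp
    also have "\<dots> = PC (Ew i @ [Suc i])"
      using PC_cong[OF id, of "[]" "[Suc i]"] by simp
    finally show ?thesis .
  qed
  ultimately show ?case by simp
qed simp

lemma Ew_absorb: "i \<le> j \<Longrightarrow> j \<le> N \<Longrightarrow> PC (Ew i @ Ew j) = PC (Ew j)"
proof (induction j rule: dec_induct)
  case base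
  then show ?case using Ew_idem by simp
next
  case (step j)
  then show ?case using PC_cong[of "Ew i @ Ew j" "Ew j" "[]" "[j] @ Ew j"] by simp
qed

lemma Ew_A: "1 \<le> i \<Longrightarrow> i < N \<Longrightarrow> PC ([i] @ Ew i @ [i]) = PC (Ew (i - 1) @ [i])"
  using Ew_idem[of i] by simp

lemma Ew_D: assumes "1 \<le> i" "i < N" shows "PC ([i] @ Ew (Suc i)) = PC ([i] @ Ew i)"
proof -
  have "PC ([i] @ Ew (Suc i)) = PC (Ew (i - 1) @ [i] @ Ew i)"
    using PC_cong[OF Ew_A[OF assms], of "[]" "Ew i"] by simp
  also have "\<dots> = PC ([i] @ Ew (i - 1) @ Ew i)"
    using PC_cong[OF Ew_far[of "i - 1" "i - 1"], of "[]" "Ew i"] assms by simp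
  also have "\<dots> = PC ([i] @ Ew i)"
    using PC_cong[OF Ew_absorb[of "i - 1" i], of "[i]" "[]"] assms by simp
  finally show ?thesis .
qed

text \<open>The word form of a fact about paths: a tile at \<open>i + 1\<close> on the fundamental
  path creates a slope at \<open>i\<close>, or an initial up step if \<open>i = 0\<close>, and
  \<open>e_i\<close> annihilates such a path.\<close>

lemma Ew_up: assumes "Suc i < N" shows "PC ([i, Suc i] @ Ew N) = PC ([i] @ Ew N)"
proof -
  have "PC ([i, Suc i] @ Ew (Suc (Suc i))) = PC ([i] @ Ew (Suc (Suc i)))"
  proof (cases "i = 0")
    case True
    have "PC ([0, 1] @ Ew 2) = PC [0, 1, 0]"
      using PC_cong[OF PC_braid[of 1 0], of "[0]" "[0]"] assms by (simp add: numeral_2_eq_2)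
    also have "\<dots> = PC ([0] @ Ew 2)"
      using PC_cong[OF PC_square[of 0], of "[]" "[1, 0]"] by (simp add: numeral_2_eq_2)
    finally show ?thesis using True by (simp add: numeral_2_eq_2)
  next
    case False
    have "PC ([i, Suc i] @ Ew (Suc (Suc i))) = PC ([i] @ Ew i @ [Suc i] @ Ew (Suc i))"
      using PC_cong[OF Ew_A[of "Suc i"], of "[i]" "Ew (Suc i)"] assms by (simp del: Ew.simps add: Ew.simps(2)[of "Suc i"])
    also have "\<dots> = PC ([i] @ Ew (Suc i) @ [Suc i] @ Ew (Suc i))"
      using PC_cong[OF Ew_D[of i], of "[]" "[Suc i] @ Ew (Suc i)"] assms False by (simp del: Ew.simps)
    finally show ?thesis by (simp del: Ew.simps add: Ew.simps(2)[of "Suc i"])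
  qed
  then have "PC ([i, Suc i] @ Ew (Suc (Suc i)) @ Ew N) = PC ([i] @ Ew (Suc (Suc i)) @ Ew N)"
    using PC_cong[of "[i, Suc i] @ Ew (Suc (Suc i))" "[i] @ Ew (Suc (Suc i))" "[]" "Ew N"] by (simp del: Ew.simps)
  moreover have "PC (Ew (Suc (Suc i)) @ Ew N) = PC (Ew N)" using Ew_absorb assms by (simp del: Ew.simps)
  ultimately show ?thesis
    using PC_cong[of "Ew (Suc (Suc i)) @ Ew N" "Ew N" "[i, Suc i]" "[]"]
      PC_cong[of "Ew (Suc (Suc i)) @ Ew N" "Ew N" "[i]" "[]"] by (simp del: Ew.simps)
qed

lemma Ew_down: assumes "2 \<le> i" "i < N" shows "PC ([i, i - 1] @ Ew N) = PC ([i] @ Ew N)"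
proof -
  obtain m where m: "i = Suc m" "1 \<le> m" using assms by (cases i) auto
  have "PC ([i, m] @ Ew (Suc i)) = PC ([i] @ Ew (Suc i))"
  proof -
    have "PC ([i, m] @ Ew (Suc i)) = PC ([i, m] @ Ew m @ [i] @ Ew i)"
      using PC_cong[OF Ew_D[of m], of "[i]" "[i] @ Ew i"] assms m by (simp del: Ew.simps add: Ew.simps(2)[of "Suc m"])
    also have "\<dots> = PC ([i, m, i] @ Ew m @ Ew i)"
      using PC_cong[OF Ew_far[of m m, symmetric], of "[i, m]" "Ew i"] m by (simp del: Ew.simps)
    also have "\<dots> = PC ([i] @ Ew m @ Ew i)"
      using PC_cong[OF PC_braid[of i m], of "[]" "Ew m @ Ew i"] assms m by (simp del: Ew.simps)
    also have "\<dots> = PC ([i] @ Ew i)"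
      using PC_cong[OF Ew_absorb[of m i], of "[i]" "[]"] assms m by (simp del: Ew.simps)
    also have "\<dots> = PC ([i] @ Ew (Suc i))"
      using Ew_D[of i] assms by simp
    finally show ?thesis .
  qed
  then have "PC ([i, m] @ Ew (Suc i) @ Ew N) = PC ([i] @ Ew (Suc i) @ Ew N)"
    using PC_cong[of "[i, m] @ Ew (Suc i)" "[i] @ Ew (Suc i)" "[]" "Ew N"] by (simp del: Ew.simps)
  moreover have "PC (Ew (Suc i) @ Ew N) = PC (Ew N)" using Ew_absorb[of "Suc i" N] assms by (simp del: Ew.simps)
  ultimately show ?thesis
    using PC_cong[of "Ew (Suc i) @ Ew N" "Ew N" "[i, m]" "[]"]
      PC_cong[of "Ew (Suc i) @ Ew N" "Ew N" "[i]" "[]"] m by (simp del: Ew.simps)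
qed

text \<open>The word \<open>TT j\<close> is \<open>e\<^sub>j\<^sub>-\<^sub>1 e\<^sub>j\<^sub>-\<^sub>3 \<cdots>\<close>; the last two, \<open>TT N\<close> and \<open>TT (N + 1)\<close>, are
  \<open>I\<^sub>1\<close> and \<open>I\<^sub>2\<close> in some order.\<close>

fun TT :: "nat \<Rightarrow> nat list" where
  "TT 0 = []"
| "TT (Suc 0) = [0]"
| "TT (Suc (Suc j)) = Suc j # TT j"

lemma TT_letters: "j \<in> set (TT i) \<Longrightarrow> j < i"
  by (induction i rule: TT.induct) auto

lemma TT_far: "i \<le> m \<Longrightarrow> PC (Suc m # TT i) = PC (TT i @ [Suc m])"
  by (intro PC_far1) (auto dest: TT_letters)

lemma TT_idem: "j \<le> Suc N \<Longrightarrow> PC (TT j @ TT j) = PC (TT j)"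
proof (induction j rule: TT.induct)
  case 2
  then show ?case using PC_square[of 0] by simp
next
  case (3 j)
  have "PC (TT (Suc (Suc j)) @ TT (Suc (Suc j))) = PC ([Suc j, Suc j] @ TT j @ TT j)"
    using PC_cong[OF TT_far[of j j, symmetric], of "[Suc j]" "TT j"] by simp
  also have "\<dots> = PC ([Suc j] @ TT j @ TT j)"
    using PC_cong[OF PC_square[of "Suc j"], of "[]" "TT j @ TT j"] 3 by simp
  also have "\<dots> = PC (TT (Suc (Suc j)))"
    using PC_cong[OF 3(1), of "[Suc j]" "[]"] 3(2) by simp
  finally show ?case .
qed simp

lemma TT_braid: "j < N \<Longrightarrow> PC (TT (Suc j) @ TT j @ TT (Suc j)) = PC (TT (Suc j))"
proof (induction j rule: TT.induct)
  case 1
  then show ?case using PC_square[of 0] by simp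
next
  case 2
  then show ?case using PC_braid[of 1 0] by simp
next
  case (3 j)
  let ?e = "Suc (Suc j)"
  have f: "PC (?e # TT (Suc j)) = PC (TT (Suc j) @ [?e])" "PC (?e # TT j) = PC (TT j @ [?e])"
    by (rule TT_far; simp)+
  have "PC (TT (Suc ?e) @ TT ?e @ TT (Suc ?e)) = PC (TT (Suc j) @ [?e, Suc j] @ TT j @ [?e] @ TT (Suc j))"
    using PC_cong[OF f(1), of "[]" "[Suc j] @ TT j @ [?e] @ TT (Suc j)"] by simp
  also have "\<dots> = PC (TT (Suc j) @ [?e, Suc j, ?e] @ TT j @ TT (Suc j))"
    using PC_cong[OF f(2)[symmetric], of "TT (Suc j) @ [?e, Suc j]" "TT (Suc j)"] by simp
  also have "\<dots> = PC (TT (Suc j) @ [?e] @ TT j @ TT (Suc j))"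
    using PC_cong[OF PC_braid[of ?e "Suc j"], of "TT (Suc j)" "TT j @ TT (Suc j)"] 3(2) by simp
  also have "\<dots> = PC ([?e] @ TT (Suc j) @ TT j @ TT (Suc j))"
    using PC_cong[OF f(1)[symmetric], of "[]" "TT j @ TT (Suc j)"] by simp
  also have "\<dots> = PC (TT (Suc ?e))"
    using PC_cong[OF 3(1), of "[?e]" "[]"] 3(2) by simp
  finally show ?case .
qed

text \<open>\<open>PP\<close> and its mirror image \<open>PQ\<close> express \<open>E i\<close> as a
  palindrome \<open>T_1 ... T_i T_i ... T_1\<close> of alternating products, where the loop
  relations can be applied.\<close>

primrec PP :: "nat \<Rightarrow> nat list" where
  "PP 0 = []" | "PP (Suc i) = PP i @ TT (Suc i)"
primrec PQ :: "nat \<Rightarrow> nat list" where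
  "PQ 0 = []" | "PQ (Suc i) = TT (Suc i) @ PQ i"

lemma PP_letters: "j \<in> set (PP i) \<Longrightarrow> j < i" and PQ_letters: "j \<in> set (PQ i) \<Longrightarrow> j < i"
  by (induction i) (auto dest: TT_letters simp: less_Suc_eq)

lemma PQ_PP: "i \<le> N \<Longrightarrow> PC (PQ i @ PP i) = PC (TT i)"
proof (induction i)
  case (Suc i)
  have "PC (PQ (Suc i) @ PP (Suc i)) = PC (TT (Suc i) @ TT i @ TT (Suc i))"
    using PC_cong[OF Suc.IH, of "TT (Suc i)" "TT (Suc i)"] Suc.prems by simp
  then show ?case using TT_braid[of i] Suc.prems by simp
qed simp

lemma PP_TT: assumes "i \<le> N" shows "PC (PP i @ TT i) = PC (PP i)"
proof (cases i)
  case (Suc m)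
  then show ?thesis using PC_cong[OF TT_idem[of i], of "PP m" "[]"] assms by simp
qed simp

text \<open>In \<open>E_i e_i E_i\<close> the inner halves of the two palindromes meet and collapse
  by \<open>PQ_PP\<close>, and together with \<open>e_i\<close> they form the next alternating
  product.\<close>

lemma Ew_PP: "i \<le> N \<Longrightarrow> PC (Ew i) = PC (PP i @ PQ i)"
proof (induction i)
  case (Suc i)
  then have IH: "PC (Ew i) = PC (PP i @ PQ i)" and i: "i < N" by auto
  show ?case
  proof (cases i)
    case 0
    then show ?thesis using PC_square[of 0] by simp
  next
    case (Suc m)
    have TTs: "TT (Suc i) = i # TT m" using Suc by simp
    have "PC (Ew (Suc i)) = PC (PP i @ PQ i @ [i] @ Ew i)"
      using PC_cong[OF IH, of "[]" "[i] @ Ew i"] by simp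
    also have "\<dots> = PC (PP i @ PQ i @ [i] @ PP i @ PQ i)"
      using PC_cong[OF IH, of "PP i @ PQ i @ [i]" "[]"] by simp
    \<comment> \<open>The letter \<open>i\<close> commutes with \<open>PQ m\<close>, whose letters
      are smaller than \<open>i - 1\<close>; moving it to the left exposes the collapsing
      factor.\<close>
    also have "\<dots> = PC (PP i @ TT i @ [i] @ (PQ m @ PP m) @ TT i @ PQ i)"
    proof -
      have "PC (PQ m @ [i]) = PC (i # PQ m)"
        by (rule PC_far1[symmetric]) (auto dest: PQ_letters simp: Suc)
      from PC_cong[OF this, of "PP i @ TT i" "PP i @ PQ i"] show ?thesis by (simp add: Suc)
    qed
    also have "\<dots> = PC (PP i @ TT i @ TT (Suc i) @ TT i @ PQ i)"
      using PC_cong[OF PQ_PP[of m], of "PP i @ TT i @ [i]" "TT i @ PQ i"] i Suc TTs by simp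
    also have "\<dots> = PC (PP i @ TT (Suc i) @ TT i @ PQ i)"
      using PC_cong[OF PP_TT[of i], of "[]" "TT (Suc i) @ TT i @ PQ i"] i by simp
    also have "\<dots> = PC (PP i @ TT (Suc i) @ PQ i)"
      using PC_cong[OF TT_idem[of i], of "PP i @ TT (Suc i)" "PQ m"] i Suc by simp
    also have "\<dots> = PC (PP i @ TT (Suc i) @ TT (Suc i) @ PQ i)"
      using PC_cong[OF TT_idem[of "Suc i", symmetric], of "PP i" "PQ i"] i by simp
    finally show ?thesis by simp
  qed
qed simp

lemma TT_filter: "PC (TT j) = PC (filter (\<lambda>i. even i \<noteq> even j) [0..<j])"
proof (induction j rule: TT.induct)
  case (3 j)
  have "PC (TT (Suc (Suc j))) = PC (TT j @ [Suc j])" using TT_far[of j j] by simp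
  also have "\<dots> = PC (filter (\<lambda>i. even i \<noteq> even j) [0..<j] @ [Suc j])"
    using PC_cong[OF 3, of "[]" "[Suc j]"] by simp
  finally show ?case by simp
qed simp_all

text \<open>The parity of \<open>N\<close> decides which of the two words is
  \<open>I\<^sub>1\<close>. The scalar contains \<open>b\<close>, which may be 0, so the result
  cannot be phrased as equality of classes \<open>PC\<close>.\<close>

lemma loop_words: "\<exists>c. eqv (mon (TT N @ TT (Suc N) @ TT N)) (scal c * mon (TT N))"
proof -
  have mon_filter: "mon (filter Q [0..<Suc N]) = prod_list (map gen (filter Q [0..<Suc N]))" for Q
    unfolding mon_def by (intro arg_cong[of _ _ prod_list] map_cong) (auto simp del: upt_Suc)
  have "filter (\<lambda>i. even i \<noteq> even N) [0..<N] = filter (\<lambda>i. even i \<noteq> even N) [0..<Suc N]" by simp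
  then have f: "PC (TT N) = PC (filter (\<lambda>i. even i \<noteq> even N) [0..<Suc N])"
    "PC (TT (Suc N)) = PC (filter (\<lambda>i. even i = even N) [0..<Suc N])"
    using TT_filter[of N] TT_filter[of "Suc N"] by (simp_all del: upt_Suc)
  have loop: "\<exists>c. eqv (mon (TT N @ TT (Suc N) @ TT N)) (scal c * mon (TT N))"
    if a: "sim (mon (TT N)) A" "sim (mon (TT (Suc N))) B" and AB: "eqv (A * B * A) (scal b0 * A)" and A: "A \<in> carrier F" for A B
  proof -
    have "sim (mon (TT N @ TT (Suc N) @ TT N)) (A * B * A)"
      using sim_mult[OF sim_mult[OF a] a(1)] by (simp add: mult.assoc)
    then obtain c where c: "eqv (mon (TT N @ TT (Suc N) @ TT N)) (scal c * (A * B * A))" by (auto simp: sim_def)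
    obtain d where d: "eqv A (scal d * mon (TT N))" using sim_sym[OF a(1) A] by (auto simp: sim_def)
    have "eqv (mon (TT N @ TT (Suc N) @ TT N)) (scal c * (scal b0 * (scal d * mon (TT N))))"
      using eqv_trans[OF c eqv_scal[OF eqv_trans[OF AB eqv_scal[OF d]]]] .
    then show ?thesis by (auto simp: scal_scal)
  qed
  show ?thesis
  proof (cases "even N")
    case True
    have "mon (filter (\<lambda>i. even i \<noteq> even N) [0..<Suc N]) = mon (filter odd [0..<Suc N])"
      "mon (filter (\<lambda>i. even i = even N) [0..<Suc N]) = mon (filter even [0..<Suc N])"
      using True by (auto intro!: arg_cong[of _ _ mon] filter_cong simp del: upt_Suc)
    then have "mon (filter (\<lambda>i. even i \<noteq> even N) [0..<Suc N]) = I\<^sub>1" "mon (filter (\<lambda>i. even i = even N) [0..<Suc N]) = I\<^sub>2"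
      unfolding mon_filter[of odd] mon_filter[of even] I\<^sub>1_def I\<^sub>2_def by blast+
    moreover have "eqv (I\<^sub>1 * I\<^sub>2 * I\<^sub>1) (scal b0 * I\<^sub>1)"
      unfolding eqv_def using cc_loop1 I_in by (auto intro!: mult_in)
    ultimately show ?thesis using loop f I_in unfolding PC_eq by metis
  next
    case False
    have "mon (filter (\<lambda>i. even i \<noteq> even N) [0..<Suc N]) = mon (filter even [0..<Suc N])"
      "mon (filter (\<lambda>i. even i = even N) [0..<Suc N]) = mon (filter odd [0..<Suc N])"
      using False by (auto intro!: arg_cong[of _ _ mon] filter_cong simp del: upt_Suc)
    then have "mon (filter (\<lambda>i. even i \<noteq> even N) [0..<Suc N]) = I\<^sub>2" "mon (filter (\<lambda>i. even i = even N) [0..<Suc N]) = I\<^sub>1"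
      unfolding mon_filter[of odd] mon_filter[of even] I\<^sub>1_def I\<^sub>2_def by blast+
    moreover have "eqv (I\<^sub>2 * I\<^sub>1 * I\<^sub>2) (scal b0 * I\<^sub>2)"
      unfolding eqv_def using cc_loop2 I_in by (auto intro!: mult_in)
    ultimately show ?thesis using loop f I_in unfolding PC_eq by metis
  qed
qed

text \<open>The case of \<open>Ew_up\<close> at the right boundary, and the only point of the
  spanning argument at which the loop relations are used. Moving \<open>e_{N-1}\<close> and
  \<open>e_N\<close> into the palindrome completes it to
  \<open>TT N @ TT (Suc N) @ TT N\<close>.\<close>

lemma Ew_top: "\<exists>c. eqv (mon ([N - 1, N] @ Ew N)) (scal c * mon ([N - 1] @ Ew N))"
proof -
  obtain m where m: "N = Suc (Suc m)" using N2 by (metis add_2_eq_Suc le_Suc_ex)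
  have e: "Ew N = Ew N" ..
  have PPN: "PP N = PP m @ TT (Suc m) @ TT N" using m by simp
  have TTN: "TT N = Suc m # TT m" "TT (Suc N) = N # TT (Suc m)" using m by simp_all
  have cN: "PC ([N] @ PP m) = PC (PP m @ [N])" "PC ([Suc m] @ PP m) = PC (PP m @ [Suc m])"
    by (rule PC_far; auto dest: PP_letters simp: m)+
  \<comment> \<open>\<open>PP m\<close> absorbs \<open>TT m\<close> on its right, so a lone
    \<open>e_{N-1}\<close> behind it can be completed to the alternating product
    \<open>TT N\<close>.\<close>
  have pm: "PC (PP m @ [Suc m]) = PC (PP m @ TT N)"
  proof -
    have "PC (PP m @ [Suc m]) = PC (PP m @ TT m @ [Suc m])"
      using PC_cong[OF PP_TT[of m, symmetric], of "[]" "[Suc m]"] m by simp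
    also have "\<dots> = PC (PP m @ TT N)"
      using PC_cong[OF TT_far[of m m, symmetric], of "PP m" "[]"] TTN by simp
    finally show ?thesis .
  qed
  have "PC ([Suc m, N] @ Ew N) = PC ([Suc m, N] @ PP N @ PQ N)"
    using PC_cong[OF Ew_PP[of N], of "[Suc m, N]" "[]"] by simp
  also have "\<dots> = PC ([Suc m] @ PP m @ [N] @ TT (Suc m) @ TT N @ PQ N)"
    using PC_cong[OF cN(1), of "[Suc m]" "TT (Suc m) @ TT N @ PQ N"] PPN by simp
  also have "\<dots> = PC (PP m @ [Suc m] @ TT (Suc N) @ TT N @ PQ N)"
    using PC_cong[OF cN(2), of "[]" "[N] @ TT (Suc m) @ TT N @ PQ N"] TTN(2) by simp
  also have "\<dots> = PC (PP m @ (TT N @ TT (Suc N) @ TT N) @ PQ N)"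
    using PC_cong[OF pm, of "[]" "TT (Suc N) @ TT N @ PQ N"] by simp
  finally have L: "sim (mon ([Suc m, N] @ Ew N)) (mon (PP m @ (TT N @ TT (Suc N) @ TT N) @ PQ N))"
    unfolding PC_eq .
  have "PC ([Suc m] @ Ew N) = PC ([Suc m] @ PP N @ PQ N)"
    using PC_cong[OF Ew_PP[of N], of "[Suc m]" "[]"] by simp
  also have "\<dots> = PC (PP m @ [Suc m] @ TT (Suc m) @ TT N @ PQ N)"
    using PC_cong[OF cN(2), of "[]" "TT (Suc m) @ TT N @ PQ N"] PPN by simp
  also have "\<dots> = PC (PP m @ TT N @ TT (Suc m) @ TT N @ PQ N)"
    using PC_cong[OF pm, of "[]" "TT (Suc m) @ TT N @ PQ N"] by simp
  also have "\<dots> = PC (PP m @ TT N @ PQ N)"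
    using PC_cong[OF TT_braid[of "Suc m"], of "PP m" "PQ N"] m by simp
  finally have R: "sim (mon (PP m @ TT N @ PQ N)) (mon ([Suc m] @ Ew N))"
    unfolding PC_eq[symmetric] by simp
  obtain c where c: "eqv (mon (TT N @ TT (Suc N) @ TT N)) (scal c * mon (TT N))" using loop_words by blast
  have "eqv (mon (PP m) * (mon (TT N @ TT (Suc N) @ TT N) * mon (PQ N))) (mon (PP m) * (scal c * mon (TT N) * mon (PQ N)))"
    by (intro eqv_mult c eqv_refl mon_in)
  then have M: "eqv (mon (PP m @ (TT N @ TT (Suc N) @ TT N) @ PQ N)) (scal c * mon (PP m @ TT N @ PQ N))"
    by (simp only: mon_simps mult.assoc scal_left_comm)
  obtain a where a: "eqv (mon ([Suc m, N] @ Ew N)) (scal a * mon (PP m @ (TT N @ TT (Suc N) @ TT N) @ PQ N))"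
    using L by (auto simp: sim_def)
  obtain d where d: "eqv (mon (PP m @ TT N @ PQ N)) (scal d * mon ([Suc m] @ Ew N))"
    using R by (auto simp: sim_def)
  have "eqv (mon ([Suc m, N] @ Ew N)) (scal a * (scal c * (scal d * mon ([Suc m] @ Ew N))))"
    using eqv_trans[OF a eqv_scal[OF eqv_trans[OF M eqv_scal[OF d]]]] .
  then show ?thesis using m by (auto simp only: scal_scal diff_Suc_1)
qed

subsection \<open>Tiles in the double quotient\<close>

lemma lev_nh: "lev (nh h) \<noteq> 0"
  by (simp add: lev_def nh_def)

lemma lev_oh: "h \<noteq> nh (oh h) \<Longrightarrow> lev h = 0 \<and> lev (oh h) = 0"
  by (auto simp: lev_def nh_def oh_def split: if_splits)

lemma nh_nh: "nh (nh h) \<noteq> h"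
  by (simp add: nh_def)

lemma dd_nh: "dd i h (nh h) = cf i (- uu h)" and dd_oh: "dd i h (oh h) = cf i (uu h)"
  using oh_nh(3)[of h] by (auto simp: dd_def aa_def bb_def)

lemma X_eq: "1 \<le> i \<Longrightarrow> i \<le> N \<Longrightarrow> X \<theta> i u = gen i - scal (cf i u)"
  by (auto simp: X_def cf_def)

lemma E_relation:
  assumes "\<exists>c. eqv (mon (u @ Ew N)) (scal c * mon (v @ Ew N))"
  shows "\<exists>c. eqv (mon u * E N) (scal c * (mon v * E N))"
proof -
  have s: "sim (E N) (mon (Ew N))" by (rule E_sim) simp
  obtain a where a: "eqv (E N) (scal a * mon (Ew N))" using s by (auto simp: sim_def)
  obtain d where d: "eqv (mon (Ew N)) (scal d * E N)" using sim_sym[OF s mon_in] by (auto simp: sim_def)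
  obtain c where c: "eqv (mon (u @ Ew N)) (scal c * mon (v @ Ew N))" using assms by blast
  have "eqv (mon u * E N) (scal a * mon (u @ Ew N))"
    using eqv_mult[OF eqv_refl[OF mon_in, of u] a] by (simp add: scal_left_comm[of "mon u"])
  also have "eqv (scal a * mon (u @ Ew N)) (scal a * (scal c * mon (v @ Ew N)))"
    by (rule eqv_scal[OF c])
  also have "eqv (scal a * (scal c * mon (v @ Ew N))) (scal a * (scal c * (scal d * (mon v * E N))))"
    using eqv_mult[OF eqv_refl[OF mon_in, of v] d] by (intro eqv_scal) (simp add: scal_left_comm[of "mon v"])
  finally show ?thesis by (auto simp: scal_scal)
qed

lemma pef_slope:
  assumes "1 \<le> i" "i \<le> N" "\<not> turn p i" shows "pef i (vv p) = (\<lambda>_. 0)"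
proof
  fix s
  have "s[i := z] \<noteq> p" if "turn s i" for z
    using assms(3) turn_upd_same[OF assms(1), of s z] that by auto
  then show "pef i (vv p) s = 0" using assms by (auto simp: pef_def S1_def vv_def)
qed

lemma pef_0_vv: "p \<in> Paths \<Longrightarrow> pef 0 (vv p) = (\<lambda>q. if p ! 1 = - 1 then s\<^sub>1 * vv p q else 0)"
  by (auto simp: pef_def vv_def)

text \<open>The word calculus yields the relation with an unknown scalar \<open>c\<close>. Applying
  both sides to \<open>vv fund_path\<close> identifies \<open>c\<close> with the coefficient in
  \<open>X\<close>, because \<open>e_i\<close> kills the path with the added tile.\<close>

lemma base_rel:
  assumes ex: "\<exists>c. eqv (gen i * (gen j * E N)) (scal c * (gen i * E N))" and ij: "i \<le> N" "1 \<le> j" "j \<le> N"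
    and slope: "pef i (vv (fund_path[j := nh (fund_path ! (j - 1))])) = (\<lambda>_. 0)"
  shows "eqv (gen i * (X \<theta> j (uu (fund_path ! (j - 1))) * E N)) 0"
proof -
  let ?c = "cf j (uu (fund_path ! (j - 1)))"
  have fo: "fund_path ! l = oh (fund_path ! (l - 1))" "turn fund_path l" if "1 \<le> l" "l \<le> N" for l
    using that fund_turn by (auto simp: oh_def)
  obtain c where c: "eqv (gen i * (gen j * E N)) (scal c * (gen i * E N))" using ex by blast
  have E: "app (rho (E N)) (vv fund_path) = vv fund_path" by (rule rho_bvec[OF bvec.base])
  have "app (rho (gen i * (gen j * E N))) (vv fund_path) = app (rho (scal c * (gen i * E N))) (vv fund_path)"
    using eqv_rho[OF c] by simp
  then have "pef i (pef j (vv fund_path)) = (\<lambda>q. c * pef i (vv fund_path) q)"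
    by (simp add: ev_mult E)
  moreover have "pef i (pef j (vv fund_path)) = (\<lambda>q. ?c * pef i (vv fund_path) q)"
    using pef_vv[OF fund_path_Paths ij(2,3) fo(2)[OF ij(2,3)] fo(1)[OF ij(2,3)]] slope
      app_add[of "pe i" "\<lambda>s. ?c * vv fund_path s" "vv (fund_path[j := nh (fund_path ! (j - 1))])"]
      app_cmult[of "pe i" ?c "vv fund_path"] by simp
  \<comment> \<open>Both scalars multiply this function, so they can be compared as soon as it is
    nonzero.\<close>
  moreover have "\<exists>q. pef i (vv fund_path) q \<noteq> 0"
  proof (cases "i = 0")
    case True
    then show ?thesis using pef_0_vv[OF fund_path_Paths] s1_nz N2 by (intro exI[of _ fund_path]) (simp add: vv_def)
  next
    case False
    then have i: "1 \<le> i" by simp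
    let ?p = "fund_path[i := nh (fund_path ! (i - 1))]"
    have "?p ! i \<noteq> fund_path ! i" using fo(1)[OF i ij(1)] oh_nh(3) ij(1) by (simp add: nth_list_update) metis
    then have "?p \<noteq> fund_path" by metis
    then show ?thesis
      using pef_vv[OF fund_path_Paths i ij(1) fo(2)[OF i ij(1)] fo(1)[OF i ij(1)]]
      by (intro exI[of _ ?p]) (simp add: vv_def)
  qed
  ultimately have "c = ?c" by (auto simp: fun_eq_iff)
  have "eqv (gen i * (gen j * E N) - scal c * (gen i * E N)) (scal c * (gen i * E N) - scal c * (gen i * E N))"
    using eqv_diff[OF c eqv_refl] eqv_in(2)[OF c] by blast
  moreover have "gen i * (X \<theta> j (uu (fund_path ! (j - 1))) * E N) = gen i * (gen j * E N) - scal c * (gen i * E N)"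
    using ij \<open>c = ?c\<close> by (simp add: X_eq left_diff_distrib right_diff_distrib scal_left_comm[of "gen i"])
  ultimately show ?thesis by simp
qed

lemma sim_ex: "PC u = PC v \<Longrightarrow> \<exists>c. eqv (mon u) (scal c * mon v)"
  unfolding PC_eq sim_def by blast

lemma base_up: assumes "i < N" shows "eqv (gen i * (X \<theta> (Suc i) (uu (fund_path ! i)) * E N)) 0"
proof -
  have "\<exists>c. eqv (mon ([i, Suc i] @ Ew N)) (scal c * mon ([i] @ Ew N))"
  proof (cases "Suc i < N")
    case True
    then show ?thesis using sim_ex[OF Ew_up] by blast
  next
    case False
    then have "N - 1 = i" "N = Suc i" using assms by auto
    then show ?thesis using Ew_top by simp
  qed
  then have "\<exists>c. eqv (gen i * (gen (Suc i) * E N)) (scal c * (gen i * E N))"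
    using E_relation[of "[i, Suc i]" "[i]"] assms by (simp add: mult.assoc)
  moreover have "pef i (vv (fund_path[Suc i := nh (fund_path ! i)])) = (\<lambda>_. 0)"
  proof (cases "i = 0")
    case True
    have "fund_path[Suc i := nh (fund_path ! i)] \<in> Paths"
      using flip_path[OF fund_path_Paths, of "Suc i"] fund_turn[of "Suc i"] assms oh_nh(2) by simp
    from pef_0_vv[OF this] show ?thesis using True N2 by (simp add: nth_list_update nh_def)
  next
    case False
    then have "\<not> turn (fund_path[Suc i := nh (fund_path ! i)]) i"
      using assms by (auto simp: turn_def nth_list_update nh_def)
    then show ?thesis using pef_slope[of i] False assms by simp
  qed
  ultimately show ?thesis using base_rel[of i "Suc i"] assms by simp
qed

lemma base_down: assumes "2 \<le> i" "i < N" shows "eqv (gen i * (X \<theta> (i - 1) (uu (fund_path ! (i - 1 - 1))) * E N)) 0"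
proof -
  have "\<exists>c. eqv (mon ([i, i - 1] @ Ew N)) (scal c * mon ([i] @ Ew N))"
    using sim_ex[OF Ew_down] assms by blast
  then have "\<exists>c. eqv (gen i * (gen (i - 1) * E N)) (scal c * (gen i * E N))"
    using E_relation[of "[i, i - 1]" "[i]"] assms by (simp add: mult.assoc)
  moreover have "\<not> turn (fund_path[i - 1 := nh (fund_path ! (i - 1 - 1))]) i"
    using assms by (auto simp: turn_def nth_list_update nh_def)
  ultimately show ?thesis using base_rel[of i "i - 1"] pef_slope[of i] assms by simp
qed

lemma gen_X_far:
  assumes "far i j" "i \<le> N" "1 \<le> j" "j \<le> N" "z \<in> carrier F"
  shows "eqv (gen i * (X \<theta> j u * z)) (X \<theta> j u * (gen i * z))"
proof -
  have "eqv (gen i * gen j * z - scal (cf j u) * (gen i * z)) (gen j * gen i * z - scal (cf j u) * (gen i * z))"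
    using assms by (intro eqv_diff eqv_mult[OF eqv_far] eqv_refl mult_in) auto
  then show ?thesis
    using assms by (simp add: X_eq left_diff_distrib right_diff_distrib scal_left_comm[of "gen i"] mult.assoc)
qed

lemma X_X_far:
  assumes "far i j" "1 \<le> i" "i \<le> N" "1 \<le> j" "j \<le> N" "z \<in> carrier F"
  shows "eqv (X \<theta> i v * (X \<theta> j u * z)) (X \<theta> j u * (X \<theta> i v * z))"
proof -
  have Xin: "X \<theta> j u \<in> carrier F" using X_in assms by simp
  have "eqv (gen i * (X \<theta> j u * z) - scal (cf i v) * (X \<theta> j u * z)) (X \<theta> j u * (gen i * z) - scal (cf i v) * (X \<theta> j u * z))"
    using assms Xin by (intro eqv_diff gen_X_far eqv_refl mult_in) auto
  then show ?thesis
    using assms by (simp add: X_eq[of i] left_diff_distrib right_diff_distrib scal_left_comm[of "X \<theta> j u"])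
qed

lemma eqv_zero_left: "x \<in> carrier F \<Longrightarrow> eqv y 0 \<Longrightarrow> eqv (x * y) 0"
  using eqv_mult[OF eqv_refl] by fastforce

text \<open>A tile leaves a height of positive \<open>lev\<close>. If all heights in the window
  \<open>a..c\<close> have \<open>lev\<close> 0, no tile was ever added there; every factor of
  \<open>z\<close> then commutes with \<open>gen i\<close> and with the new tile, and the claim
  reduces to the fundamental path.\<close>

lemma level_zero:
  assumes "bvec m q z" "\<And>l. a \<le> l \<Longrightarrow> l \<le> c \<Longrightarrow> l \<le> N \<Longrightarrow> lev (q ! l) = 0"
    and ij: "i \<le> N" "1 \<le> j" "j \<le> N" "a \<le> j - 1" "j - 1 \<le> c"
    and out: "\<And>l. \<not> (a \<le> l \<and> l \<le> c) \<Longrightarrow> far i l \<and> far j l"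
    and base: "eqv (gen i * (X \<theta> j (uu (fund_path ! (j - 1))) * E N)) 0"
  shows "eqv (gen i * (X \<theta> j (uu (q ! (j - 1))) * z)) 0"
  using assms(1,2)
proof (induction rule: bvec.induct)
  case base
  then show ?case using assms by simp
next
  case (tile m p y l)
  let ?q = "p[l := nh (p ! (l - 1))]" and ?Y = "X \<theta> l (uu (p ! (l - 1)))"
  have len: "length p = Suc N" and y: "y \<in> carrier F" using bvec_in[OF tile.hyps(1)] path_length by auto
  have "lev (?q ! l) \<noteq> 0" using lev_nh tile.hyps(3) len by simp
  then have nl: "\<not> (a \<le> l \<and> l \<le> c)" using tile.prems[of l] tile.hyps(3) by auto
  then have f: "far i l" "far j l" using out by auto
  have "lev (p ! s) = 0" if "a \<le> s" "s \<le> c" "s \<le> N" for s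
    using tile.prems[OF that] nl that by (auto simp: nth_list_update split: if_splits)
  then have IH: "eqv (gen i * (X \<theta> j (uu (p ! (j - 1))) * y)) 0" by (rule tile.IH)
  have pj: "?q ! (j - 1) = p ! (j - 1)" using nl ij by (metis nth_list_update_neq)
  let ?Z = "X \<theta> j (uu (p ! (j - 1)))"
  have in': "?Y \<in> carrier F" "?Z \<in> carrier F" "gen i \<in> carrier F" using X_in tile ij by auto
  have "eqv (gen i * (?Z * (?Y * y))) (gen i * (?Y * (?Z * y)))"
    by (rule eqv_mult[OF eqv_refl[OF in'(3)] X_X_far]) (use f tile ij y in auto)
  also have "eqv (gen i * (?Y * (?Z * y))) (?Y * (gen i * (?Z * y)))"
    by (rule gen_X_far) (use f tile ij y in' in \<open>auto intro: mult_in\<close>)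
  also have "eqv (?Y * (gen i * (?Z * y))) 0"
    by (rule eqv_zero_left[OF in'(1) IH])
  finally show ?case unfolding pj .
qed

text \<open>Expanding both tiles with the square and the relation \<open>e_i e_j e_i = e_i\<close>
  turns the left side into one scalar times \<open>gen i * z\<close>; the condition \<open>c\<close>
  says that this scalar is 0.\<close>

lemma slope_step:
  assumes i: "1 \<le> i" "i < N" and j: "j = Suc i \<or> j = i - 1" "1 \<le> j" and z: "z \<in> carrier F"
    and d: "eqv (gen i * (gen j * z)) (scal d * (gen i * z))"
    and c: "1 - cf i v * d - cf j u * (tau i - cf i v) = 0"
  shows "eqv (gen i * (X \<theta> j u * (X \<theta> i v * z))) 0"
proof -
  have jN: "j \<le> N" using i j by auto
  have in': "gen i \<in> carrier F" "gen j \<in> carrier F" "gen i * z \<in> carrier F" using i jN z by (auto intro: mult_in)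
  let ?r = "cf i v" and ?s = "cf j u"
  have "gen i * (X \<theta> j u * (X \<theta> i v * z)) =
      gen i * gen j * gen i * z - scal ?r * (gen i * (gen j * z)) - scal ?s * (gen i * gen i * z) + scal (?s * ?r) * (gen i * z)"
    using i j jN by (simp add: X_eq left_diff_distrib right_diff_distrib mult.assoc scal_left_comm[of "gen i"] scal_left_comm[of "gen j"] scal_scal)
  moreover have "eqv \<dots> (gen i * z - scal ?r * (scal d * (gen i * z)) - scal ?s * (scal (tau i) * gen i * z) + scal (?s * ?r) * (gen i * z))"
    by (intro eqv_add eqv_diff eqv_scal d eqv_refl in' eqv_mult[OF eqv_braid] eqv_mult[OF eqv_square]) (use i j z in' in \<open>auto intro: mult_in\<close>)
  moreover have "gen i * z - scal ?r * (scal d * (gen i * z)) - scal ?s * (scal (tau i) * gen i * z) + scal (?s * ?r) * (gen i * z) =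
      scal (1 - ?r * d - ?s * (tau i - ?r)) * (gen i * z)"
    by (simp add: scal_diff scal_add left_diff_distrib distrib_right mult.assoc scal_scal right_diff_distrib)
  ultimately show ?thesis using c by simp
qed

text \<open>Shows that the generators act on tiled vectors in the double quotient as they do on
  paths. The statements are proved together: exchanging tiles allows a conveniently placed tile to
  be removed, and killing slopes for fewer tiles supplies the scalar in
  \<open>slope_step\<close>.\<close>

lemma bvec_main:
  "bvec m p y \<Longrightarrow>
    (\<forall>i. 1 \<le> i \<longrightarrow> i \<le> N \<longrightarrow> turn p i \<longrightarrow> p ! i = nh (p ! (i - 1)) \<longrightarrow>
      (\<exists>m' y'. m = Suc m' \<and> bvec m' (p[i := oh (p ! (i - 1))]) y' \<and> eqv y (X \<theta> i (uu (p ! (i - 1))) * y'))) \<and>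
    (\<forall>i. 1 \<le> i \<longrightarrow> i < N \<longrightarrow> \<not> turn p i \<longrightarrow> eqv (gen i * y) 0) \<and>
    eqv (gen 0 * y) (if p ! 1 = - 1 then scal s\<^sub>1 * y else 0)"
proof (induction m arbitrary: p y rule: less_induct)
  case (less m)
  from less.prems show ?case
  proof (cases rule: bvec.cases)
    case base
    have "eqv (gen 0 * E N) (scal s\<^sub>1 * E N)"
    proof -
      have "PC ([0] @ Ew N) = PC (Ew N)"
      proof -
        have a: "PC ([0] @ Ew N) = PC ([0] @ Ew 1 @ Ew N)"
          using PC_cong[OF Ew_absorb[of 1 N, symmetric], of "[0]" "[]"] N2 by simp
        also have "\<dots> = PC (Ew 1 @ Ew N)"
          using PC_cong[OF PC_square[of 0], of "[]" "Ew N"] by simp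
        also have "\<dots> = PC (Ew N)" using Ew_absorb[of 1 N] N2 by simp
        finally show ?thesis .
      qed
      then obtain c where c: "eqv (gen 0 * E N) (scal c * E N)"
        using E_relation[of "[0]" "[]", OF sim_ex] by auto
      have E: "app (rho (E N)) (vv fund_path) = vv fund_path" by (rule rho_bvec[OF bvec.base])
      have "app (rho (gen 0 * E N)) (vv fund_path) fund_path = app (rho (scal c * E N)) (vv fund_path) fund_path"
        using eqv_rho[OF c] by simp
      then have "c = s\<^sub>1" using N2 by (simp add: ev_mult E pef_0_vv[OF fund_path_Paths]) (simp add: vv_def)
      then show ?thesis using c by simp
    qed
    then show ?thesis using base N2 fund_turn by (auto simp: nh_def)
  next
    case (tile m0 q z j)
    note j = tile(5,6)
    have q: "bvec m0 q z" by (rule tile(4))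
    have qP: "q \<in> Paths" and z: "z \<in> carrier F" and len: "length q = Suc N"
      using bvec_in[OF q] path_length by auto
    have pP: "p \<in> Paths" using bvec_in[OF less.prems] by simp
    have m0: "m0 < m" and m: "m = Suc m0" using tile by auto
    let ?Y = "X \<theta> j (uu (q ! (j - 1)))"
    have Yin: "?Y \<in> carrier F" using X_in j by simp
    have y: "y = ?Y * z" and p: "p = q[j := nh (q ! (j - 1))]" using tile by auto
    have pj: "p ! j = nh (q ! (j - 1))" using p j len by simp
    have pn: "p ! l = q ! l" if "l \<noteq> j" for l using p that by simp
    have IHa: "\<exists>m' y'. n = Suc m' \<and> bvec m' (s[i := oh (s ! (i - 1))]) y' \<and> eqv x (X \<theta> i (uu (s ! (i - 1))) * y')"
      if "n < m" "bvec n s x" "1 \<le> i" "i \<le> N" "turn s i" "s ! i = nh (s ! (i - 1))" for n s x i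
      using less.IH[OF that(1,2)] that(3-) by blast
    have IHb: "eqv (gen i * x) 0" if "n < m" "bvec n s x" "1 \<le> i" "i < N" "\<not> turn s i" for n s x i
      using less.IH[OF that(1,2)] that(3-) by blast
    have A: "\<exists>m' y'. m = Suc m' \<and> bvec m' (p[i := oh (p ! (i - 1))]) y' \<and> eqv y (X \<theta> i (uu (p ! (i - 1))) * y')"
      if i: "1 \<le> i" "i \<le> N" "turn p i" "p ! i = nh (p ! (i - 1))" for i
    proof -
      consider "i = j" | "far i j" | "j = Suc i" | "i = Suc j" by linarith
      then show ?thesis
      proof cases
        case 1
        have e: "p ! (i - 1) = q ! (i - 1)" using pn[of "i - 1"] i 1 by simp
        have "p[i := oh (p ! (i - 1))] = q"
          unfolding e unfolding 1 p using tile(8) by (metis list_update_id list_update_overwrite)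
        moreover have "eqv y (X \<theta> i (uu (p ! (i - 1))) * z)"
          unfolding e unfolding 1 y using Yin z by (intro eqv_refl mult_in)
        ultimately show ?thesis using m q by auto
      next
        case 2
        have e: "p ! (i - 1) = q ! (i - 1)" "p ! i = q ! i" using pn[of "i - 1"] pn[of i] i 2 by auto
        have "turn q i" using i(3) turn_upd_far[of j i q "nh (q ! (j - 1))"] 2 i(1) p by auto
        then obtain m1 z' where 3: "m0 = Suc m1" "bvec m1 (q[i := oh (q ! (i - 1))]) z'" "eqv z (X \<theta> i (uu (q ! (i - 1))) * z')"
          using IHa[OF m0 q i(1,2)] i(4) e by auto
        let ?q = "q[i := oh (q ! (i - 1))]" and ?Z = "X \<theta> i (uu (q ! (i - 1)))"
        have z': "z' \<in> carrier F" using bvec_in[OF 3(2)] by simp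
        have qj: "?q ! (j - 1) = q ! (j - 1)" "?q ! j = q ! j" "turn ?q j"
          using 2 j turn_upd_far[of i j q] tile(7) by auto
        have "bvec (Suc m1) (?q[j := nh (?q ! (j - 1))]) (X \<theta> j (uu (?q ! (j - 1))) * z')"
          by (rule bvec.tile[OF 3(2) j]) (use qj tile(8) in auto)
        then have b: "bvec m0 (?q[j := nh (q ! (j - 1))]) (?Y * z')" unfolding qj using 3(1) by simp
        have "p[i := oh (p ! (i - 1))] = ?q[j := nh (q ! (j - 1))]"
          unfolding e unfolding p using 2 by (intro list_update_swap) auto
        moreover have "eqv y (?Z * (?Y * z'))"
        proof -
          have "eqv y (?Y * (?Z * z'))" unfolding y by (rule eqv_mult[OF eqv_refl[OF Yin] 3(3)])
          also have "eqv (?Y * (?Z * z')) (?Z * (?Y * z'))"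
            by (rule X_X_far) (use 2 i j z' in auto)
          finally show ?thesis .
        qed
        ultimately show ?thesis using m b e by auto
      next
        case 3
        \<comment> \<open>Two removable tiles cannot be adjacent: each of the heights would have to
          lie further out than the other.\<close>
        have "p ! Suc i = p ! (i - 1)" using i(3) j 3 by (simp add: turn_def)
        moreover have "p ! Suc i = nh (p ! i)" using pj pn[of i] 3 by simp
        ultimately show ?thesis using i(4) nh_nh by metis
      next
        case 4
        have "q ! i = q ! (j - 1)" using tile(7) 4 i by (simp add: turn_def)
        then have "p ! i = q ! (j - 1)" using pn 4 by simp
        moreover have "p ! (i - 1) = nh (q ! (j - 1))" using pj 4 by simp
        ultimately show ?thesis using i(4) nh_nh by metis
      qed
    qed
    have B: "eqv (gen i * y) 0" if i: "1 \<le> i" "i < N" "\<not> turn p i" for i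
    proof -
      have gin: "gen i \<in> carrier F" using i by simp
      have "i \<noteq> j" using i(3) turn_upd_same[OF j(1), of q] tile(7) p by auto
      then consider "far i j" | "j = Suc i" | "i = Suc j" by linarith
      then show ?thesis
      proof cases
        case 1
        then have "\<not> turn q i" using i turn_upd_far[of j i q "nh (q ! (j - 1))"] p by auto
        then have "eqv (gen i * z) 0" using IHb[OF m0 q] i by simp
        moreover have "eqv (gen i * y) (?Y * (gen i * z))"
          unfolding y by (rule gen_X_far) (use 1 i j z in auto)
        ultimately show ?thesis using eqv_trans eqv_zero_left[OF Yin] by blast
      next
        case 2
        \<comment> \<open>Before the last tile was added, the heights at \<open>i - 1\<close>,
          \<open>i\<close>, \<open>i + 1\<close> were \<open>g\<close>, \<open>h\<close>,
          \<open>g\<close>. Either \<open>h\<close> is further out than \<open>g\<close>, and a tile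
          at \<open>i\<close> can be removed as well, or both heights are at \<open>lev\<close> 0
          and \<open>level_zero\<close> applies.\<close>
        define h where "h = q ! i"
        define g where "g = oh h"
        have hj: "q ! (j - 1) = h" "q ! j = g" "p ! Suc i = nh h" using 2 h_def g_def tile(8) pj by auto
        have qi: "q ! (i - 1) = g"
        proof -
          have "p ! (i - 1) \<noteq> nh h" using i(3) hj i(2) by (auto simp: turn_def)
          then have "q ! (i - 1) \<noteq> nh h" using pn[of "i - 1"] 2 i by auto
          moreover have "q ! (i - 1) = h + 1 \<or> q ! (i - 1) = h - 1" using path_step'[OF qP i(1)] i h_def by auto
          ultimately show ?thesis using oh_nh(5)[of "q ! (i - 1)" h] g_def by auto
        qed
        have qt: "turn q i" using hj qi 2 by (auto simp: turn_def)
        have q2: "q ! Suc j = h" if "j < N" using tile(7) that hj by (simp add: turn_def)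
        show ?thesis
        proof (cases "h = nh g")
          case False
          then have l: "lev h = 0" "lev g = 0" using lev_oh[of h] g_def by auto
          have "eqv (gen i * (X \<theta> j (uu (q ! (j - 1))) * z)) 0"
          proof (rule level_zero[OF q, of "i - 1" "i + 2"])
            fix l assume "i - 1 \<le> l" "l \<le> i + 2" "l \<le> N"
            then consider "l = i - 1" | "l = i" | "l = j" | "l = Suc j" "j < N" using 2 by linarith
            then show "lev (q ! l) = 0" using l qi h_def hj q2 by cases auto
          qed (use i j 2 base_up[of i] in auto)
          then show ?thesis unfolding y .
        next
          case hg: True
          obtain m1 z' where 3: "m0 = Suc m1" "bvec m1 (q[i := oh g]) z'" "eqv z (X \<theta> i (uu g) * z')"
            using IHa[OF m0 q i(1) _ qt] i h_def hg qi by auto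
          let ?q = "q[i := oh g]"
          have z': "z' \<in> carrier F" using bvec_in[OF 3(2)] by simp
          have gh: "dd i g h = cf i (- uu g)" "dd i g (oh g) = cf i (uu g)" "dd j h g = cf j (uu h)"
            using dd_nh dd_oh hg g_def by metis+
          have ti: "tau i - cf i (uu g) = dd i g h" using cf_sum[OF qn_uu, of i g] gh by (simp add: algebra_simps)
          \<comment> \<open>Below \<open>N\<close> the path of \<open>z'\<close> has a slope at
            \<open>j\<close>, so \<open>d = 0\<close> and the condition is \<open>dd_pair\<close>.
            At \<open>N\<close> there is no slope, \<open>d\<close> is a diagonal weight of the
            half-tile, and the condition becomes \<open>dd_sumN\<close>.\<close>
          have "\<exists>d. eqv (gen i * (gen j * z')) (scal d * (gen i * z')) \<and> 1 - cf i (uu g) * d - cf j (uu h) * (tau i - cf i (uu g)) = 0"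
          proof (cases "j < N")
            case True
            have "\<not> turn ?q j" using True q2 2 len i hg oh_nh(3)[of g] by (auto simp: turn_def)
            then have "eqv (gen j * z') 0" using IHb[OF _ 3(2) j(1) True] 3(1) m by simp
            then have "eqv (gen i * (gen j * z')) (scal 0 * (gen i * z'))"
              using eqv_zero_left[OF gin] by simp
            moreover have "dd i g h * dd j h g = 1"
              using dd_pair[of i j h g] True i oh_nh(2)[of g] hg by auto
            ultimately show ?thesis using gh ti by (intro exI[of _ 0]) (simp add: mult.commute)
          next
            case False
            then have jN: "j = N" "N = Suc i" "N - 1 = i" using j 2 by auto
            define f where "f = oh g"
            have qf: "?q ! i = f" "?q ! N = g" "?q ! (i - 1) = g"
              using len i hj jN qi f_def by auto
            have qfN: "turn ?q N" by (simp add: turn_def)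
            have flip: "\<not> turn (?q[N := w]) i" if "w \<noteq> g" for w
            proof -
              have "?q[N := w] ! N = w" "?q[N := w] ! (i - 1) = g" using len qf(3) jN(2) by auto
              then show ?thesis unfolding turn_def jN(2)[symmetric] using that i by simp
            qed
            have XN: "X \<theta> N (uu f) * x = gen N * x - scal (cf N (uu f)) * x" for x
              using N2 by (simp add: X_eq left_diff_distrib)
            \<comment> \<open>A flip at \<open>N\<close> turns the path of \<open>z'\<close> into
              one with a slope at \<open>i\<close>, which \<open>gen i\<close> kills, so only the
              diagonal part of \<open>gen N\<close> is left. The cases are whether a half-tile has
              to be removed or added for this flip.\<close>
            have d: "eqv (gen i * (gen N * z')) (scal (dd N f g) * (gen i * z'))"
            proof (cases "g = nh f")
              case gf: True
              obtain m2 z2 where 4: "m1 = Suc m2" "bvec m2 (?q[N := oh f]) z2" "eqv z' (X \<theta> N (uu f) * z2)"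
                using IHa[OF _ 3(2), of N] 3(1) m N2 qf qfN jN gf by auto
              have z2: "z2 \<in> carrier F" using bvec_in[OF 4(2)] by simp
              have i2: "eqv (gen i * z2) 0"
                using IHb[OF _ 4(2) i(1,2) flip] 3(1) 4(1) m gf oh_nh(3)[of f] by simp
              let ?c = "cf N (uu f)" and ?d = "cf N (- uu f)"
              have "eqv (gen i * (gen N * z')) (gen i * (gen N * (X \<theta> N (uu f) * z2)))"
                using i by (intro eqv_mult[OF eqv_refl] 4(3)) auto
              also have "gen i * (gen N * (X \<theta> N (uu f) * z2)) = gen i * (gen N * gen N * z2) - scal ?c * (gen i * (gen N * z2))"
                unfolding XN by (simp add: right_diff_distrib scal_left_comm[of "gen N"] scal_left_comm[of "gen i"] mult.assoc)
              also have "eqv \<dots> (gen i * (scal (tau N) * gen N * z2) - scal ?c * (gen i * (gen N * z2)))"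
                using i N2 z2 by (intro eqv_diff eqv_mult[OF eqv_refl] eqv_mult[OF eqv_square] eqv_refl mult_in) auto
              also have "gen i * (scal (tau N) * gen N * z2) - scal ?c * (gen i * (gen N * z2)) = scal ?d * (gen i * (gen N * z2))"
                unfolding cf_sum[OF qn_uu, of N f, symmetric]
                by (simp add: mult.assoc scal_left_comm[of "gen i"] scal_add distrib_right distrib_left)
              also have "gen i * (gen N * z2) = gen i * (X \<theta> N (uu f) * z2) + scal ?c * (gen i * z2)"
                unfolding XN by (simp add: right_diff_distrib scal_left_comm[of "gen i"])
              also have "eqv (scal ?d * (gen i * (X \<theta> N (uu f) * z2) + scal ?c * (gen i * z2))) (scal ?d * (gen i * z' + scal ?c * 0))"
                using gin by (intro eqv_scal eqv_add eqv_mult[OF eqv_refl] eqv_sym[OF 4(3)] i2) auto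
              finally show ?thesis using dd_nh[of N f] gf by simp
            next
              case False
              then have gf: "g = oh f" using f_def g_def hg by (metis oh_nh(1,5) add_diff_cancel_right' diff_add_cancel)
              \<comment> \<open>Adding the half-tile gives \<open>m0\<close> tiles, still fewer than
                \<open>m\<close>, so the induction hypothesis covers this path.\<close>
              have b: "bvec (Suc m1) (?q[N := nh f]) (X \<theta> N (uu f) * z')"
                using bvec.tile[OF 3(2), of N] qf qfN jN N2 gf by simp
              have "eqv (gen i * (X \<theta> N (uu f) * z')) 0"
                using IHb[OF _ b i(1,2) flip] 3(1) m gf oh_nh(3)[of f] by simp
              then have "eqv (gen i * (X \<theta> N (uu f) * z') + scal (cf N (uu f)) * (gen i * z')) (0 + scal (cf N (uu f)) * (gen i * z'))"
                using gin z' by (intro eqv_add eqv_refl mult_in) auto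
              moreover have "gen i * (X \<theta> N (uu f) * z') + scal (cf N (uu f)) * (gen i * z') = gen i * (gen N * z')"
                unfolding XN by (simp add: right_diff_distrib scal_left_comm[of "gen i"])
              ultimately show ?thesis using dd_oh[of N f] gf by simp
            qed
            have "dd i g h * dd N h g + dd i g f * dd N f g = 1"
              using dd_sumN[of i g] i oh_nh(1,2,3)[of g] hg f_def by (auto simp: add.commute)
            then have "1 - cf i (uu g) * dd N f g - cf j (uu h) * (tau i - cf i (uu g)) = 0"
              unfolding ti using gh f_def jN by (simp add: algebra_simps)
            then show ?thesis using d jN by blast
          qed
          then obtain d where d: "eqv (gen i * (gen j * z')) (scal d * (gen i * z'))"
            "1 - cf i (uu g) * d - cf j (uu h) * (tau i - cf i (uu g)) = 0" by blast
          have "eqv (gen i * y) (gen i * (X \<theta> j (uu h) * (X \<theta> i (uu g) * z')))"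
            unfolding y hj using Yin hj by (intro eqv_mult eqv_refl gin 3(3)) auto
          also have "eqv \<dots> 0"
            by (rule slope_step[OF i(1,2) _ j(1) z' d]) (use 2 in auto)
          finally show ?thesis .
        qed
      next
        case 3
        then have jN: "j < N" and ij: "j = i - 1" using i by auto
        \<comment> \<open>The mirror image of the previous case. As \<open>j < N\<close>, the scalar
          \<open>d\<close> is always 0.\<close>
        define h where "h = q ! (j - 1)"
        define g where "g = oh h"
        have hj: "q ! j = g" "p ! j = nh h" "q ! i = h"
          using h_def g_def tile(7,8) pj jN 3 by (auto simp: turn_def)
        have qi: "q ! Suc i = g"
        proof -
          have "p ! Suc i \<noteq> nh h" using i(2,3) hj ij by (auto simp: turn_def)
          then have "q ! Suc i \<noteq> nh h" using pn[of "Suc i"] 3 by auto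
          moreover have "q ! Suc i = h + 1 \<or> q ! Suc i = h - 1" using path_step[OF qP i(2)] hj by auto
          ultimately show ?thesis using oh_nh(5)[of "q ! Suc i" h] g_def by auto
        qed
        have qt: "turn q i" using hj qi ij by (auto simp: turn_def)
        show ?thesis
        proof (cases "h = nh g")
          case False
          then have l: "lev h = 0" "lev g = 0" using lev_oh[of h] g_def by auto
          have "eqv (gen i * (X \<theta> j (uu (q ! (j - 1))) * z)) 0"
          proof (rule level_zero[OF q, of "i - 2" "i + 1"])
            fix l assume "i - 2 \<le> l" "l \<le> i + 1" "l \<le> N"
            then consider "l = j - 1" | "l = j" | "l = i" | "l = Suc i" using 3 j by linarith
            then show "lev (q ! l) = 0" using l qi h_def hj by cases auto
          qed (use i j 3 base_down[of i] in auto)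
          then show ?thesis unfolding y .
        next
          case hg: True
          have qi1: "q ! (i - 1) = g" using hj ij by simp
          obtain m1 z' where 4: "m0 = Suc m1" "bvec m1 (q[i := oh g]) z'" "eqv z (X \<theta> i (uu g) * z')"
            using IHa[OF m0 q i(1) _ qt] i hj hg qi1 by auto
          have z': "z' \<in> carrier F" using bvec_in[OF 4(2)] by simp
          have gh: "dd i g h = cf i (- uu g)" "dd j h g = cf j (uu h)"
            using dd_nh dd_oh hg g_def by metis+
          have ti: "tau i - cf i (uu g) = dd i g h" using cf_sum[OF qn_uu, of i g] gh by (simp add: algebra_simps)
          have "\<not> turn (q[i := oh g]) j"
            using jN 3 len i h_def hg oh_nh(3)[of g] j by (auto simp: turn_def)
          then have "eqv (gen j * z') 0" using IHb[OF _ 4(2) j(1) jN] 4(1) m by simp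
          then have d: "eqv (gen i * (gen j * z')) (scal 0 * (gen i * z'))"
            using eqv_zero_left[OF gin] by simp
          have "dd i g h * dd j h g = 1"
            using dd_pair[of i j h g] jN i oh_nh(2)[of g] hg by auto
          then have c: "1 - cf i (uu g) * 0 - cf j (uu h) * (tau i - cf i (uu g)) = 0"
            using gh ti by (simp add: mult.commute)
          have "eqv (gen i * y) (gen i * (X \<theta> j (uu h) * (X \<theta> i (uu g) * z')))"
            unfolding y h_def[symmetric] using Yin h_def by (intro eqv_mult eqv_refl gin 4(3)) auto
          also have "eqv \<dots> 0"
            by (rule slope_step[OF i(1,2) _ j(1) z' d c]) (use ij in auto)
          finally show ?thesis .
        qed
      qed
    qed
    have C: "eqv (gen 0 * y) (if p ! 1 = - 1 then scal s\<^sub>1 * y else 0)"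
    proof (cases "j = 1")
      case True
      have q0: "q ! 0 = 0" "q ! 1 = - 1" "q ! 2 = 0"
        using path_0[OF qP] tile(7,8) True N2 by (auto simp: turn_def oh_def numeral_2_eq_2)
      \<comment> \<open>A last tile at 1 makes the path start upwards, so \<open>e_0\<close> has to
        kill it. Before that tile the path began with 0, -1, 0, where no tile can have been
        added.\<close>
      have "eqv (gen 0 * (X \<theta> j (uu (q ! (j - 1))) * z)) 0"
      proof (rule level_zero[OF q, of 0 2])
        fix l :: nat assume "l \<le> 2"
        then consider "l = 0" | "l = 1" | "l = 2" by linarith
        then show "lev (q ! l) = 0" using q0 by cases (auto simp: lev_def)
      qed (use True N2 base_up[of 0] in auto)
      moreover have "p ! 1 = 1" using pj True q0 by (simp add: nh_def)
      ultimately show ?thesis unfolding y by simp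
    next
      case False
      then have j2: "2 \<le> j" using j by simp
      have e: "p ! 1 = q ! 1" using pn False by simp
      have "eqv (gen 0 * y) (?Y * (gen 0 * z))"
        unfolding y by (rule gen_X_far) (use j2 j z in auto)
      also have "eqv \<dots> (?Y * (if q ! 1 = - 1 then scal s\<^sub>1 * z else 0))"
        using less.IH[OF m0 q] by (intro eqv_mult eqv_refl Yin) blast
      also have "?Y * (if q ! 1 = - 1 then scal s\<^sub>1 * z else 0) = (if q ! 1 = - 1 then scal s\<^sub>1 * (?Y * z) else 0)"
        by (auto intro: scal_left_comm)
      finally show ?thesis unfolding e y .
    qed
    show ?thesis using A B C by blast
  qed
qed

text \<open>The last tile of the first tiling is removable, hence may also be taken as the last tile
  of the second one.\<close>

lemma bvec_unique: "bvec m p y \<Longrightarrow> bvec m' p y' \<Longrightarrow> eqv y y'"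
proof (induction m arbitrary: p y m' y')
  case 0
  from 0(1) have p: "p = fund_path" "y = E N" by (auto elim: bvec.cases)
  from 0(2) show ?case
  proof (cases rule: bvec.cases)
    case base
    then show ?thesis using p E_in eqv_refl by simp
  next
    case (tile m q z j)
    have "length q = Suc N" using bvec_in[OF tile(4)] path_length by auto
    then have "lev (p ! j) \<noteq> 0" using tile lev_nh by simp
    then show ?thesis using p tile(6) by (auto simp: lev_def split: if_splits)
  qed
next
  case (Suc m)
  from Suc.prems(1) show ?case
  proof (cases rule: bvec.cases)
    case (tile q z j)
    have len: "length q = Suc N" using bvec_in[OF tile(3)] path_length by auto
    have p: "p = q[j := nh (q ! (j - 1))]" "y = X \<theta> j (uu (q ! (j - 1))) * z" using tile by auto
    have pj: "p ! (j - 1) = q ! (j - 1)" "p ! j = nh (p ! (j - 1))" "turn p j"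
      using p tile len turn_upd_same by auto
    have qb: "p[j := oh (p ! (j - 1))] = q"
      unfolding pj(1) unfolding p using tile(7) by (metis list_update_id list_update_overwrite)
    obtain n y1 where n: "bvec n q y1" "eqv y' (X \<theta> j (uu (q ! (j - 1))) * y1)"
      using bvec_main[OF Suc.prems(2)] tile(4,5) pj qb by metis
    have "eqv z y1" using Suc.IH[of q z n y1] tile(3) n(1) by simp
    then have "eqv y (X \<theta> j (uu (q ! (j - 1))) * y1)"
      unfolding p(2) using X_in tile by (intro eqv_mult eqv_refl) auto
    then show ?thesis using n(2) eqv_sym eqv_trans by blast
  qed
qed

subsection \<open>The module is spanned by path vectors\<close>

definition bx :: "int list \<Rightarrow> nat free_alg" where "bx p = (SOME y. \<exists>m. bvec m p y)"

lemma bx: assumes "p \<in> Paths" shows "\<exists>m. bvec m p (bx p)"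
  unfolding bx_def by (rule someI_ex) (use bvec_ex[OF assms] in blast)

lemma bx_in: "p \<in> Paths \<Longrightarrow> bx p \<in> carrier F"
  using bx bvec_in by blast

lemma bvec_bx: "bvec m p y \<Longrightarrow> eqv y (bx p)"
  using bvec_unique bx bvec_in by blast

text \<open>The linear map that sends the unit function at \<open>p\<close> to \<open>b_p\<close>.
  By \<open>mult_psi\<close> it respects the action, and \<open>rho_psi\<close> provides a left
  inverse.\<close>

definition psi :: "(int list \<Rightarrow> complex) \<Rightarrow> nat free_alg"
  where "psi f = (\<Sum>p\<in>Paths. scal (f p) * bx p)"

lemma psi_in: "psi f \<in> carrier F"
  unfolding psi_def by (intro sum_in mult_in) (auto intro: bx_in)

lemma psi_add: "psi (\<lambda>p. f p + f' p) = psi f + psi f'"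
  by (simp add: psi_def scal_add distrib_right sum.distrib)

lemma psi_cmult: "psi (\<lambda>p. c * f p) = scal c * psi f"
  by (simp add: psi_def sum_distrib_left scal_scal)

lemma psi_zero: "psi (\<lambda>p. 0) = 0"
  by (simp add: psi_def)

lemma psi_sum: "psi (\<lambda>p. \<Sum>i\<in>I. f i p) = (\<Sum>i\<in>I. psi (f i))"
  by (induction I rule: infinite_finite_induct) (auto simp: psi_zero psi_add)

lemma psi_vv: assumes "p \<in> Paths" shows "psi (vv p) = bx p"
proof -
  have "psi (vv p) = (\<Sum>q\<in>Paths. if q = p then bx q else 0)"
    unfolding psi_def by (intro sum.cong) (auto simp: vv_def)
  then show ?thesis using assms finite_Paths by simp
qed

text \<open>The second column of a rank one block is proportional to the first, which is known from
  \<open>pef_vv\<close>; the factor is read off from \<open>pe_square\<close>.\<close>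

lemma pef_vv_nh:
  assumes q: "q \<in> Paths" "1 \<le> i" "i \<le> N" "turn q i" "q ! i = oh (q ! (i - 1))"
  defines "h \<equiv> q ! (i - 1)"
  shows "pef i (vv (q[i := nh h])) = (\<lambda>s. cf i (- uu h) * (cf i (uu h) * vv q s + vv (q[i := nh h]) s))"
proof -
  let ?p = "q[i := nh h]" and ?c = "cf i (uu h)"
  have pv: "pef i (vv q) = (\<lambda>s. ?c * vv q s + vv ?p s)"
    unfolding h_def by (rule pef_vv[OF q])
  have "app (pe i) (\<lambda>s. ?c * vv q s + vv ?p s) = (\<lambda>s. tau i * pef i (vv q) s)"
    using arg_cong[OF pe_square[OF q(2,3)], of "\<lambda>A. app A (vv q)"] pv by simp
  then have "(\<lambda>s. ?c * pef i (vv q) s + pef i (vv ?p) s) = (\<lambda>s. tau i * pef i (vv q) s)"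
    unfolding app_add app_cmult by simp
  then have "?c * pef i (vv q) s + pef i (vv ?p) s = tau i * pef i (vv q) s" for s
    by (rule fun_cong)
  then have "pef i (vv ?p) s = (tau i - ?c) * pef i (vv q) s" for s
    by (simp only: left_diff_distrib eq_diff_eq add.commute)
  moreover have "tau i - ?c = cf i (- uu h)" using cf_sum[OF qn_uu, of i h] by (simp add: algebra_simps)
  ultimately show ?thesis unfolding pv by auto
qed

lemma gen_bx:
  assumes p: "p \<in> Paths" and i: "i \<le> N"
  shows "eqv (gen i * bx p) (psi (pef i (vv p)))"
proof -
  obtain m where b: "bvec m p (bx p)" using bx[OF p] by blast
  have gin: "gen i \<in> carrier F" using i by simp
  consider "i = 0" | "1 \<le> i" "\<not> turn p i" | "1 \<le> i" "turn p i" "p ! i = oh (p ! (i - 1))"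
    | "1 \<le> i" "turn p i" "p ! i = nh (p ! (i - 1))"
    using path_step'[OF p _ i] oh_nh(5) by (metis One_nat_def Suc_leI neq0_conv)
  then show ?thesis
  proof cases
    case 1
    have "psi (pef 0 (vv p)) = (if p ! 1 = - 1 then scal s\<^sub>1 * bx p else 0)"
      using psi_vv[OF p] by (simp add: pef_0_vv[OF p] psi_cmult psi_zero)
    then show ?thesis using bvec_main[OF b] 1 by simp
  next
    case 2
    then have "i < N" using i by (auto simp: turn_def)
    then show ?thesis using bvec_main[OF b] 2 pef_slope[OF 2(1) i 2(2)] by (simp add: psi_zero)
  next
    case 3
    let ?h = "p ! (i - 1)"
    let ?q = "p[i := nh ?h]"
    have q: "bvec (Suc m) ?q (X \<theta> i (uu ?h) * bx p)" by (rule bvec.tile[OF b 3(1) i 3(2,3)])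
    have "eqv (scal (cf i (uu ?h)) * bx p + X \<theta> i (uu ?h) * bx p) (scal (cf i (uu ?h)) * bx p + bx ?q)"
      using bx_in[OF p] by (intro eqv_add bvec_bx[OF q] eqv_refl mult_in) auto
    moreover have "scal (cf i (uu ?h)) * bx p + X \<theta> i (uu ?h) * bx p = gen i * bx p"
      using X_eq[OF 3(1) i] by (simp add: left_diff_distrib)
    moreover have "psi (pef i (vv p)) = scal (cf i (uu ?h)) * bx p + bx ?q"
      unfolding pef_vv[OF p 3(1) i 3(2,3)] psi_add psi_cmult using psi_vv[OF p] psi_vv[of ?q] bvec_in[OF q] by simp
    ultimately show ?thesis by simp
  next
    case 4
    let ?h = "p ! (i - 1)"
    let ?q = "p[i := oh ?h]"
    have l: "length p = Suc N" using p by (rule path_length)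
    obtain n y where y: "bvec n ?q y" "eqv (bx p) (X \<theta> i (uu ?h) * y)"
      using bvec_main[OF b, THEN conjunct1, rule_format, OF 4(1) i 4(2,3)] by blast
    have q: "?q \<in> Paths" "y \<in> carrier F" using bvec_in[OF y(1)] by auto
    have qi: "?q ! (i - 1) = ?h" "?q ! i = oh ?h" "turn ?q i" "?q[i := nh (?q ! (i - 1))] = p"
      using 4 i l turn_upd_same[OF 4(1)] by (auto simp: nth_list_update) (metis list_update_id)
    let ?c = "cf i (uu ?h)" and ?d = "cf i (- uu ?h)"
    have "pef i (vv p) = (\<lambda>s. ?d * (?c * vv ?q s + vv p s))"
      using pef_vv_nh[OF q(1) 4(1) i qi(3)] qi by simp
    then have R: "psi (pef i (vv p)) = scal ?d * (scal ?c * bx ?q + bx p)"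
      using psi_vv[OF p] psi_vv[OF q(1)] by (simp only: psi_add psi_cmult)
    have "eqv (gen i * bx p) (gen i * (X \<theta> i (uu ?h) * y))"
      using i by (intro eqv_mult y(2) eqv_refl) auto
    also have "gen i * (X \<theta> i (uu ?h) * y) = gen i * gen i * y - scal ?c * (gen i * y)"
      using X_eq[OF 4(1) i] by (simp add: left_diff_distrib right_diff_distrib scal_left_comm[of "gen i"] mult.assoc)
    also have "eqv \<dots> (scal (tau i) * gen i * y - scal ?c * (gen i * y))"
      using q i 4 by (intro eqv_diff eqv_mult[OF eqv_square] eqv_refl mult_in) auto
    also have "scal (tau i) * gen i * y - scal ?c * (gen i * y) = scal ?d * (gen i * y)"
      unfolding cf_sum[OF qn_uu, of i ?h, symmetric] by (simp add: mult.assoc scal_add distrib_right)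
    also have "gen i * y = scal ?c * y + X \<theta> i (uu ?h) * y"
      using X_eq[OF 4(1) i] by (simp add: left_diff_distrib)
    also have "eqv (scal ?d * (scal ?c * y + X \<theta> i (uu ?h) * y)) (scal ?d * (scal ?c * bx ?q + bx p))"
      by (intro eqv_scal eqv_add bvec_bx[OF y(1)] eqv_sym[OF y(2)])
    finally show ?thesis unfolding R .
  qed
qed

lemma gen_psi: assumes "f \<in> supp_fun Paths" "i \<le> N" shows "eqv (gen i * psi f) (psi (pef i f))"
proof -
  have f: "f = (\<lambda>q. \<Sum>p\<in>Paths. f p * vv p q)" by (rule supp_sum[OF finite_Paths assms(1)])
  have "psi (pef i f) = psi (app (pe i) (\<lambda>q. \<Sum>p\<in>Paths. f p * vv p q))" using f by simp
  also have "\<dots> = (\<Sum>p\<in>Paths. scal (f p) * psi (pef i (vv p)))"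
    unfolding app_sum app_cmult by (simp add: psi_sum psi_cmult)
  finally have R: "psi (pef i f) = (\<Sum>p\<in>Paths. scal (f p) * psi (pef i (vv p)))" .
  have "gen i * psi f = (\<Sum>p\<in>Paths. scal (f p) * (gen i * bx p))"
    by (simp add: psi_def sum_distrib_left scal_left_comm[of "gen i"])
  then show ?thesis unfolding R using gen_bx assms(2) by (auto intro!: eqv_sum eqv_scal)
qed

lemma mult_psi: assumes "a \<in> carrier F" "f \<in> supp_fun Paths" shows "eqv (a * psi f) (psi (app (rho a) f))"
  using assms(1)
proof (induction rule: free_algebra_induct)
  case one
  then show ?case by (simp add: eqv_refl psi_in)
next
  case (gen i y)
  have "eqv (gen i * (y * psi f)) (gen i * psi (app (rho y) f))"
    using gen by (intro eqv_mult eqv_refl) auto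
  also have "eqv \<dots> (psi (pef i (app (rho y) f)))"
    using gen by (intro gen_psi rho_supp assms) auto
  finally show ?case by (simp add: mult.assoc ev_mult)
next
  case (add y z)
  then show ?case by (simp add: distrib_right ev_add psi_add eqv_add)
next
  case (scal c y)
  then show ?case by (simp add: mult.assoc ev_mult psi_cmult eqv_scal)
qed

lemma E_psi: "eqv (E N) (psi (vv fund_path))"
  using bvec_bx[OF bvec.base] psi_vv[OF fund_path_Paths] by simp

text \<open>Recovers the coefficients of a combination of the \<open>b_p\<close> by acting on the
  fundamental path. This is the source of linear independence in the double quotient.\<close>

lemma rho_psi: assumes "f \<in> supp_fun Paths" shows "app (rho (psi f)) (vv fund_path) = f"
proof -
  have "app (rho (bx p)) (vv fund_path) = vv p" if "p \<in> Paths" for p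
    using bx[OF that] rho_bvec by blast
  then have "app (rho (psi f)) (vv fund_path) = (\<lambda>q. \<Sum>p\<in>Paths. f p * vv p q)"
    by (simp add: psi_def ev_sum ev_mult app_sum_left)
  then show ?thesis using supp_sum[OF finite_Paths assms] by simp
qed

lemma psi_inj: "f \<in> supp_fun Paths \<Longrightarrow> f' \<in> supp_fun Paths \<Longrightarrow> cc (psi f) = cc (psi f') \<Longrightarrow> f = f'"
  using cc_eq_rho[OF psi_in psi_in] rho_psi by metis

section \<open>Modules carried by sets of paths\<close>

definition tr :: "int list set \<Rightarrow> (int list \<Rightarrow> complex) \<Rightarrow> int list \<Rightarrow> complex"
  where "tr S f = (\<lambda>p. if p \<in> S then f p else 0)"

lemma supp_add: "f \<in> supp_fun S \<Longrightarrow> f' \<in> supp_fun S \<Longrightarrow> (\<lambda>p. f p + f' p) \<in> supp_fun S"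
  and supp_cmult: "f \<in> supp_fun S \<Longrightarrow> (\<lambda>p. c * f p) \<in> supp_fun S"
  and supp_zero: "(\<lambda>p. 0) \<in> supp_fun S"
  and tr_supp: "tr S f \<in> supp_fun S"
  and tr_id: "f \<in> supp_fun S \<Longrightarrow> tr S f = f"
  by (auto simp: supp_fun_def tr_def fun_eq_iff)

lemma supp_mono: "S \<subseteq> T \<Longrightarrow> f \<in> supp_fun S \<Longrightarrow> f \<in> supp_fun T"
  by (auto simp: supp_fun_def)

lemma tr_add: "tr S (\<lambda>p. f p + f' p) = (\<lambda>p. tr S f p + tr S f' p)"
  and tr_cmult: "tr S (\<lambda>p. c * f p) = (\<lambda>p. c * tr S f p)"
  by (auto simp: tr_def)

text \<open>The action of \<open>a\<close> on a subquotient of the path representation is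
  \<open>f \<mapsto> tr S (rho a f)\<close>; \<open>stable S\<close> says that this is multiplicative.\<close>

definition stable :: "int list set \<Rightarrow> bool"
  where "stable S \<longleftrightarrow> (\<forall>a\<in>carrier F. \<forall>f\<in>supp_fun Paths. \<forall>f'\<in>supp_fun Paths.
    tr S f = tr S f' \<longrightarrow> tr S (app (rho a) f) = tr S (app (rho a) f'))
    \<or> (\<forall>a\<in>carrier F. \<forall>f\<in>supp_fun S. app (rho a) f \<in> supp_fun S)"

text \<open>A common interface to \<open>W\<close>, its submodules and its quotients, all identified
  with functions on a set \<open>S\<close> of paths. Irreducibility, dimension and the action of
  \<open>Z\<close> are then proved once.\<close>

definition model :: "(nat free_alg set, 'm) module \<Rightarrow> int list set \<Rightarrow> ((int list \<Rightarrow> complex) \<Rightarrow> 'm) \<Rightarrow> bool"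
  where "model M S \<phi> \<longleftrightarrow> S \<subseteq> Paths \<and> stable S \<and> bij_betw \<phi> (supp_fun S) (carrier M) \<and>
    \<zero>\<^bsub>M\<^esub> = \<phi> (\<lambda>p. 0) \<and>
    (\<forall>f\<in>supp_fun S. \<forall>f'\<in>supp_fun S. \<phi> f \<oplus>\<^bsub>M\<^esub> \<phi> f' = \<phi> (\<lambda>p. f p + f' p)) \<and>
    (\<forall>a\<in>carrier F. \<forall>f\<in>supp_fun S. cl a \<odot>\<^bsub>M\<^esub> \<phi> f = \<phi> (tr S (app (rho a) f)))"

text \<open>The alternatives in \<open>stable\<close> are the two situations that occur. In a
  quotient, the truncated function depends on the restriction to \<open>S\<close> alone; in a
  submodule, truncation changes nothing.\<close>

lemma stable_mult:
  assumes "stable S" "S \<subseteq> Paths" "a \<in> carrier F" "b \<in> carrier F" "f \<in> supp_fun S"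
  shows "tr S (app (rho (a * b)) f) = tr S (app (rho a) (tr S (app (rho b) f)))"
proof -
  have g: "app (rho b) f \<in> supp_fun Paths"
    using rho_supp[OF assms(4)] supp_mono[OF assms(2,5)] by blast
  have g': "tr S (app (rho b) f) \<in> supp_fun Paths" "tr S (app (rho b) f) = tr S (tr S (app (rho b) f))"
    using supp_mono[OF assms(2) tr_supp] tr_id[OF tr_supp] by auto
  consider "\<forall>a\<in>carrier F. \<forall>f\<in>supp_fun Paths. \<forall>f'\<in>supp_fun Paths.
      tr S f = tr S f' \<longrightarrow> tr S (app (rho a) f) = tr S (app (rho a) f')"
    | "\<forall>a\<in>carrier F. \<forall>f\<in>supp_fun S. app (rho a) f \<in> supp_fun S"
    using assms(1) unfolding stable_def by blast
  then show ?thesis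
  proof cases
    case 1
    from 1[rule_format, OF assms(3) g g'] show ?thesis by (simp add: ev_mult)
  next
    case 2
    then have "tr S (app (rho b) f) = app (rho b) f" using assms by (intro tr_id) blast
    then show ?thesis by (simp add: ev_mult)
  qed
qed

lemma abelian_group_transport:
  assumes "carrier M = \<phi> ` supp_fun S" "\<zero>\<^bsub>M\<^esub> = \<phi> (\<lambda>p. 0)"
    and add: "\<And>f f'. f \<in> supp_fun S \<Longrightarrow> f' \<in> supp_fun S \<Longrightarrow> \<phi> f \<oplus>\<^bsub>M\<^esub> \<phi> f' = \<phi> (\<lambda>p. f p + f' p)"
  shows "abelian_group M"
proof (rule abelian_groupI)
  show "\<exists>y\<in>carrier M. y \<oplus>\<^bsub>M\<^esub> x = \<zero>\<^bsub>M\<^esub>" if "x \<in> carrier M" for x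
  proof -
    obtain f where f: "f \<in> supp_fun S" "x = \<phi> f" using \<open>x \<in> carrier M\<close> assms(1) by auto
    have m: "(\<lambda>p. - 1 * f p) \<in> supp_fun S" using supp_cmult[OF f(1), of "- 1"] .
    have "\<phi> (\<lambda>p. - 1 * f p) \<oplus>\<^bsub>M\<^esub> x = \<zero>\<^bsub>M\<^esub>"
      unfolding f(2) add[OF m f(1)] assms(2) by simp
    then show ?thesis using m assms(1) by blast
  qed
qed (auto simp: assms(1,2) add supp_add supp_zero ac_simps)

context
  fixes M :: "(nat free_alg set, 'm) module" and S \<phi>
  assumes mod: "model M S \<phi>"
begin

lemma model_facts:
  shows model_sub: "S \<subseteq> Paths" and model_stable: "stable S" and model_bij: "bij_betw \<phi> (supp_fun S) (carrier M)"
    and model_carrier: "carrier M = \<phi> ` supp_fun S"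
    and model_inj: "\<And>f f'. f \<in> supp_fun S \<Longrightarrow> f' \<in> supp_fun S \<Longrightarrow> \<phi> f = \<phi> f' \<Longrightarrow> f = f'"
    and model_zero: "\<zero>\<^bsub>M\<^esub> = \<phi> (\<lambda>p. 0)"
    and model_add: "\<And>f f'. f \<in> supp_fun S \<Longrightarrow> f' \<in> supp_fun S \<Longrightarrow> \<phi> f \<oplus>\<^bsub>M\<^esub> \<phi> f' = \<phi> (\<lambda>p. f p + f' p)"
    and model_smult: "\<And>a f. a \<in> carrier F \<Longrightarrow> f \<in> supp_fun S \<Longrightarrow> cl a \<odot>\<^bsub>M\<^esub> \<phi> f = \<phi> (tr S (app (rho a) f))"
  using mod unfolding model_def bij_betw_def inj_on_def by auto

lemma model_finite: "finite S"
  using finite_Paths model_sub finite_subset by blast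

lemma model_in: "f \<in> supp_fun S \<Longrightarrow> \<phi> f \<in> carrier M"
  using model_carrier by blast

lemma model_abelian: "abelian_group M"
  by (rule abelian_group_transport[OF model_carrier model_zero model_add])

lemma model_scal: "f \<in> supp_fun S \<Longrightarrow> cl (scal c) \<odot>\<^bsub>M\<^esub> \<phi> f = \<phi> (\<lambda>p. c * f p)"
  using model_smult[of "scal c" f] tr_id[OF supp_cmult, of f S c] by simp

lemma model_left_module: "left_module TL M"
proof (intro left_module.intro left_module_axioms.intro TL_ring model_abelian)
  fix a x assume "a \<in> carrier TL" "x \<in> carrier M"
  then obtain y f where y: "y \<in> carrier F" "a = cl y" and f: "f \<in> supp_fun S" "x = \<phi> f"
    using TL_carrier model_carrier by auto
  show "a \<odot>\<^bsub>M\<^esub> x \<in> carrier M" unfolding y f using y f by (simp add: model_smult model_in tr_supp)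
next
  fix a b x assume "a \<in> carrier TL" "b \<in> carrier TL" "x \<in> carrier M"
  then obtain y z f where y: "y \<in> carrier F" "a = cl y" "z \<in> carrier F" "b = cl z" and f: "f \<in> supp_fun S" "x = \<phi> f"
    using TL_carrier model_carrier by auto
  show "(a \<oplus>\<^bsub>TL\<^esub> b) \<odot>\<^bsub>M\<^esub> x = a \<odot>\<^bsub>M\<^esub> x \<oplus>\<^bsub>M\<^esub> b \<odot>\<^bsub>M\<^esub> x"
    unfolding y(2,4) f(2) using y(1,3) f(1)
    by (simp add: cl_simps[symmetric] model_smult add_in model_add tr_supp ev_add tr_add)
  show "(a \<otimes>\<^bsub>TL\<^esub> b) \<odot>\<^bsub>M\<^esub> x = a \<odot>\<^bsub>M\<^esub> (b \<odot>\<^bsub>M\<^esub> x)"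
    unfolding y(2,4) f(2) using y(1,3) f(1)
    by (simp add: cl_simps[symmetric] model_smult mult_in tr_supp stable_mult[OF model_stable model_sub])
next
  fix a x x' assume "a \<in> carrier TL" "x \<in> carrier M" "x' \<in> carrier M"
  then obtain y f f' where y: "y \<in> carrier F" "a = cl y" and f: "f \<in> supp_fun S" "x = \<phi> f" "f' \<in> supp_fun S" "x' = \<phi> f'"
    using TL_carrier model_carrier by auto
  show "a \<odot>\<^bsub>M\<^esub> (x \<oplus>\<^bsub>M\<^esub> x') = a \<odot>\<^bsub>M\<^esub> x \<oplus>\<^bsub>M\<^esub> a \<odot>\<^bsub>M\<^esub> x'"
    unfolding y(2) f(2,4) using y(1) f(1,3)
    by (simp add: model_smult model_add tr_supp supp_add app_add tr_add)
next
  fix x assume "x \<in> carrier M"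
  then obtain f where f: "f \<in> supp_fun S" "x = \<phi> f" using model_carrier by auto
  show "\<one>\<^bsub>TL\<^esub> \<odot>\<^bsub>M\<^esub> x = x"
    unfolding cl_one[symmetric] f(2) using f(1) by (simp add: model_smult tr_id)
qed

lemma model_acts_Z: "acts_as_scalar Z M zval"
  unfolding acts_as_scalar_def
proof
  fix w assume "w \<in> carrier M"
  then obtain f where f: "f \<in> supp_fun S" "w = \<phi> f" using model_carrier by auto
  obtain z where z: "z \<in> carrier F" "Z = cl z" using Z_closed TL_carrier by auto
  have "app (rho z) f = (\<lambda>p. zval * f p)"
    using ZZ_scalar[OF supp_mono[OF model_sub f(1)]] trho_Z z by simp
  then have "Z \<odot>\<^bsub>M\<^esub> w = \<phi> (\<lambda>p. zval * f p)"
    unfolding z f(2) using model_smult[OF z(1) f(1)] tr_id[OF supp_cmult[OF f(1)]] by simp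
  then show "Z \<odot>\<^bsub>M\<^esub> w = zval \<odot>\<^bsub>vspace M\<^esub> w"
    unfolding f(2) vspace_def using model_scal[OF f(1)] by simp
qed

subsection \<open>Dimension\<close>

lemma vspace_simps [simp]:
  "carrier (vspace M) = carrier M" "zero (vspace M) = zero M" "add (vspace M) = add M"
  "smult (vspace M) c w = cl (scal c) \<odot>\<^bsub>M\<^esub> w"
  by (simp_all add: vspace_def)

lemma model_vectorspace: "vectorspace class_ring (vspace M)"
proof -
  have "abelian_group (vspace M)"
    by (rule abelian_group_transport[of _ \<phi> S]) (auto simp: model_carrier model_zero model_add)
  then have "Module.module class_ring (vspace M)"
  proof (intro moduleI class_cring.is_cring, goal_cases)
    case (2 a x)
    then show ?case using model_carrier by (auto simp: model_scal intro!: model_in supp_cmult)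
  next
    case (3 a b x)
    then show ?case using model_carrier by (auto simp: model_scal model_add supp_cmult distrib_right)
  next
    case (4 a x y)
    then show ?case using model_carrier by (auto simp: model_scal model_add supp_cmult supp_add distrib_left)
  next
    case (5 a b x)
    then show ?case using model_carrier by (auto simp: model_scal supp_cmult mult.assoc)
  next
    case (6 x)
    then show ?case using model_carrier model_scal[of _ 1] by auto
  qed auto
  then show ?thesis
    unfolding vectorspace_def using class_field.field_axioms by blast
qed

interpretation VV: vectorspace class_ring "vspace M"
  by (rule model_vectorspace)

abbreviation "bas T \<equiv> (\<lambda>p. \<phi> (vv p)) ` T"

lemma bas_inj: "inj_on (\<lambda>p. \<phi> (vv p)) S"
proof (rule inj_onI)
  fix p q assume "p \<in> S" "q \<in> S" "\<phi> (vv p) = \<phi> (vv q)"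
  then have "vv p = vv q" using model_inj vv_supp by blast
  then have "vv p p = vv q p" by simp
  then show "p = q" by (simp add: vv_def split: if_splits)
qed

lemma bas_in: "T \<subseteq> S \<Longrightarrow> bas T \<subseteq> carrier M"
  using model_in vv_supp by blast

lemma lincomb_bas:
  assumes "T \<subseteq> S"
  shows "VV.lincomb a (bas T) = \<phi> (\<lambda>p. if p \<in> T then a (\<phi> (vv p)) else 0)"
proof -
  have "finite T" using assms model_finite finite_subset by blast
  then show ?thesis using assms
  proof (induction T rule: finite_induct)
    case empty
    then show ?case using model_zero by (simp add: VV.lincomb_def)
  next
    case (insert q T)
    have q: "q \<in> S" "T \<subseteq> S" using insert by auto
    have nin: "\<phi> (vv q) \<notin> bas T" using bas_inj insert q by (auto simp: inj_on_def)
    have g: "(\<lambda>p. if p \<in> T then a (\<phi> (vv p)) else 0) \<in> supp_fun S" using q by (auto simp: supp_fun_def)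
    have v: "(\<lambda>p. a (\<phi> (vv q)) * vv q p) \<in> supp_fun S" using q by (intro supp_cmult vv_supp)
    have "VV.lincomb a (insert (\<phi> (vv q)) (bas T)) = (cl (scal (a (\<phi> (vv q)))) \<odot>\<^bsub>M\<^esub> \<phi> (vv q)) \<oplus>\<^bsub>M\<^esub> VV.lincomb a (bas T)"
      unfolding VV.lincomb_def
      by (subst VV.finsum_insert)
        (use insert nin q bas_in[OF q(2)] VV.smult_closed model_in[OF vv_supp[OF q(1)]] in \<open>auto simp del: vspace_simps(4) simp: vspace_simps(4)[symmetric]\<close>)
    also have "\<dots> = \<phi> (\<lambda>p. a (\<phi> (vv q)) * vv q p + (if p \<in> T then a (\<phi> (vv p)) else 0))"
      using insert.IH[OF q(2)] model_scal[OF vv_supp[OF q(1)]] model_add[OF v g] by simp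
    also have "(\<lambda>p. a (\<phi> (vv q)) * vv q p + (if p \<in> T then a (\<phi> (vv p)) else 0)) =
        (\<lambda>p. if p \<in> insert q T then a (\<phi> (vv p)) else 0)"
      using insert by (auto simp: vv_def)
    finally show ?case by simp
  qed
qed

lemma span_bas: assumes T: "T \<subseteq> S" shows "VV.span (bas T) = \<phi> ` supp_fun T"
proof -
  have fin: "finite (bas T)" using T model_finite finite_subset by blast
  have "VV.span (bas T) = {VV.lincomb a (bas T) | a. a \<in> bas T \<rightarrow> carrier class_ring}"
    by (rule VV.finite_span[OF fin]) (use bas_in[OF T] in simp)
  also have "\<dots> = {\<phi> (\<lambda>p. if p \<in> T then a (\<phi> (vv p)) else 0) | a. True}"
    unfolding lincomb_bas[OF T] by simp
  also have "\<dots> = \<phi> ` supp_fun T"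
  proof (intro equalityI subsetI)
    fix w assume "w \<in> \<phi> ` supp_fun T"
    then obtain f where f: "f \<in> supp_fun T" "w = \<phi> f" by auto
    let ?a = "\<lambda>w. f (inv_into S (\<lambda>p. \<phi> (vv p)) w)"
    have fe: "f = (\<lambda>p. if p \<in> T then ?a (\<phi> (vv p)) else 0)"
      using f(1) T inv_into_f_f[OF bas_inj] by (force simp: supp_fun_def)
    have "w = \<phi> (\<lambda>p. if p \<in> T then ?a (\<phi> (vv p)) else 0)"
      by (rule trans[OF f(2) arg_cong[OF fe, of \<phi>]])
    then show "w \<in> {\<phi> (\<lambda>p. if p \<in> T then a (\<phi> (vv p)) else 0) | a. True}"
      by (intro CollectI exI[of _ ?a] conjI TrueI)
  qed (auto simp: supp_fun_def)
  finally show ?thesis .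
qed

lemma model_dimension: "fin_dim M" "dimension M = card S"
proof -
  have fin: "finite (bas S)" using model_finite by simp
  have gen: "VV.span (bas S) = carrier (vspace M)" using span_bas[of S] model_carrier by simp
  then show "fin_dim M"
    unfolding fin_dim_def VV.fin_dim_def using fin bas_in[of S] by auto
  have "VV.lin_indpt (bas S)"
  proof (rule VV.finite_lin_indpt2[OF fin])
    show "bas S \<subseteq> carrier (vspace M)" using bas_in[of S] by simp
    fix a assume "VV.lincomb a (bas S) = \<zero>\<^bsub>vspace M\<^esub>"
    then have "\<phi> (\<lambda>p. if p \<in> S then a (\<phi> (vv p)) else 0) = \<phi> (\<lambda>p. 0)"
      using lincomb_bas[of S] model_zero by simp
    then have "(\<lambda>p. if p \<in> S then a (\<phi> (vv p)) else 0) = (\<lambda>p. 0)"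
      by (intro model_inj) (auto simp: supp_fun_def)
    then show "\<forall>v\<in>bas S. a v = \<zero>\<^bsub>class_ring\<^esub>" by (auto simp: fun_eq_iff split: if_splits)
  qed
  then have "VV.basis (bas S)" using gen bas_in[of S] by (simp add: VV.basis_def)
  then show "dimension M = card S"
    unfolding dimension_def using VV.dim_basis[OF fin] card_image[OF bas_inj] by simp
qed

lemma span_bas': assumes T: "T \<subseteq> S"
  shows "LinearCombinations.module.span class_ring (vspace M) (bas T) = \<phi> ` supp_fun T"
  using span_bas[OF T] .

subsection \<open>Irreducibility\<close>

text \<open>A nonzero element of a submodule is cut down to a multiple of some \<open>vv p\<close>
  by the projection onto \<open>p\<close>, and \<open>conn\<close> carries this to all other unit
  functions.\<close>

lemma model_irreducible:
  assumes ne: "S \<noteq> {}"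
    and conn: "\<And>p q. p \<in> S \<Longrightarrow> q \<in> S \<Longrightarrow> \<exists>a\<in>carrier F. app (rho a) (vv p) = vv q"
  shows "irreducible_module TL M"
  unfolding irreducible_module_def
proof (intro conjI allI impI model_left_module)
  obtain p where p: "p \<in> S" using ne by blast
  have "vv p \<noteq> (\<lambda>p. 0)" by (auto simp: vv_def fun_eq_iff)
  then have "\<phi> (vv p) \<noteq> \<zero>\<^bsub>M\<^esub>" using model_inj[OF vv_supp[OF p] supp_zero] model_zero by auto
  then show "carrier M \<noteq> {\<zero>\<^bsub>M\<^esub>}" using model_in[OF vv_supp[OF p]] by blast
next
  fix H assume H: "Module.submodule H TL M"
  have sub: "H \<subseteq> carrier M" using subgroup.subset[OF Module.submodule.axioms(1)[OF H]] by simp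
  have add: "\<And>x y. x \<in> H \<Longrightarrow> y \<in> H \<Longrightarrow> x \<oplus>\<^bsub>M\<^esub> y \<in> H" and z: "\<zero>\<^bsub>M\<^esub> \<in> H"
    and sm: "\<And>a x. a \<in> carrier F \<Longrightarrow> x \<in> H \<Longrightarrow> cl a \<odot>\<^bsub>M\<^esub> x \<in> H"
    using Module.submodule.axioms(1)[OF H] Module.submodule.smult_closed[OF H] cl_closed
    by (auto dest: subgroup.m_closed subgroup.one_closed)
  show "H = {\<zero>\<^bsub>M\<^esub>} \<or> H = carrier M"
  proof (cases "H = {\<zero>\<^bsub>M\<^esub>}")
    case False
    then obtain w where w: "w \<in> H" "w \<noteq> \<zero>\<^bsub>M\<^esub>" using z by auto
    then obtain f where f: "f \<in> supp_fun S" "w = \<phi> f" using sub model_carrier by auto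
    have "f \<noteq> (\<lambda>p. 0)" using w(2) f(2) model_zero by auto
    then obtain p where fp: "f p \<noteq> 0" by auto
    then have p: "p \<in> S" using f by (auto simp: supp_fun_def)
    then have pP: "p \<in> Paths" using model_sub by blast
    obtain x where x: "x \<in> carrier F" "\<And>g q. q \<in> Paths \<Longrightarrow> app (rho x) g q = (if q = p then g q else 0)"
      using path_proj_ex[OF pP] by metis
    have "app (rho x) f = (\<lambda>q. f p * vv p q)"
      using supp_mono[OF model_sub f(1)] x(2) pP
      by (intro supp_fun_eqI[of _ Paths] rho_supp x(1)) (auto simp: supp_fun_def vv_def)
    then have "tr S (app (rho (scal (1 / f p) * x)) f) = vv p"
      using tr_id[OF vv_supp[OF p]] fp by (simp add: ev_mult)
    then have vp: "\<phi> (vv p) \<in> H"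
      using sm[of "scal (1 / f p) * x" w] w(1) model_smult[of "scal (1 / f p) * x" f] f x(1) by (simp add: mult_in)
    have vq: "\<phi> (vv q) \<in> H" if q: "q \<in> S" for q
    proof -
      obtain a where a: "a \<in> carrier F" "app (rho a) (vv p) = vv q" using conn[OF p q] by blast
      then show ?thesis using sm[OF a(1) vp] model_smult[OF a(1) vv_supp[OF p]] tr_id[OF vv_supp[OF q]] by simp
    qed
    have all: "\<phi> (\<lambda>q. if q \<in> T then h q else 0) \<in> H" if "finite T" "T \<subseteq> S" for T h
      using that
    proof (induction T rule: finite_induct)
      case empty
      then show ?case using z model_zero by simp
    next
      case (insert q T)
      have q: "q \<in> S" "T \<subseteq> S" using insert by auto
      have 1: "cl (scal (h q)) \<odot>\<^bsub>M\<^esub> \<phi> (vv q) \<in> H" using sm[OF scal_in vq[OF q(1)]] .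
      have g: "(\<lambda>p. if p \<in> T then h p else 0) \<in> supp_fun S" using q by (auto simp: supp_fun_def)
      have "\<phi> (\<lambda>p. h q * vv q p) \<oplus>\<^bsub>M\<^esub> \<phi> (\<lambda>p. if p \<in> T then h p else 0) \<in> H"
        using add[OF 1 insert.IH[OF q(2)]] model_scal[OF vv_supp[OF q(1)]] by simp
      moreover have "(\<lambda>p. h q * vv q p + (if p \<in> T then h p else 0)) = (\<lambda>p. if p \<in> insert q T then h p else 0)"
        using insert by (auto simp: vv_def)
      ultimately show ?case using model_add[OF supp_cmult[OF vv_supp[OF q(1)]] g] by simp
    qed
    have "carrier M \<subseteq> H"
    proof
      fix w assume "w \<in> carrier M"
      then obtain h where h: "h \<in> supp_fun S" "w = \<phi> h" using model_carrier by auto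
      have "h = (\<lambda>q. if q \<in> S then h q else 0)" using h(1) by (auto simp: supp_fun_def)
      then show "w \<in> H" using all[OF model_finite subset_refl, of h] h(2) by simp
    qed
    then show ?thesis using sub by blast
  qed simp
qed

end

text \<open>The algebra element projecting onto \<open>p\<close> fixes a nonzero vector of
  \<open>M\<close> but annihilates all of \<open>M'\<close>.\<close>

lemma models_not_equivalent:
  fixes M :: "(nat free_alg set, 'm) module" and M' :: "(nat free_alg set, 'k) module"
  assumes M: "model M S \<phi>" and M': "model M' S' \<phi>'" and "p \<in> S" "p \<notin> S'"
  shows "\<not> equivalent_modules TL M M'"
proof
  assume "equivalent_modules TL M M'"
  then obtain h where h: "h \<in> LinearCombinations.module_hom TL M M'" "bij_betw h (carrier M) (carrier M')"
    unfolding equivalent_modules_def by blast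
  have pP: "p \<in> Paths" using model_sub[OF M] assms by blast
  obtain x where x: "x \<in> carrier F" "\<And>g q. q \<in> Paths \<Longrightarrow> app (rho x) g q = (if q = p then g q else 0)"
    using path_proj_ex[OF pP] by metis
  have v: "vv p \<in> supp_fun S" by (rule vv_supp) fact
  have "app (rho x) (vv p) = vv p"
    using x(2) pP by (intro supp_fun_eqI[of _ Paths] rho_supp x(1) vv_supp) (auto simp: vv_def)
  then have 1: "cl x \<odot>\<^bsub>M\<^esub> \<phi> (vv p) = \<phi> (vv p)"
    using model_smult[OF M x(1) v] tr_id[OF v] by simp
  have in1: "\<phi> (vv p) \<in> carrier M" using model_in[OF M v] .
  then have "h (\<phi> (vv p)) \<in> carrier M'" using h(2) by (auto simp: bij_betw_def)
  then obtain f where f: "f \<in> supp_fun S'" "h (\<phi> (vv p)) = \<phi>' f" using model_carrier[OF M'] by auto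
  have "f p = 0" using f(1) assms by (simp add: supp_fun_def)
  then have "app (rho x) f = (\<lambda>q. 0)"
    using x(2) supp_mono[OF model_sub[OF M'] f(1)]
    by (intro supp_fun_eqI[of _ Paths] rho_supp x(1)) (auto simp: supp_fun_def)
  then have "cl x \<odot>\<^bsub>M'\<^esub> \<phi>' f = \<phi>' (\<lambda>q. 0)"
    using model_smult[OF M' x(1) f(1)] tr_id[OF supp_zero] by simp
  moreover have "h (\<phi> (vv p)) = cl x \<odot>\<^bsub>M'\<^esub> h (\<phi> (vv p))"
    using module_hom_smult[OF h(1) cl_closed[OF x(1)] in1] 1 by simp
  ultimately have e: "h (\<phi> (vv p)) = \<phi>' (\<lambda>q. 0)" using f(2) by simp
  have z: "\<phi> (\<lambda>q. 0) \<in> carrier M" using model_in[OF M supp_zero] .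
  \<comment> \<open>Zero is preserved because it is the scalar 0 times a vector.\<close>
  have "h (\<phi> (\<lambda>q. 0)) = \<phi>' (\<lambda>q. 0)"
  proof -
    have "h (\<phi> (\<lambda>q. 0)) = cl (scal 0) \<odot>\<^bsub>M'\<^esub> h (\<phi> (vv p))"
      using module_hom_smult[OF h(1) cl_closed[OF scal_in] in1, of 0] model_scal[OF M v, of 0] by simp
    then show ?thesis unfolding e using model_scal[OF M' supp_zero, of 0] by simp
  qed
  then have "\<phi> (vv p) = \<phi> (\<lambda>q. 0)"
    using e h(2) in1 z by (auto simp: bij_betw_def inj_on_def)
  then have "vv p p = 0" using model_inj[OF M v supp_zero] by simp
  then show False by (simp add: vv_def)
qed

subsection \<open>The modules \<open>W\<close>, \<open>V\<close> and its quotient\<close>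

abbreviation WW :: "(nat free_alg set, nat free_alg set set) module" where "WW \<equiv> W b0"

definition Psi :: "(int list \<Rightarrow> complex) \<Rightarrow> nat free_alg set set" where "Psi f = cc (psi f)"

lemma WW_simps:
  "carrier WW = (\<lambda>a. a \<otimes>\<^bsub>DQ b0\<^esub> cc (E N)) ` carrier (DQ b0)"
  "zero WW = zero (DQ b0)" "add WW = add (DQ b0)" "smult WW t w = clDQ b0 t \<otimes>\<^bsub>DQ b0\<^esub> w"
  by (simp_all add: W_def cc_def)

lemma Psi_smult: "a \<in> carrier F \<Longrightarrow> f \<in> supp_fun Paths \<Longrightarrow> cl a \<odot>\<^bsub>WW\<^esub> Psi f = Psi (app (rho a) f)"
  using mult_psi[of a f] by (simp add: WW_simps Psi_def cc_def[symmetric] cc_simps(2)[symmetric] psi_in eqv_def)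

lemma Psi_add: "Psi f \<oplus>\<^bsub>WW\<^esub> Psi f' = Psi (\<lambda>p. f p + f' p)"
  by (simp add: WW_simps Psi_def cc_simps(1)[symmetric] psi_in psi_add)

lemma Psi_inj: "f \<in> supp_fun Paths \<Longrightarrow> f' \<in> supp_fun Paths \<Longrightarrow> Psi f = Psi f' \<Longrightarrow> f = f'"
  unfolding Psi_def by (rule psi_inj)

lemma Psi_carrier: "carrier WW = Psi ` supp_fun Paths"
proof (intro equalityI subsetI)
  fix w assume "w \<in> carrier WW"
  then obtain x where x: "x \<in> carrier F" "w = cc x \<otimes>\<^bsub>DQ b0\<^esub> cc (E N)"
    by (auto simp: WW_simps DQ_carrier)
  have v: "vv fund_path \<in> supp_fun Paths" by (rule vv_supp[OF fund_path_Paths])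
  have "eqv (x * E N) (psi (app (rho x) (vv fund_path)))"
    using eqv_trans[OF eqv_mult[OF eqv_refl[OF x(1)] E_psi] mult_psi[OF x(1) v]] .
  then have "w = Psi (app (rho x) (vv fund_path))"
    using x E_in[of N] by (simp add: cc_simps(2) eqv_def Psi_def)
  then show "w \<in> Psi ` supp_fun Paths" using rho_supp[OF x(1) v] by blast
next
  fix w assume "w \<in> Psi ` supp_fun Paths"
  then obtain f where f: "f \<in> supp_fun Paths" "w = Psi f" by auto
  have v: "vv fund_path \<in> supp_fun Paths" by (rule vv_supp[OF fund_path_Paths])
  \<comment> \<open>\<open>psi f\<close> lies in the left ideal, since right multiplication by
    \<open>E N\<close> reproduces it: modulo the relations the product is \<open>psi\<close> of
    \<open>rho (psi f)\<close> applied to \<open>vv fund_path\<close>, which is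
    \<open>f\<close>.\<close>
  have "eqv (psi f * E N) (psi f)"
    using eqv_trans[OF eqv_mult[OF eqv_refl[OF psi_in[of f]] E_psi] mult_psi[OF psi_in[of f] v]] rho_psi[OF f(1)] by simp
  then have "w = cc (psi f) \<otimes>\<^bsub>DQ b0\<^esub> cc (E N)"
    using f(2) psi_in E_in[of N] by (simp add: cc_simps(2) eqv_def Psi_def)
  then show "w \<in> carrier WW" using psi_in by (auto simp: WW_simps DQ_carrier)
qed

lemma Psi_zero: "zero WW = Psi (\<lambda>p. 0)"
  by (simp add: WW_simps Psi_def psi_zero cc_zero)

lemma model_W: "model WW Paths Psi"
  unfolding model_def
  using Psi_carrier Psi_inj Psi_zero Psi_add Psi_smult rho_supp
  by (auto simp: stable_def bij_betw_def inj_on_def tr_id)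

lemma basis_vec_iff: "basis_vec \<theta> p w \<longleftrightarrow> p \<in> Paths \<and> w = Psi (vv p)"
proof
  assume "basis_vec \<theta> p w"
  then have "\<exists>m y. bvec m p y \<and> w = cc y"
  proof (induction rule: basis_vec.induct)
    case fundamental
    then show ?case using bvec.base by (auto simp: cc_def)
  next
    case (from_above p w i)
    then obtain m y where y: "bvec m p y" "w = cc y" by blast
    have "bvec (Suc m) (p[i := nh (p ! (i - 1))]) (X \<theta> i (uu (p ! (i - 1))) * y)"
      by (rule bvec.tile[OF y(1)]) (use from_above in \<open>auto simp: turn_def oh_def\<close>)
    moreover have "cl (X \<theta> i (uu (p ! (i - 1)))) \<odot>\<^bsub>WW\<^esub> w = cc (X \<theta> i (uu (p ! (i - 1))) * y)"
      using y bvec_in[OF y(1)] X_in from_above by (simp add: WW_simps cc_def[symmetric] cc_simps)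
    ultimately show ?case using from_above by (auto simp: nh_def uu_def)
  next
    case (from_below p w i)
    then obtain m y where y: "bvec m p y" "w = cc y" by blast
    have "bvec (Suc m) (p[i := nh (p ! (i - 1))]) (X \<theta> i (uu (p ! (i - 1))) * y)"
      by (rule bvec.tile[OF y(1)]) (use from_below in \<open>auto simp: turn_def oh_def\<close>)
    moreover have "cl (X \<theta> i (uu (p ! (i - 1)))) \<odot>\<^bsub>WW\<^esub> w = cc (X \<theta> i (uu (p ! (i - 1))) * y)"
      using y bvec_in[OF y(1)] X_in from_below by (simp add: WW_simps cc_def[symmetric] cc_simps)
    moreover have "uu (p ! (i - 1)) = - \<omega>\<^sub>1 + of_int (p ! (i - 1))" "nh (p ! (i - 1)) = p ! (i - 1) - 1"
      using from_below by (simp_all add: uu_def nh_def)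
    ultimately show ?case by metis
  qed
  then obtain m y where y: "bvec m p y" "w = cc y" by blast
  then show "p \<in> Paths \<and> w = Psi (vv p)"
    using bvec_in[OF y(1)] bvec_bx[OF y(1)] psi_vv[of p] by (simp add: Psi_def eqv_def)
next
  have rev: "bvec m p y \<Longrightarrow> basis_vec \<theta> p (cc y)" for m p y
  proof (induction rule: bvec.induct)
    case base
    then show ?case using basis_vec.fundamental by (simp add: cc_def)
  next
    case (tile m p y i)
    have e: "cl (X \<theta> i (uu (p ! (i - 1)))) \<odot>\<^bsub>WW\<^esub> cc y = cc (X \<theta> i (uu (p ! (i - 1))) * y)"
      using bvec_in[OF tile(1)] X_in tile by (simp add: WW_simps cc_def[symmetric] cc_simps)
    have t: "i < N \<longrightarrow> p ! (i + 1) = p ! (i - 1)" using tile by (simp add: turn_def)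
    show ?case
    proof (cases "p ! (i - 1) \<ge> 0")
      case True
      then have "uu (p ! (i - 1)) = \<omega>\<^sub>1 - of_int (p ! (i - 1))" "nh (p ! (i - 1)) = p ! (i - 1) + 1"
        "p ! i = p ! (i - 1) - 1" using tile by (simp_all add: uu_def nh_def oh_def)
      then show ?thesis using basis_vec.from_above[OF tile.IH _ _ t True] tile.hyps e by simp
    next
      case False
      then have "uu (p ! (i - 1)) = - \<omega>\<^sub>1 + of_int (p ! (i - 1))" "nh (p ! (i - 1)) = p ! (i - 1) - 1"
        "p ! i = p ! (i - 1) + 1" "p ! (i - 1) < 0" using tile by (simp_all add: uu_def nh_def oh_def)
      then show ?thesis using basis_vec.from_below[OF tile.IH _ _ t] tile.hyps e by (simp only:)
    qed
  qed
  assume "p \<in> Paths \<and> w = Psi (vv p)"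
  then show "basis_vec \<theta> p w"
    using bx[of p] rev psi_vv[of p] by (auto simp: Psi_def)
qed

definition invariant :: "int list set \<Rightarrow> bool"
  where "invariant S \<longleftrightarrow> S \<subseteq> Paths \<and> (\<forall>a\<in>carrier F. \<forall>f\<in>supp_fun S. app (rho a) f \<in> supp_fun S)"

lemma model_submodule:
  assumes "invariant S"
  shows "model (WW\<lparr>carrier := Psi ` supp_fun S\<rparr>) S Psi"
proof -
  have S: "S \<subseteq> Paths" "\<And>a f. a \<in> carrier F \<Longrightarrow> f \<in> supp_fun S \<Longrightarrow> app (rho a) f \<in> supp_fun S"
    using assms by (auto simp: invariant_def)
  have "inj_on Psi (supp_fun S)"
    using Psi_inj supp_mono[OF S(1)] by (auto intro!: inj_onI)
  moreover have "stable S" using S by (simp add: stable_def)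
  ultimately show ?thesis
    unfolding model_def using S supp_mono[OF S(1)] Psi_zero Psi_add Psi_smult
    by (simp add: bij_betw_def tr_id)
qed

text \<open>A coset of the submodule consists of the vectors whose functions have a given
  restriction to the complement \<open>R\<close>, so cosets correspond to functions on
  \<open>R\<close>. \<open>\<phi>\<close> returns the coset itself as a set, as the quotient module
  demands.\<close>

lemma model_quotient:
  assumes inv: "invariant S"
  defines "R \<equiv> Paths - S"
  defines "\<phi> \<equiv> \<lambda>f. Psi ` {h \<in> supp_fun Paths. tr R h = f}"
  shows "model (quotient_module WW (Psi ` supp_fun S)) R \<phi>"
proof -
  let ?U = "Psi ` supp_fun S" and ?Q = "quotient_module WW (Psi ` supp_fun S)"
  have S: "S \<subseteq> Paths" "\<And>a f. a \<in> carrier F \<Longrightarrow> f \<in> supp_fun S \<Longrightarrow> app (rho a) f \<in> supp_fun S"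
    using inv by (auto simp: invariant_def)
  have R: "R \<subseteq> Paths" by (auto simp: R_def)
  have tr0: "tr R f = (\<lambda>p. 0) \<longleftrightarrow> f \<in> supp_fun S" if "f \<in> supp_fun Paths" for f
    using that S(1) by (auto simp: tr_def supp_fun_def R_def fun_eq_iff)
  have trd: "tr R (\<lambda>p. f p - f' p) = (\<lambda>p. tr R f p - tr R f' p)" for f f' by (auto simp: tr_def)
  have sd: "(\<lambda>p. f p - f' p) \<in> supp_fun Paths" if "f \<in> supp_fun Paths" "f' \<in> supp_fun Paths" for f f'
    using that by (auto simp: supp_fun_def)
  have cos: "?U +>\<^bsub>WW\<^esub> Psi f = \<phi> (tr R f)" if f: "f \<in> supp_fun Paths" for f
  proof (intro equalityI subsetI)
    fix w assume "w \<in> ?U +>\<^bsub>WW\<^esub> Psi f"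
    then obtain s where s: "s \<in> supp_fun S" "w = Psi s \<oplus>\<^bsub>WW\<^esub> Psi f" by (auto simp: a_r_coset_def')
    have sP: "s \<in> supp_fun Paths" using supp_mono[OF S(1) s(1)] .
    have "tr R (\<lambda>p. s p + f p) = tr R f"
      unfolding tr_add using tr0[OF sP] s(1) by (simp add: fun_eq_iff)
    then show "w \<in> \<phi> (tr R f)" unfolding \<phi>_def s(2) Psi_add using supp_add[OF sP f] by blast
  next
    fix w assume "w \<in> \<phi> (tr R f)"
    then obtain h where h: "h \<in> supp_fun Paths" "tr R h = tr R f" "w = Psi h" by (auto simp: \<phi>_def)
    let ?s = "\<lambda>p. h p - f p"
    have "tr R ?s = (\<lambda>p. 0)" unfolding trd h(2) by simp
    then have "?s \<in> supp_fun S" using tr0[OF sd[OF h(1) f]] by simp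
    moreover have "w = Psi ?s \<oplus>\<^bsub>WW\<^esub> Psi f" unfolding Psi_add h(3) by simp
    ultimately show "w \<in> ?U +>\<^bsub>WW\<^esub> Psi f" by (auto simp: a_r_coset_def')
  qed
  have RP: "f \<in> supp_fun Paths" if "f \<in> supp_fun R" for f using supp_mono[OF R that] .
  \<comment> \<open>Functions with the same restriction to \<open>R\<close> differ by one supported
    on \<open>S\<close>, and that stays in \<open>supp_fun S\<close> by invariance.\<close>
  have act: "tr R (app (rho a) f) = tr R (app (rho a) f')"
    if "a \<in> carrier F" "f \<in> supp_fun Paths" "f' \<in> supp_fun Paths" "tr R f = tr R f'" for a f f'
  proof -
    have "tr R (\<lambda>p. f p - f' p) = (\<lambda>p. 0)" unfolding trd that(4) by simp
    then have "(\<lambda>p. f p - f' p) \<in> supp_fun S" using tr0[OF sd[OF that(2,3)]] by simp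
    then have 1: "app (rho a) (\<lambda>p. f p - f' p) \<in> supp_fun S" using S(2)[OF that(1)] by blast
    have "app (rho a) f = app (rho a) (\<lambda>p. (f p - f' p) + f' p)" by simp
    also have "\<dots> = (\<lambda>p. app (rho a) (\<lambda>p. f p - f' p) p + app (rho a) f' p)" unfolding app_add ..
    finally show ?thesis
      using 1 by (auto simp: tr_def supp_fun_def R_def)
  qed
  have st: "stable R" unfolding stable_def using act by blast
  have inj: "f = f'" if f: "f \<in> supp_fun R" and e: "\<phi> f = \<phi> f'" for f f'
  proof -
    have "Psi f \<in> \<phi> f'" unfolding e[symmetric] unfolding \<phi>_def using RP[OF f] tr_id[OF f] by blast
    then obtain h where h: "h \<in> supp_fun Paths" "tr R h = f'" "Psi f = Psi h" unfolding \<phi>_def by blast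
    then show ?thesis using Psi_inj[OF RP[OF f] h(1)] tr_id[OF f] by simp
  qed
  have car: "carrier ?Q = \<phi> ` supp_fun R"
  proof -
    have "carrier ?Q = (\<lambda>f. ?U +>\<^bsub>WW\<^esub> Psi f) ` supp_fun Paths"
      unfolding quotient_module_def using Psi_carrier by (auto simp: A_RCOSETS_def')
    also have "\<dots> = \<phi> ` (tr R ` supp_fun Paths)" using cos by (simp add: image_image)
    also have "tr R ` supp_fun Paths = supp_fun R"
    proof (intro equalityI subsetI)
      fix f assume "f \<in> supp_fun R"
      then show "f \<in> tr R ` supp_fun Paths" using RP tr_id by (metis imageI)
    qed (auto simp: tr_supp)
    finally show ?thesis .
  qed
  have zer: "\<zero>\<^bsub>?Q\<^esub> = \<phi> (\<lambda>p. 0)"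
    unfolding quotient_module_def \<phi>_def using tr0 supp_mono[OF S(1)] by auto
  have add: "\<phi> f \<oplus>\<^bsub>?Q\<^esub> \<phi> f' = \<phi> (\<lambda>p. f p + f' p)" if f: "f \<in> supp_fun R" "f' \<in> supp_fun R" for f f'
  proof (intro equalityI subsetI)
    fix w assume "w \<in> \<phi> f \<oplus>\<^bsub>?Q\<^esub> \<phi> f'"
    then obtain h h' where h: "h \<in> supp_fun Paths" "tr R h = f" "h' \<in> supp_fun Paths" "tr R h' = f'" "w = Psi h \<oplus>\<^bsub>WW\<^esub> Psi h'"
      by (auto simp: quotient_module_def set_add_def' \<phi>_def)
    then show "w \<in> \<phi> (\<lambda>p. f p + f' p)"
      unfolding \<phi>_def Psi_add using supp_add[OF h(1,3)] tr_add by auto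
  next
    fix w assume "w \<in> \<phi> (\<lambda>p. f p + f' p)"
    then obtain h where h: "h \<in> supp_fun Paths" "tr R h = (\<lambda>p. f p + f' p)" "w = Psi h" by (auto simp: \<phi>_def)
    have "tr R (\<lambda>p. h p - f' p) = f" unfolding trd h(2) tr_id[OF f(2)] by simp
    then have "Psi (\<lambda>p. h p - f' p) \<in> \<phi> f" unfolding \<phi>_def using sd[OF h(1) RP[OF f(2)]] by blast
    moreover have "Psi f' \<in> \<phi> f'" unfolding \<phi>_def using RP[OF f(2)] tr_id[OF f(2)] by blast
    moreover have "w = Psi (\<lambda>p. h p - f' p) \<oplus>\<^bsub>WW\<^esub> Psi f'" unfolding Psi_add h(3) by simp
    ultimately show "w \<in> \<phi> f \<oplus>\<^bsub>?Q\<^esub> \<phi> f'"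
      unfolding quotient_module_def set_add_def' by auto
  qed
  have smu: "cl a \<odot>\<^bsub>?Q\<^esub> \<phi> f = \<phi> (tr R (app (rho a) f))" if a: "a \<in> carrier F" and f: "f \<in> supp_fun R" for a f
  proof -
    have c: "?U +>\<^bsub>WW\<^esub> (cl a \<odot>\<^bsub>WW\<^esub> w) = \<phi> (tr R (app (rho a) f))" if w: "w \<in> \<phi> f" for w
    proof -
      obtain h where h: "h \<in> supp_fun Paths" "tr R h = f" "w = Psi h" using w by (auto simp: \<phi>_def)
      have "tr R (app (rho a) h) = tr R (app (rho a) f)"
        by (rule act[OF a h(1) RP[OF f]]) (simp add: h(2) tr_id[OF f])
      then show ?thesis
        unfolding h(3) Psi_smult[OF a h(1)] cos[OF rho_supp[OF a h(1)]] by simp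
    qed
    have "Psi f \<in> \<phi> f" unfolding \<phi>_def using RP[OF f] tr_id[OF f] by blast
    then show ?thesis unfolding quotient_module_def using c by auto
  qed
  have "bij_betw \<phi> (supp_fun R) (carrier ?Q)"
    using inj car by (auto simp: bij_betw_def intro!: inj_onI)
  then show ?thesis
    unfolding model_def using R st zer add smu by simp
qed

end

section \<open>Counting paths\<close>

context two_BTL
begin

text \<open>Paths correspond to the sets of positions of their down steps, so counting by final
  height becomes counting subsets by size.\<close>

definition down_path :: "nat set \<Rightarrow> int list"
  where "down_path D = map (\<lambda>i. int i - 2 * int (card (D \<inter> {..<i}))) [0..<Suc N]"

lemma down_path_nth: "i \<le> N \<Longrightarrow> down_path D ! i = int i - 2 * int (card (D \<inter> {..<i}))"
  unfolding down_path_def by (subst nth_map) (auto simp: nth_append)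

lemma card_below_Suc: "card (D \<inter> {..<Suc i}) = card (D \<inter> {..<i}) + (if i \<in> D then 1 else 0)"
  by (simp add: lessThan_Suc Int_insert_right)

lemma down_path_Suc: "i < N \<Longrightarrow> down_path D ! Suc i = down_path D ! i + (if i \<in> D then - 1 else 1)"
  by (simp add: down_path_nth card_below_Suc)

lemma bij_down_path: "bij_betw down_path (Pow {..<N}) Paths"
  unfolding bij_betw_def
proof
  show "inj_on down_path (Pow {..<N})"
  proof (rule inj_onI)
    fix D D' assume D: "D \<in> Pow {..<N}" "D' \<in> Pow {..<N}" "down_path D = down_path D'"
    have "i \<in> D \<longleftrightarrow> i \<in> D'" if "i < N" for i
      using down_path_Suc[OF that, of D] down_path_Suc[OF that, of D'] D(3) by (auto split: if_splits)
    then show "D = D'" using D(1,2) by blast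
  qed
  show "down_path ` Pow {..<N} = Paths"
  proof (intro equalityI subsetI)
    fix p assume "p \<in> down_path ` Pow {..<N}"
    then show "p \<in> Paths"
      by (auto simp: Paths_def down_path_Suc down_path_nth[of 0]) (simp_all add: down_path_def)
  next
    fix p assume p: "p \<in> Paths"
    define D where "D = {i. i < N \<and> p ! Suc i = p ! i - 1}"
    have "i \<le> N \<Longrightarrow> p ! i = down_path D ! i" for i
    proof (induction i)
      case 0
      then show ?case using p by (simp add: Paths_def down_path_nth)
    next
      case (Suc i)
      have "p ! Suc i = p ! i + 1 \<or> p ! Suc i = p ! i - 1" using p Suc.prems by (simp add: Paths_def)
      then show ?case using Suc down_path_Suc[of i D] by (auto simp: D_def)
    qed
    then have "p = down_path D"
      using p by (intro nth_equalityI) (auto simp: Paths_def down_path_def simp del: upt_Suc)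
    moreover have "D \<in> Pow {..<N}" by (auto simp: D_def)
    ultimately show "p \<in> down_path ` Pow {..<N}" by blast
  qed
qed

lemma card_paths: "card {p \<in> Paths. Q (p ! N)} = (\<Sum>k \<in> {k. k \<le> N \<and> Q (int N - 2 * int k)}. N choose k)"
proof -
  let ?K = "{k. k \<le> N \<and> Q (int N - 2 * int k)}"
  let ?A = "\<lambda>k. {D. D \<subseteq> {..<N} \<and> card D = k}"
  let ?B = "{D \<in> Pow {..<N}. Q (int N - 2 * int (card D))}"
  have last: "down_path D ! N = int N - 2 * int (card D)" if "D \<in> Pow {..<N}" for D
    using that by (simp add: down_path_nth Int_absorb2)
  have "{p \<in> Paths. Q (p ! N)} = down_path ` ?B"
    unfolding bij_betw_imp_surj_on[OF bij_down_path, symmetric] using last by auto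
  then have "card {p \<in> Paths. Q (p ! N)} = card ?B"
    using card_image[of down_path ?B] bij_down_path by (metis (no_types, lifting) bij_betw_def inj_on_subset mem_Collect_eq subsetI)
  also have "?B = (\<Union>k\<in>?K. ?A k)"
    using card_mono[of "{..<N}"] by auto
  also have "card \<dots> = (\<Sum>k\<in>?K. card (?A k))"
    by (rule card_UN_disjoint) (auto intro: finite_subset[of _ "Pow {..<N}"])
  also have "\<dots> = (\<Sum>k\<in>?K. N choose k)"
    by (simp add: n_subsets)
  finally show ?thesis .
qed

lemma card_Paths: "card Paths = 2 ^ N"
  using bij_betw_same_card[OF bij_down_path] by (simp add: card_Pow)

lemma card_paths_symmetric: "card {p \<in> Paths. p ! N < - c} = card {p \<in> Paths. p ! N > c}"
proof -
  have "(\<Sum>k \<in> {k. k \<le> N \<and> int N - 2 * int k < - c}. N choose k) = (\<Sum>k \<in> {k. k \<le> N \<and> int N - 2 * int k > c}. N choose k)"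
    by (rule sum.reindex_bij_witness[of _ "\<lambda>k. N - k" "\<lambda>k. N - k"]) (auto simp: binomial_symmetric[symmetric])
  then show ?thesis
    using card_paths[of "\<lambda>h. h < - c"] card_paths[of "\<lambda>h. h > c"] by simp
qed

text \<open>A path with \<open>k\<close> down steps ends at \<open>N - 2 * k\<close>, which exceeds
  \<open>n\<close> iff \<open>k < K\<close>; the index of the sum in \<open>numM\<close> is
  \<open>K - k\<close>.\<close>

lemma card_paths_numM:
  assumes "1 \<le> n" "n < N" "odd (N + n)"
  shows "card {p \<in> Paths. p ! N > int n} = numM N (int n)"
proof -
  define K where "K = (N + 1 - n) div 2"
  have K: "N + 1 = n + 2 * K" using assms unfolding K_def by (auto elim!: oddE) presburger?
  have "numM N (int n) = (\<Sum>i = 1..int K. N choose nat (int K - i))"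
  proof -
    have "(int N + 1 - \<bar>int n\<bar>) div 2 = int K" using K by simp
    moreover have "binB N (\<bar>int n\<bar> + 2 * i - 1) = N choose nat (int K - i)" for i
    proof -
      have "int N - (\<bar>int n\<bar> + 2 * i - 1) = 2 * (int K - i)" using K by simp
      then show ?thesis unfolding binB_def by (simp only: nonzero_mult_div_cancel_left zero_neq_numeral[symmetric] if_True not_False_eq_True simp_thms)
    qed
    ultimately show ?thesis by (simp add: numM_def)
  qed
  also have "\<dots> = (\<Sum>k \<in> {k. k \<le> N \<and> int N - 2 * int k > int n}. N choose k)"
    by (rule sum.reindex_bij_witness[of _ "\<lambda>k. int K - int k" "\<lambda>i. nat (int K - i)"]) (use K in auto)
  finally show ?thesis using card_paths[of "\<lambda>h. h > int n"] by simp
qed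

lemma path_parity: "p \<in> Paths \<Longrightarrow> i \<le> N \<Longrightarrow> even (p ! i) \<longleftrightarrow> even i"
proof (induction i)
  case (Suc i)
  have "p ! Suc i = p ! i + 1 \<or> p ! Suc i = p ! i - 1" using Suc.prems by (simp add: Paths_def)
  then show ?case using Suc by auto
qed (simp add: Paths_def)

lemma path_bound: "p \<in> Paths \<Longrightarrow> i \<le> N \<Longrightarrow> \<bar>p ! i\<bar> \<le> int i"
proof (induction i)
  case (Suc i)
  have "p ! Suc i = p ! i + 1 \<or> p ! Suc i = p ! i - 1" using Suc.prems by (simp add: Paths_def)
  then show ?case using Suc by auto
qed (simp add: Paths_def)

lemma card_paths_middle:
  assumes "odd N" shows "card {p \<in> Paths. p ! N > 0} = 2 ^ (N - 1)"
proof -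
  let ?A = "{p \<in> Paths. p ! N > 0}" and ?B = "{p \<in> Paths. p ! N < - 0}"
  have fin: "finite Paths" using bij_betw_finite[OF bij_down_path] by simp
  have "p ! N \<noteq> 0" if "p \<in> Paths" for p
    using path_parity[OF that, of N] assms by auto
  then have "Paths = ?A \<union> ?B" by fastforce
  then have "card Paths = card ?A + card ?B"
    using fin by (metis (no_types, lifting) card_Un_disjoint disjoint_iff finite_Un less_irrefl mem_Collect_eq minus_zero order.strict_trans)
  then have "2 * card ?A = 2 ^ N"
    using card_paths_symmetric[of 0] by (simp add: card_Paths)
  also have "\<dots> = 2 * 2 ^ (N - 1)" using assms by (cases N) auto
  finally show ?thesis by simp
qed

section \<open>Exceptional points\<close>

text \<open>The height before the last step at which the half-tile degenerates: up to sign
  conventions, \<open>\<theta>_of l\<close> is a signed combination of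
  \<open>\<omega>\<^sub>1 - center l\<close> and \<open>\<omega>\<^sub>2\<close>
  (\<open>center_exceptional\<close>).\<close>

primrec center :: "label \<Rightarrow> int" where
  "center (Generic n \<epsilon>\<^sub>1 \<epsilon>\<^sub>2) = \<epsilon>\<^sub>1 * int n"
| "center (Middle \<epsilon>) = 0"

lemma labels_Generic: "Generic n \<epsilon>\<^sub>1 \<epsilon>\<^sub>2 \<in> labels \<longleftrightarrow>
    1 \<le> n \<and> n < N \<and> odd (N + n) \<and> \<epsilon>\<^sub>1 \<in> {1, - 1} \<and> \<epsilon>\<^sub>2 \<in> {1, - 1}" if "N \<ge> 2"
proof (cases "even N")
  case True
  have "(\<exists>i. n = 2 * i + 1 \<and> i \<le> (N - 2) div 2) \<longleftrightarrow> 1 \<le> n \<and> n < N \<and> odd (N + n)"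
    using True that by (auto elim!: evenE oddE) presburger+
  then show ?thesis using True by (auto simp: labels_def)
next
  case False
  have "(\<exists>i. n = 2 * i \<and> 1 \<le> i \<and> i \<le> (N - 1) div 2) \<longleftrightarrow> 1 \<le> n \<and> n < N \<and> odd (N + n)"
    using False that by (auto elim!: evenE oddE)
  then show ?thesis using False by (auto simp: labels_def)
qed

lemma labels_Middle: "Middle \<epsilon> \<in> labels \<longleftrightarrow> odd N \<and> \<epsilon> \<in> {1, - 1}"
  by (auto simp: labels_def)

lemma center_bound:
  assumes "N \<ge> 2" "l \<in> labels" shows "\<bar>center l\<bar> < int N" "odd (int N + center l)"
  using assms labels_Generic labels_Middle by (cases l; auto)+

lemma height_cond_iff:
  assumes "N \<ge> 2" "l \<in> labels"
  shows "height_cond l h \<longleftrightarrow> (if center l \<ge> 0 then h > center l else h < center l)"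
  using assms labels_Generic labels_Middle by (cases l) auto

text \<open>Every signed combination of \<open>\<omega>\<^sub>1 - h\<close> and
  \<open>\<omega>\<^sub>2\<close> with an admissible \<open>h\<close> is plus or minus the
  \<open>\<theta>_of\<close> of a label with centre \<open>h\<close>. Distinctness of the
  exceptional points then forces this label to be \<open>l\<close>.\<close>

lemma exceptional_center:
  assumes N: "N \<ge> 2" and dist: exceptional_points_distinct and l: "l \<in> labels"
    and h: "\<bar>h\<bar> < int N" "odd (int N + h)" and ab: "a \<in> {1, - 1}" "b \<in> {1, - 1 :: int}"
    and eq: "qp (\<theta>_of l) = qp (of_int a * (\<omega>\<^sub>1 - of_int h) + of_int b * \<omega>\<^sub>2)"
  shows "h = center l"
proof -
  have "\<exists>\<sigma>\<in>{1, - 1 :: int}. \<exists>l'\<in>labels. of_int a * (\<omega>\<^sub>1 - of_int h) + of_int b * \<omega>\<^sub>2 = of_int \<sigma> * \<theta>_of l' \<and> h = center l'"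
  proof (cases "h = 0")
    case True
    have "Middle (a * b) \<in> labels" using True h ab by (auto simp: labels_Middle)
    moreover have "of_int a * (\<omega>\<^sub>1 - of_int h) + of_int b * \<omega>\<^sub>2 = of_int a * \<theta>_of (Middle (a * b))"
      using True ab by (auto simp: algebra_simps)
    ultimately show ?thesis using True ab by (intro bexI[of _ a] bexI[of _ "Middle (a * b)"]) auto
  next
    case False
    define s where "s = (if h > 0 then 1 else - 1 :: int)"
    let ?n = "nat \<bar>h\<bar>"
    \<comment> \<open>Solves \<open>a (\<omega>\<^sub>1 - h) + b \<omega>\<^sub>2 = \<sigma>
      \<theta>\<close> for the label with \<open>\<sigma> = a s\<close>, where
      \<open>h = s |h|\<close>.\<close>
    let ?l = "Generic ?n s (a * s * b)"
    have hs: "h = s * int ?n" using False by (auto simp: s_def)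
    have "odd (N + ?n)"
    proof -
      have "odd (int N + \<bar>h\<bar>)" using h(2) by auto
      then show ?thesis by (metis even_add even_nat_iff even_of_nat abs_ge_zero)
    qed
    then have "?l \<in> labels" using False h ab N by (auto simp: labels_Generic s_def)
    moreover have "of_int a * (\<omega>\<^sub>1 - of_int h) + of_int b * \<omega>\<^sub>2 = of_int (a * s) * \<theta>_of ?l"
    proof -
      have "of_nat ?n = (of_int (s * h) :: complex)" using False by (auto simp: s_def)
      then show ?thesis using ab by (auto simp: s_def algebra_simps)
    qed
    moreover have "h = center ?l" using hs by simp
    moreover have "a * s \<in> {1, - 1}" using ab by (auto simp: s_def)
    ultimately show ?thesis by blast
  qed
  then obtain \<sigma> l' where s: "\<sigma> \<in> {1, - 1 :: int}" "l' \<in> labels" "h = center l'"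
    "of_int a * (\<omega>\<^sub>1 - of_int h) + of_int b * \<omega>\<^sub>2 = of_int \<sigma> * \<theta>_of l'" by blast
  have "qp (of_int 1 * \<theta>_of l) = qp (of_int \<sigma> * \<theta>_of l')" using eq s(4) by simp
  then have "(1, l) = (\<sigma>, l')"
    using dist l s(1,2) unfolding exceptional_points_distinct_def inj_on_def by force
  then show ?thesis using s(3) by simp
qed

lemma center_exceptional:
  assumes "N \<ge> 2" "l \<in> labels"
  shows "\<exists>a\<in>{1, - 1 :: int}. \<exists>b\<in>{1, - 1 :: int}. \<theta>_of l = of_int a * (\<omega>\<^sub>1 - of_int (center l)) + of_int b * \<omega>\<^sub>2"
proof (cases l)
  case (Generic n \<epsilon>\<^sub>1 \<epsilon>\<^sub>2)
  then have "\<epsilon>\<^sub>1 \<in> {1, - 1}" "\<epsilon>\<^sub>2 \<in> {1, - 1}" using assms labels_Generic by auto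
  then show ?thesis using Generic by (intro bexI[of _ \<epsilon>\<^sub>1] bexI[of _ \<epsilon>\<^sub>2]) (auto simp: algebra_simps)
next
  case (Middle \<epsilon>)
  then have "\<epsilon> \<in> {1, - 1}" using assms labels_Middle by auto
  then show ?thesis using Middle by (intro bexI[of _ 1] bexI[of _ \<epsilon>]) auto
qed

end

lemma add_inverse_eq_iff:
  fixes x t :: complex
  assumes "x \<noteq> 0" "t \<noteq> 0"
  shows "x + inverse x - t - inverse t = 0 \<longleftrightarrow> t = x \<or> t = inverse x"
proof -
  have "x * t * (x + inverse x - t - inverse t) = (x - t) * (x * t - 1)"
    using assms by (simp add: field_simps)
  then have "x + inverse x - t - inverse t = 0 \<longleftrightarrow> x - t = 0 \<or> x * t - 1 = 0"
    using assms by (metis mult_eq_0_iff)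
  moreover have "x * t - 1 = 0 \<longleftrightarrow> t = inverse x" using assms by (auto simp: field_simps)
  ultimately show ?thesis by auto
qed

context btl
begin

lemma k_zero:
  assumes "qn u \<noteq> 0" shows "k \<theta> u = 0 \<longleftrightarrow> qp \<theta> = qp (u - \<omega>\<^sub>2) \<or> qp \<theta> = qp (- (u - \<omega>\<^sub>2))"
  using add_inverse_eq_iff[of "qp (u - \<omega>\<^sub>2)" "qp \<theta>"] assms DD w2_gen
  unfolding k_eq by (simp add: qpow_minus[of _ "u - \<omega>\<^sub>2", simplified] qpow_minus[of _ \<theta>])

text \<open>In the block at \<open>N\<close> one off-diagonal entry is 1 and the other is this
  product, so its vanishing means that the half-tile can be added but not removed. The two zeros of
  each of the two factors give the four sign choices.\<close>

lemma crit_iff: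
  "cf N (uu h) * cf N (- uu h) = 0 \<longleftrightarrow>
    (\<exists>a\<in>{1, - 1 :: int}. \<exists>b\<in>{1, - 1 :: int}. qp \<theta> = qp (of_int a * (\<omega>\<^sub>1 - of_int h) + of_int b * \<omega>\<^sub>2))"
proof -
  let ?v = "\<omega>\<^sub>1 - of_int h"
  have n: "qn ?v \<noteq> 0" "qn (- ?v) \<noteq> 0" using qn_w1[of h] unfolding qnum_minus by auto
  have "uu h = ?v \<or> uu h = - ?v" by (auto simp: uu_def)
  then have "cf N (uu h) * cf N (- uu h) = 0 \<longleftrightarrow> k \<theta> ?v = 0 \<or> k \<theta> (- ?v) = 0"
    unfolding cf_def by auto
  also have "\<dots> \<longleftrightarrow> qp \<theta> = qp (?v - \<omega>\<^sub>2) \<or> qp \<theta> = qp (- (?v - \<omega>\<^sub>2)) \<or> qp \<theta> = qp (- ?v - \<omega>\<^sub>2) \<or> qp \<theta> = qp (- (- ?v - \<omega>\<^sub>2))"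
    unfolding k_zero[OF n(1)] k_zero[OF n(2)] by blast
  also have "\<dots> \<longleftrightarrow> (\<exists>a\<in>{1, - 1 :: int}. \<exists>b\<in>{1, - 1 :: int}. qp \<theta> = qp (of_int a * ?v + of_int b * \<omega>\<^sub>2))"
    by (simp add: algebra_simps) blast
  finally show ?thesis .
qed

subsection \<open>Invariant subspaces\<close>

text \<open>For \<open>c = 0\<close> the upper side is taken, in accordance with the condition
  \<open>h \<ge> 1\<close> for the middle labels.\<close>

definition side :: "int \<Rightarrow> int list set"
  where "side c = {p \<in> Paths. if c \<ge> 0 then p ! N > c else p ! N < c}"

text \<open>Support can leave the side only by a flip at \<open>N\<close> across \<open>c\<close>,
  from \<open>nh c\<close> to \<open>oh c\<close>. The matrix entry of this flip is
  \<open>cf N (uu c) * cf N (- uu c)\<close>. Parity rules out the final height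
  \<open>c\<close>.\<close>

lemma pef_side:
  assumes zero: "cf N (uu c) * cf N (- uu c) = 0" and par: "odd (int N + c)"
    and f: "f \<in> supp_fun (side c)" and i: "i \<le> N"
  shows "pef i f \<in> supp_fun (side c)"
proof -
  have "pef i f q = 0" if q: "q \<notin> side c" for q
  proof (cases "q \<in> Paths")
    case True
    have f0: "f p = 0" if "p \<notin> side c" for p using f that by (simp add: supp_fun_def)
    have qN: "q ! N \<noteq> c" using path_parity[OF True, of N] par by auto
    show ?thesis
    proof (cases "i = 0")
      case True
      then show ?thesis using f0[OF q] by (simp add: pef_def)
    next
      case False
      then have i1: "1 \<le> i" by simp
      show ?thesis
      proof (cases "i < N")
        case iN: True
        have "f (q[i := z]) = 0" for z
          using q True iN by (intro f0) (auto simp: side_def)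
        then show ?thesis using i1 by (simp add: pef_def S1_def)
      next
        case False
        then have iN: "i = N" using i by simp
        let ?h = "q ! (N - 1)"
        have l: "length q = Suc N" using True by (rule path_length)
        have st: "q ! N = ?h + 1 \<or> q ! N = ?h - 1" using path_step'[OF True i1] iN by auto
        have fz: "f (q[N := z]) = 0" if "if c \<ge> 0 then z \<le> c else z \<ge> c" for z
          using that l by (intro f0) (auto simp: side_def split: if_splits)
        show ?thesis
        proof (cases "?h = c")
          case h: True
          have "aa N c (q ! N) * S1 N f q = aa N c (q ! N) * (cf N (- uu c) * f (q[N := nh c]))"
            using fz[of "oh c"] h by (simp add: S1_alt oh_def)
          moreover have "aa N c (q ! N) = cf N (uu c)"
            using st h q True by (auto simp: side_def aa_def nh_def split: if_splits)
          ultimately show ?thesis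
            using zero iN i1 h by (auto simp: pef_def)
        next
          case False
          have "f (q[N := ?h + 1]) = 0" "f (q[N := ?h - 1]) = 0"
            using False st q qN True by (auto intro!: fz simp: side_def split: if_splits)
          then show ?thesis using iN i1 by (simp add: pef_def S1_def)
        qed
      qed
    qed
  qed (simp add: pef_not_path)
  then show ?thesis by (simp add: supp_fun_def)
qed

lemma invariant_side:
  assumes "cf N (uu c) * cf N (- uu c) = 0" "odd (int N + c)"
  shows "invariant (side c)"
  unfolding invariant_def
proof (intro conjI ballI)
  fix a f assume a: "a \<in> carrier F" and f: "f \<in> supp_fun (side c)"
  from a show "app (rho a) f \<in> supp_fun (side c)"
  proof (induction rule: free_algebra_induct)
    case (gen i y)
    then show ?case using pef_side[OF assms] by (simp add: ev_mult)
  qed (use f in \<open>simp_all add: ev_add ev_mult supp_add supp_cmult\<close>)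
qed (auto simp: side_def)

subsection \<open>Connecting paths\<close>

definition reach :: "int list \<Rightarrow> int list \<Rightarrow> bool"
  where "reach p q \<longleftrightarrow> (\<exists>a\<in>carrier F. app (rho a) (vv p) = vv q)"

lemma reach_refl: "reach p p"
  unfolding reach_def by (rule bexI[of _ 1]) auto

lemma reach_trans: "reach p q \<Longrightarrow> reach q s \<Longrightarrow> reach p s"
  unfolding reach_def by (metis app_simps(6) ev_mult mult_in)

text \<open>Adding a tile has coefficient 1 and is always possible. Removing it requires division by
  the other off-diagonal entry, whence the condition at \<open>N\<close>.\<close>

lemma reach_flip:
  assumes p: "p \<in> Paths" "1 \<le> i" "i \<le> N" "turn p i" "z = p ! (i - 1) + 1 \<or> z = p ! (i - 1) - 1"
    and nz: "i = N \<Longrightarrow> cf N (uu (p ! (N - 1))) * cf N (- uu (p ! (N - 1))) \<noteq> 0"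
  shows "reach p (p[i := z])"
proof -
  let ?h = "p ! (i - 1)"
  have l: "length p = Suc N" using p(1) by (rule path_length)
  have cz: "cf i (uu ?h) * cf i (- uu ?h) \<noteq> 0"
  proof (cases "i = N")
    case False
    then have "dd i ?h (oh ?h) \<noteq> 0" "dd i ?h (nh ?h) \<noteq> 0" using dd_nz[of i] p oh_nh by auto
    then show ?thesis by (simp add: dd_oh dd_nh)
  qed (use nz in simp)
  have pi: "p ! i = oh ?h \<or> p ! i = nh ?h" "z = oh ?h \<or> z = nh ?h"
    using path_step'[OF p(1-3)] p(5) oh_nh(5) by metis+
  have gin: "gen i \<in> carrier F" using p by simp
  consider "p ! i = z" | "p ! i = oh ?h" "z = nh ?h" | "p ! i = nh ?h" "z = oh ?h" using pi by metis
  then show ?thesis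
  proof cases
    case 1
    then show ?thesis using reach_refl by (metis list_update_id)
  next
    case 2
    have "app (rho (gen i - scal (cf i (uu ?h)))) (vv p) = vv (p[i := nh ?h])"
      using pef_vv[OF p(1-4) 2(1)] by (simp add: ev_diff)
    then show ?thesis unfolding 2 reach_def by (rule bexI) (rule diff_in[OF gin scal_in])
  next
    case 3
    let ?q = "p[i := oh ?h]" and ?c = "cf i (uu ?h)" and ?d = "cf i (- uu ?h)"
    have q: "?q \<in> Paths" using flip_path[OF p(1-4)] oh_nh(1) by auto
    have qi: "?q ! (i - 1) = ?h" "?q ! i = oh ?h" "turn ?q i" "?q[i := nh ?h] = p"
      using p(2-4) l turn_upd_same[OF p(2)] 3(1) by (auto simp: nth_list_update) (metis list_update_id)
    have "pef i (vv p) = (\<lambda>s. ?d * (?c * vv ?q s + vv p s))"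
      using pef_vv_nh[OF q p(2,3) qi(3)] qi by simp
    have id: "1 / (c * d) * (d * (c * x + y) - d * y) = x" if "c * d \<noteq> 0" for c d x y :: complex
    proof -
      have "d * (c * x + y) - d * y = (c * d) * x" by (simp add: algebra_simps)
      then show ?thesis using that by simp
    qed
    have "app (rho (scal (1 / (?c * ?d)) * (gen i - scal ?d))) (vv p) =
        (\<lambda>s. 1 / (?c * ?d) * (pef i (vv p) s - ?d * vv p s))"
      by (simp only: ev_mult ev_diff ev_scal ev_gen app_simps app_pe)
    also have "\<dots> = (\<lambda>s. 1 / (?c * ?d) * (?d * (?c * vv ?q s + vv p s) - ?d * vv p s))"
      by (simp only: \<open>pef i (vv p) = _\<close>)
    also have "\<dots> = vv ?q"
      by (rule ext) (rule id[OF cz])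
    finally have "app (rho (scal (1 / (?c * ?d)) * (gen i - scal ?d))) (vv p) = vv ?q" .
    then show ?thesis unfolding 3(2) reach_def
      by (rule bexI[where x = "scal (1 / (?c * ?d)) * (gen i - scal ?d)"])
        (rule mult_in[OF scal_in diff_in[OF gin scal_in]])
  qed
qed

definition ext :: "int \<Rightarrow> int list" where "ext \<sigma> = map (\<lambda>i. \<sigma> * int i) [0..<Suc N]"

lemma ext_nth: "i \<le> N \<Longrightarrow> ext \<sigma> ! i = \<sigma> * int i"
  unfolding ext_def by (subst nth_map) (auto simp: nth_append)

lemma ext_Paths: "\<sigma> \<in> {1, - 1} \<Longrightarrow> ext \<sigma> \<in> Paths"
  by (auto simp: Paths_def ext_nth) (auto simp: ext_def)

text \<open>Every path beyond \<open>c\<close> is moved outwards to the straight path by flips that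
  stay beyond \<open>c\<close>. Both directions are carried along in the induction because
  \<open>reach\<close> is not symmetric in general.\<close>

lemma reach_ext:
  assumes s: "\<sigma> \<in> {1, - 1 :: int}"
    and nz: "\<And>q. q \<in> Paths \<Longrightarrow> q ! (N - 1) \<noteq> c \<Longrightarrow> cf N (uu (q ! (N - 1))) * cf N (- uu (q ! (N - 1))) \<noteq> 0"
  shows "p \<in> Paths \<Longrightarrow> \<sigma> * p ! N > \<sigma> * c \<Longrightarrow> reach p (ext \<sigma>) \<and> reach (ext \<sigma>) p"
proof (induction "nat (\<Sum>i\<le>N. int N - \<sigma> * p ! i)" arbitrary: p rule: less_induct)
  case less
  have l: "length p = Suc N" using less.prems(1) by (rule path_length)
  let ?I = "{i. 1 \<le> i \<and> i \<le> N \<and> p ! i = p ! (i - 1) - \<sigma>}"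
  have step: "p ! i = p ! (i - 1) + \<sigma> \<or> p ! i = p ! (i - 1) - \<sigma>" if "1 \<le> i" "i \<le> N" for i
    using path_step'[OF less.prems(1) that] s by auto
  show ?case
  proof (cases "?I = {}")
    case True
    have "i \<le> N \<Longrightarrow> p ! i = ext \<sigma> ! i" for i
    proof (induction i)
      case (Suc i)
      then show ?case using step[of "Suc i"] True by (auto simp: ext_nth algebra_simps)
    qed (simp add: ext_nth path_0[OF less.prems(1)])
    then have "p = ext \<sigma>" using l by (intro nth_equalityI) (auto simp: ext_def simp del: upt_Suc)
    then show ?thesis using reach_refl by simp
  next
    case False
    \<comment> \<open>At the last step against the direction \<open>\<sigma>\<close> the path turns,
      because the following step, if there is one, goes in direction
      \<open>\<sigma>\<close>.\<close>
    define i where "i = Max ?I"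
    have fin: "finite ?I" by simp
    have i: "1 \<le> i" "i \<le> N" "p ! i = p ! (i - 1) - \<sigma>" using Max_in[OF fin False] by (auto simp: i_def)
    have "Suc i \<notin> ?I"
    proof
      assume "Suc i \<in> ?I"
      from Max_ge[OF fin this] show False unfolding i_def[symmetric] by simp
    qed
    then have t: "turn p i" using step[of "Suc i"] i by (auto simp: turn_def)
    let ?z = "p ! (i - 1) + \<sigma>"
    let ?q = "p[i := ?z]"
    have zz: "?z = p ! (i - 1) + 1 \<or> ?z = p ! (i - 1) - 1" "p ! i = p ! (i - 1) + 1 \<or> p ! i = p ! (i - 1) - 1"
      using s i by auto
    have q: "?q \<in> Paths" by (rule flip_path[OF less.prems(1) i(1,2) t zz(1)])
    have ss: "\<sigma> * \<sigma> = 1" using s by auto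
    have up: "\<sigma> * ?q ! j = \<sigma> * p ! j + (if j = i then 2 else 0)" if "j \<le> N" for j
      using that l arg_cong[OF i(3), of "\<lambda>x. \<sigma> * x"] ss by (auto simp: nth_list_update algebra_simps)
    have "(\<Sum>j\<le>N. int N - \<sigma> * ?q ! j) < (\<Sum>j\<le>N. int N - \<sigma> * p ! j)"
      by (rule sum_strict_mono_ex1) (use up i in \<open>auto intro!: bexI[of _ i]\<close>)
    moreover have "0 \<le> (\<Sum>j\<le>N. int N - \<sigma> * ?q ! j)"
    proof (rule sum_nonneg)
      fix j assume j: "j \<in> {..N}"
      then have "\<bar>?q ! j\<bar> \<le> int N" using path_bound[OF q, of j] by simp
      then show "0 \<le> int N - \<sigma> * ?q ! j" using s by auto
    qed
    ultimately have m: "nat (\<Sum>j\<le>N. int N - \<sigma> * ?q ! j) < nat (\<Sum>j\<le>N. int N - \<sigma> * p ! j)" by simp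
    have qN: "\<sigma> * ?q ! N > \<sigma> * c" using up[of N] less.prems(2) by (auto split: if_splits)
    have IH: "reach ?q (ext \<sigma>) \<and> reach (ext \<sigma>) ?q" by (rule less.hyps[OF m q qN])
    \<comment> \<open>A flip at \<open>N\<close> happens where the last step goes against
      \<open>\<sigma>\<close>, so the height before it lies even further beyond \<open>c\<close>
      than the final height.\<close>
    have nzp: "cf N (uu (p ! (N - 1))) * cf N (- uu (p ! (N - 1))) \<noteq> 0" if "i = N"
    proof (rule nz[OF less.prems(1)])
      have "\<sigma> * p ! (N - 1) = \<sigma> * p ! N + 1" using arg_cong[OF i(3), of "\<lambda>x. \<sigma> * x"] that ss by (simp add: algebra_simps)
      then show "p ! (N - 1) \<noteq> c" using less.prems(2) by auto
    qed
    have 1: "reach p ?q" by (rule reach_flip[OF less.prems(1) i(1,2) t zz(1) nzp])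
    have e: "?q ! (i - 1) = p ! (i - 1)" using i by simp
    have eN: "?q ! (N - 1) = p ! (N - 1)" if "i = N" using e that by simp
    have "reach ?q (?q[i := p ! i])"
      by (rule reach_flip[OF q i(1,2)]) (use t turn_upd_same[OF i(1)] zz(2) e eN nzp in auto)
    then have 2: "reach ?q p" by simp
    show ?thesis using IH 1 2 reach_trans by blast
  qed
qed

subsection \<open>The representations at an exceptional point\<close>

context
  fixes l :: label
  assumes l: "l \<in> labels" and \<theta>: "\<theta> = \<theta>_of l" and dist: exceptional_points_distinct
begin

abbreviation (input) SS\<^sub>l :: "int list set" where "SS\<^sub>l \<equiv> side (center l)"

lemma label_zero: "cf N (uu (center l)) * cf N (- uu (center l)) = 0"
  unfolding crit_iff using center_exceptional[OF N2 l] \<theta> by fastforce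

lemma label_nonzero:
  assumes "q \<in> Paths" "q ! (N - 1) \<noteq> center l"
  shows "cf N (uu (q ! (N - 1))) * cf N (- uu (q ! (N - 1))) \<noteq> 0"
proof
  assume "cf N (uu (q ! (N - 1))) * cf N (- uu (q ! (N - 1))) = 0"
  then obtain a b :: int where ab: "a \<in> {1, - 1}" "b \<in> {1, - 1}"
    "qp (\<theta>_of l) = qp (of_int a * (\<omega>\<^sub>1 - of_int (q ! (N - 1))) + of_int b * \<omega>\<^sub>2)"
    unfolding crit_iff unfolding \<theta> by blast
  have "\<bar>q ! (N - 1)\<bar> < int N" using path_bound[OF assms(1), of "N - 1"] N2 by simp
  moreover have "odd (int N + q ! (N - 1))" using path_parity[OF assms(1), of "N - 1"] N2 by simp
  ultimately show False using exceptional_center[OF N2 dist l _ _ ab] assms(2) by blast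
qed

lemma label_side: "{p \<in> Paths. height_cond l (p ! N)} = SS\<^sub>l"
  unfolding side_def height_cond_iff[OF N2 l] ..

lemma label_invariant: "invariant SS\<^sub>l"
  by (rule invariant_side[OF label_zero center_bound(2)[OF N2 l]])

lemma label_V: "V l = WW\<lparr>carrier := Psi ` supp_fun SS\<^sub>l\<rparr>" "V_tilde l = quotient_module WW (Psi ` supp_fun SS\<^sub>l)"
proof -
  have "{w. \<exists>p. basis_vec \<theta> p w \<and> height_cond l (p ! N)} = (\<lambda>p. Psi (vv p)) ` SS\<^sub>l"
    unfolding basis_vec_iff label_side[symmetric] by auto
  moreover have "SS\<^sub>l \<subseteq> Paths" using label_invariant by (simp add: invariant_def)
  ultimately have "V_space l = Psi ` supp_fun SS\<^sub>l"
    unfolding V_space_def \<theta>[symmetric] using span_bas'[OF model_W] by simp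
  then show "V l = WW\<lparr>carrier := Psi ` supp_fun SS\<^sub>l\<rparr>" "V_tilde l = quotient_module WW (Psi ` supp_fun SS\<^sub>l)"
    by (simp_all add: V_def V_tilde_def \<theta>)
qed

lemma label_models: "model (V l) SS\<^sub>l Psi"
  "model (V_tilde l) (Paths - SS\<^sub>l) (\<lambda>f. Psi ` {h \<in> supp_fun Paths. tr (Paths - SS\<^sub>l) h = f})"
  unfolding label_V using model_submodule[OF label_invariant] model_quotient[OF label_invariant] .

text \<open>By parity no path ends at \<open>center l\<close>, so the complement of the side is the
  opposite strict half, and \<open>reach_ext\<close> serves both with opposite signs.\<close>

lemma label_extremes:
  defines "\<sigma> \<equiv> if center l \<ge> 0 then 1 else - 1 :: int"
  shows "SS\<^sub>l = {p \<in> Paths. \<sigma> * p ! N > \<sigma> * center l}" "Paths - SS\<^sub>l = {p \<in> Paths. - \<sigma> * p ! N > - \<sigma> * center l}"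
    "ext \<sigma> \<in> SS\<^sub>l" "ext (- \<sigma>) \<in> Paths - SS\<^sub>l"
proof -
  have ne: "p ! N \<noteq> center l" if "p \<in> Paths" for p
    using path_parity[OF that, of N] center_bound(2)[OF N2 l] by auto
  show 1: "SS\<^sub>l = {p \<in> Paths. \<sigma> * p ! N > \<sigma> * center l}" by (auto simp: side_def \<sigma>_def)
  show 2: "Paths - SS\<^sub>l = {p \<in> Paths. - \<sigma> * p ! N > - \<sigma> * center l}"
    unfolding 1 using ne by (force simp: \<sigma>_def)
  show "ext \<sigma> \<in> SS\<^sub>l" "ext (- \<sigma>) \<in> Paths - SS\<^sub>l"
    unfolding 1 2 using ext_Paths center_bound(1)[OF N2 l] by (auto simp: \<sigma>_def ext_nth)
qed

lemma label_connected:
  "p \<in> SS\<^sub>l \<Longrightarrow> q \<in> SS\<^sub>l \<Longrightarrow> reach p q" "p \<in> Paths - SS\<^sub>l \<Longrightarrow> q \<in> Paths - SS\<^sub>l \<Longrightarrow> reach p q"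
proof -
  let ?s = "if center l \<ge> 0 then 1 else - 1 :: int"
  have s: "?s \<in> {1, - 1}" "- ?s \<in> {1, - 1}" by auto
  show "p \<in> SS\<^sub>l \<Longrightarrow> q \<in> SS\<^sub>l \<Longrightarrow> reach p q"
    unfolding label_extremes(1) using reach_ext[OF s(1) label_nonzero] reach_trans by blast
  show "p \<in> Paths - SS\<^sub>l \<Longrightarrow> q \<in> Paths - SS\<^sub>l \<Longrightarrow> reach p q"
    unfolding label_extremes(2) using reach_ext[OF s(2) label_nonzero] reach_trans by blast
qed

lemma label_irreducible: "irreducible_module TL (V l)" "irreducible_module TL (V_tilde l)"
  using model_irreducible[OF label_models(1)] model_irreducible[OF label_models(2)]
    label_connected label_extremes(3,4) unfolding reach_def by blast+

lemma label_acts: "acts_as_scalar Z (V l) zval" "acts_as_scalar Z (V_tilde l) zval"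
  using model_acts_Z label_models by blast+

lemma label_dimensions:
  "fin_dim (V l)" "fin_dim (V_tilde l)" "dimension (V l) = card SS\<^sub>l" "dimension (V_tilde l) = 2 ^ N - card SS\<^sub>l"
proof -
  have "SS\<^sub>l \<subseteq> Paths" by (auto simp: side_def)
  then have "card (Paths - SS\<^sub>l) = 2 ^ N - card SS\<^sub>l"
    using card_Diff_subset[of SS\<^sub>l Paths] finite_subset[OF _ finite_Paths] card_Paths by simp
  then show "fin_dim (V l)" "fin_dim (V_tilde l)" "dimension (V l) = card SS\<^sub>l" "dimension (V_tilde l) = 2 ^ N - card SS\<^sub>l"
    using model_dimension[OF label_models(1)] model_dimension[OF label_models(2)] by auto
qed

lemma label_not_equivalent: "\<not> equivalent_modules TL (V l) (V_tilde l)"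
  using models_not_equivalent[OF label_models] label_extremes(3) by blast

end

section \<open>Separating the labels by the scalar of \<open>Z\<close>\<close>

lemma scalar_not_equivalent:
  assumes M: "model M S \<phi>" "p \<in> S" and c: "acts_as_scalar Z M' c" "c \<noteq> zval"
  shows "\<not> equivalent_modules TL M M'"
proof
  assume "equivalent_modules TL M M'"
  then obtain h where h: "h \<in> LinearCombinations.module_hom TL M M'" "bij_betw h (carrier M) (carrier M')"
    unfolding equivalent_modules_def by blast
  have v: "vv p \<in> supp_fun S" using M(2) by (rule vv_supp)
  let ?w = "\<phi> (vv p)"
  have w: "?w \<in> carrier M" by (rule model_in[OF M(1) v])
  have s: "\<phi> (\<lambda>q. d * vv p q) \<in> carrier M" for d by (rule model_in[OF M(1) supp_cmult[OF v]])
  have "Z \<odot>\<^bsub>M\<^esub> ?w = \<phi> (\<lambda>q. zval * vv p q)"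
    using model_acts_Z[OF M(1)] w model_scal[OF M(1) v] by (simp add: acts_as_scalar_def vspace_def)
  then have "h (\<phi> (\<lambda>q. zval * vv p q)) = Z \<odot>\<^bsub>M'\<^esub> h ?w"
    using module_hom_smult[OF h(1) Z_closed w] by simp
  also have "\<dots> = cl (scal c) \<odot>\<^bsub>M'\<^esub> h ?w"
    using c(1) h(2) w by (auto simp: acts_as_scalar_def vspace_def bij_betw_def)
  also have "\<dots> = h (\<phi> (\<lambda>q. c * vv p q))"
    using module_hom_smult[OF h(1) cl_closed[OF scal_in] w] model_scal[OF M(1) v] by simp
  finally have "\<phi> (\<lambda>q. zval * vv p q) = \<phi> (\<lambda>q. c * vv p q)"
    using h(2) s by (auto simp: bij_betw_def inj_on_def)
  then have "(\<lambda>q. zval * vv p q) = (\<lambda>q. c * vv p q)"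
    by (rule model_inj[OF M(1) supp_cmult[OF v] supp_cmult[OF v]])
  from fun_cong[OF this, of p] show False using c(2) by (simp add: vv_def)
qed

lemma qn_N: "qn (of_nat N) \<noteq> 0"
proof
  assume "qn (of_nat N) = 0"
  then have "qp (2 * of_nat N) = 1" using qnum_eq_0_iff[OF DD] by blast
  moreover have "qp (of_nat m) = qp 1 ^ m" for m
    by (induction m) (auto simp: qpow_add distrib_left)
  from this[of "2 * N"] have "qp (2 * of_nat N) = qp 1 ^ (2 * N)" by simp
  ultimately show False using q_gen[rule_format, of "2 * N"] N2 by simp
qed

end

text \<open>A nonzero \<open>x\<close> is determined up to inversion by
  \<open>x + inverse x\<close>, so equal scalars would make two of the distinct exceptional values
  coincide.\<close>

lemma (in btl) zval_distinct:
  assumes dist: exceptional_points_distinct and l: "l \<in> labels" "l' \<in> labels" "l \<noteq> l'"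
  shows "qn (of_nat N) * (qp (\<theta>_of l) + qp (- \<theta>_of l)) \<noteq> qn (of_nat N) * (qp (\<theta>_of l') + qp (- \<theta>_of l'))"
proof
  assume "qn (of_nat N) * (qp (\<theta>_of l) + qp (- \<theta>_of l)) = qn (of_nat N) * (qp (\<theta>_of l') + qp (- \<theta>_of l'))"
  then have "qp (\<theta>_of l) + inverse (qp (\<theta>_of l)) - qp (\<theta>_of l') - inverse (qp (\<theta>_of l')) = 0"
    using qn_N by (simp add: qpow_minus)
  then have "qp (\<theta>_of l') = qp (\<theta>_of l) \<or> qp (\<theta>_of l') = qp (- \<theta>_of l)"
    unfolding qpow_minus by (subst (asm) add_inverse_eq_iff) auto
  then have "\<exists>\<sigma>\<in>{1, - 1 :: int}. qp (of_int 1 * \<theta>_of l') = qp (of_int \<sigma> * \<theta>_of l)" by auto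
  then show False
    using dist l unfolding exceptional_points_distinct_def inj_on_def by force
qed

theorem theorem6p4:
  fixes N :: nat and \<eta> \<omega>\<^sub>1 \<omega>\<^sub>2 :: complex
  assumes "N \<ge> 2"
    and "\<forall>m::nat. m > 0 \<longrightarrow> qpow \<eta> 1 ^ m \<noteq> 1"
    and "\<forall>m::int. qnum \<eta> (\<omega>\<^sub>1 - of_int m) \<noteq> 0"
    and "qnum \<eta> \<omega>\<^sub>2 \<noteq> 0" and "qnum \<eta> (\<omega>\<^sub>2 + 1) \<noteq> 0"
    and "two_BTL.exceptional_points_distinct N \<eta> \<omega>\<^sub>1 \<omega>\<^sub>2"
  shows
    "(\<forall>l \<in> two_BTL.labels N.
       irreducible_module (two_BTL.TL N \<eta> \<omega>\<^sub>1 \<omega>\<^sub>2) (two_BTL.V N \<eta> \<omega>\<^sub>1 \<omega>\<^sub>2 l) \<and>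
       irreducible_module (two_BTL.TL N \<eta> \<omega>\<^sub>1 \<omega>\<^sub>2) (two_BTL.V_tilde N \<eta> \<omega>\<^sub>1 \<omega>\<^sub>2 l)) \<and>
     (\<forall>l \<in> two_BTL.labels N. \<forall>l' \<in> two_BTL.labels N. l \<noteq> l' \<longrightarrow>
       \<not> equivalent_modules (two_BTL.TL N \<eta> \<omega>\<^sub>1 \<omega>\<^sub>2)
           (two_BTL.V N \<eta> \<omega>\<^sub>1 \<omega>\<^sub>2 l) (two_BTL.V N \<eta> \<omega>\<^sub>1 \<omega>\<^sub>2 l') \<and>
       \<not> equivalent_modules (two_BTL.TL N \<eta> \<omega>\<^sub>1 \<omega>\<^sub>2)
           (two_BTL.V_tilde N \<eta> \<omega>\<^sub>1 \<omega>\<^sub>2 l) (two_BTL.V_tilde N \<eta> \<omega>\<^sub>1 \<omega>\<^sub>2 l')) \<and>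
     (\<forall>l \<in> two_BTL.labels N. \<forall>l' \<in> two_BTL.labels N.
       \<not> equivalent_modules (two_BTL.TL N \<eta> \<omega>\<^sub>1 \<omega>\<^sub>2)
           (two_BTL.V N \<eta> \<omega>\<^sub>1 \<omega>\<^sub>2 l) (two_BTL.V_tilde N \<eta> \<omega>\<^sub>1 \<omega>\<^sub>2 l')) \<and>
     (\<forall>l \<in> two_BTL.labels N.
       two_BTL.fin_dim N \<eta> \<omega>\<^sub>1 \<omega>\<^sub>2 (two_BTL.V N \<eta> \<omega>\<^sub>1 \<omega>\<^sub>2 l) \<and>
       two_BTL.fin_dim N \<eta> \<omega>\<^sub>1 \<omega>\<^sub>2 (two_BTL.V_tilde N \<eta> \<omega>\<^sub>1 \<omega>\<^sub>2 l)) \<and>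
     (\<forall>n \<epsilon>\<^sub>1 \<epsilon>\<^sub>2. Generic n \<epsilon>\<^sub>1 \<epsilon>\<^sub>2 \<in> two_BTL.labels N \<longrightarrow>
       two_BTL.dimension N \<eta> \<omega>\<^sub>1 \<omega>\<^sub>2 (two_BTL.V N \<eta> \<omega>\<^sub>1 \<omega>\<^sub>2 (Generic n \<epsilon>\<^sub>1 \<epsilon>\<^sub>2)) = numM N (int n) \<and>
       int (two_BTL.dimension N \<eta> \<omega>\<^sub>1 \<omega>\<^sub>2 (two_BTL.V_tilde N \<eta> \<omega>\<^sub>1 \<omega>\<^sub>2 (Generic n \<epsilon>\<^sub>1 \<epsilon>\<^sub>2)))
         = 2 ^ N - int (numM N (int n))) \<and>
     (\<forall>\<epsilon>. Middle \<epsilon> \<in> two_BTL.labels N \<longrightarrow>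
       two_BTL.dimension N \<eta> \<omega>\<^sub>1 \<omega>\<^sub>2 (two_BTL.V N \<eta> \<omega>\<^sub>1 \<omega>\<^sub>2 (Middle \<epsilon>)) = 2 ^ (N - 1) \<and>
       two_BTL.dimension N \<eta> \<omega>\<^sub>1 \<omega>\<^sub>2 (two_BTL.V_tilde N \<eta> \<omega>\<^sub>1 \<omega>\<^sub>2 (Middle \<epsilon>)) = 2 ^ (N - 1)) \<and>
     (\<forall>l \<in> two_BTL.labels N.
       let c = qnum \<eta> (of_nat N) *
               (qpow \<eta> (two_BTL.\<theta>_of \<omega>\<^sub>1 \<omega>\<^sub>2 l) + qpow \<eta> (- two_BTL.\<theta>_of \<omega>\<^sub>1 \<omega>\<^sub>2 l))
       in two_BTL.acts_as_scalar N \<eta> \<omega>\<^sub>1 \<omega>\<^sub>2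
            (two_BTL.Z N \<eta> \<omega>\<^sub>1 \<omega>\<^sub>2) (two_BTL.V N \<eta> \<omega>\<^sub>1 \<omega>\<^sub>2 l) c \<and>
          two_BTL.acts_as_scalar N \<eta> \<omega>\<^sub>1 \<omega>\<^sub>2
            (two_BTL.Z N \<eta> \<omega>\<^sub>1 \<omega>\<^sub>2) (two_BTL.V_tilde N \<eta> \<omega>\<^sub>1 \<omega>\<^sub>2 l) c)"
proof -
  \<comment> \<open>No assumption of the locale mentions \<open>\<theta>\<close>, so this single
    fact gives the lemmas for every \<open>\<theta>_of l\<close>. The interpretation at 0 supplies
    the facts in which \<open>\<theta>\<close> does not occur.\<close>
  have B: "btl N \<eta> \<omega>\<^sub>1 \<omega>\<^sub>2" using assms(1-5) by unfold_locales auto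
  interpret btl N \<eta> \<omega>\<^sub>1 \<omega>\<^sub>2 0 by (rule B)
  note dist = assms(6)
  let ?z = "\<lambda>l. qnum \<eta> (of_nat N) * (qpow \<eta> (\<theta>_of l) + qpow \<eta> (- \<theta>_of l))"
  have z: "btl.zval N \<eta> (\<theta>_of l) = ?z l" for l by (simp add: btl.zval_def[OF B])
  note mod = btl.label_models[OF B _ refl dist] and ext = btl.label_extremes(3,4)[OF B _ refl dist]
  have irr: "irreducible_module TL (V l)" "irreducible_module TL (V_tilde l)" if "l \<in> labels" for l
    using btl.label_irreducible[OF B that refl dist] by auto
  have acts: "acts_as_scalar Z (V l) (?z l)" "acts_as_scalar Z (V_tilde l) (?z l)" if "l \<in> labels" for l
    using btl.label_acts[OF B that refl dist] unfolding z by auto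
  have ne1: "\<not> equivalent_modules TL (V l) (V l')" "\<not> equivalent_modules TL (V_tilde l) (V_tilde l')"
    "\<not> equivalent_modules TL (V l) (V_tilde l')" if l: "l \<in> labels" "l' \<in> labels" "l \<noteq> l'" for l l'
  proof -
    have d: "?z l' \<noteq> btl.zval N \<eta> (\<theta>_of l)" unfolding z using zval_distinct[OF dist l(2,1)] l(3) by auto
    show "\<not> equivalent_modules TL (V l) (V l')"
      by (rule btl.scalar_not_equivalent[OF B mod(1)[OF l(1)] ext(1)[OF l(1)] acts(1)[OF l(2)] d])
    show "\<not> equivalent_modules TL (V_tilde l) (V_tilde l')"
      by (rule btl.scalar_not_equivalent[OF B mod(2)[OF l(1)] ext(2)[OF l(1)] acts(2)[OF l(2)] d])
    show "\<not> equivalent_modules TL (V l) (V_tilde l')"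
      by (rule btl.scalar_not_equivalent[OF B mod(1)[OF l(1)] ext(1)[OF l(1)] acts(2)[OF l(2)] d])
  qed
  have ne2: "\<not> equivalent_modules TL (V l) (V_tilde l')" if "l \<in> labels" "l' \<in> labels" for l l'
    using ne1(3)[of l l'] btl.label_not_equivalent[OF B that(1) refl dist] that by (cases "l = l'") auto
  have fd: "fin_dim (V l)" "fin_dim (V_tilde l)" "dimension (V l) = card (side (center l))"
    "dimension (V_tilde l) = 2 ^ N - card (side (center l))" if "l \<in> labels" for l
    using btl.label_dimensions[OF B that refl dist] by auto
  have side_le: "card (side c) \<le> 2 ^ N" for c
    using card_mono[OF finite_Paths, of "side c"] card_Paths by (auto simp: side_def)
  have cG: "card (side (center (Generic n \<epsilon>\<^sub>1 \<epsilon>\<^sub>2))) = numM N (int n)" if g: "Generic n \<epsilon>\<^sub>1 \<epsilon>\<^sub>2 \<in> labels" for n \<epsilon>\<^sub>1 \<epsilon>\<^sub>2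
  proof -
    have n: "1 \<le> n" "n < N" "odd (N + n)" "\<epsilon>\<^sub>1 = 1 \<or> \<epsilon>\<^sub>1 = - 1"
      using g labels_Generic[OF assms(1)] by auto
    show ?thesis
      using n(4) card_paths_numM[OF n(1-3)] card_paths_symmetric[of "int n"] n(1)
      by (auto simp: side_def)
  qed
  have cM: "card (side (center (Middle \<epsilon>))) = 2 ^ (N - 1)" if "Middle \<epsilon> \<in> labels" for \<epsilon>
    using that card_paths_middle by (simp add: labels_Middle side_def)
  have pow: "(2 :: nat) ^ N = 2 ^ (N - 1) + 2 ^ (N - 1)" using assms(1) by (cases N) auto
  have dG: "dimension (V (Generic n \<epsilon>\<^sub>1 \<epsilon>\<^sub>2)) = numM N (int n)"
    "int (dimension (V_tilde (Generic n \<epsilon>\<^sub>1 \<epsilon>\<^sub>2))) = 2 ^ N - int (numM N (int n))"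
    if g: "Generic n \<epsilon>\<^sub>1 \<epsilon>\<^sub>2 \<in> labels" for n \<epsilon>\<^sub>1 \<epsilon>\<^sub>2
    using fd(3,4)[OF g] cG[OF g] side_le[of "center (Generic n \<epsilon>\<^sub>1 \<epsilon>\<^sub>2)"] by (auto simp: of_nat_diff)
  have dM: "dimension (V (Middle \<epsilon>)) = 2 ^ (N - 1)" "dimension (V_tilde (Middle \<epsilon>)) = 2 ^ (N - 1)"
    if m: "Middle \<epsilon> \<in> labels" for \<epsilon>
    using fd(3,4)[OF m] cM[OF m] pow by auto
  show ?thesis
    unfolding Let_def using irr ne1(1,2) ne2 fd(1,2) dG dM acts by (intro conjI ballI allI impI)
qed

end
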